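(* Let $\beta\ge 0$ be arbitrary. A real-valued distribution $q\in H^{\beta-1}(\mathbb{R})$ belongs to $\operatorname{Im}(B_\beta)$ if and only if (i) $L_q\geq 0$, and (ii) $q$ can be presented in the form $q=f'+g$ for some $f\in L^2(\mathbb{R})$ and $g\in L^1(\mathbb{R})$.
   Context: $H^{\alpha}(\mathbb{R})$ denotes the usual $L^2$-based Sobolev space. The Miura map is $B(r)=r'+r^2$ (distributional derivative) for real-valued $r\in L^2_{\mathrm{loc}}(\mathbb{R})$. For $\beta\ge0$, $B_\beta$ denotes the restriction of $B$ to (real-valued functions in) $H^\beta(\mathbb{R})$; it takes values in $H^{\beta-1}(\mathbb{R})$, and $\operatorname{Im}(B_\beta)$ is its image. For real-valued $q\in H^{-1}_{\mathrm{loc}}(\mathbb{R})$, $L_q=-d^2/dx^2+q$, and $L_q\ge 0$ means $(L_q\varphi,\varphi)=\int_{\mathbb{R}}|\varphi'|^2\,dx+(q,|\varphi|^2)\ge 0$ for all $\varphi\in C_0^\infty(\mathbb{R})$, where $(\cdot,\cdot)$ is the pairing of distributions with test functions extending the $L^2$ inner product. *)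

theory Defs
  imports "HOL-Analysis.Analysis"
begin

subsection \<open>Test functions and distributions on the real line\<close>

definition nderiv :: "nat \<Rightarrow> (real \<Rightarrow> complex) \<Rightarrow> real \<Rightarrow> complex" where
  "nderiv n f = ((\<lambda>g x. vector_derivative g (at x)) ^^ n) f"

definition smooth :: "(real \<Rightarrow> complex) \<Rightarrow> bool" where
  "smooth f \<longleftrightarrow> (\<forall>n x. nderiv n f differentiable (at x))"

definition test_functions :: "(real \<Rightarrow> complex) set" where
  "test_functions = {\<phi>. smooth \<phi> \<and> compact (closure {x. \<phi> x \<noteq> 0})}"

definition linear_functional_on ::
    "(real \<Rightarrow> complex) set \<Rightarrow> ((real \<Rightarrow> complex) \<Rightarrow> complex) \<Rightarrow> bool" where
  "linear_functional_on V T \<longleftrightarrow>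
     (\<forall>\<phi>\<in>V. \<forall>\<psi>\<in>V. T (\<lambda>x. \<phi> x + \<psi> x) = T \<phi> + T \<psi>) \<and>
     (\<forall>c. \<forall>\<phi>\<in>V. T (\<lambda>x. c * \<phi> x) = c * T \<phi>)"

text \<open>
  Distributions are functionals that are \<^emph>\<open>extensional\<close>, i.e. take the value
  \<^const>\<open>undefined\<close> off the test functions, so that HOL equality of elements of this set
  is equality of distributions. The pairing is bilinear: a locally integrable \<open>f\<close> acts by
  \<open>\<phi> \<mapsto> \<integral> f \<phi>\<close>, without conjugation.
\<close>

definition distributions :: "((real \<Rightarrow> complex) \<Rightarrow> complex) set" where
  "distributions = {T \<in> extensional test_functions.
     linear_functional_on test_functions T \<and>
     (\<forall>K. compact K \<longrightarrow> (\<exists>N C. \<forall>\<phi>\<in>test_functions. closure {x. \<phi> x \<noteq> 0} \<subseteq> K \<longrightarrow>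
        norm (T \<phi>) \<le> C * (\<Sum>n\<le>N. SUP x. norm (nderiv n \<phi> x))))}"

definition real_valued_dist :: "((real \<Rightarrow> complex) \<Rightarrow> complex) \<Rightarrow> bool" where
  "real_valued_dist T \<longleftrightarrow> (\<forall>\<phi>\<in>test_functions. (\<forall>x. \<phi> x \<in> \<real>) \<longrightarrow> T \<phi> \<in> \<real>)"

definition dist_of_fun :: "(real \<Rightarrow> complex) \<Rightarrow> (real \<Rightarrow> complex) \<Rightarrow> complex" where
  "dist_of_fun f = (\<lambda>\<phi>\<in>test_functions. LINT x|lborel. f x * \<phi> x)"

definition dist_deriv ::
    "((real \<Rightarrow> complex) \<Rightarrow> complex) \<Rightarrow> (real \<Rightarrow> complex) \<Rightarrow> complex" where
  "dist_deriv T = (\<lambda>\<phi>\<in>test_functions. - T (nderiv 1 \<phi>))"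

definition dist_add :: "((real \<Rightarrow> complex) \<Rightarrow> complex) \<Rightarrow>
    ((real \<Rightarrow> complex) \<Rightarrow> complex) \<Rightarrow> (real \<Rightarrow> complex) \<Rightarrow> complex" where
  "dist_add S T = (\<lambda>\<phi>\<in>test_functions. S \<phi> + T \<phi>)"

subsection \<open>Tempered distributions and Sobolev spaces\<close>

definition schwartz_functions :: "(real \<Rightarrow> complex) set" where
  "schwartz_functions = {\<phi>. smooth \<phi> \<and> (\<forall>k n. \<exists>C. \<forall>x. \<bar>x\<bar> ^ k * norm (nderiv n \<phi> x) \<le> C)}"

definition tempered_distributions :: "((real \<Rightarrow> complex) \<Rightarrow> complex) set" where
  "tempered_distributions = {U \<in> extensional schwartz_functions.
     linear_functional_on schwartz_functions U \<and>
     (\<exists>N C. \<forall>\<phi>\<in>schwartz_functions.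
        norm (U \<phi>) \<le> C * (\<Sum>k\<le>N. \<Sum>n\<le>N. SUP x. \<bar>x\<bar> ^ k * norm (nderiv n \<phi> x)))}"

definition fourier :: "(real \<Rightarrow> complex) \<Rightarrow> real \<Rightarrow> complex" where
  "fourier \<phi> \<xi> = (LINT x|lborel. cis (- (x * \<xi>)) * \<phi> x)"

definition fourier_tempered ::
    "((real \<Rightarrow> complex) \<Rightarrow> complex) \<Rightarrow> (real \<Rightarrow> complex) \<Rightarrow> complex" where
  "fourier_tempered U = (\<lambda>\<phi>\<in>schwartz_functions. U (fourier \<phi>))"

text \<open>
  The usual space \<open>H\<^sup>s\<close> of tempered distributions whose Fourier transform is a measurable
  function, square integrable with weight \<open>(1 + \<xi>\<^sup>2)\<^sup>s\<close>; its elements are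
  regarded as distributions by restriction to the test functions.
\<close>

definition sobolev :: "real \<Rightarrow> ((real \<Rightarrow> complex) \<Rightarrow> complex) set" where
  "sobolev s = {T \<in> distributions. \<exists>U\<in>tempered_distributions.
     T = restrict U test_functions \<and>
     (\<exists>F \<in> borel_measurable lborel.
        integrable lborel (\<lambda>\<xi>. (1 + \<xi>\<^sup>2) powr s * (norm (F \<xi>))\<^sup>2) \<and>
        fourier_tempered U = (\<lambda>\<phi>\<in>schwartz_functions. LINT \<xi>|lborel. F \<xi> * \<phi> \<xi>))}"

definition L1_space :: "(real \<Rightarrow> complex) set" where
  "L1_space = {g. integrable lborel g}"

definition L2_space :: "(real \<Rightarrow> complex) set" where
  "L2_space = {f \<in> borel_measurable lborel. integrable lborel (\<lambda>x. (norm (f x))\<^sup>2)}"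

text \<open>
  For \<open>s \<ge> 0\<close> the elements of \<open>H\<^sup>s\<close> are (classes of) \<open>L\<^sup>2\<close> functions; these are the
  real-valued ones.
\<close>

definition real_sobolev_functions :: "real \<Rightarrow> (real \<Rightarrow> real) set" where
  "real_sobolev_functions s =
     {r. (\<lambda>x. of_real (r x)) \<in> L2_space \<and> dist_of_fun (\<lambda>x. of_real (r x)) \<in> sobolev s}"

subsection \<open>The Miura map and the Schroedinger form\<close>

definition miura :: "(real \<Rightarrow> real) \<Rightarrow> (real \<Rightarrow> complex) \<Rightarrow> complex" where
  "miura r = dist_add (dist_deriv (dist_of_fun (\<lambda>x. of_real (r x))))
                      (dist_of_fun (\<lambda>x. of_real ((r x)\<^sup>2)))"

definition miura_image :: "real \<Rightarrow> ((real \<Rightarrow> complex) \<Rightarrow> complex) set" where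
  "miura_image \<beta> = miura ` real_sobolev_functions \<beta>"

text \<open>
  \<open>L\<^sub>q \<ge> 0\<close> in the sense of forms. For real-valued \<open>q\<close> the number \<open>q (\<bar>\<phi>\<bar>\<^sup>2)\<close> is real, and
  \<^const>\<open>Re\<close> only changes its type.
\<close>

definition schroedinger_nonneg :: "((real \<Rightarrow> complex) \<Rightarrow> complex) \<Rightarrow> bool" where
  "schroedinger_nonneg q \<longleftrightarrow> (\<forall>\<phi>\<in>test_functions.
     (LINT x|lborel. (norm (nderiv 1 \<phi> x))\<^sup>2) + Re (q (\<lambda>x. of_real ((norm (\<phi> x))\<^sup>2))) \<ge> 0)"

end

theory Submission
  imports Defs "HOL-Probability.Probability" "HOL-Real_Asymp.Real_Asymp"
begin

text \<open>
  If \<open>q = r' + r\<^sup>2\<close>, the form of \<open>L\<^sub>q\<close> is \<open>\<integral> \<bar>\<phi>' - r \<phi>\<bar>\<^sup>2\<close>.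
  Conversely, let \<open>q = f' + g\<close> with nonnegative form. Replace \<open>f, g\<close> by test functions
  \<open>f\<^sub>n, g\<^sub>n\<close> so close to them that adding a small \<open>\<epsilon>\<^sub>n > 0\<close> to \<open>f\<^sub>n' + g\<^sub>n\<close> makes the form
  positive definite; then the solution of \<open>\<psi>'' = (f\<^sub>n' + g\<^sub>n + \<epsilon>\<^sub>n) \<psi>\<close> with \<open>\<psi>(-n) = 0\<close>,
  \<open>\<psi>'(-n) = 1\<close> has no further zero in \<open>(-n, n]\<close>, and \<open>r\<^sub>n = \<psi>'/\<psi>\<close> solves the Riccati equation.
  Its \<open>L\<^sup>2\<close> norm on compact intervals is bounded independently of \<open>n\<close>, the differences \<open>r\<^sub>n - f\<^sub>n\<close>
  converge locally uniformly along a subsequence by Gronwall's argument, and the limit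
  \<open>r \<in> L\<^sup>2\<close> satisfies \<open>r' + r\<^sup>2 = q\<close>. For the regularity of \<open>r\<close> write \<open>R\<close> and \<open>Q\<close> for the
  Fourier transforms of \<open>r\<close> and \<open>q\<close>: then \<open>Q = \<i> \<xi> R + (R * R) / (2 \<pi>)\<close>, and decay of \<open>R\<close> improves
  that of \<open>R * R\<close>, hence that of \<open>R\<close>, until the decay of \<open>Q\<close> is the only limit.
\<close>

subsection \<open>Smooth functions and test functions\<close>

text \<open>Nonnegativity of the form is not stable under approximation of \<open>f\<close> and
  \<open>g\<close>; hence \<open>\<epsilon>\<close>. The approximation error is at most
  \<open>\<delta>\<close> times the energy plus twice the squared maximum of the function tested.
  For a solution that vanishes at both ends of an interval these are bounded by its L2 norm, with a
  factor that depends neither on the interval nor on \<open>\<epsilon>\<close>, so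
  \<open>\<delta>\<close> can be fixed before the solution is known. The unknown is
  \<open>v = r - f\<close>: in \<open>v' = g + \<epsilon> - (f + v)\<^sup>2\<close> the derivative
  of \<open>f\<close> has cancelled. The equation stays meaningful for \<open>f\<close> in L2 and
  its solutions converge locally uniformly, whereas \<open>r\<close> converges only in L2 on compact
  sets. That convergence is strong, which lets the square pass to the limit. For the regularity,
  products are not controlled in Sobolev norms of low order. On the Fourier side, weighted square
  integrability of \<open>R\<close> gives pointwise decay of the convolution, and division by
  \<open>\<xi>\<close> gains more than the return to square integrability costs.\<close>

declare One_nat_def [simp del] \<comment> \<open>otherwise \<open>nderiv 1\<close> becomes \<open>nderiv (Suc 0)\<close>\<close>

section \<open>Iterated derivatives and closure properties of smooth functions\<close>

lemma nderiv_0 [simp]: "nderiv 0 f = f"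
  by (simp add: nderiv_def)

lemma nderiv_Suc: "nderiv (Suc n) f = (\<lambda>x. vector_derivative (nderiv n f) (at x))"
  by (simp add: nderiv_def)

lemma nderiv_Suc_0 [simp]: "nderiv (Suc 0) = nderiv 1"
  by (simp add: One_nat_def)

lemma nderiv_nderiv: "nderiv m (nderiv n f) = nderiv (m + n) f"
  by (simp add: nderiv_def funpow_add)

lemma nderiv_Suc': "nderiv (Suc n) f = nderiv n (nderiv 1 f)"
  unfolding nderiv_nderiv by (simp only: Suc_eq_plus1)

lemma smooth_has_vector_derivative:
  "smooth f \<Longrightarrow> (nderiv n f has_vector_derivative nderiv (Suc n) f x) (at x)"
  by (simp add: smooth_def nderiv_Suc vector_derivative_works)

lemma smooth_has_vector_derivative_1:
  "smooth f \<Longrightarrow> (f has_vector_derivative nderiv 1 f x) (at x)"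
  using smooth_has_vector_derivative[of f 0] by simp

lemma smooth_nderiv: "smooth f \<Longrightarrow> smooth (nderiv n f)"
  unfolding smooth_def nderiv_nderiv by blast

lemma nderiv_1_eqI:
  assumes "\<And>x. (f has_vector_derivative f' x) (at x)"
  shows "nderiv 1 f = f'"
proof -
  have "nderiv (Suc 0) f = f'"
    unfolding nderiv_Suc nderiv_0 using assms vector_derivative_at by blast
  then show ?thesis by simp
qed

text \<open>Smoothness is a greatest fixed point: a property that passes from a function to some
  derivative of it holds for all iterated derivatives. Later smoothness proofs only have to name an
  invariant family, never a formula for the derivative of order \<open>n\<close>.\<close>

lemma smooth_coinduct:
  assumes P: "P f"
    and step: "\<And>f. P f \<Longrightarrow> \<exists>f'. P f' \<and> (\<forall>x. (f has_vector_derivative f' x) (at x))"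
  shows "smooth f"
proof -
  have "P (nderiv n f)" for n
  proof (induction n)
    case (Suc n)
    then obtain f' where f': "P f'" "\<forall>x. (nderiv n f has_vector_derivative f' x) (at x)"
      using step by blast
    then have "nderiv (Suc n) f = f'"
      unfolding nderiv_Suc using vector_derivative_at by blast
    then show ?case using f' by simp
  qed (simp add: P)
  then show ?thesis
    unfolding smooth_def using step differentiableI_vector by blast
qed

lemma smooth_continuous_on: "smooth f \<Longrightarrow> continuous_on S f"
  by (metis continuous_at_imp_continuous_on differentiable_imp_continuous_within nderiv_0 smooth_def)

lemma smooth_measurable [measurable_dest]: "smooth f \<Longrightarrow> f \<in> borel_measurable borel"
  by (simp add: borel_measurable_continuous_onI smooth_continuous_on)

text \<open>Differentiating a product yields a sum of products, so sums and products have to be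
  treated together. The closure under both is invariant under differentiation and can be fed to
  \<open>smooth_coinduct\<close>.\<close>

inductive smooth_alg :: "(real \<Rightarrow> complex) \<Rightarrow> bool" where
  base: "smooth f \<Longrightarrow> smooth_alg f"
| add: "smooth_alg f \<Longrightarrow> smooth_alg g \<Longrightarrow> smooth_alg (\<lambda>x. f x + g x)"
| mult: "smooth_alg f \<Longrightarrow> smooth_alg g \<Longrightarrow> smooth_alg (\<lambda>x. f x * g x)"

lemma smooth_alg_smooth: "smooth_alg f \<Longrightarrow> smooth f"
proof (erule smooth_coinduct)
  fix f assume "smooth_alg f"
  then show "\<exists>f'. smooth_alg f' \<and> (\<forall>x. (f has_vector_derivative f' x) (at x))"
  proof induction
    case (base f)
    then show ?case
      using smooth_has_vector_derivative_1 smooth_nderiv smooth_alg.base by blast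
  next
    case (add f g)
    then obtain f' g' where "smooth_alg f'" "smooth_alg g'"
      "\<forall>x. (f has_vector_derivative f' x) (at x)" "\<forall>x. (g has_vector_derivative g' x) (at x)" by blast
    then show ?case
      by (intro exI[of _ "\<lambda>x. f' x + g' x"])
        (auto intro!: smooth_alg.add derivative_eq_intros)
  next
    case (mult f g)
    then obtain f' g' where "smooth_alg f'" "smooth_alg g'"
      "\<forall>x. (f has_vector_derivative f' x) (at x)" "\<forall>x. (g has_vector_derivative g' x) (at x)" by blast
    then show ?case
      by (intro exI[of _ "\<lambda>x. f x * g' x + f' x * g x"])
        (auto intro!: smooth_alg.add smooth_alg.mult mult.hyps has_vector_derivative_mult)
  qed
qed

lemma smooth_add: "smooth f \<Longrightarrow> smooth g \<Longrightarrow> smooth (\<lambda>x. f x + g x)"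
  and smooth_mult: "smooth f \<Longrightarrow> smooth g \<Longrightarrow> smooth (\<lambda>x. f x * g x)"
  by (auto intro: smooth_alg_smooth smooth_alg.intros)

lemma smooth_const: "smooth (\<lambda>x. c)"
  by (rule smooth_coinduct[where P = "\<lambda>f. \<exists>c. f = (\<lambda>x. c)"])
    (use has_vector_derivative_const in blast)+

lemma smooth_cmult: "smooth f \<Longrightarrow> smooth (\<lambda>x. c * f x)"
  by (intro smooth_mult smooth_const)

lemma smooth_diff: "smooth f \<Longrightarrow> smooth g \<Longrightarrow> smooth (\<lambda>x. f x - g x)"
  using smooth_add[OF _ smooth_cmult[of g "-1"]] by simp

lemma nderiv_of_real_ident: "nderiv 1 complex_of_real = (\<lambda>x. 1)"
proof (rule nderiv_1_eqI)
  fix x :: real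
  show "(complex_of_real has_vector_derivative 1) (at x)"
    by (auto intro!: derivative_eq_intros)
qed

lemma smooth_of_real: "smooth complex_of_real"
proof (rule smooth_coinduct[where P = "\<lambda>f. f = complex_of_real \<or> (\<exists>c. f = (\<lambda>x. c))"])
  fix f assume "f = complex_of_real \<or> (\<exists>c. f = (\<lambda>x. c))"
  moreover have "\<forall>x. (complex_of_real has_vector_derivative 1) (at x)"
    by (auto intro!: derivative_eq_intros)
  ultimately show "\<exists>f'. (f' = complex_of_real \<or> (\<exists>c. f' = (\<lambda>x. c))) \<and> (\<forall>x. (f has_vector_derivative f' x) (at x))"
    using has_vector_derivative_const by blast
qed simp

lemma smooth_cnj: "smooth f \<Longrightarrow> smooth (\<lambda>x. cnj (f x))"
proof (rule smooth_coinduct[where P = "\<lambda>h. \<exists>f. smooth f \<and> h = (\<lambda>x. cnj (f x))"], blast)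
  fix h assume "\<exists>f. smooth f \<and> h = (\<lambda>x. cnj (f x))"
  then obtain f where f: "smooth f" "h = (\<lambda>x. cnj (f x))" by blast
  then show "\<exists>f'. (\<exists>f. smooth f \<and> f' = (\<lambda>x. cnj (f x))) \<and> (\<forall>x. (h has_vector_derivative f' x) (at x))"
    using smooth_nderiv[OF f(1), of 1] has_vector_derivative_cnj[OF smooth_has_vector_derivative_1[OF f(1)]]
    by blast
qed

lemma nderiv_add:
  "smooth f \<Longrightarrow> smooth g \<Longrightarrow> nderiv n (\<lambda>x. f x + g x) = (\<lambda>x. nderiv n f x + nderiv n g x)"
proof (induction n arbitrary: f g)
  case (Suc n)
  have "nderiv 1 (\<lambda>x. f x + g x) = (\<lambda>x. nderiv 1 f x + nderiv 1 g x)"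
    by (intro nderiv_1_eqI has_vector_derivative_add smooth_has_vector_derivative_1 Suc.prems)
  then show ?case
    using Suc.IH[OF smooth_nderiv[OF Suc.prems(1), of 1] smooth_nderiv[OF Suc.prems(2), of 1]]
    by (simp add: nderiv_Suc'[of n])
qed simp

lemma nderiv_1_mult:
  "smooth f \<Longrightarrow> smooth g \<Longrightarrow> nderiv 1 (\<lambda>x. f x * g x) = (\<lambda>x. f x * nderiv 1 g x + nderiv 1 f x * g x)"
  by (intro nderiv_1_eqI has_vector_derivative_mult smooth_has_vector_derivative_1)

lemma nderiv_1_const: "nderiv 1 (\<lambda>x. c) = (\<lambda>x. 0)"
  by (intro nderiv_1_eqI) auto

lemma nderiv_cmult:
  "smooth f \<Longrightarrow> nderiv n (\<lambda>x. c * f x) = (\<lambda>x. c * nderiv n f x)"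
proof (induction n arbitrary: f)
  case (Suc n)
  have "nderiv 1 (\<lambda>x. c * f x) = (\<lambda>x. c * nderiv 1 f x)"
    by (simp only: nderiv_1_mult[OF smooth_const Suc.prems] nderiv_1_const) simp
  then show ?case
    using Suc.IH[OF smooth_nderiv[OF Suc.prems, of 1]] by (simp add: nderiv_Suc'[of n])
qed simp

lemma has_vector_derivative_affine:
  fixes c d :: real
  assumes "smooth f"
  shows "((\<lambda>x. f (c * x + d)) has_vector_derivative of_real c * nderiv 1 f (c * x + d)) (at x)"
proof -
  have "((f \<circ> (\<lambda>x. c * x + d)) has_vector_derivative c *\<^sub>R nderiv 1 f (c * x + d)) (at x)"
  proof (rule vector_diff_chain_at)
    show "((\<lambda>x. c * x + d) has_vector_derivative c) (at x)"
      by (auto intro!: derivative_eq_intros)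
  qed (rule smooth_has_vector_derivative_1[OF assms])
  then show ?thesis by (simp add: o_def scaleR_conv_of_real)
qed

lemma smooth_affine: "smooth f \<Longrightarrow> smooth (\<lambda>x. f (c * x + d))"
proof (rule smooth_coinduct[where P = "\<lambda>h. \<exists>f. smooth f \<and> h = (\<lambda>x. f (c * x + d))"], blast)
  fix h assume "\<exists>f. smooth f \<and> h = (\<lambda>x. f (c * x + d))"
  then obtain f where f: "smooth f" "h = (\<lambda>x. f (c * x + d))" by blast
  show "\<exists>f'. (\<exists>f. smooth f \<and> f' = (\<lambda>x. f (c * x + d))) \<and> (\<forall>x. (h has_vector_derivative f' x) (at x))"
    using smooth_cmult[OF smooth_nderiv[OF f(1), of 1], of "of_real c"]
      has_vector_derivative_affine[OF f(1), of c d]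
    by (intro exI[of _ "\<lambda>x. of_real c * nderiv 1 f (c * x + d)"])
      (auto simp: f(2) intro!: exI[of _ "\<lambda>x. of_real c * nderiv 1 f x"])
qed

lemma nderiv_affine:
  "smooth f \<Longrightarrow> nderiv n (\<lambda>x. f (c * x + d)) = (\<lambda>x. of_real c ^ n * nderiv n f (c * x + d))"
proof (induction n arbitrary: f)
  case (Suc n)
  have "nderiv 1 (\<lambda>x. f (c * x + d)) = (\<lambda>x. of_real c * nderiv 1 f (c * x + d))"
    by (intro nderiv_1_eqI has_vector_derivative_affine Suc.prems)
  then show ?case
    using Suc.IH[OF smooth_nderiv[OF Suc.prems, of 1]]
      nderiv_cmult[OF smooth_affine[OF smooth_nderiv[OF Suc.prems, of 1]], of n "of_real c"]
    by (simp add: nderiv_Suc'[of n] mult.assoc)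
qed simp

text \<open>A crude Leibniz rule. Keeping all derivatives up to order \<open>n\<close> of both
  factors avoids binomial coefficients; each differentiation turns one product into two, which
  accounts for the power of 2.\<close>

lemma norm_nderiv_mult_le:
  "smooth f \<Longrightarrow> smooth g \<Longrightarrow> norm (nderiv n (\<lambda>x. f x * g x) x)
    \<le> 2 ^ n * (\<Sum>i\<le>n. norm (nderiv i f x)) * (\<Sum>i\<le>n. norm (nderiv i g x))"
proof (induction n arbitrary: f g)
  case 0
  then show ?case by (simp add: norm_mult)
next
  case (Suc n)
  let ?S = "\<lambda>n f. \<Sum>i\<le>n. norm (nderiv i f x)"
  have mono: "?S n h \<le> ?S (Suc n) h" for h by simp
  have shift: "?S n (nderiv 1 h) \<le> ?S (Suc n) h" for h
    unfolding sum.atMost_Suc_shift by (simp add: nderiv_Suc'[symmetric])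
  have pos: "0 \<le> ?S n h" for n h by (simp add: sum_nonneg)
  note sm = smooth_nderiv[OF Suc.prems(1), of 1] smooth_nderiv[OF Suc.prems(2), of 1]
  have "norm (nderiv (Suc n) (\<lambda>x. f x * g x) x)
      = norm (nderiv n (\<lambda>x. f x * nderiv 1 g x) x + nderiv n (\<lambda>x. nderiv 1 f x * g x) x)"
    by (simp only: nderiv_Suc'[of n] nderiv_1_mult[OF Suc.prems]
        nderiv_add[OF smooth_mult[OF Suc.prems(1) sm(2)] smooth_mult[OF sm(1) Suc.prems(2)]])
  also have "\<dots> \<le> 2 ^ n * ?S n f * ?S n (nderiv 1 g) + 2 ^ n * ?S n (nderiv 1 f) * ?S n g"
    by (intro norm_triangle_le add_mono Suc.IH Suc.prems sm)
  also have "\<dots> \<le> 2 ^ n * ?S (Suc n) f * ?S (Suc n) g + 2 ^ n * ?S (Suc n) f * ?S (Suc n) g"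
    by (intro add_mono mult_mono mono shift order.refl pos mult_nonneg_nonneg) auto
  finally show ?case by simp
qed

section \<open>A smooth bump function\<close>

definition flat :: "real \<Rightarrow> real" where
  "flat x = (if x > 0 then exp (- (1 / x)) else 0)"

lemma poly_exp_tendsto_0:
  "((\<lambda>x. poly p (1 / x) * exp (- (1 / x))) \<longlongrightarrow> 0) (at_right (0::real))"
proof -
  have "((\<lambda>y. poly p y * exp (- y)) \<longlongrightarrow> 0) at_top"
  proof (induction p)
    case (pCons a p)
    have 1: "((\<lambda>y::real. a * exp (- y)) \<longlongrightarrow> 0) at_top"
      by real_asymp
    have "((\<lambda>y. y * poly p y * exp (- y)) \<longlongrightarrow> 0) at_top"
    proof -
      have "((\<lambda>y. \<Sum>i\<le>degree p. coeff p i * (y ^ Suc i / exp y)) \<longlongrightarrow> (\<Sum>i\<le>degree p. coeff p i * 0)) at_top"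
        by (intro tendsto_sum tendsto_mult tendsto_const tendsto_power_div_exp_0)
      moreover have "(\<lambda>y. \<Sum>i\<le>degree p. coeff p i * (y ^ Suc i / exp y)) = (\<lambda>y. y * poly p y * exp (- y))"
        by (rule ext) (simp add: poly_altdef exp_minus sum_distrib_left sum_distrib_right field_simps)
      ultimately show ?thesis by simp
    qed
    from tendsto_add[OF 1 this] show ?case by (simp add: algebra_simps)
  qed simp
  moreover have "filterlim (\<lambda>x::real. 1 / x) at_top (at_right 0)" by real_asymp
  ultimately show ?thesis by (rule filterlim_compose)
qed

text \<open>With \<open>y = 1 / x\<close> the family \<open>p(y) exp(-y)\<close> is closed under
  differentiation: \<open>y\<close> has derivative \<open>- y\<^sup>2\<close>, so \<open>p\<close>
  is replaced by \<open>y\<^sup>2 (p - p')\<close>. At 0 the difference quotient belongs to the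
  family again, with the polynomial \<open>y p\<close>, and tends to 0 because the exponential beats
  every polynomial.\<close>

lemma flat_poly_has_derivative:
  fixes p :: "real poly"
  defines "f \<equiv> \<lambda>p x::real. if x > 0 then poly p (1 / x) * exp (- (1 / x)) else 0"
  shows "(f p has_real_derivative f ([:0, 0, 1:] * (p - pderiv p)) x) (at x)"
proof (cases x "0::real" rule: linorder_cases)
  case less
  have "((\<lambda>x. 0) has_real_derivative 0) (at x)" by simp
  moreover have "open {..<0::real}" "x \<in> {..<0}" using less by auto
  ultimately have "(f p has_real_derivative 0) (at x)"
    by (rule has_field_derivative_transform_within_open) (auto simp: f_def)
  then show ?thesis using less by (simp add: f_def)
next
  case greater
  have "((\<lambda>x. poly p (1 / x) * exp (- (1 / x))) has_real_derivative
      f ([:0, 0, 1:] * (p - pderiv p)) x) (at x)"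
    using greater
    by (auto intro!: derivative_eq_intros poly_DERIV[THEN DERIV_chain2] simp: f_def field_simps power2_eq_square)
  moreover have "open {0::real<..}" "x \<in> {0<..}" using greater by auto
  ultimately show ?thesis
    by (rule has_field_derivative_transform_within_open) (auto simp: f_def)
next
  case equal
  have "((\<lambda>y. f p y / y) \<longlongrightarrow> 0) (at_left 0)"
    by (rule tendsto_eventually) (auto simp: f_def eventually_at_filter)
  moreover have "((\<lambda>y. f p y / y) \<longlongrightarrow> 0) (at_right 0)"
  proof (rule Lim_transform_eventually[OF poly_exp_tendsto_0[of "[:0, 1:] * p"]])
    show "\<forall>\<^sub>F x in at_right 0. poly ([:0, 1:] * p) (1 / x) * exp (- (1 / x)) = f p x / x"
      by (auto simp: f_def eventually_at_filter)
  qed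
  ultimately have "((\<lambda>y. f p y / y) \<longlongrightarrow> 0) (at 0)"
    by (simp add: filterlim_split_at)
  then show ?thesis
    using equal by (simp add: has_field_derivative_iff f_def)
qed

lemma smooth_flat: "smooth (\<lambda>x. of_real (flat x))"
proof -
  define f where "f = (\<lambda>(p::real poly) x. if x > 0 then poly p (1 / x) * exp (- (1 / x)) else 0)"
  have "smooth (\<lambda>x. of_real (f 1 x))"
  proof (rule smooth_coinduct[where P = "\<lambda>g. \<exists>p. g = (\<lambda>x. of_real (f p x))"], blast)
    fix g assume "\<exists>p. g = (\<lambda>x. complex_of_real (f p x))"
    then obtain p where "g = (\<lambda>x. complex_of_real (f p x))" by blast
    then show "\<exists>f'. (\<exists>p. f' = (\<lambda>x. of_real (f p x))) \<and> (\<forall>x. (g has_vector_derivative f' x) (at x))"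
      using has_vector_derivative_of_real[OF flat_poly_has_derivative[of p]] unfolding f_def by blast
  qed
  moreover have "f 1 = flat" by (auto simp: f_def flat_def)
  ultimately show ?thesis by simp
qed

definition bump :: "real \<Rightarrow> real \<Rightarrow> real \<Rightarrow> real" where
  "bump a b x = flat (x - a) * flat (b - x)"

lemma smooth_bump: "smooth (\<lambda>x. of_real (bump a b x))"
  using smooth_mult[OF smooth_affine[OF smooth_flat, of 1 "- a"] smooth_affine[OF smooth_flat, of "-1" b]]
  by (simp add: bump_def)

lemma bump_nonneg: "0 \<le> bump a b x"
  and bump_pos: "a < x \<Longrightarrow> x < b \<Longrightarrow> 0 < bump a b x"
  and bump_eq_0: "x \<notin> {a..b} \<Longrightarrow> bump a b x = 0"
  by (auto simp: bump_def flat_def)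

section \<open>Test functions and their supports\<close>

lemma test_functionI:
  assumes "smooth \<phi>" and "\<And>x. x \<notin> {a..b} \<Longrightarrow> \<phi> x = 0"
  shows "\<phi> \<in> test_functions"
proof -
  have "closure {x. \<phi> x \<noteq> 0} \<subseteq> {a..b}"
    by (rule closure_minimal) (use assms(2) in \<open>force+\<close>)
  then have "compact (closure {x. \<phi> x \<noteq> 0})"
    by (metis bounded_subset compact_Icc compact_eq_bounded_closed closed_closure)
  then show ?thesis using assms(1) by (simp add: test_functions_def)
qed

lemma test_function_smooth: "\<phi> \<in> test_functions \<Longrightarrow> smooth \<phi>"
  by (simp add: test_functions_def)

lemma test_function_support:
  assumes "\<phi> \<in> test_functions"
  obtains N :: real where "N > 0" "\<And>x. \<bar>x\<bar> \<ge> N \<Longrightarrow> \<phi> x = 0"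
proof -
  have "bounded (closure {x. \<phi> x \<noteq> 0})"
    using assms by (simp add: test_functions_def compact_imp_bounded)
  then obtain N where N: "\<And>x. \<phi> x \<noteq> 0 \<Longrightarrow> \<bar>x\<bar> \<le> N"
    unfolding bounded_iff using closure_subset by (metis (mono_tags, lifting) mem_Collect_eq real_norm_def subsetD)
  show ?thesis
    by (rule that[of "\<bar>N\<bar> + 1"]) (use N in fastforce)+
qed

lemma nderiv_vanishes_outside:
  assumes "smooth \<phi>" "closed K" "\<And>x. x \<notin> K \<Longrightarrow> \<phi> x = 0" "x \<notin> K"
  shows "nderiv n \<phi> x = 0"
  using assms(4)
proof (induction n arbitrary: x)
  case 0
  then show ?case using assms by simp
next
  case (Suc n)
  have "((\<lambda>x. 0) has_vector_derivative 0) (at x)" by simp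
  then have "(nderiv n \<phi> has_vector_derivative 0) (at x)"
    by (rule has_vector_derivative_transform_within_open[of _ _ _ "- K"])
      (use Suc assms(2) in auto)
  then show ?case
    by (simp add: nderiv_Suc vector_derivative_at)
qed

lemma test_function_nderiv:
  assumes "\<phi> \<in> test_functions"
  shows "nderiv n \<phi> \<in> test_functions"
proof -
  obtain N where N: "N > 0" "\<And>x. \<bar>x\<bar> \<ge> N \<Longrightarrow> \<phi> x = 0"
    using test_function_support[OF assms] by blast
  show ?thesis
  proof (rule test_functionI[of _ "-N" N])
    show "smooth (nderiv n \<phi>)" using assms by (simp add: test_function_smooth smooth_nderiv)
    show "nderiv n \<phi> x = 0" if "x \<notin> {-N..N}" for x
      by (rule nderiv_vanishes_outside[of _ "{-N..N}"]) (use that N assms test_function_smooth in auto)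
  qed
qed

lemma test_function_bounded:
  assumes "\<phi> \<in> test_functions"
  obtains C where "\<And>x. norm (\<phi> x) \<le> C"
proof -
  obtain N where N: "N > 0" "\<And>x. \<bar>x\<bar> \<ge> N \<Longrightarrow> \<phi> x = 0"
    using test_function_support[OF assms] by blast
  have "bounded (\<phi> ` {-N..N})"
    by (intro compact_imp_bounded compact_continuous_image smooth_continuous_on compact_Icc
        test_function_smooth assms)
  then obtain C where C: "\<forall>x\<in>{-N..N}. norm (\<phi> x) \<le> C"
    unfolding bounded_iff by auto
  have "norm (\<phi> x) \<le> \<bar>C\<bar>" for x
  proof (cases "x \<in> {-N..N}")
    case True
    then show ?thesis using bspec[OF C True] by linarith
  next
    case False
    then have "\<bar>x\<bar> \<ge> N" by auto
    then show ?thesis using N(2) by simp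
  qed
  then show ?thesis using that by blast
qed

lemma test_subset_schwartz: "test_functions \<subseteq> schwartz_functions"
proof
  fix \<phi> assume \<phi>: "\<phi> \<in> test_functions"
  have "\<exists>C. \<forall>x. \<bar>x\<bar> ^ k * norm (nderiv n \<phi> x) \<le> C" for k n
  proof -
    obtain N where N: "N > 0" "\<And>x. \<bar>x\<bar> \<ge> N \<Longrightarrow> nderiv n \<phi> x = 0"
      using test_function_support[OF test_function_nderiv[OF \<phi>]] by blast
    obtain C where C: "\<And>x. norm (nderiv n \<phi> x) \<le> C"
      using test_function_bounded[OF test_function_nderiv[OF \<phi>]] by blast
    have "\<bar>x\<bar> ^ k * norm (nderiv n \<phi> x) \<le> N ^ k * C" for x
    proof (cases "\<bar>x\<bar> \<ge> N")
      case True
      then show ?thesis using N C[of x] by (simp add: N(2))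
    next
      case False
      then show ?thesis using N C[of x] by (intro mult_mono power_mono) auto
    qed
    then show ?thesis by blast
  qed
  then show "\<phi> \<in> schwartz_functions"
    using \<phi> by (simp add: schwartz_functions_def test_function_smooth)
qed

lemma test_function_mult: "\<phi> \<in> test_functions \<Longrightarrow> smooth g \<Longrightarrow> (\<lambda>x. \<phi> x * g x) \<in> test_functions"
proof -
  assume \<phi>: "\<phi> \<in> test_functions" and g: "smooth g"
  obtain N where "N > 0" "\<And>x. \<bar>x\<bar> \<ge> N \<Longrightarrow> \<phi> x = 0"
    using test_function_support[OF \<phi>] by blast
  then show ?thesis
    by (intro test_functionI[of _ "-N" N] smooth_mult g test_function_smooth[OF \<phi>]) fastforce
qed

lemma test_function_add:
  assumes "\<phi> \<in> test_functions" "\<psi> \<in> test_functions"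
  shows "(\<lambda>x. \<phi> x + \<psi> x) \<in> test_functions"
proof -
  obtain N where N: "N > 0" "\<And>x. \<bar>x\<bar> \<ge> N \<Longrightarrow> \<phi> x = 0"
    using test_function_support[OF assms(1)] by blast
  obtain M where M: "M > 0" "\<And>x. \<bar>x\<bar> \<ge> M \<Longrightarrow> \<psi> x = 0"
    using test_function_support[OF assms(2)] by blast
  show ?thesis
  proof (rule test_functionI[of _ "- (N + M)" "N + M"])
    show "smooth (\<lambda>x. \<phi> x + \<psi> x)"
      by (intro smooth_add test_function_smooth assms)
    fix x assume "x \<notin> {- (N + M)..N + M}"
    then have "\<bar>x\<bar> \<ge> N" "\<bar>x\<bar> \<ge> M" using N(1) M(1) by auto
    then show "\<phi> x + \<psi> x = 0" by (simp add: N(2) M(2))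
  qed
qed

lemma test_function_cmult: "\<phi> \<in> test_functions \<Longrightarrow> (\<lambda>x. c * \<phi> x) \<in> test_functions"
  using test_function_mult[OF _ smooth_const[of c]] by (simp add: mult.commute)

lemma test_function_cnj: "\<phi> \<in> test_functions \<Longrightarrow> (\<lambda>x. cnj (\<phi> x)) \<in> test_functions"
proof -
  assume \<phi>: "\<phi> \<in> test_functions"
  obtain N where "N > 0" "\<And>x. \<bar>x\<bar> \<ge> N \<Longrightarrow> \<phi> x = 0"
    using test_function_support[OF \<phi>] by blast
  then show ?thesis
    by (intro test_functionI[of _ "-N" N] smooth_cnj test_function_smooth[OF \<phi>]) fastforce
qed

subsection \<open>Density of the test functions\<close>

text \<open>The distributions act on complex test functions, but the arguments with signs, squares
  and order run over real ones; this predicate moves between the two types.\<close>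

definition real_test :: "(real \<Rightarrow> real) \<Rightarrow> bool" where
  "real_test p \<longleftrightarrow> (\<lambda>x. complex_of_real (p x)) \<in> test_functions"

lemma real_polynomial_function_smooth:
  assumes "real_polynomial_function (p :: real \<Rightarrow> real)"
  shows "smooth (\<lambda>x. of_real (p x))"
  using assms
proof induction
  case (linear f)
  then interpret bounded_linear f .
  have "f x = f 1 * x" for x
    using scaleR[of x 1] by simp
  then have "(\<lambda>x. complex_of_real (f x)) = (\<lambda>x. of_real (f 1) * of_real x)"
    by (metis of_real_mult)
  then show ?case by (simp add: smooth_cmult smooth_of_real)
qed (simp_all add: smooth_const smooth_add smooth_mult)

lemma flat_le_1: "flat x \<le> 1"
  by (simp add: flat_def)

lemma bump_le_1: "bump a b x \<le> 1"
  unfolding bump_def using flat_le_1[of "x - a"] flat_le_1[of "b - x"]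
  by (intro mult_le_one) (auto simp: flat_def)

lemma continuous_bump: "continuous_on S (bump a b)"
  using continuous_on_Re[OF smooth_continuous_on[OF smooth_bump]] by simp

text \<open>Smooth approximation without mollifiers: divide \<open>h\<close> by a bump function on
  \<open>{a..b}\<close>, approximate the quotient by continuous functions and these by polynomials,
  and multiply by the bump again. The strict inequalities \<open>a < c\<close> and
  \<open>d < b\<close> keep the bump away from zero on the support of \<open>h\<close>, so the
  quotient is bounded.\<close>

lemma real_test_approx_AE:
  fixes h :: "real \<Rightarrow> real"
  assumes [measurable]: "h \<in> borel_measurable borel"
    and bd: "\<And>x. \<bar>h x\<bar> \<le> M"
    and supp: "\<And>x. x \<notin> {c..d} \<Longrightarrow> h x = 0"
    and "a < c" "c \<le> d" "d < b"
  obtains p B where "\<And>n::nat. real_test (p n)" "\<And>n x. x \<notin> {a..b} \<Longrightarrow> p n x = 0"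
    "\<And>n x. \<bar>p n x\<bar> \<le> B" "AE x in lborel. (\<lambda>n. p n x) \<longlonglongrightarrow> h x"
proof -
  have "\<exists>x\<in>{c..d}. \<forall>y\<in>{c..d}. bump a b x \<le> bump a b y"
    by (rule continuous_attains_inf) (use assms continuous_bump in auto)
  then obtain x0 where x0: "x0 \<in> {c..d}" "\<And>y. y \<in> {c..d} \<Longrightarrow> bump a b x0 \<le> bump a b y" by blast
  define m where "m = bump a b x0"
  have m: "m > 0" unfolding m_def using x0(1) assms by (intro bump_pos) auto
  define k where "k = (\<lambda>x. h x / bump a b x)"
  have [measurable]: "bump a b \<in> borel_measurable borel"
    by (intro borel_measurable_continuous_onI continuous_bump)
  have M: "0 \<le> M" using bd[of 0] by simp
  have kbd: "\<bar>k x\<bar> \<le> M / m" for x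
  proof (cases "x \<in> {c..d}")
    case True
    then show ?thesis
      unfolding k_def abs_divide using x0(2)[OF True] m bd[of x] M
      by (intro frac_le) (auto simp: m_def)
  next
    case False
    then show ?thesis using supp m M by (simp add: k_def)
  qed
  have hk: "bump a b x * k x = h x" for x
  proof (cases "x \<in> {c..d}")
    case True
    then have "bump a b x \<noteq> 0" using bump_pos[of a x b] assms by auto
    then show ?thesis by (simp add: k_def)
  next
    case False
    then show ?thesis using supp by (simp add: k_def)
  qed
  have "k \<in> borel_measurable lborel" unfolding k_def by measurable
  then have "k \<in> borel_measurable lebesgue" by (rule measurable_completion)
  then have "k measurable_on UNIV"
    by (simp add: lebesgue_measurable_imp_measurable_on)
  then obtain N g where N: "negligible N" and g: "\<And>n. continuous_on UNIV (g n)"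
    "\<And>x. x \<notin> N \<Longrightarrow> (\<lambda>n. g n x) \<longlonglongrightarrow> k x"
    unfolding measurable_on_def by auto
  \<comment> \<open>Truncating at the bound of \<open>k\<close> does not change the limit, but makes
    the approximants uniformly bounded, as dominated convergence will demand.\<close>
  define g' where "g' = (\<lambda>n x. max (- (M / m)) (min (M / m) (g n x)))"
  have g'c: "continuous_on {a..b} (g' n)" for n
    unfolding g'_def by (intro continuous_intros continuous_on_subset[OF g(1)]) auto
  have g'l: "(\<lambda>n. g' n x) \<longlonglongrightarrow> k x" if "x \<notin> N" for x
  proof -
    have "(\<lambda>n. g' n x) \<longlonglongrightarrow> max (- (M / m)) (min (M / m) (k x))"
      unfolding g'_def by (intro tendsto_intros g that)
    moreover have "max (- (M / m)) (min (M / m) (k x)) = k x" using kbd[of x] by auto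
    ultimately show ?thesis by simp
  qed
  have "\<exists>q. real_polynomial_function q \<and> (\<forall>x\<in>{a..b}. \<bar>g' n x - q x\<bar> < 1 / real (Suc n))" for n
  proof -
    obtain q where "real_polynomial_function q" "\<And>x. x \<in> {a..b} \<Longrightarrow> \<bar>g' n x - q x\<bar> < 1 / real (Suc n)"
      by (rule Stone_Weierstrass_real_polynomial_function[OF compact_Icc g'c[of n], where e = "1 / real (Suc n)"]) auto
    then show ?thesis by blast
  qed
  then obtain q where q: "\<And>n. real_polynomial_function (q n)"
    "\<And>n x. x \<in> {a..b} \<Longrightarrow> \<bar>g' n x - q n x\<bar> < 1 / real (Suc n)" by metis
  define p where "p = (\<lambda>n x. bump a b x * q n x)"
  show ?thesis
  proof (rule that[of p "M / m + 1"])
    show p0: "p n x = 0" if "x \<notin> {a..b}" for n x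
      using that by (simp add: p_def bump_eq_0)
    show "real_test (p n)" for n
      unfolding real_test_def
    proof (rule test_functionI[of _ a b])
      show "smooth (\<lambda>x. complex_of_real (p n x))"
        unfolding p_def of_real_mult
        by (intro smooth_mult smooth_bump real_polynomial_function_smooth q)
    qed (simp add: p0)
    show "\<bar>p n x\<bar> \<le> M / m + 1" for n x
    proof (cases "x \<in> {a..b}")
      case True
      have "\<bar>g' n x\<bar> \<le> M / m" using divide_nonneg_pos[OF M m] by (auto simp: g'_def max_def min_def)
      moreover have "1 / real (Suc n) \<le> 1" by simp
      ultimately have "\<bar>q n x\<bar> \<le> M / m + 1" using q(2)[OF True, of n] by linarith
      then have "\<bar>bump a b x\<bar> * \<bar>q n x\<bar> \<le> 1 * (M / m + 1)"
        using bump_le_1[of a b x] bump_nonneg[of a b x] by (intro mult_mono) auto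
      then show ?thesis by (simp add: p_def abs_mult)
    next
      case False
      then show ?thesis using p0 M m by simp
    qed
    have pl: "(\<lambda>n. p n x) \<longlonglongrightarrow> h x" if "x \<notin> N" for x
    proof (cases "x \<in> {a..b}")
      case True
      have "(\<lambda>n. g' n x - q n x) \<longlonglongrightarrow> 0"
      proof (rule Lim_null_comparison)
        show "\<forall>\<^sub>F n in sequentially. norm (g' n x - q n x) \<le> 1 / real (Suc n)"
          using q(2)[OF True] by (intro always_eventually) (auto intro: less_imp_le)
        show "(\<lambda>n. 1 / real (Suc n)) \<longlonglongrightarrow> 0"
          using LIMSEQ_inverse_real_of_nat by (simp add: inverse_eq_divide)
      qed
      from tendsto_diff[OF g'l[OF that] this]
      have "(\<lambda>n. q n x) \<longlonglongrightarrow> k x" by simp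
      then show ?thesis
        unfolding p_def hk[of x, symmetric] by (intro tendsto_intros)
    next
      case False
      then have "h x = 0" using supp[of x] assms by auto
      then show ?thesis using False p0 by simp
    qed
    have "AE x in lebesgue. x \<notin> N"
      using N by (simp add: negligible_iff_null_sets AE_not_in)
    then have "AE x in lborel. x \<notin> N"
      by (simp add: AE_completion_iff)
    then show "AE x in lborel. (\<lambda>n. p n x) \<longlonglongrightarrow> h x"
      by eventually_elim (rule pl)
  qed
qed

lemma real_test_measurable: "real_test p \<Longrightarrow> p \<in> borel_measurable borel"
proof -
  assume "real_test p"
  then have [measurable]: "(\<lambda>x. complex_of_real (p x)) \<in> borel_measurable borel"
    unfolding real_test_def using smooth_measurable test_function_smooth by blast
  have "(\<lambda>x. Re (complex_of_real (p x))) \<in> borel_measurable borel" by measurable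
  then show ?thesis by simp
qed

lemma abs_add_power_le: "\<bar>x + y\<bar> ^ p \<le> 2 ^ p * (\<bar>x\<bar> ^ p + \<bar>y\<bar> ^ p)" for x y :: real
proof -
  have "\<bar>x + y\<bar> ^ p \<le> (2 * max \<bar>x\<bar> \<bar>y\<bar>) ^ p"
    by (intro power_mono) auto
  also have "\<dots> = 2 ^ p * max \<bar>x\<bar> \<bar>y\<bar> ^ p" by (simp add: power_mult_distrib)
  also have "\<dots> \<le> 2 ^ p * (\<bar>x\<bar> ^ p + \<bar>y\<bar> ^ p)"
    by (intro mult_left_mono) (auto simp: max_def)
  finally show ?thesis .
qed

text \<open>The support of \<open>\<rho>\<close> must not leave the given interval, so
  \<open>h\<close> is first cut down to a smaller interval and to bounded values; then
  \<open>real_test_approx_AE\<close> has room for its bump. Both replacements are controlled by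
  dominated convergence.\<close>

lemma real_test_dense_Icc:
  fixes h :: "real \<Rightarrow> real"
  assumes [measurable]: "h \<in> borel_measurable borel"
    and int: "integrable lborel (\<lambda>x. \<bar>h x\<bar> ^ p)"
    and supp: "\<And>x. x \<notin> {a..b} \<Longrightarrow> h x = 0"
    and "a < b" "p > 0" "e > 0"
  obtains \<rho> where "real_test \<rho>" "\<And>x. x \<notin> {a..b} \<Longrightarrow> \<rho> x = 0"
    "integrable lborel (\<lambda>x. \<bar>h x - \<rho> x\<bar> ^ p)" "(LINT x|lborel. \<bar>h x - \<rho> x\<bar> ^ p) < e"
proof -
  \<comment> \<open>The factor 3 keeps the shrunk interval
    \<open>{a + \<delta> n..b - \<delta> n}\<close> nonempty already for \<open>n = 0\<close>. The
    end points \<open>a\<close> and \<open>b\<close> are cut off for every \<open>n\<close>, so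
    convergence there is lost, on a null set.\<close>
  define \<delta> where "\<delta> = (\<lambda>n. (b - a) / (3 * real (Suc n)))"
  have \<delta>pos: "\<delta> n > 0" for n using assms by (simp add: \<delta>_def)
  have \<delta>le: "3 * \<delta> n \<le> b - a" for n
    using assms mult_right_mono[of a b "real n"] unfolding \<delta>_def by (simp add: field_simps)
  have \<delta>0: "\<delta> \<longlonglongrightarrow> 0" unfolding \<delta>_def by real_asymp
  define H where "H = (\<lambda>n x. if x \<in> {a + \<delta> n..b - \<delta> n} \<and> \<bar>h x\<bar> \<le> real n then h x else 0)"
  have [measurable]: "H n \<in> borel_measurable borel" for n unfolding H_def by measurable
  have Hlim: "(\<lambda>n. H n x) \<longlonglongrightarrow> h x" if "x \<noteq> a" "x \<noteq> b" for x
  proof (cases "x \<in> {a..b}")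
    case True
    then have "a < x" "x < b" using that by auto
    have "\<forall>\<^sub>F n in sequentially. \<delta> n < min (x - a) (b - x)"
      by (rule order_tendstoD(2)[OF \<delta>0]) (use \<open>a < x\<close> \<open>x < b\<close> in auto)
    moreover have "\<forall>\<^sub>F n in sequentially. \<bar>h x\<bar> \<le> real n"
      by (metis eventually_sequentiallyI of_nat_le_iff order_trans real_arch_simple)
    ultimately have "\<forall>\<^sub>F n in sequentially. H n x = h x"
      by eventually_elim (auto simp: H_def)
    then show ?thesis by (rule tendsto_eventually)
  next
    case False
    then have "H n x = 0" for n using \<delta>pos[of n] by (auto simp: H_def)
    then show ?thesis using False by (simp add: supp)
  qed
  have "(\<lambda>n. LINT x|lborel. \<bar>h x - H n x\<bar> ^ p) \<longlonglongrightarrow> (LINT x::real|lborel. 0)"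
  proof (rule integral_dominated_convergence[where w = "\<lambda>x. \<bar>h x\<bar> ^ p"])
    have "AE x in lborel. x \<noteq> a \<and> x \<noteq> b"
      using AE_lborel_singleton[of a] AE_lborel_singleton[of b] by eventually_elim auto
    then show "AE x in lborel. (\<lambda>n. \<bar>h x - H n x\<bar> ^ p) \<longlonglongrightarrow> 0"
    proof eventually_elim
      case (elim x)
      have "(\<lambda>n. \<bar>h x - H n x\<bar> ^ p) \<longlonglongrightarrow> \<bar>h x - h x\<bar> ^ p"
        by (intro tendsto_intros Hlim) (use elim in auto)
      then show ?case
        using \<open>p > 0\<close> by (metis cancel_comm_monoid_add_class.diff_cancel abs_zero zero_power)
    qed
    show "AE x in lborel. norm (\<bar>h x - H n x\<bar> ^ p) \<le> \<bar>h x\<bar> ^ p" for n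
      by (auto simp: H_def intro!: power_mono)
  qed (use int in auto)
  \<comment> \<open>There are two errors, and \<open>abs_add_power_le\<close> charges a factor
    \<open>2 ^ p\<close> for adding them.\<close>
  moreover define e' where "e' = e / (2 * 2 ^ p)"
  have e': "e' > 0" using \<open>e > 0\<close> by (simp add: e'_def)
  ultimately have "\<forall>\<^sub>F n in sequentially. (LINT x|lborel. \<bar>h x - H n x\<bar> ^ p) < e'"
    by (intro order_tendstoD) auto
  then obtain n where n: "(LINT x|lborel. \<bar>h x - H n x\<bar> ^ p) < e'"
    using eventually_happens'[OF sequentially_bot] by blast
  have Hint: "integrable lborel (\<lambda>x. \<bar>h x - H n x\<bar> ^ p)"
    by (rule Bochner_Integration.integrable_bound[OF int]) (auto simp: H_def intro!: power_mono)
  have order: "a < a + \<delta> n" "a + \<delta> n \<le> b - \<delta> n" "b - \<delta> n < b" using \<delta>pos[of n] \<delta>le[of n] by auto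
  obtain q B where q: "\<And>k. real_test (q k)" "\<And>k x. x \<notin> {a..b} \<Longrightarrow> q k x = 0"
    "\<And>k x. \<bar>q k x\<bar> \<le> B" "AE x in lborel. (\<lambda>k. q k x) \<longlonglongrightarrow> H n x"
  proof (rule real_test_approx_AE[of "H n" "real n" "a + \<delta> n" "b - \<delta> n" a b])
    show "\<bar>H n x\<bar> \<le> real n" for x by (simp add: H_def)
    show "H n x = 0" if "x \<notin> {a + \<delta> n..b - \<delta> n}" for x using that by (auto simp: H_def)
  qed (use order in auto)
  have [measurable]: "q k \<in> borel_measurable borel" for k using q(1) real_test_measurable by blast
  have wint: "integrable lborel (\<lambda>x. indicator {a..b} x * (real n + B) ^ p)"
    using lborel_integrable_real_affine by (intro integrable_mult_left) (auto simp: assms(4) less_imp_le)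
  have bound: "\<bar>H n x - q k x\<bar> ^ p \<le> indicator {a..b} x * (real n + B) ^ p" for k x
  proof (cases "x \<in> {a..b}")
    case True
    have "\<bar>H n x\<bar> \<le> real n" by (simp add: H_def)
    then have "\<bar>H n x - q k x\<bar> \<le> real n + B" using q(3)[of k x] by linarith
    then show ?thesis using True by (simp add: power_mono)
  next
    case False
    then show ?thesis using q(2)[OF False] supp[OF False] \<open>p > 0\<close> by (simp add: H_def zero_power)
  qed
  have "(\<lambda>k. LINT x|lborel. \<bar>H n x - q k x\<bar> ^ p) \<longlonglongrightarrow> (LINT x::real|lborel. 0)"
  proof (rule integral_dominated_convergence[OF _ _ wint])
    show "AE x in lborel. (\<lambda>k. \<bar>H n x - q k x\<bar> ^ p) \<longlonglongrightarrow> 0"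
      using q(4)
    proof eventually_elim
      case (elim x)
      have "(\<lambda>k. \<bar>H n x - q k x\<bar> ^ p) \<longlonglongrightarrow> \<bar>H n x - H n x\<bar> ^ p"
        by (intro tendsto_intros elim)
      then show ?case
        using \<open>p > 0\<close> by (metis cancel_comm_monoid_add_class.diff_cancel abs_zero zero_power)
    qed
    show "AE x in lborel. norm (\<bar>H n x - q k x\<bar> ^ p) \<le> indicator {a..b} x * (real n + B) ^ p" for k
      using bound by auto
  qed auto
  then have "\<forall>\<^sub>F k in sequentially. (LINT x|lborel. \<bar>H n x - q k x\<bar> ^ p) < e'"
    using e' by (intro order_tendstoD) auto
  then obtain k where k: "(LINT x|lborel. \<bar>H n x - q k x\<bar> ^ p) < e'"
    using eventually_happens'[OF sequentially_bot] by blast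
  have qint: "integrable lborel (\<lambda>x. \<bar>H n x - q k x\<bar> ^ p)"
    by (rule Bochner_Integration.integrable_bound[OF wint])
      (auto intro!: AE_I2 order_trans[OF bound abs_ge_self])
  have le: "\<bar>h x - q k x\<bar> ^ p \<le> 2 ^ p * (\<bar>h x - H n x\<bar> ^ p + \<bar>H n x - q k x\<bar> ^ p)" for x
    using abs_add_power_le[of "h x - H n x" "H n x - q k x" p] by simp
  have sint: "integrable lborel (\<lambda>x. 2 ^ p * (\<bar>h x - H n x\<bar> ^ p + \<bar>H n x - q k x\<bar> ^ p))"
    using Hint qint by auto
  have int': "integrable lborel (\<lambda>x. \<bar>h x - q k x\<bar> ^ p)"
    by (rule Bochner_Integration.integrable_bound[OF sint]) (use le in auto)
  have "(LINT x|lborel. \<bar>h x - q k x\<bar> ^ p)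
      \<le> (LINT x|lborel. 2 ^ p * (\<bar>h x - H n x\<bar> ^ p + \<bar>H n x - q k x\<bar> ^ p))"
    by (intro integral_mono int' sint le)
  also have "\<dots> = 2 ^ p * ((LINT x|lborel. \<bar>h x - H n x\<bar> ^ p) + (LINT x|lborel. \<bar>H n x - q k x\<bar> ^ p))"
    using Hint qint by simp
  also have "\<dots> < 2 ^ p * (e' + e')"
    using n k by (intro mult_strict_left_mono add_strict_mono) auto
  also have "\<dots> = e" by (simp add: e'_def field_simps)
  finally show ?thesis using that[of "q k"] q int' by blast
qed

lemma real_test_dense:
  fixes h :: "real \<Rightarrow> real"
  assumes [measurable]: "h \<in> borel_measurable borel"
    and int: "integrable lborel (\<lambda>x. \<bar>h x\<bar> ^ p)" and "p > 0" "e > 0"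
  obtains \<rho> where "real_test \<rho>"
    "integrable lborel (\<lambda>x. \<bar>h x - \<rho> x\<bar> ^ p)" "(LINT x|lborel. \<bar>h x - \<rho> x\<bar> ^ p) < e"
proof -
  define H where "H = (\<lambda>n x. if \<bar>x\<bar> \<le> real n then h x else 0)"
  have [measurable]: "H n \<in> borel_measurable borel" for n unfolding H_def by measurable
  have Hlim: "(\<lambda>n. H n x) \<longlonglongrightarrow> h x" for x
  proof -
    have "\<forall>\<^sub>F n in sequentially. \<bar>x\<bar> \<le> real n"
      by (metis eventually_sequentiallyI of_nat_le_iff order_trans real_arch_simple)
    then have "\<forall>\<^sub>F n in sequentially. H n x = h x"
      by eventually_elim (auto simp: H_def)
    then show ?thesis by (rule tendsto_eventually)
  qed
  have "(\<lambda>n. LINT x|lborel. \<bar>h x - H n x\<bar> ^ p) \<longlonglongrightarrow> (LINT x::real|lborel. 0)"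
  proof (rule integral_dominated_convergence[where w = "\<lambda>x. \<bar>h x\<bar> ^ p"])
    have "(\<lambda>n. \<bar>h x - H n x\<bar> ^ p) \<longlonglongrightarrow> \<bar>h x - h x\<bar> ^ p" for x
      by (intro tendsto_intros Hlim)
    then show "AE x in lborel. (\<lambda>n. \<bar>h x - H n x\<bar> ^ p) \<longlonglongrightarrow> 0"
      using \<open>p > 0\<close> by (intro AE_I2) (metis cancel_comm_monoid_add_class.diff_cancel abs_zero zero_power)
    show "AE x in lborel. norm (\<bar>h x - H n x\<bar> ^ p) \<le> \<bar>h x\<bar> ^ p" for n
      by (auto simp: H_def intro!: power_mono)
  qed (use int in auto)
  moreover define e' where "e' = e / (2 * 2 ^ p)"
  have e': "e' > 0" using \<open>e > 0\<close> by (simp add: e'_def)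
  ultimately have "\<forall>\<^sub>F n in sequentially. (LINT x|lborel. \<bar>h x - H n x\<bar> ^ p) < e'"
    by (intro order_tendstoD) auto
  then obtain n where n: "(LINT x|lborel. \<bar>h x - H n x\<bar> ^ p) < e'"
    using eventually_happens'[OF sequentially_bot] by blast
  have Hint: "integrable lborel (\<lambda>x. \<bar>h x - H n x\<bar> ^ p)"
    by (rule Bochner_Integration.integrable_bound[OF int]) (auto simp: H_def intro!: power_mono)
  have "integrable lborel (\<lambda>x. \<bar>H n x\<bar> ^ p)"
    by (rule Bochner_Integration.integrable_bound[OF int]) (auto simp: H_def intro!: power_mono)
  note Hp = this
  obtain \<rho> where \<rho>: "real_test \<rho>"
    "integrable lborel (\<lambda>x. \<bar>H n x - \<rho> x\<bar> ^ p)" "(LINT x|lborel. \<bar>H n x - \<rho> x\<bar> ^ p) < e'"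
  proof (rule real_test_dense_Icc[of "H n" p "- real n - 1" "real n + 1" e'])
    show "H n x = 0" if "x \<notin> {- real n - 1..real n + 1}" for x
      using that by (auto simp: H_def)
  qed (use e' \<open>p > 0\<close> Hp in simp_all)
  have [measurable]: "\<rho> \<in> borel_measurable borel" using \<rho>(1) real_test_measurable by blast
  have le: "\<bar>h x - \<rho> x\<bar> ^ p \<le> 2 ^ p * (\<bar>h x - H n x\<bar> ^ p + \<bar>H n x - \<rho> x\<bar> ^ p)" for x
    using abs_add_power_le[of "h x - H n x" "H n x - \<rho> x" p] by simp
  have sint: "integrable lborel (\<lambda>x. 2 ^ p * (\<bar>h x - H n x\<bar> ^ p + \<bar>H n x - \<rho> x\<bar> ^ p))"
    using Hint \<rho> by auto
  have int': "integrable lborel (\<lambda>x. \<bar>h x - \<rho> x\<bar> ^ p)"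
    by (rule Bochner_Integration.integrable_bound[OF sint]) (use le in auto)
  have "(LINT x|lborel. \<bar>h x - \<rho> x\<bar> ^ p)
      \<le> (LINT x|lborel. 2 ^ p * (\<bar>h x - H n x\<bar> ^ p + \<bar>H n x - \<rho> x\<bar> ^ p))"
    by (intro integral_mono int' sint le)
  also have "\<dots> = 2 ^ p * ((LINT x|lborel. \<bar>h x - H n x\<bar> ^ p) + (LINT x|lborel. \<bar>H n x - \<rho> x\<bar> ^ p))"
    using Hint \<rho> by simp
  also have "\<dots> < 2 ^ p * (e' + e')"
    using n \<rho> by (intro mult_strict_left_mono add_strict_mono) auto
  also have "\<dots> = e" by (simp add: e'_def field_simps)
  finally show ?thesis using that[of \<rho>] \<rho> int' by blast
qed

section \<open>The fundamental lemma of the calculus of variations\<close>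

lemma integrable_mult_bounded_support:
  fixes H \<phi> :: "real \<Rightarrow> 'a :: {real_normed_div_algebra, banach, second_countable_topology}"
  assumes H: "set_integrable lborel {a..b} H"
    and [measurable]: "H \<in> borel_measurable borel" "\<phi> \<in> borel_measurable borel"
    and "\<And>x. norm (\<phi> x) \<le> B" "\<And>x. x \<notin> {a..b} \<Longrightarrow> \<phi> x = 0"
  shows "integrable lborel (\<lambda>x. H x * \<phi> x)"
proof (rule Bochner_Integration.integrable_bound)
  show "integrable lborel (\<lambda>x. B * norm (indicator {a..b} x *\<^sub>R H x))"
    using H unfolding set_integrable_def by (intro integrable_mult_right integrable_norm)
  have "norm (H x * \<phi> x) \<le> B * norm (indicator {a..b} x *\<^sub>R H x)" for x
    using assms(4)[of x] assms(5)[of x] mult_right_mono[OF assms(4)[of x], of "norm (H x)"]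
    by (cases "x \<in> {a..b}") (auto simp: norm_mult mult.commute)
  then show "AE x in lborel. norm (H x * \<phi> x) \<le> norm (B * norm (indicator {a..b} x *\<^sub>R H x))"
    by (intro AE_I2) (smt (verit) norm_not_less_zero real_norm_def)
qed measurable

text \<open>Test against uniformly bounded approximations of \<open>sgn H\<close> on a window,
  supported in a window larger by 1; dominated convergence turns the hypothesis into the vanishing
  of the integral of \<open>\<bar>H\<bar>\<close> over the window.\<close>

lemma du_Bois_Reymond_real:
  fixes H :: "real \<Rightarrow> real"
  assumes [measurable]: "H \<in> borel_measurable borel"
    and int: "\<And>N. set_integrable lborel {- N..N} H"
    and zero: "\<And>p. real_test p \<Longrightarrow> (LINT x|lborel. H x * p x) = 0"
  shows "AE x in lborel. H x = 0"
proof -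
  have "AE x in lborel. indicator {- real N..real N} x * \<bar>H x\<bar> = 0" for N
  proof -
    define N' where "N' = real N"
    have N': "N' \<ge> 0" by (simp add: N'_def)
    define h where "h = (\<lambda>x. indicator {- N'..N'} x * sgn (H x))"
    obtain p B where p: "\<And>n::nat. real_test (p n)" "\<And>n x. x \<notin> {- N' - 1..N' + 1} \<Longrightarrow> p n x = 0"
      "\<And>n x. \<bar>p n x\<bar> \<le> B" "AE x in lborel. (\<lambda>n. p n x) \<longlonglongrightarrow> h x"
    proof (rule real_test_approx_AE[of h 1 "- N'" "N'" "- N' - 1" "N' + 1"])
      show "h \<in> borel_measurable borel" unfolding h_def by measurable
      show "\<bar>h x\<bar> \<le> 1" for x by (auto simp: h_def indicator_def sgn_if)
      show "h x = 0" if "x \<notin> {- N'..N'}" for x using that by (simp add: h_def)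
    qed (use N' in auto)
    have [measurable]: "p n \<in> borel_measurable borel" for n using p(1) real_test_measurable by blast
    have w: "integrable lborel (\<lambda>x. B * \<bar>indicator {- (N' + 1)..N' + 1} x *\<^sub>R H x\<bar>)"
      using int[of "N' + 1"] unfolding set_integrable_def by (intro integrable_mult_right integrable_abs)
    have "(\<lambda>n. LINT x|lborel. H x * p n x) \<longlonglongrightarrow> (LINT x|lborel. H x * h x)"
    proof (rule integral_dominated_convergence[OF _ _ w])
      show "AE x in lborel. (\<lambda>n. H x * p n x) \<longlonglongrightarrow> H x * h x"
        using p(4) by eventually_elim (intro tendsto_intros)
      have "\<bar>H x * p n x\<bar> \<le> B * \<bar>indicator {- (N' + 1)..N' + 1} x *\<^sub>R H x\<bar>" for n x
        using p(2)[of x n] p(3)[of n x] mult_right_mono[OF p(3)[of n x], of "\<bar>H x\<bar>"]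
        by (cases "x \<in> {- (N' + 1)..N' + 1}") (auto simp: abs_mult mult.commute)
      then show "AE x in lborel. norm (H x * p n x) \<le> B * \<bar>indicator {- (N' + 1)..N' + 1} x *\<^sub>R H x\<bar>" for n
        by (intro AE_I2) simp
    qed (auto simp: h_def)
    then have "(LINT x|lborel. H x * h x) = 0"
      using zero[OF p(1)] by (simp add: LIMSEQ_const_iff)
    moreover have "H x * h x = indicator {- N'..N'} x * \<bar>H x\<bar>" for x
      by (simp add: h_def sgn_if abs_if)
    ultimately have "(LINT x|lborel. indicator {- N'..N'} x * \<bar>H x\<bar>) = 0" by simp
    moreover have "integrable lborel (\<lambda>x. indicator {- N'..N'} x * \<bar>H x\<bar>)"
      using integrable_abs[OF int[of N', unfolded set_integrable_def]] by (simp add: abs_mult)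
    ultimately show ?thesis
      by (subst (asm) integral_nonneg_eq_0_iff_AE) (auto simp: N'_def)
  qed
  then have "AE x in lborel. \<forall>N. indicator {- real N..real N} x * \<bar>H x\<bar> = 0"
    unfolding AE_all_countable by blast
  then show ?thesis
  proof eventually_elim
    case (elim x)
    obtain N where "\<bar>x\<bar> \<le> real N" using real_arch_simple by blast
    then show ?case using elim[rule_format, of N] by (auto simp: indicator_def split: if_splits)
  qed
qed

lemma real_test_support:
  assumes "real_test p"
  obtains N where "N > 0" "\<And>x. \<bar>x\<bar> \<ge> N \<Longrightarrow> p x = 0"
proof -
  obtain N where "N > 0" "\<And>x. \<bar>x\<bar> \<ge> N \<Longrightarrow> complex_of_real (p x) = 0"
    using test_function_support[OF assms[unfolded real_test_def]] by blast
  then show ?thesis using that[of N] by simp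
qed

lemma real_test_bounded:
  assumes "real_test p"
  obtains C where "\<And>x. \<bar>p x\<bar> \<le> C"
proof -
  obtain C where "\<And>x. norm (complex_of_real (p x)) \<le> C"
    using test_function_bounded[OF assms[unfolded real_test_def]] by blast
  then show ?thesis using that[of C] by simp
qed

lemma du_Bois_Reymond:
  fixes H :: "real \<Rightarrow> complex"
  assumes [measurable]: "H \<in> borel_measurable borel"
    and int: "\<And>N. set_integrable lborel {- N..N} H"
    and zero: "\<And>\<phi>. \<phi> \<in> test_functions \<Longrightarrow> (LINT x|lborel. H x * \<phi> x) = 0"
  shows "AE x in lborel. H x = 0"
proof -
  have I: "integrable lborel (\<lambda>x. H x * of_real (p x))" if p: "real_test p" for p
  proof -
    obtain N where N: "N > 0" "\<And>x. \<bar>x\<bar> \<ge> N \<Longrightarrow> p x = 0" using real_test_support[OF p] by blast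
    obtain C where C: "\<And>x. \<bar>p x\<bar> \<le> C" using real_test_bounded[OF p] by blast
    have [measurable]: "p \<in> borel_measurable borel" using p by (rule real_test_measurable)
    show ?thesis
      by (rule integrable_mult_bounded_support[OF int[of N], where B = C]) (use C N(2) in auto)
  qed
  have "AE x in lborel. Re (H x) = 0"
  proof (rule du_Bois_Reymond_real)
    show "set_integrable lborel {- N..N} (\<lambda>x. Re (H x))" for N
      using integrable_Re[OF int[of N, unfolded set_integrable_def]] by (simp add: set_integrable_def)
    show "(LINT x|lborel. Re (H x) * p x) = 0" if "real_test p" for p
      using integral_Re[OF I[OF that]] zero[OF that[unfolded real_test_def]] by simp
  qed measurable
  moreover have "AE x in lborel. Im (H x) = 0"
  proof (rule du_Bois_Reymond_real)
    show "set_integrable lborel {- N..N} (\<lambda>x. Im (H x))" for N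
      using integrable_Im[OF int[of N, unfolded set_integrable_def]] by (simp add: set_integrable_def)
    show "(LINT x|lborel. Im (H x) * p x) = 0" if "real_test p" for p
      using integral_Im[OF I[OF that]] zero[OF that[unfolded real_test_def]] by simp
  qed measurable
  ultimately show ?thesis by eventually_elim (simp add: complex_eq_iff)
qed

section \<open>Square integrable functions and the Cauchy-Schwarz inequality\<close>

lemma integrable_mult_L2:
  fixes f g :: "'a \<Rightarrow> 'b :: {real_normed_div_algebra, banach, second_countable_topology}"
  assumes [measurable]: "f \<in> borel_measurable M" "g \<in> borel_measurable M"
    and "integrable M (\<lambda>x. (norm (f x))\<^sup>2)" "integrable M (\<lambda>x. (norm (g x))\<^sup>2)"
  shows "integrable M (\<lambda>x. f x * g x)"
proof (rule Bochner_Integration.integrable_bound)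
  show "integrable M (\<lambda>x. (norm (f x))\<^sup>2 + (norm (g x))\<^sup>2)" using assms by auto
  have "norm (f x * g x) \<le> (norm (f x))\<^sup>2 + (norm (g x))\<^sup>2" for x
    using sum_squares_bound[of "norm (f x)" "norm (g x)"] mult_nonneg_nonneg[OF norm_ge_zero norm_ge_zero, of "f x" "g x"]
    unfolding norm_mult mult.assoc by linarith
  then show "AE x in M. norm (f x * g x) \<le> norm ((norm (f x))\<^sup>2 + (norm (g x))\<^sup>2)" by simp
qed measurable

lemma discriminant_nonpos:
  fixes A B C :: real
  assumes "0 \<le> A" and q: "\<And>t. 0 \<le> A * t\<^sup>2 - 2 * t * C + B"
  shows "C\<^sup>2 \<le> A * B"
proof (cases "A = 0")
  case True
  have "C = 0"
  proof (rule ccontr)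
    assume "C \<noteq> 0"
    \<comment> \<open>For \<open>A = 0\<close> the polynomial is affine in \<open>t\<close>; this
      \<open>t\<close> gives it the value -1.\<close>
    then have "2 * ((B + 1) / (2 * C)) * C = B + 1" by simp
    then show False using q[of "(B + 1) / (2 * C)"] True by simp
  qed
  then show ?thesis using True by simp
next
  case False
  have "A * (C / A)\<^sup>2 - 2 * (C / A) * C + B = B - C\<^sup>2 / A"
    using False by (simp add: power2_eq_square)
  then have "C\<^sup>2 / A \<le> B" using q[of "C / A"] by simp
  then show ?thesis using False assms(1) by (simp add: pos_divide_le_eq mult.commute)
qed

lemma Cauchy_Schwarz_integral:
  fixes f g :: "'a \<Rightarrow> real"
  assumes [measurable]: "f \<in> borel_measurable M" "g \<in> borel_measurable M"
    and f: "integrable M (\<lambda>x. (f x)\<^sup>2)" and g: "integrable M (\<lambda>x. (g x)\<^sup>2)"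
  shows "(LINT x|M. \<bar>f x\<bar> * \<bar>g x\<bar>)\<^sup>2 \<le> (LINT x|M. (f x)\<^sup>2) * (LINT x|M. (g x)\<^sup>2)"
proof -
  let ?A = "LINT x|M. (f x)\<^sup>2" and ?B = "LINT x|M. (g x)\<^sup>2" and ?C = "LINT x|M. \<bar>f x\<bar> * \<bar>g x\<bar>"
  have fg: "integrable M (\<lambda>x. \<bar>f x\<bar> * \<bar>g x\<bar>)"
    by (rule integrable_mult_L2) (use f g in auto)
  have q: "0 \<le> ?A * t\<^sup>2 - 2 * t * ?C + ?B" for t
  proof -
    have "0 \<le> (LINT x|M. (t * \<bar>f x\<bar> - \<bar>g x\<bar>)\<^sup>2)" by simp
    also have "(\<lambda>x. (t * \<bar>f x\<bar> - \<bar>g x\<bar>)\<^sup>2) = (\<lambda>x. t\<^sup>2 * (f x)\<^sup>2 - 2 * t * (\<bar>f x\<bar> * \<bar>g x\<bar>) + (g x)\<^sup>2)"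
      by (rule ext) (simp add: power2_diff power_mult_distrib)
    also have "(LINT x|M. t\<^sup>2 * (f x)\<^sup>2 - 2 * t * (\<bar>f x\<bar> * \<bar>g x\<bar>) + (g x)\<^sup>2) = t\<^sup>2 * ?A - 2 * t * ?C + ?B"
      using f g fg by simp
    finally show ?thesis by (simp add: mult.commute)
  qed
  show ?thesis by (rule discriminant_nonpos[OF _ q]) simp
qed

lemma Cauchy_Schwarz_integral_norm:
  fixes f g :: "'a \<Rightarrow> 'b :: {real_normed_div_algebra, banach, second_countable_topology}"
  assumes [measurable]: "f \<in> borel_measurable M" "g \<in> borel_measurable M"
    and f: "integrable M (\<lambda>x. (norm (f x))\<^sup>2)" and g: "integrable M (\<lambda>x. (norm (g x))\<^sup>2)"
  shows "norm (LINT x|M. f x * g x) \<le> sqrt (LINT x|M. (norm (f x))\<^sup>2) * sqrt (LINT x|M. (norm (g x))\<^sup>2)"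
proof -
  have "norm (LINT x|M. f x * g x) \<le> (LINT x|M. norm (f x) * norm (g x))"
    using integral_norm_bound[of M "\<lambda>x. f x * g x"] by (simp add: norm_mult)
  also have "\<dots> \<le> sqrt ((LINT x|M. (norm (f x))\<^sup>2) * (LINT x|M. (norm (g x))\<^sup>2))"
    using Cauchy_Schwarz_integral[of "\<lambda>x. norm (f x)" M "\<lambda>x. norm (g x)"] f g
    by (intro real_le_rsqrt) simp
  finally show ?thesis by (simp add: real_sqrt_mult)
qed

lemma L2_norm_add_sq_le:
  fixes f g :: "'a \<Rightarrow> 'b :: {real_normed_div_algebra, banach, second_countable_topology}"
  assumes [measurable]: "f \<in> borel_measurable M" "g \<in> borel_measurable M"
    and f: "integrable M (\<lambda>x. (norm (f x))\<^sup>2)" and g: "integrable M (\<lambda>x. (norm (g x))\<^sup>2)"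
  shows "integrable M (\<lambda>x. (norm (f x + g x))\<^sup>2)"
    and "(LINT x|M. (norm (f x + g x))\<^sup>2) \<le> 2 * (LINT x|M. (norm (f x))\<^sup>2) + 2 * (LINT x|M. (norm (g x))\<^sup>2)"
proof -
  have le: "(norm (f x + g x))\<^sup>2 \<le> 2 * (norm (f x))\<^sup>2 + 2 * (norm (g x))\<^sup>2" for x
  proof -
    have "(norm (f x + g x))\<^sup>2 \<le> (norm (f x) + norm (g x))\<^sup>2"
      by (intro power_mono norm_triangle_ineq) auto
    then show ?thesis using sum_squares_bound[of "norm (f x)" "norm (g x)"] by (simp add: power2_sum)
  qed
  have I: "integrable M (\<lambda>x. 2 * (norm (f x))\<^sup>2 + 2 * (norm (g x))\<^sup>2)" using f g by auto
  show 1: "integrable M (\<lambda>x. (norm (f x + g x))\<^sup>2)"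
    by (rule Bochner_Integration.integrable_bound[OF I]) (use le in auto)
  show "(LINT x|M. (norm (f x + g x))\<^sup>2) \<le> 2 * (LINT x|M. (norm (f x))\<^sup>2) + 2 * (LINT x|M. (norm (g x))\<^sup>2)"
    using integral_mono[OF 1 I le] f g by simp
qed

subsection \<open>The Riccati equation with smooth data\<close>

lemma FTC_Icc:
  fixes F F' :: "real \<Rightarrow> real"
  assumes "a \<le> b" "\<And>x. x \<in> {a..b} \<Longrightarrow> (F has_real_derivative F' x) (at x within {a..b})"
    and "continuous_on {a..b} F'"
  shows "(LINT x:{a..b}|lborel. F' x) = F b - F a"
  unfolding set_lebesgue_integral_def
  by (rule integral_FTC_atLeastAtMost)
    (use assms in \<open>auto simp: has_real_derivative_iff_has_vector_derivative\<close>)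

lemma continuous_on_derivative:
  fixes F :: "real \<Rightarrow> real"
  assumes "\<And>x. x \<in> S \<Longrightarrow> (F has_real_derivative F' x) (at x within S)"
  shows "continuous_on S F"
  using assms by (meson DERIV_continuous continuous_on_eq_continuous_within)

lemma FTC_abs_diff_le:
  fixes F F' :: "real \<Rightarrow> real"
  assumes F: "\<And>x. x \<in> {a..b} \<Longrightarrow> (F has_real_derivative F' x) (at x within {a..b})"
    and F': "continuous_on {a..b} F'" and "x \<in> {a..b}" "y \<in> {a..b}"
  shows "\<bar>F x - F y\<bar> \<le> (LINT t:{a..b}|lborel. \<bar>F' t\<bar>)"
proof -
  have *: "\<bar>F y - F x\<bar> \<le> (LINT t:{a..b}|lborel. \<bar>F' t\<bar>)"
    if xy: "x \<le> y" "x \<in> {a..b}" "y \<in> {a..b}" for x y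
  proof -
    have sub: "{x..y} \<subseteq> {a..b}" using xy by auto
    have I: "set_integrable lborel {a..b} (\<lambda>t. \<bar>F' t\<bar>)"
      by (intro borel_integrable_atLeastAtMost' continuous_intros F')
    have J: "set_integrable lborel {x..y} F'"
      by (intro borel_integrable_atLeastAtMost' continuous_on_subset[OF F' sub])
    have "F y - F x = (LINT t:{x..y}|lborel. F' t)"
      by (rule FTC_Icc[symmetric])
        (use xy sub in \<open>auto intro: DERIV_subset[OF F] continuous_on_subset[OF F' sub]\<close>)
    then have "\<bar>F y - F x\<bar> \<le> (LINT t:{x..y}|lborel. \<bar>F' t\<bar>)"
      using set_integral_norm_bound[OF J] by simp
    also have "\<dots> \<le> (LINT t:{a..b}|lborel. \<bar>F' t\<bar>)"
      unfolding set_lebesgue_integral_def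
      by (rule integral_mono[OF set_integrable_subset[OF I _ sub, unfolded set_integrable_def] I[unfolded set_integrable_def]])
        (use sub in \<open>auto simp: indicator_def\<close>)
    finally show ?thesis .
  qed
  show ?thesis
  proof (cases "x \<le> y")
    case True
    from *[OF True assms(3,4)] show ?thesis by (simp add: abs_minus_commute)
  next
    case False
    from *[OF _ assms(4,3)] False show ?thesis by simp
  qed
qed

text \<open>Neumann series for the first order system \<open>u' = w\<close>, \<open>w' = V u\<close>
  with initial vector \<open>(0, 1)\<close>. The pair \<open>uw k\<close> is the
  \<open>k\<close>-fold Volterra integral of the initial vector; each integration contributes one
  more factor to the factorial in \<open>E\<close>, so the series and its termwise derivative
  converge uniformly on the whole interval, however long.\<close>

lemma linear_ode_exists:
  fixes V :: "real \<Rightarrow> real"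
  assumes ab: "a < b" and V: "continuous_on {a..b} V"
  obtains \<psi> \<psi>' where "\<And>x. x \<in> {a..b} \<Longrightarrow> (\<psi> has_real_derivative \<psi>' x) (at x within {a..b})"
    "\<And>x. x \<in> {a..b} \<Longrightarrow> (\<psi>' has_real_derivative V x * \<psi> x) (at x within {a..b})"
    "\<psi> a = 0" "\<psi>' a = 1"
proof -
  have "bounded (V ` {a..b})"
    by (intro compact_imp_bounded compact_continuous_image V compact_Icc)
  then obtain K where K: "\<forall>x\<in>{a..b}. \<bar>V x\<bar> \<le> K" unfolding bounded_iff by auto
  \<comment> \<open>A common bound for both coefficients of the system, \<open>1\<close> and
    \<open>V\<close>.\<close>
  define C where "C = max 1 K"
  have C: "C \<ge> 1" "\<And>x. x \<in> {a..b} \<Longrightarrow> \<bar>V x\<bar> \<le> C" using K by (auto simp: C_def max_def) force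
  define st where "st = (\<lambda>(u, w :: real \<Rightarrow> real). (\<lambda>t. integral {a..t} w, \<lambda>t. integral {a..t} (\<lambda>s. V s * u s)))"
  define uw where "uw = (\<lambda>k. (st ^^ k) (\<lambda>t. 0, \<lambda>t. 1))"
  define u where "u = (\<lambda>k. fst (uw k))"
  define w where "w = (\<lambda>k. snd (uw k))"
  have u0: "u 0 = (\<lambda>t. 0)" and w0: "w 0 = (\<lambda>t. 1)" by (auto simp: u_def w_def uw_def)
  have uS: "u (Suc k) = (\<lambda>t. integral {a..t} (w k))"
    and wS: "w (Suc k) = (\<lambda>t. integral {a..t} (\<lambda>s. V s * u k s))" for k
    by (auto simp: u_def w_def uw_def st_def case_prod_beta)
  have cont: "continuous_on {a..b} (u k) \<and> continuous_on {a..b} (w k)" for k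
  proof (induction k)
    case (Suc k)
    then show ?case
      unfolding uS wS
      by (auto intro!: indefinite_integral_continuous_1 integrable_continuous_interval continuous_intros V)
  qed (simp add: u0 w0)
  have du: "(u (Suc k) has_real_derivative w k x) (at x within {a..b})"
    and dw: "(w (Suc k) has_real_derivative V x * u k x) (at x within {a..b})" if "x \<in> {a..b}" for k x
    unfolding uS wS using that cont
    by (auto intro!: integral_has_real_derivative continuous_intros V)
  define E where "E = (\<lambda>k s. (C * (s - a)) ^ k / fact k)"
  have pw: "((\<lambda>s. C * E k s) has_integral E (Suc k) t) {a..t}"
    if "t \<in> {a..b}" for k t
  proof -
    have "((\<lambda>s. C * E k s) has_integral
        (E (Suc k) t - E (Suc k) a)) {a..t}"
    proof (rule fundamental_theorem_of_calculus)
      show "a \<le> t" using that by simp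
      fix x
      have "((\<lambda>s. E (Suc k) s) has_real_derivative
          C * E k x) (at x within {a..t})"
        unfolding E_def by (rule derivative_eq_intros refl | simp)+
      then show "((\<lambda>s. E (Suc k) s) has_vector_derivative
          C * E k x) (at x within {a..t})"
        by (simp add: has_real_derivative_iff_has_vector_derivative)
    qed
    then show ?thesis by (simp add: E_def)
  qed
  have E0: "0 \<le> E k t" if "t \<in> {a..b}" for k t
    using that C(1) by (auto simp: E_def)
  have bd: "\<bar>u k t\<bar> \<le> E k t \<and> \<bar>w k t\<bar> \<le> E k t"
    if "t \<in> {a..b}" for k t
    using that
  proof (induction k arbitrary: t)
    case (Suc k)
    have sub: "{a..t} \<subseteq> {a..b}" using Suc.prems by auto
    have ci: "continuous_on {a..t} (w k)" "continuous_on {a..t} (\<lambda>s. V s * u k s)"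
      using cont[of k] by (auto intro!: continuous_on_mult continuous_on_subset[OF _ sub] V)
    have IH: "\<bar>u k s\<bar> \<le> E k s" "\<bar>w k s\<bar> \<le> E k s"
      if "s \<in> {a..t}" for s using Suc.IH[OF subsetD[OF sub that]] by blast+
    have "norm (integral {a..t} (w k)) \<le> integral {a..t} (\<lambda>s. C * E k s)"
    proof (rule integral_norm_bound_integral)
      fix s assume s: "s \<in> {a..t}"
      have "\<bar>w k s\<bar> \<le> 1 * E k s" using IH(2)[OF s] by simp
      also have "\<dots> \<le> C * E k s"
        using s C(1) sub by (intro mult_right_mono E0) auto
      finally show "norm (w k s) \<le> C * E k s" by simp
    qed (use integrable_continuous_interval[OF ci(1)] has_integral_integrable[OF pw[OF Suc.prems]] in simp_all)
    moreover have "norm (integral {a..t} (\<lambda>s. V s * u k s)) \<le> integral {a..t} (\<lambda>s. C * E k s)"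
    proof (rule integral_norm_bound_integral)
      fix s assume s: "s \<in> {a..t}"
      then have "\<bar>V s\<bar> * \<bar>u k s\<bar> \<le> C * E k s"
        using C(1) IH(1)[OF s] sub by (intro mult_mono C) auto
      then show "norm (V s * u k s) \<le> C * E k s" by (simp add: abs_mult)
    qed (use integrable_continuous_interval[OF ci(2)] has_integral_integrable[OF pw[OF Suc.prems]] in simp_all)
    ultimately show ?case
      using integral_unique[OF pw[OF Suc.prems, of k]] by (simp add: uS wS)
  qed (auto simp: u0 w0 E_def)
  define Mk where "Mk = (\<lambda>k. C * E k b)"
  have Mk: "summable Mk"
    unfolding Mk_def E_def using summable_mult[OF summable_exp[of "C * (b - a)"], of C]
    by (simp add: divide_inverse mult.commute)
  have pwle: "E k t \<le> E k b" if "t \<in> {a..b}" for t k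
    unfolding E_def using that C(1) by (intro divide_right_mono power_mono mult_left_mono) auto
  have bw: "norm (w k t) \<le> Mk k" if "t \<in> {a..b}" for k t
  proof -
    have "\<bar>w k t\<bar> \<le> 1 * E k b" using bd[OF that, of k] pwle[OF that, of k] by simp
    also have "\<dots> \<le> Mk k" unfolding Mk_def using C(1) ab by (intro mult_right_mono E0) auto
    finally show ?thesis by simp
  qed
  have bu: "norm (V t * u k t) \<le> Mk k" if "t \<in> {a..b}" for k t
  proof -
    have "\<bar>V t\<bar> * \<bar>u k t\<bar> \<le> C * E k b"
      using bd[OF that, of k] pwle[OF that, of k] C that by (intro mult_mono) auto
    then show ?thesis by (simp add: Mk_def abs_mult)
  qed
  have a: "a \<in> {a..b}" using ab by simp
  have ua: "u (Suc k) a = 0" and wa: "w (Suc k) a = 0" for k by (simp_all add: uS wS)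
  have "\<exists>g. \<forall>x\<in>{a..b}. (\<lambda>k. u (Suc k) x) sums g x \<and>
      (g has_field_derivative (\<Sum>k. w k x)) (at x within {a..b})"
    by (rule has_field_derivative_series[OF _ du Weierstrass_m_test[OF bw Mk] a]) (auto simp: ua)
  then obtain \<psi> where \<psi>: "\<And>x. x \<in> {a..b} \<Longrightarrow> (\<lambda>k. u (Suc k) x) sums \<psi> x"
    "\<And>x. x \<in> {a..b} \<Longrightarrow> (\<psi> has_field_derivative (\<Sum>k. w k x)) (at x within {a..b})" by blast
  have "\<exists>g. \<forall>x\<in>{a..b}. (\<lambda>k. w (Suc k) x) sums g x \<and>
      (g has_field_derivative (\<Sum>k. V x * u k x)) (at x within {a..b})"
    by (rule has_field_derivative_series[OF _ dw Weierstrass_m_test[OF bu Mk] a]) (auto simp: wa)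
  then obtain g where g: "\<And>x. x \<in> {a..b} \<Longrightarrow> (\<lambda>k. w (Suc k) x) sums g x"
    "\<And>x. x \<in> {a..b} \<Longrightarrow> (g has_field_derivative (\<Sum>k. V x * u k x)) (at x within {a..b})" by blast
  \<comment> \<open>The series are differentiated from index 1 on. For \<open>u\<close> nothing is
    lost since \<open>u 0\<close> vanishes; for \<open>w\<close> the first term 1 has to be put
    back, and it is the initial value of the derivative.\<close>
  have w_sum: "(\<Sum>k. w k x) = g x + 1" if "x \<in> {a..b}" for x
    using g(1)[OF that] sums_Suc[of "\<lambda>k. w k x" "g x"] by (simp add: w0 sums_unique[symmetric])
  have u_sum: "(\<Sum>k. V x * u k x) = V x * \<psi> x" if "x \<in> {a..b}" for x
    using sums_mult[OF sums_Suc[of "\<lambda>k. u k x", OF \<psi>(1)[OF that]], of "V x"]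
    by (simp add: u0 sums_unique[symmetric])
  show ?thesis
  proof (rule that[of \<psi> "\<lambda>x. g x + 1"])
    show "(\<psi> has_real_derivative g x + 1) (at x within {a..b})" if "x \<in> {a..b}" for x
      using \<psi>(2)[OF that] w_sum[OF that] by simp
    show "((\<lambda>x. g x + 1) has_real_derivative V x * \<psi> x) (at x within {a..b})" if "x \<in> {a..b}" for x
      using DERIV_add[OF g(2)[OF that] DERIV_const[of 1]] u_sum[OF that] by simp
    show "\<psi> a = 0" "g a + 1 = 1"
      using \<psi>(1)[OF a] g(1)[OF a] by (simp_all add: ua wa sums_iff)
  qed
qed

section \<open>Integrals over compact intervals\<close>

lemma set_integrable_mult_continuous:
  fixes h c :: "real \<Rightarrow> real"
  assumes h: "set_integrable lborel {a..b} h" and c: "continuous_on {a..b} c"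
  shows "set_integrable lborel {a..b} (\<lambda>x. h x * c x)"
proof -
  have "bounded (c ` {a..b})"
    by (intro compact_imp_bounded compact_continuous_image c compact_Icc)
  then obtain K where K: "\<forall>x\<in>{a..b}. \<bar>c x\<bar> \<le> K" unfolding bounded_iff by auto
  have hm: "(\<lambda>x. indicator {a..b} x *\<^sub>R h x) \<in> borel_measurable lborel"
    using h unfolding set_integrable_def by (rule borel_measurable_integrable)
  have cm: "(\<lambda>x. indicator {a..b} x *\<^sub>R c x) \<in> borel_measurable lborel"
    using borel_integrable_atLeastAtMost'[OF c] unfolding set_integrable_def by (rule borel_measurable_integrable)
  have eq: "indicator {a..b} x *\<^sub>R (h x * c x) = (indicator {a..b} x *\<^sub>R h x) * (indicator {a..b} x *\<^sub>R c x)" for x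
    by (simp add: indicator_def)
  show ?thesis
    unfolding set_integrable_def
  proof (rule Bochner_Integration.integrable_bound)
    show "integrable lborel (\<lambda>x. K * \<bar>indicator {a..b} x *\<^sub>R h x\<bar>)"
      using h unfolding set_integrable_def by (intro integrable_mult_right integrable_abs)
    show "(\<lambda>x. indicator {a..b} x *\<^sub>R (h x * c x)) \<in> borel_measurable lborel"
      unfolding eq by (intro borel_measurable_times hm cm)
    have "\<bar>h x * c x\<bar> \<le> \<bar>K * h x\<bar>" if "x \<in> {a..b}" for x
      using K[rule_format, OF that] by (simp add: abs_mult mult.commute mult_right_mono)
    then show "AE x in lborel. norm (indicator {a..b} x *\<^sub>R (h x * c x)) \<le> norm (K * \<bar>indicator {a..b} x *\<^sub>R h x\<bar>)"
      by (intro AE_I2) (auto simp: indicator_def abs_mult)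
  qed
qed

lemma set_integrable_of_square:
  fixes f :: "real \<Rightarrow> real"
  assumes [measurable]: "f \<in> borel_measurable borel" and f: "set_integrable lborel {a..b} (\<lambda>x. (f x)\<^sup>2)"
  shows "set_integrable lborel {a..b} f"
proof -
  have 1: "set_integrable lborel {a..b} (\<lambda>x. (f x)\<^sup>2 + 1)"
    by (intro set_integral_add f borel_integrable_atLeastAtMost') auto
  have "\<bar>f x\<bar> \<le> (f x)\<^sup>2 + 1" for x
    using sum_squares_bound[of "\<bar>f x\<bar>" 1] by (simp add: power2_eq_square)
  then show ?thesis
    unfolding set_integrable_def
    by (intro Bochner_Integration.integrable_bound[OF 1[unfolded set_integrable_def]])
      (auto simp: indicator_def intro!: order_trans[OF _ abs_ge_self])
qed

lemma set_integral_le_integral: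
  fixes h :: "real \<Rightarrow> real"
  assumes "integrable lborel h" "\<And>x. 0 \<le> h x" "S \<in> sets borel"
  shows "set_integrable lborel S h" "(LINT x:S|lborel. h x) \<le> (LINT x|lborel. h x)"
proof -
  show 1: "set_integrable lborel S h"
    using assms integrable_mult_indicator[of S lborel h] by (simp add: set_integrable_def)
  show "(LINT x:S|lborel. h x) \<le> (LINT x|lborel. h x)"
    unfolding set_lebesgue_integral_def
    by (rule integral_mono[OF 1[unfolded set_integrable_def] assms(1)]) (use assms in \<open>auto simp: indicator_def\<close>)
qed

lemma set_integral_2abs_mult_le:
  fixes u w :: "real \<Rightarrow> real"
  assumes u: "continuous_on {a..b} u" and w: "continuous_on {a..b} w" and "c > 0"
  shows "(LINT x:{a..b}|lborel. \<bar>2 * u x * w x\<bar>) \<le>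
    (LINT x:{a..b}|lborel. (w x)\<^sup>2) / c + c * (LINT x:{a..b}|lborel. (u x)\<^sup>2)"
proof -
  have I: "set_integrable lborel {a..b} (\<lambda>x. (w x)\<^sup>2)" "set_integrable lborel {a..b} (\<lambda>x. (u x)\<^sup>2)"
    "set_integrable lborel {a..b} (\<lambda>x. \<bar>2 * u x * w x\<bar>)"
    by (intro borel_integrable_atLeastAtMost' continuous_intros u w)+
  have "\<bar>2 * u x * w x\<bar> \<le> (w x)\<^sup>2 / c + c * (u x)\<^sup>2" for x
  proof -
    have "0 \<le> (\<bar>w x\<bar> - c * \<bar>u x\<bar>)\<^sup>2 / c" using \<open>c > 0\<close> by simp
    also have "\<dots> = \<bar>w x\<bar>\<^sup>2 / c + c * \<bar>u x\<bar>\<^sup>2 - 2 * \<bar>u x\<bar> * \<bar>w x\<bar>"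
      using \<open>c > 0\<close> by (simp only: power2_eq_square) (simp add: field_simps)
    finally show ?thesis by (simp add: abs_mult)
  qed
  then have "(LINT x:{a..b}|lborel. \<bar>2 * u x * w x\<bar>) \<le> (LINT x:{a..b}|lborel. (w x)\<^sup>2 / c + c * (u x)\<^sup>2)"
    by (intro set_integral_mono I set_integral_add(1) set_integrable_divide set_integrable_mult_right) auto
  also have "\<dots> = (LINT x:{a..b}|lborel. (w x)\<^sup>2) / c + c * (LINT x:{a..b}|lborel. (u x)\<^sup>2)"
    using I by (subst set_integral_add(2)) (auto intro: set_integrable_divide set_integrable_mult_right)
  finally show ?thesis .
qed

text \<open>
  \<open>L\<^sub>q \<ge> 0\<close> for \<open>q = f' + g\<close>, tested against \<open>C\<^sup>1\<close> functions vanishing at the ends of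
  an interval; \<open>(f', \<phi>\<^sup>2)\<close> is integrated by parts.
\<close>

definition form_nonneg :: "(real \<Rightarrow> real) \<Rightarrow> (real \<Rightarrow> real) \<Rightarrow> bool" where
  "form_nonneg f g \<longleftrightarrow> (\<forall>a b \<phi> \<phi>'. a < b \<longrightarrow>
     (\<forall>x\<in>{a..b}. (\<phi> has_real_derivative \<phi>' x) (at x within {a..b})) \<longrightarrow>
     continuous_on {a..b} \<phi>' \<longrightarrow> \<phi> a = 0 \<longrightarrow> \<phi> b = 0 \<longrightarrow>
     0 \<le> (LINT x:{a..b}|lborel. (\<phi>' x)\<^sup>2 - 2 * f x * \<phi> x * \<phi>' x + g x * (\<phi> x)\<^sup>2))"

text \<open>
  At a zero \<open>c\<close> of \<open>\<psi>\<close> the function \<open>\<psi>\<close> would be admissible on \<open>[a, c]\<close>. Its form for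
  \<open>ft, gt + \<epsilon>\<close> is zero by integration by parts, so the form for \<open>f, g\<close> is
  \<open>- \<epsilon> \<integral> \<psi>\<^sup>2\<close> up to an error that is smaller because \<open>\<delta>\<close> is small.
\<close>

lemma perturbed_solution_no_zero:
  fixes f g ft gt \<psi> \<psi>' :: "real \<Rightarrow> real"
  assumes ac: "a < c"
    and d\<psi>: "\<And>x. x \<in> {a..c} \<Longrightarrow> (\<psi> has_real_derivative \<psi>' x) (at x within {a..c})"
    and d\<psi>': "\<And>x. x \<in> {a..c} \<Longrightarrow> (\<psi>' has_real_derivative (ft' x + gt x + \<epsilon>) * \<psi> x) (at x within {a..c})"
    and dft: "\<And>x. x \<in> {a..c} \<Longrightarrow> (ft has_real_derivative ft' x) (at x within {a..c})"
    and cont: "continuous_on {a..c} ft'" "continuous_on {a..c} gt"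
    and zero: "\<psi> a = 0" and pos: "\<psi>' a = 1"
    and form: "form_nonneg f g"
    and [measurable]: "f \<in> borel_measurable borel"
    and f: "integrable lborel (\<lambda>x. (f x)\<^sup>2)" and g: "integrable lborel g"
    and df: "integrable lborel (\<lambda>x. (f x - ft x)\<^sup>2)" "(LINT x|lborel. (f x - ft x)\<^sup>2) \<le> \<delta>\<^sup>2"
    and dg: "integrable lborel (\<lambda>x. \<bar>g x - gt x\<bar>)" "(LINT x|lborel. \<bar>g x - gt x\<bar>) \<le> \<delta>"
    and ft: "integrable lborel (\<lambda>x. (ft x)\<^sup>2)" "(LINT x|lborel. (ft x)\<^sup>2) \<le> \<Phi>"
    and gt: "integrable lborel (\<lambda>x. \<bar>gt x\<bar>)" "(LINT x|lborel. \<bar>gt x\<bar>) \<le> \<Gamma>"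
    and K: "K = 4 * \<Phi> + 2 * \<Gamma> + 1" and \<delta>: "\<delta> > 0" "\<delta> * (4 * K\<^sup>2 + 8 * K) < \<epsilon>"
  shows "\<psi> c \<noteq> 0"
proof
  assume zc: "\<psi> c = 0"
  let ?I = "{a..c}"
  have c\<psi>: "continuous_on ?I \<psi>" "continuous_on ?I \<psi>'" "continuous_on ?I ft"
    using continuous_on_derivative[OF d\<psi>] continuous_on_derivative[OF d\<psi>'] continuous_on_derivative[OF dft] by simp_all
  have "(LINT x|lborel. (ft x)\<^sup>2) \<ge> 0" "(LINT x|lborel. \<bar>gt x\<bar>) \<ge> 0" by simp_all
  then have nn: "0 \<le> \<Phi>" "0 \<le> \<Gamma>" using ft(2) gt(2) by linarith+
  then have K1: "K \<ge> 1" "K > 0" "4 * \<Phi> + 2 * \<Gamma> \<le> K" using K by auto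
  define A where "A = (LINT x:?I|lborel. (\<psi>' x)\<^sup>2)"
  define B where "B = (LINT x:?I|lborel. (\<psi> x)\<^sup>2)"
  \<comment> \<open>A bound for \<open>\<psi>\<^sup>2\<close>: since \<open>\<psi> a = 0\<close>, it
    is at most the integral of \<open>\<bar>2 \<psi> \<psi>'\<bar>\<close>, split by the weighted
    inequality of means. The weight \<open>2 * K\<close> makes the share of \<open>A\<close> in
    \<open>S * K\<close> exactly one half, which can be absorbed.\<close>
  define S where "S = A / (2 * K) + 2 * K * B"
  have ci: "set_integrable lborel ?I h" if "continuous_on ?I h" for h :: "real \<Rightarrow> real"
    using that by (rule borel_integrable_atLeastAtMost')
  have AB: "0 \<le> A" "0 \<le> B" unfolding A_def B_def set_lebesgue_integral_def by simp_all
  have S0: "0 \<le> S" using AB K1 by (simp add: S_def)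
  have sup: "(\<psi> x)\<^sup>2 \<le> S" if x: "x \<in> ?I" for x
  proof -
    have "\<bar>(\<psi> x)\<^sup>2 - (\<psi> a)\<^sup>2\<bar> \<le> (LINT t:?I|lborel. \<bar>2 * \<psi> t * \<psi>' t\<bar>)"
    proof (rule FTC_abs_diff_le[where F = "\<lambda>t. (\<psi> t)\<^sup>2"])
      show "((\<lambda>t. (\<psi> t)\<^sup>2) has_real_derivative 2 * \<psi> t * \<psi>' t) (at t within ?I)" if "t \<in> ?I" for t
        using DERIV_power[OF d\<psi>[OF that], of 2] by (simp add: mult_ac)
    qed (use x ac c\<psi> in \<open>auto intro!: continuous_intros\<close>)
    also have "\<dots> \<le> A / (2 * K) + 2 * K * B"
      unfolding A_def B_def by (rule set_integral_2abs_mult_le) (use c\<psi> K1 in auto)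
    finally show ?thesis by (simp add: zero S_def)
  qed
  have fI: "set_integrable lborel ?I (\<lambda>x. (f x)\<^sup>2)" and gI: "set_integrable lborel ?I g"
    and dfI: "set_integrable lborel ?I (\<lambda>x. (f x - ft x)\<^sup>2)" "(LINT x:?I|lborel. (f x - ft x)\<^sup>2) \<le> \<delta>\<^sup>2"
    and dgI: "set_integrable lborel ?I (\<lambda>x. \<bar>g x - gt x\<bar>)" "(LINT x:?I|lborel. \<bar>g x - gt x\<bar>) \<le> \<delta>"
    and ftI: "set_integrable lborel ?I (\<lambda>x. (ft x)\<^sup>2)" "(LINT x:?I|lborel. (ft x)\<^sup>2) \<le> \<Phi>"
    and gtI: "set_integrable lborel ?I (\<lambda>x. \<bar>gt x\<bar>)" "(LINT x:?I|lborel. \<bar>gt x\<bar>) \<le> \<Gamma>"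
    using set_integral_le_integral[OF f, where S = ?I] set_integral_le_integral[OF df(1), where S = ?I]
      set_integral_le_integral[OF dg(1), where S = ?I] set_integral_le_integral[OF ft(1), where S = ?I]
      set_integral_le_integral[OF gt(1), where S = ?I] df(2) dg(2) ft(2) gt(2)
      integrable_mult_indicator[OF _ g, of ?I]
    by (auto simp: set_integrable_def intro: order_trans)
  have fI1: "set_integrable lborel ?I f" by (rule set_integrable_of_square) (use fI in auto)
  let ?J = "\<lambda>x. (\<psi>' x)\<^sup>2 - 2 * ft x * \<psi> x * \<psi>' x + (gt x + \<epsilon>) * (\<psi> x)\<^sup>2"
  \<comment> \<open>By the differential equation \<open>?J\<close> is the derivative of
    \<open>\<psi> \<psi>' - ft \<psi>\<^sup>2\<close>, which vanishes at both ends.\<close>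
  have "(LINT x:?I|lborel. ?J x) = (\<psi> c * \<psi>' c - ft c * (\<psi> c)\<^sup>2) - (\<psi> a * \<psi>' a - ft a * (\<psi> a)\<^sup>2)"
  proof (rule FTC_Icc)
    fix x assume x: "x \<in> ?I"
    show "((\<lambda>x. \<psi> x * \<psi>' x - ft x * (\<psi> x)\<^sup>2) has_real_derivative ?J x) (at x within ?I)"
      by (rule derivative_eq_intros refl d\<psi>[OF x] d\<psi>'[OF x] dft[OF x])+
        (simp add: algebra_simps power2_eq_square)
  qed (use ac c\<psi> cont in \<open>auto intro!: continuous_intros\<close>)
  then have J0: "(LINT x:?I|lborel. ?J x) = 0" by (simp add: zero zc)
  let ?P = "\<lambda>x. 2 * ft x * \<psi> x * \<psi>' x - gt x * (\<psi> x)\<^sup>2"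
  have Pc: "continuous_on ?I ?P" by (intro continuous_intros c\<psi> cont)
  have "(LINT x:?I|lborel. ?J x) = (LINT x:?I|lborel. ((\<psi>' x)\<^sup>2 - ?P x) + \<epsilon> * (\<psi> x)\<^sup>2)"
    by (rule arg_cong[of _ _ "set_lebesgue_integral lborel ?I"]) (auto simp: algebra_simps)
  also have "\<dots> = (A - (LINT x:?I|lborel. ?P x)) + \<epsilon> * B"
    unfolding A_def B_def
    by (subst set_integral_add(2) set_integral_diff(2))+ (auto intro!: ci continuous_intros c\<psi> cont)
  finally have eqA: "A + \<epsilon> * B = (LINT x:?I|lborel. ?P x)" using J0 by simp
  have K0: "0 \<le> 4 * K\<^sup>2 + 8 * K" using K1 by simp
  then have \<epsilon>: "\<epsilon> > 0" using \<delta> by (meson mult_nonneg_nonneg less_imp_le order_le_less_trans)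
  have "(LINT x:?I|lborel. ?P x) \<le> (LINT x:?I|lborel. (1/2) * (\<psi>' x)\<^sup>2 + ((2 * S) * (ft x)\<^sup>2 + S * \<bar>gt x\<bar>))"
  proof (rule set_integral_mono)
    fix x assume x: "x \<in> ?I"
    have "0 \<le> (\<psi>' x - 2 * ft x * \<psi> x)\<^sup>2 / 2" by simp
    also have "\<dots> = (1/2) * (\<psi>' x)\<^sup>2 + 2 * (ft x)\<^sup>2 * (\<psi> x)\<^sup>2 - 2 * ft x * \<psi> x * \<psi>' x"
      by (simp add: power2_eq_square field_simps)
    finally have 1: "2 * ft x * \<psi> x * \<psi>' x \<le> (1/2) * (\<psi>' x)\<^sup>2 + 2 * (ft x)\<^sup>2 * (\<psi> x)\<^sup>2" by simp
    have 2: "2 * (ft x)\<^sup>2 * (\<psi> x)\<^sup>2 \<le> 2 * (ft x)\<^sup>2 * S"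
      by (intro mult_left_mono sup x) auto
    have "- (gt x * (\<psi> x)\<^sup>2) \<le> \<bar>gt x\<bar> * (\<psi> x)\<^sup>2"
      by (metis abs_ge_minus_self mult_minus_left mult_right_mono zero_le_power2)
    also have "\<dots> \<le> \<bar>gt x\<bar> * S" by (intro mult_left_mono sup x) auto
    finally show "?P x \<le> (1/2) * (\<psi>' x)\<^sup>2 + ((2 * S) * (ft x)\<^sup>2 + S * \<bar>gt x\<bar>)"
      using 1 2 by (simp add: mult.commute mult.left_commute)
  qed (intro set_integral_add(1) set_integrable_mult_right ftI gtI ci continuous_intros c\<psi> cont)+
  also have "\<dots> = (1/2) * A + ((2 * S) * (LINT x:?I|lborel. (ft x)\<^sup>2) + S * (LINT x:?I|lborel. \<bar>gt x\<bar>))"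
  proof -
    have i1: "set_integrable lborel ?I (\<lambda>x. (1/2) * (\<psi>' x)\<^sup>2)" by (intro ci continuous_intros c\<psi>)
    have i2: "set_integrable lborel ?I (\<lambda>x. (2 * S) * (ft x)\<^sup>2)" by (intro set_integrable_mult_right ftI)
    have i3: "set_integrable lborel ?I (\<lambda>x. S * \<bar>gt x\<bar>)" by (intro set_integrable_mult_right gtI)
    show ?thesis
      by (subst set_integral_add(2)[OF i1 set_integral_add(1)[OF i2 i3]], subst set_integral_add(2)[OF i2 i3])
        (simp add: A_def)
  qed
  also have "\<dots> \<le> (1/2) * A + ((2 * S) * \<Phi> + S * \<Gamma>)"
    using S0 ftI gtI by (intro add_mono mult_left_mono) auto
  finally have "A + \<epsilon> * B \<le> (1/2) * A + ((2 * S) * \<Phi> + S * \<Gamma>)" using eqA by simp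
  moreover have "A \<le> 2 * Z" if "A + \<epsilon> * B \<le> (1/2) * A + Z" for Z
    using that mult_nonneg_nonneg[OF less_imp_le[OF \<epsilon>] AB(2)] by linarith
  \<comment> \<open>From here \<open>A \<le> S * K = A / 2 + 2 * K\<^sup>2 * B\<close>: the energy
    of the solution is bounded by its L2 norm, and so is its maximum through \<open>S\<close>. Only
    the norms of \<open>ft\<close> and \<open>gt\<close> enter, not the length of the
    interval.\<close>
  ultimately have "A \<le> 2 * ((2 * S) * \<Phi> + S * \<Gamma>)" by blast
  also have "\<dots> = S * (4 * \<Phi> + 2 * \<Gamma>)" by (simp add: algebra_simps)
  also have "\<dots> \<le> S * K" using K1 S0 by (intro mult_left_mono) auto
  also have "\<dots> = A / 2 + 2 * K\<^sup>2 * B" using K1 by (simp add: S_def field_simps power2_eq_square)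
  finally have AB': "A \<le> 4 * K\<^sup>2 * B" by simp
  then have "A / (2 * K) \<le> 2 * K * B" using K1 by (simp add: field_simps power2_eq_square)
  then have SB: "S \<le> 4 * K * B" unfolding S_def by linarith
  \<comment> \<open>The final comparison is strict only for \<open>B > 0\<close>; the initial slope
    1 provides a point where \<open>\<psi>\<close> is positive.\<close>
  obtain y where y: "y \<in> ?I" "\<psi> y > 0"
  proof -
    obtain d where d: "d > 0" "\<forall>h>0. a + h \<in> ?I \<longrightarrow> h < d \<longrightarrow> \<psi> a < \<psi> (a + h)"
      using has_real_derivative_pos_inc_right[OF d\<psi>[of a]] ac pos by auto
    show ?thesis
      by (rule that[of "a + min (d / 2) (c - a)"]) (use d(2)[rule_format, of "min (d / 2) (c - a)"] d(1) ac zero in auto)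
  qed
  have "0 < (\<psi> y)\<^sup>2" using y by simp
  also have "\<dots> \<le> 4 * K * B" using sup[OF y(1)] SB by simp
  finally have B: "B > 0" using K1 by (simp add: zero_less_mult_iff)
  let ?Q = "\<lambda>x. (\<psi>' x)\<^sup>2 - 2 * f x * \<psi> x * \<psi>' x + g x * (\<psi> x)\<^sup>2"
  have Q: "0 \<le> (LINT x:?I|lborel. ?Q x)"
    using form[unfolded form_nonneg_def, rule_format, of a c \<psi> \<psi>'] ac d\<psi> c\<psi>(2) zero zc by blast
  have QI: "set_integrable lborel ?I ?Q"
  proof -
    have "set_integrable lborel ?I (\<lambda>x. (\<psi>' x)\<^sup>2 - f x * (2 * \<psi> x * \<psi>' x) + g x * (\<psi> x)\<^sup>2)"
      by (intro set_integral_add(1) set_integral_diff(1) set_integrable_mult_continuous fI1 gI ci continuous_intros c\<psi>)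
    then show ?thesis by (simp add: algebra_simps)
  qed
  have JI: "set_integrable lborel ?I ?J" by (intro ci continuous_intros c\<psi> cont)
  \<comment> \<open>Adding the nonnegative form of \<open>f, g\<close> and subtracting the vanishing
    one of \<open>ft, gt + \<epsilon>\<close> cancels \<open>\<psi>'\<^sup>2\<close> and the term
    with \<open>\<epsilon>\<close>, so that only \<open>f - ft\<close> and \<open>g - gt\<close>
    remain.\<close>
  have "\<epsilon> * B = (LINT x:?I|lborel. \<epsilon> * (\<psi> x)\<^sup>2)" by (simp add: B_def)
  also have "\<dots> \<le> (LINT x:?I|lborel. \<epsilon> * (\<psi> x)\<^sup>2) + (LINT x:?I|lborel. ?Q x) - (LINT x:?I|lborel. ?J x)"
    using Q J0 by simp
  also have "\<dots> = (LINT x:?I|lborel. \<epsilon> * (\<psi> x)\<^sup>2 + ?Q x - ?J x)"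
  proof -
    have i: "set_integrable lborel ?I (\<lambda>x. \<epsilon> * (\<psi> x)\<^sup>2)" by (intro ci continuous_intros c\<psi>)
    show ?thesis
      by (simp only: set_integral_diff(2)[OF set_integral_add(1)[OF i QI] JI] set_integral_add(2)[OF i QI])
  qed
  also have "\<dots> \<le> (LINT x:?I|lborel. \<delta> * (\<psi>' x)\<^sup>2 + ((S / \<delta>) * (f x - ft x)\<^sup>2 + S * \<bar>g x - gt x\<bar>))"
  proof (rule set_integral_mono)
    show "set_integrable lborel ?I (\<lambda>x. \<epsilon> * (\<psi> x)\<^sup>2 + ?Q x - ?J x)"
      by (intro set_integral_diff(1) set_integral_add(1) QI JI ci continuous_intros c\<psi>)
    fix x assume x: "x \<in> ?I"
    \<comment> \<open>Weight \<open>\<delta>\<close> on \<open>\<psi>'\<^sup>2\<close> leaves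
      \<open>1 / \<delta>\<close> on \<open>(f - ft)\<^sup>2\<close>, whose integral is at most
      \<open>\<delta>\<^sup>2\<close>; thus every error term comes out linear in
      \<open>\<delta>\<close>.\<close>
    have "0 \<le> (\<delta> * \<psi>' x + (f x - ft x) * \<psi> x)\<^sup>2 / \<delta>" using \<delta> by simp
    also have "\<dots> = \<delta> * (\<psi>' x)\<^sup>2 + (f x - ft x)\<^sup>2 * (\<psi> x)\<^sup>2 / \<delta> + 2 * (f x - ft x) * \<psi> x * \<psi>' x"
      using \<delta>(1) by (simp add: power2_eq_square field_simps)
    finally have 1: "- 2 * (f x - ft x) * \<psi> x * \<psi>' x \<le> \<delta> * (\<psi>' x)\<^sup>2 + (f x - ft x)\<^sup>2 * (\<psi> x)\<^sup>2 / \<delta>" by (simp add: algebra_simps)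
    have 2: "(f x - ft x)\<^sup>2 * (\<psi> x)\<^sup>2 / \<delta> \<le> (f x - ft x)\<^sup>2 * S / \<delta>"
      using \<delta>(1) by (intro divide_right_mono mult_left_mono sup x) auto
    have "(g x - gt x) * (\<psi> x)\<^sup>2 \<le> \<bar>g x - gt x\<bar> * (\<psi> x)\<^sup>2"
      by (intro mult_right_mono) auto
    also have "\<dots> \<le> \<bar>g x - gt x\<bar> * S" by (intro mult_left_mono sup x) auto
    finally have 3: "(g x - gt x) * (\<psi> x)\<^sup>2 \<le> \<bar>g x - gt x\<bar> * S" .
    have "\<epsilon> * (\<psi> x)\<^sup>2 + ?Q x - ?J x = - 2 * (f x - ft x) * \<psi> x * \<psi>' x + (g x - gt x) * (\<psi> x)\<^sup>2"
      by (simp add: algebra_simps)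
    also have "\<dots> \<le> \<delta> * (\<psi>' x)\<^sup>2 + (f x - ft x)\<^sup>2 * S / \<delta> + \<bar>g x - gt x\<bar> * S" using 1 2 3 by linarith
    finally show "\<epsilon> * (\<psi> x)\<^sup>2 + ?Q x - ?J x \<le> \<delta> * (\<psi>' x)\<^sup>2 + ((S / \<delta>) * (f x - ft x)\<^sup>2 + S * \<bar>g x - gt x\<bar>)"
      by (simp add: mult.commute)
  qed (intro set_integral_add(1) set_integrable_mult_right dfI dgI ci continuous_intros c\<psi>)
  also have "\<dots> = \<delta> * A + ((S / \<delta>) * (LINT x:?I|lborel. (f x - ft x)\<^sup>2) + S * (LINT x:?I|lborel. \<bar>g x - gt x\<bar>))"
  proof -
    have i1: "set_integrable lborel ?I (\<lambda>x. \<delta> * (\<psi>' x)\<^sup>2)" by (intro ci continuous_intros c\<psi>)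
    have i2: "set_integrable lborel ?I (\<lambda>x. (S / \<delta>) * (f x - ft x)\<^sup>2)" by (intro set_integrable_mult_right dfI)
    have i3: "set_integrable lborel ?I (\<lambda>x. S * \<bar>g x - gt x\<bar>)" by (intro set_integrable_mult_right dgI)
    show ?thesis
      by (subst set_integral_add(2)[OF i1 set_integral_add(1)[OF i2 i3]], subst set_integral_add(2)[OF i2 i3])
        (simp add: A_def)
  qed
  also have "\<dots> \<le> \<delta> * A + ((S / \<delta>) * \<delta>\<^sup>2 + S * \<delta>)"
    using S0 \<delta> dfI dgI by (intro add_mono mult_left_mono) auto
  also have "\<dots> = \<delta> * (A + 2 * S)" using \<delta>(1) by (simp add: field_simps power2_eq_square)
  also have "\<dots> \<le> \<delta> * ((4 * K\<^sup>2 + 8 * K) * B)"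
    using \<delta>(1) AB' SB by (intro mult_left_mono) (auto simp: algebra_simps)
  also have "\<dots> < \<epsilon> * B" using mult_strict_right_mono[OF \<delta>(2) B] by (simp add: mult.assoc)
  finally show False by simp
qed

lemma riccati_solution_exists:
  fixes f g ft gt :: "real \<Rightarrow> real"
  assumes N: "N > 0"
    and dft: "\<And>x. (ft has_real_derivative ft' x) (at x)"
    and cont: "continuous_on UNIV ft'" "continuous_on UNIV gt"
    and form: "form_nonneg f g"
    and f: "f \<in> borel_measurable borel" "integrable lborel (\<lambda>x. (f x)\<^sup>2)" and g: "integrable lborel g"
    and df: "integrable lborel (\<lambda>x. (f x - ft x)\<^sup>2)" "(LINT x|lborel. (f x - ft x)\<^sup>2) \<le> \<delta>\<^sup>2"
    and dg: "integrable lborel (\<lambda>x. \<bar>g x - gt x\<bar>)" "(LINT x|lborel. \<bar>g x - gt x\<bar>) \<le> \<delta>"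
    and ft: "integrable lborel (\<lambda>x. (ft x)\<^sup>2)" "(LINT x|lborel. (ft x)\<^sup>2) \<le> \<Phi>"
    and gt: "integrable lborel (\<lambda>x. \<bar>gt x\<bar>)" "(LINT x|lborel. \<bar>gt x\<bar>) \<le> \<Gamma>"
    and K: "K = 4 * \<Phi> + 2 * \<Gamma> + 1" and \<delta>: "\<delta> > 0" "\<delta> * (4 * K\<^sup>2 + 8 * K) < \<epsilon>"
  obtains v where
    "\<And>x. x \<in> {- N..N} \<Longrightarrow> (v has_real_derivative gt x + \<epsilon> - (ft x + v x)\<^sup>2) (at x within {- N..N})"
proof -
  \<comment> \<open>The solution starts one unit to the left of the interval wanted, because
    \<open>\<psi>' / \<psi>\<close> is singular at the starting point.\<close>
  define a b where "a = - N - 1" and "b = N + 1"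
  define V where "V = (\<lambda>x. ft' x + gt x + \<epsilon>)"
  have ab: "a < b" using N by (simp add: a_def b_def)
  have "continuous_on {a..b} V"
    unfolding V_def by (intro continuous_intros continuous_on_subset[OF cont(1)] continuous_on_subset[OF cont(2)]) auto
  then obtain \<psi> \<psi>' where \<psi>: "\<And>x. x \<in> {a..b} \<Longrightarrow> (\<psi> has_real_derivative \<psi>' x) (at x within {a..b})"
    "\<And>x. x \<in> {a..b} \<Longrightarrow> (\<psi>' has_real_derivative V x * \<psi> x) (at x within {a..b})"
    "\<psi> a = 0" "\<psi>' a = 1"
    using linear_ode_exists[OF ab] by metis
  have nz: "\<psi> c \<noteq> 0" if c: "a < c" "c \<le> b" for c
  proof (rule perturbed_solution_no_zero[where f = f and g = g and ft = ft and gt = gt and \<psi> = \<psi> and \<psi>' = \<psi>' and ft' = ft'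
        and a = a and c = c and \<delta> = \<delta> and \<epsilon> = \<epsilon> and K = K and \<Phi> = \<Phi> and \<Gamma> = \<Gamma>])
    have sub: "{a..c} \<subseteq> {a..b}" using c by auto
    show "(\<psi> has_real_derivative \<psi>' x) (at x within {a..c})" if "x \<in> {a..c}" for x
      using DERIV_subset[OF \<psi>(1) sub] that sub by blast
    show "(\<psi>' has_real_derivative (ft' x + gt x + \<epsilon>) * \<psi> x) (at x within {a..c})" if "x \<in> {a..c}" for x
      using DERIV_subset[OF \<psi>(2) sub] that sub unfolding V_def by blast
    show "(ft has_real_derivative ft' x) (at x within {a..c})" if "x \<in> {a..c}" for x
      using dft has_field_derivative_at_within by blast
    show "continuous_on {a..c} ft'" "continuous_on {a..c} gt"
      using cont by (auto intro: continuous_on_subset)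
  qed (use c \<psi> form f g df dg ft gt K \<delta> in auto)
  define v where "v = (\<lambda>x. \<psi>' x / \<psi> x - ft x)"
  show ?thesis
  proof (rule that)
    fix x assume x: "x \<in> {- N..N}"
    have sub: "{- N..N} \<subseteq> {a..b}" by (auto simp: a_def b_def)
    have x': "x \<in> {a..b}" "a < x" "x \<le> b" using x by (auto simp: a_def b_def)
    note 1 = DERIV_subset[OF \<psi>(1)[OF x'(1)] sub] and 2 = DERIV_subset[OF \<psi>(2)[OF x'(1)] sub]
      and 3 = has_field_derivative_at_within[OF dft]
    have nzx: "\<psi> x \<noteq> 0" using nz x' by blast
    have "(v has_real_derivative (V x * \<psi> x * \<psi> x - \<psi>' x * \<psi>' x) / (\<psi> x * \<psi> x) - ft' x) (at x within {- N..N})"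
      unfolding v_def by (intro DERIV_diff DERIV_divide 1 2 3 nzx)
    moreover have "(V x * \<psi> x * \<psi> x - \<psi>' x * \<psi>' x) / (\<psi> x * \<psi> x) - ft' x = gt x + \<epsilon> - (ft x + v x)\<^sup>2"
      using nzx by (simp add: V_def v_def field_simps power2_eq_square)
    ultimately show "(v has_real_derivative gt x + \<epsilon> - (ft x + v x)\<^sup>2) (at x within {- N..N})" by simp
  qed
qed

lemma set_integral_const_Icc:
  "a \<le> b \<Longrightarrow> (LINT x:{a..b}|lborel. c) = (b - a) * (c :: real)"
proof -
  assume "a \<le> b"
  have "(LINT x:{a..b}|lborel. c) = c * b - c * a"
    by (rule FTC_Icc[OF \<open>a \<le> b\<close>]) (auto intro!: derivative_eq_intros)
  then show ?thesis by (simp add: algebra_simps)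
qed

text \<open>The test function \<open>1 - (x/m)\<^sup>2\<close> turns the Riccati equation into a bound on \<open>\<integral> (f + v)\<^sup>2\<close>.\<close>

lemma riccati_L2_bound:
  fixes ft gt v :: "real \<Rightarrow> real"
  assumes m: "m \<ge> 1"
    and dv: "\<And>x. x \<in> {- m..m} \<Longrightarrow> (v has_real_derivative gt x + \<epsilon> - (ft x + v x)\<^sup>2) (at x within {- m..m})"
    and cont: "continuous_on {- m..m} ft" "continuous_on {- m..m} gt"
    and ft: "integrable lborel (\<lambda>x. (ft x)\<^sup>2)" "(LINT x|lborel. (ft x)\<^sup>2) \<le> \<Phi>"
    and gt: "integrable lborel (\<lambda>x. \<bar>gt x\<bar>)" "(LINT x|lborel. \<bar>gt x\<bar>) \<le> \<Gamma>"
    and \<epsilon>: "0 \<le> \<epsilon>" "\<epsilon> * m \<le> 1"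
  shows "(LINT x:{- (m/2)..m/2}|lborel. (ft x + v x)\<^sup>2) \<le> 104 + 4 * \<Phi> + 4 * \<Gamma>"
proof -
  let ?I = "{- m..m}"
  let ?H = "{- (m/2)..m/2}"
  define r where "r = (\<lambda>x. ft x + v x)"
  define \<phi> \<phi>' where "\<phi> = (\<lambda>x. 1 - (x / m)\<^sup>2)" and "\<phi>' = (\<lambda>x. - (2 * x / m\<^sup>2))"
  have m0: "m > 0" using m by simp
  have cv: "continuous_on ?I v" using dv by (rule continuous_on_derivative)
  have cr: "continuous_on ?I r" unfolding r_def by (intro continuous_intros cv cont)
  have c\<phi>: "continuous_on S \<phi>" "continuous_on S \<phi>'" for S
    using m0 unfolding \<phi>_def \<phi>'_def by (auto intro!: continuous_intros)
  have d\<phi>: "(\<phi> has_real_derivative \<phi>' x) (at x within S)" for x S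
    unfolding \<phi>_def \<phi>'_def using m0
    by (auto intro!: derivative_eq_intros simp: power2_eq_square field_simps)
  have ci: "set_integrable lborel ?I h" if "continuous_on ?I h" for h :: "real \<Rightarrow> real"
    using that by (rule borel_integrable_atLeastAtMost')
  have \<phi>1: "0 \<le> \<phi> x" "\<phi> x \<le> 1" "(\<phi> x)\<^sup>2 \<le> 1" if "x \<in> ?I" for x
  proof -
    have "(x / m)\<^sup>2 \<le> 1" using that m0 by (simp add: abs_square_le_1 abs_le_iff)
    then show 1: "0 \<le> \<phi> x" "\<phi> x \<le> 1" by (simp_all add: \<phi>_def)
    then show "(\<phi> x)\<^sup>2 \<le> 1" by (simp add: power_le_one)
  qed
  have \<phi>'1: "(\<phi>' x)\<^sup>2 \<le> 4 / m\<^sup>2" if "x \<in> ?I" for x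
  proof -
    have "\<bar>x\<bar> \<le> m" using that by auto
    then have "\<bar>\<phi>' x\<bar> \<le> 2 / m" using m0 by (simp add: \<phi>'_def abs_mult power2_eq_square field_simps)
    then have "\<bar>\<phi>' x\<bar>\<^sup>2 \<le> (2 / m)\<^sup>2" by (intro power_mono) auto
    then show ?thesis by (simp add: power_divide)
  qed
  let ?W = "\<lambda>x. (\<phi>' x - r x * \<phi> x)\<^sup>2"
  let ?P = "\<lambda>x. (\<phi>' x)\<^sup>2 - 2 * ft x * \<phi> x * \<phi>' x + (gt x + \<epsilon>) * (\<phi> x)\<^sup>2"
  have cW: "continuous_on ?I ?W" and cP: "continuous_on ?I ?P"
    by (intro continuous_intros cr c\<phi> cont)+
  \<comment> \<open>The Riccati equation multiplied by \<open>\<phi>\<^sup>2\<close>, with the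
    square completed: the derivative of \<open>v \<phi>\<^sup>2\<close> is the form density
    \<open>?P\<close> minus \<open>(\<phi>' - r \<phi>)\<^sup>2\<close>. There are no boundary
    terms, so nothing has to be known about \<open>v\<close> at the ends.\<close>
  have "(LINT x:?I|lborel. ?P x - ?W x) = v m * (\<phi> m)\<^sup>2 - v (- m) * (\<phi> (- m))\<^sup>2"
  proof (rule FTC_Icc)
    fix x assume x: "x \<in> ?I"
    show "((\<lambda>x. v x * (\<phi> x)\<^sup>2) has_real_derivative ?P x - ?W x) (at x within ?I)"
      by (rule derivative_eq_intros refl dv[OF x] d\<phi>)+
        (simp add: r_def algebra_simps power2_eq_square)
  qed (use m0 cP cW in \<open>auto intro!: continuous_on_diff\<close>)
  moreover have "\<phi> m = 0" "\<phi> (- m) = 0" using m0 by (simp_all add: \<phi>_def)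
  ultimately have WP: "(LINT x:?I|lborel. ?W x) = (LINT x:?I|lborel. ?P x)"
    using set_integral_diff(2)[OF ci[OF cP] ci[OF cW]] by simp
  have ftI: "set_integrable lborel ?I (\<lambda>x. (ft x)\<^sup>2)" "(LINT x:?I|lborel. (ft x)\<^sup>2) \<le> \<Phi>"
    and gtI: "set_integrable lborel ?I (\<lambda>x. \<bar>gt x\<bar>)" "(LINT x:?I|lborel. \<bar>gt x\<bar>) \<le> \<Gamma>"
    using set_integral_le_integral[OF ft(1), where S = ?I] set_integral_le_integral[OF gt(1), where S = ?I] ft gt
    by auto
  have kI: "set_integrable lborel ?I (\<lambda>x. 8 / m\<^sup>2 + \<epsilon>)" by (intro ci continuous_intros)
  \<comment> \<open>\<open>8 / m\<^sup>2\<close> is twice the bound of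
    \<open>\<phi>'\<^sup>2\<close>, once from the form itself and once from splitting the mixed
    term. Over length \<open>2 * m\<close> it contributes \<open>16 / m\<close>, at most 16, and
    \<open>\<epsilon>\<close> contributes at most 2; this is the 18 below.\<close>
  have "(LINT x:?I|lborel. ?P x) \<le> (LINT x:?I|lborel. (8 / m\<^sup>2 + \<epsilon>) + ((ft x)\<^sup>2 + \<bar>gt x\<bar>))"
  proof (rule set_integral_mono[OF ci[OF cP]])
    show "set_integrable lborel ?I (\<lambda>x. (8 / m\<^sup>2 + \<epsilon>) + ((ft x)\<^sup>2 + \<bar>gt x\<bar>))"
      by (intro set_integral_add(1) kI ftI gtI)
    fix x assume x: "x \<in> ?I"
    have "0 \<le> (ft x * \<phi> x + \<phi>' x)\<^sup>2" by simp
    then have 1: "- 2 * ft x * \<phi> x * \<phi>' x \<le> (ft x)\<^sup>2 * (\<phi> x)\<^sup>2 + (\<phi>' x)\<^sup>2"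
      by (simp add: power2_eq_square algebra_simps)
    have 2: "(ft x)\<^sup>2 * (\<phi> x)\<^sup>2 \<le> (ft x)\<^sup>2 * 1" by (intro mult_left_mono \<phi>1 x) auto
    have "(gt x + \<epsilon>) * (\<phi> x)\<^sup>2 \<le> (\<bar>gt x\<bar> + \<epsilon>) * (\<phi> x)\<^sup>2" by (intro mult_right_mono) auto
    also have "\<dots> \<le> (\<bar>gt x\<bar> + \<epsilon>) * 1" using \<epsilon> by (intro mult_left_mono \<phi>1 x) auto
    finally show "?P x \<le> (8 / m\<^sup>2 + \<epsilon>) + ((ft x)\<^sup>2 + \<bar>gt x\<bar>)"
      using 1 2 \<phi>'1[OF x] by simp
  qed
  also have "\<dots> = 2 * m * (8 / m\<^sup>2 + \<epsilon>) + ((LINT x:?I|lborel. (ft x)\<^sup>2) + (LINT x:?I|lborel. \<bar>gt x\<bar>))"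
    using m0 by (simp only: set_integral_add(2)[OF kI set_integral_add(1)[OF ftI(1) gtI(1)]]
        set_integral_add(2)[OF ftI(1) gtI(1)]) (subst set_integral_const_Icc; simp)
  also have "\<dots> \<le> 18 + (\<Phi> + \<Gamma>)"
  proof -
    have "2 * m * (8 / m\<^sup>2 + \<epsilon>) = 16 / m + 2 * (\<epsilon> * m)" using m0 by (simp add: field_simps power2_eq_square)
    also have "\<dots> \<le> 16 + 2" using m \<epsilon> by (intro add_mono) (auto simp: divide_le_eq)
    finally show ?thesis using ftI gtI by linarith
  qed
  finally have W: "(LINT x:?I|lborel. ?W x) \<le> 18 + (\<Phi> + \<Gamma>)" using WP by simp
  have sub: "?H \<subseteq> ?I" using m0 by auto
  have k2: "set_integrable lborel ?I (\<lambda>x. 16 / m\<^sup>2)" by (intro ci continuous_intros)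
  have W4: "set_integrable lborel ?I (\<lambda>x. 4 * ?W x)" by (intro ci continuous_intros cr c\<phi>)
  note WI = set_integral_add(1)[OF W4 k2]
  have rH: "set_integrable lborel ?H (\<lambda>x. (r x)\<^sup>2)"
    by (intro borel_integrable_atLeastAtMost' continuous_intros continuous_on_subset[OF cr sub])
  \<comment> \<open>On the inner half \<open>\<phi> \<ge> 3/4\<close>, hence
    \<open>\<phi>\<^sup>2 \<ge> 1/2\<close>, and \<open>r\<^sup>2 \<phi>\<^sup>2\<close> is at most
    \<open>2 * ?W + 2 * \<phi>'\<^sup>2\<close>. Integration yields four times the bound 18 +
    \<open>\<Phi>\<close> + \<open>\<Gamma>\<close>, plus 32: the constant 104 of the
    statement.\<close>
  have "(LINT x:?H|lborel. (r x)\<^sup>2) \<le> (LINT x:?I|lborel. 4 * ?W x + 16 / m\<^sup>2)"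
    unfolding set_lebesgue_integral_def
  proof (rule integral_mono[OF rH[unfolded set_integrable_def] WI[unfolded set_integrable_def]])
    fix x
    have "(r x)\<^sup>2 \<le> 4 * ?W x + 16 / m\<^sup>2" if x: "x \<in> ?H"
    proof -
      have "\<bar>x / m\<bar> \<le> 1/2" using x m0 by (auto simp: abs_le_iff field_simps)
      then have "\<bar>x / m\<bar>\<^sup>2 \<le> (1/2)\<^sup>2" by (intro power_mono) auto
      then have "3/4 \<le> \<phi> x" by (simp add: \<phi>_def power_divide)
      then have "(3/4)\<^sup>2 \<le> (\<phi> x)\<^sup>2" by (intro power_mono) auto
      then have "1/2 \<le> (\<phi> x)\<^sup>2" by (simp add: power2_eq_square)
      then have "(r x)\<^sup>2 * (1/2) \<le> (r x)\<^sup>2 * (\<phi> x)\<^sup>2" by (intro mult_left_mono) auto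
      moreover have "0 \<le> (2 * \<phi>' x - r x * \<phi> x)\<^sup>2" by simp
      then have "(r x)\<^sup>2 * (\<phi> x)\<^sup>2 \<le> 2 * ?W x + 2 * (\<phi>' x)\<^sup>2"
        by (simp add: power2_eq_square algebra_simps)
      ultimately show ?thesis using \<phi>'1[of x] x sub by auto
    qed
    moreover have "0 \<le> 4 * ?W x + 16 / m\<^sup>2" by simp
    ultimately show "indicator ?H x *\<^sub>R (r x)\<^sup>2 \<le> indicator ?I x *\<^sub>R (4 * ?W x + 16 / m\<^sup>2)"
      using sub by (cases "x \<in> ?H") (auto simp: indicator_def)
  qed
  also have "\<dots> = 4 * (LINT x:?I|lborel. ?W x) + 2 * m * (16 / m\<^sup>2)"
    using m0 by (subst set_integral_add(2)[OF W4 k2]) (subst set_integral_const_Icc; simp)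
  also have "2 * m * (16 / m\<^sup>2) = 32 / m" using m0 by (simp add: field_simps power2_eq_square)
  also have "4 * (LINT x:?I|lborel. ?W x) + 32 / m \<le> 4 * (18 + (\<Phi> + \<Gamma>)) + 32"
    using W m by (intro add_mono) (auto simp: divide_le_eq)
  finally show ?thesis by (simp add: r_def)
qed

subsection \<open>Real test functions and the quadratic form\<close>

text \<open>Strong convergence of both factors in L2 replaces pointwise convergence and domination.
  It serves the quadratic form, the squared term of the Riccati equation and the convolution
  formula.\<close>

lemma L2_tendsto_mult:
  fixes u w :: "'a \<Rightarrow> 'b :: {real_normed_div_algebra, banach, second_countable_topology}"
  assumes [measurable]: "u \<in> borel_measurable M" "w \<in> borel_measurable M"
      "\<And>n. un n \<in> borel_measurable M" "\<And>n. wn n \<in> borel_measurable M"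
    and u: "integrable M (\<lambda>x. (norm (u x))\<^sup>2)" and w: "integrable M (\<lambda>x. (norm (w x))\<^sup>2)"
    and un: "\<And>n. integrable M (\<lambda>x. (norm (un n x - u x))\<^sup>2)"
    and wn: "\<And>n. integrable M (\<lambda>x. (norm (wn n x - w x))\<^sup>2)"
    and lu: "(\<lambda>n. LINT x|M. (norm (un n x - u x))\<^sup>2) \<longlonglongrightarrow> 0"
    and lw: "(\<lambda>n. LINT x|M. (norm (wn n x - w x))\<^sup>2) \<longlonglongrightarrow> 0"
  shows "(\<lambda>n. LINT x|M. un n x * wn n x) \<longlonglongrightarrow> (LINT x|M. u x * w x)"
proof -
  have uw: "integrable M (\<lambda>x. u x * w x)" by (rule integrable_mult_L2) (simp_all add: u w)
  have i1: "integrable M (\<lambda>x. (un n x - u x) * (wn n x - w x))" for n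
    by (rule integrable_mult_L2) (simp_all add: un wn)
  have i2: "integrable M (\<lambda>x. (un n x - u x) * w x)" for n
    by (rule integrable_mult_L2) (simp_all add: un w)
  have i3: "integrable M (\<lambda>x. u x * (wn n x - w x))" for n
    by (rule integrable_mult_L2) (simp_all add: u wn)
  have eq: "(LINT x|M. un n x * wn n x) = (LINT x|M. u x * w x) +
      ((LINT x|M. (un n x - u x) * (wn n x - w x)) + (LINT x|M. (un n x - u x) * w x)
        + (LINT x|M. u x * (wn n x - w x)))" for n
  proof -
    have "(LINT x|M. un n x * wn n x) = (LINT x|M. u x * w x +
        ((un n x - u x) * (wn n x - w x) + (un n x - u x) * w x + u x * (wn n x - w x)))"
      by (rule Bochner_Integration.integral_cong) (auto simp: algebra_simps)
    also have "\<dots> = (LINT x|M. u x * w x) +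
      ((LINT x|M. (un n x - u x) * (wn n x - w x)) + (LINT x|M. (un n x - u x) * w x)
        + (LINT x|M. u x * (wn n x - w x)))"
      using uw i1[of n] i2[of n] i3[of n]
      by (simp only: Bochner_Integration.integral_add Bochner_Integration.integrable_add)
    finally show ?thesis .
  qed
  let ?U = "\<lambda>n. sqrt (LINT x|M. (norm (un n x - u x))\<^sup>2)"
  let ?W = "\<lambda>n. sqrt (LINT x|M. (norm (wn n x - w x))\<^sup>2)"
  have U0: "?U \<longlonglongrightarrow> 0" using tendsto_real_sqrt[OF lu] by simp
  have W0: "?W \<longlonglongrightarrow> 0" using tendsto_real_sqrt[OF lw] by simp
  have t1: "(\<lambda>n. LINT x|M. (un n x - u x) * (wn n x - w x)) \<longlonglongrightarrow> 0"
  proof (rule Lim_null_comparison)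
    show "\<forall>\<^sub>F n in sequentially. norm (LINT x|M. (un n x - u x) * (wn n x - w x)) \<le> ?U n * ?W n"
      by (intro always_eventually allI Cauchy_Schwarz_integral_norm) (simp_all add: un wn)
    show "(\<lambda>n. ?U n * ?W n) \<longlonglongrightarrow> 0" using tendsto_mult[OF U0 W0] by simp
  qed
  have t2: "(\<lambda>n. LINT x|M. (un n x - u x) * w x) \<longlonglongrightarrow> 0"
  proof (rule Lim_null_comparison)
    show "\<forall>\<^sub>F n in sequentially. norm (LINT x|M. (un n x - u x) * w x) \<le> ?U n * sqrt (LINT x|M. (norm (w x))\<^sup>2)"
      by (intro always_eventually allI Cauchy_Schwarz_integral_norm) (simp_all add: un w)
    show "(\<lambda>n. ?U n * sqrt (LINT x|M. (norm (w x))\<^sup>2)) \<longlonglongrightarrow> 0"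
      using tendsto_mult[OF U0 tendsto_const] by simp
  qed
  have t3: "(\<lambda>n. LINT x|M. u x * (wn n x - w x)) \<longlonglongrightarrow> 0"
  proof (rule Lim_null_comparison)
    show "\<forall>\<^sub>F n in sequentially. norm (LINT x|M. u x * (wn n x - w x)) \<le> sqrt (LINT x|M. (norm (u x))\<^sup>2) * ?W n"
      by (intro always_eventually allI Cauchy_Schwarz_integral_norm) (simp_all add: u wn)
    show "(\<lambda>n. sqrt (LINT x|M. (norm (u x))\<^sup>2) * ?W n) \<longlonglongrightarrow> 0"
      using tendsto_mult[OF tendsto_const W0] by simp
  qed
  show ?thesis
    unfolding eq using tendsto_add[OF tendsto_const[of "LINT x|M. u x * w x"] tendsto_add[OF tendsto_add[OF t1 t2] t3]]
    by simp
qed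

section \<open>Derivatives and primitives of real test functions\<close>

definition real_deriv :: "(real \<Rightarrow> real) \<Rightarrow> real \<Rightarrow> real" where
  "real_deriv p x = Re (nderiv 1 (\<lambda>x. complex_of_real (p x)) x)"

lemma
  assumes "real_test p"
  shows real_test_has_derivative: "(p has_real_derivative real_deriv p x) (at x)"
    and nderiv_1_of_real: "nderiv 1 (\<lambda>x. complex_of_real (p x)) = (\<lambda>x. complex_of_real (real_deriv p x))"
    and real_test_deriv: "real_test (real_deriv p)"
proof -
  have d: "((\<lambda>x. complex_of_real (p x)) has_vector_derivative nderiv 1 (\<lambda>x. complex_of_real (p x)) x) (at x)" for x
    using assms unfolding real_test_def by (intro smooth_has_vector_derivative_1 test_function_smooth)
  show "(p has_real_derivative real_deriv p x) (at x)"
    using bounded_linear.has_vector_derivative[OF bounded_linear_Re d[of x]]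
    by (simp add: has_real_derivative_iff_has_vector_derivative real_deriv_def)
  have "Im (nderiv 1 (\<lambda>x. complex_of_real (p x)) x) = 0" for x
    using bounded_linear.has_vector_derivative[OF bounded_linear_Im d[of x]]
      vector_derivative_unique_at[of "\<lambda>x. 0" _ x 0] by simp
  then show *: "nderiv 1 (\<lambda>x. complex_of_real (p x)) = (\<lambda>x. complex_of_real (real_deriv p x))"
    by (auto simp: real_deriv_def complex_eq_iff)
  show "real_test (real_deriv p)"
    using test_function_nderiv[OF assms[unfolded real_test_def], of 1] by (simp add: * real_test_def)
qed

lemma real_test_continuous: "real_test p \<Longrightarrow> continuous_on S p"
  using real_test_has_derivative by (meson DERIV_isCont continuous_at_imp_continuous_on)

lemma real_test_smooth: "real_test p \<Longrightarrow> smooth (\<lambda>x. complex_of_real (p x))"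
  by (simp add: real_test_def test_function_smooth)

lemma real_testI:
  assumes "smooth (\<lambda>x. complex_of_real (p x))" "\<And>x. x \<notin> {a..b} \<Longrightarrow> p x = 0"
  shows "real_test p"
  unfolding real_test_def by (rule test_functionI[of _ a b]) (use assms in auto)

lemma real_test_integrable:
  assumes "real_test p"
  shows "integrable lborel p"
proof -
  obtain N where N: "N > 0" "\<And>x. \<bar>x\<bar> \<ge> N \<Longrightarrow> p x = 0" using real_test_support[OF assms] by blast
  have "integrable lborel (\<lambda>x. indicator {- N..N} x *\<^sub>R p x)"
    using borel_integrable_atLeastAtMost'[OF real_test_continuous[OF assms]] by (simp add: set_integrable_def)
  moreover have "indicator {- N..N} x *\<^sub>R p x = p x" for x
    using N(2)[of x] by (cases "x \<in> {- N..N}") auto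
  ultimately show ?thesis by (simp only:)
qed

lemma real_test_mult: "real_test p \<Longrightarrow> real_test q \<Longrightarrow> real_test (\<lambda>x. p x * q x)"
  unfolding real_test_def of_real_mult by (intro test_function_mult test_function_smooth)

lemma real_test_square_integrable: "real_test p \<Longrightarrow> integrable lborel (\<lambda>x. (p x)\<^sup>2)"
  unfolding power2_eq_square by (intro real_test_integrable real_test_mult)

text \<open>The vanishing mean is precisely what makes the primitive return to zero to the right of
  the support.\<close>

lemma real_test_primitive:
  assumes \<sigma>: "real_test \<sigma>" and supp: "\<And>x. x \<notin> {a..b} \<Longrightarrow> \<sigma> x = 0" and "a < b"
    and zero: "(LINT x|lborel. \<sigma> x) = 0"
  obtains P where "real_test P" "\<And>x. x \<notin> {a..b} \<Longrightarrow> P x = 0" "\<And>x. (P has_real_derivative \<sigma> x) (at x)"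
proof -
  \<comment> \<open>Starting strictly to the left of \<open>a\<close> makes every point from
    \<open>a\<close> on an interior point of the interval of integration, so the two-sided
    derivative is available at \<open>a\<close> too.\<close>
  define c where "c = a - 1"
  define P where "P = (\<lambda>x. integral {c..x} \<sigma>)"
  have P1: "P x = 0" if "x < a" for x
  proof -
    have "integral {c..x} \<sigma> = integral {c..x} (\<lambda>x. 0)"
      by (rule Henstock_Kurzweil_Integration.integral_cong) (use that supp in auto)
    then show ?thesis by (simp add: P_def)
  qed
  have P2: "P x = 0" if "x > b" for x
  proof -
    have "indicator {c..x} y *\<^sub>R \<sigma> y = \<sigma> y" for y
      using supp[of y] that \<open>a < b\<close> by (cases "y \<in> {c..x}") (auto simp: c_def)
    then have "(LINT y:{c..x}|lborel. \<sigma> y) = (LINT y|lborel. \<sigma> y)"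
      by (simp only: set_lebesgue_integral_def)
    moreover have "(LINT y:{c..x}|lborel. \<sigma> y) = P x"
      unfolding P_def by (rule set_borel_integral_eq_integral(2))
        (intro borel_integrable_atLeastAtMost' real_test_continuous \<sigma>)
    ultimately show ?thesis using zero by simp
  qed
  have dP: "(P has_real_derivative \<sigma> x) (at x)" for x
  proof (cases "x < a")
    case True
    have "((\<lambda>x. 0) has_real_derivative \<sigma> x) (at x)" using supp[of x] True by simp
    then show ?thesis
      by (rule has_field_derivative_transform_within_open[of _ _ _ "{..<a}"]) (use True P1 in auto)
  next
    case False
    have d: "((\<lambda>x. integral {c..x} \<sigma>) has_real_derivative \<sigma> x) (at x within {c..x + 1})"
      by (rule integral_has_real_derivative)
        (use False in \<open>auto simp: c_def intro: real_test_continuous \<sigma>\<close>)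
    have i: "x \<in> interior {c..x + 1}" using False by (simp add: c_def)
    show ?thesis using d unfolding P_def at_within_interior[OF i] .
  qed
  have "smooth (\<lambda>x. complex_of_real (P x))"
  proof (rule smooth_coinduct[where P = "\<lambda>f. f = (\<lambda>x. complex_of_real (P x)) \<or> smooth f"])
    fix f assume "f = (\<lambda>x. complex_of_real (P x)) \<or> smooth f"
    then show "\<exists>f'. (f' = (\<lambda>x. complex_of_real (P x)) \<or> smooth f') \<and> (\<forall>x. (f has_vector_derivative f' x) (at x))"
    proof
      assume "f = (\<lambda>x. complex_of_real (P x))"
      then show ?thesis
        using real_test_smooth[OF \<sigma>]
        by (intro exI[of _ "\<lambda>x. complex_of_real (\<sigma> x)"]) (simp add: has_vector_derivative_of_real[OF dP])
    next
      assume "smooth f"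
      then show ?thesis
        using smooth_has_vector_derivative_1[of f] smooth_nderiv[of f 1]
        by (intro exI[of _ "nderiv 1 f"]) simp
    qed
  qed simp
  then have "real_test P" by (rule real_testI[of _ a b]) (use P1 P2 in force)
  then show ?thesis by (rule that) (use P1 P2 dP in force)+
qed

lemma integrable_bound_le:
  fixes f :: "'a \<Rightarrow> 'b :: {banach, second_countable_topology}"
  assumes "integrable M g" "f \<in> borel_measurable M" "\<And>x. norm (f x) \<le> g x"
  shows "integrable M f"
  by (rule Bochner_Integration.integrable_bound[OF assms(1,2)])
    (use assms(3) in \<open>auto intro!: AE_I2 order_trans[OF _ abs_ge_self]\<close>)

text \<open>A solution of the differential equation, cut off at two zeros, is not smooth at these
  zeros, so the form must be extended from test functions. Approximating the derivative in L2 and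
  integrating gives uniform convergence of the functions themselves, and each of the three terms of
  the form is continuous under this pair of convergences.\<close>

lemma form_nonneg_of_tests:
  fixes f g :: "real \<Rightarrow> real"
  assumes fm [measurable]: "f \<in> borel_measurable borel" and f: "integrable lborel (\<lambda>x. (f x)\<^sup>2)"
    and g: "integrable lborel g"
    and Q: "\<And>p. real_test p \<Longrightarrow> 0 \<le> (LINT x|lborel. (real_deriv p x)\<^sup>2)
      - (LINT x|lborel. f x * (2 * p x * real_deriv p x)) + (LINT x|lborel. g x * (p x)\<^sup>2)"
  shows "form_nonneg f g"
  unfolding form_nonneg_def
proof (intro allI impI)
  fix a b :: real and \<phi> \<phi>' :: "real \<Rightarrow> real"
  assume ab: "a < b" and d\<phi>: "\<forall>x\<in>{a..b}. (\<phi> has_real_derivative \<phi>' x) (at x within {a..b})"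
    and c\<phi>': "continuous_on {a..b} \<phi>'" and \<phi>0: "\<phi> a = 0" "\<phi> b = 0"
  have c\<phi>: "continuous_on {a..b} \<phi>" using d\<phi> by (intro continuous_on_derivative) auto
  have [measurable]: "g \<in> borel_measurable borel" using borel_measurable_integrable[OF g] by simp
  define \<eta> where "\<eta> = (\<lambda>x. indicator {a..b} x *\<^sub>R \<phi>' x)"
  define F where "F = (\<lambda>x. indicator {a..b} x *\<^sub>R \<phi> x)"
  have I\<eta>: "integrable lborel \<eta>" and IF: "integrable lborel F"
    using borel_integrable_atLeastAtMost'[OF c\<phi>'] borel_integrable_atLeastAtMost'[OF c\<phi>]
    by (simp_all add: set_integrable_def \<eta>_def F_def)
  have [measurable]: "\<eta> \<in> borel_measurable borel" "F \<in> borel_measurable borel"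
    using borel_measurable_integrable[OF I\<eta>] borel_measurable_integrable[OF IF] by simp_all
  have I\<eta>2: "integrable lborel (\<lambda>x. (\<eta> x)\<^sup>2)"
  proof -
    have "set_integrable lborel {a..b} (\<lambda>x. (\<phi>' x)\<^sup>2)"
      by (intro borel_integrable_atLeastAtMost' continuous_intros c\<phi>')
    moreover have "indicator {a..b} x *\<^sub>R (\<phi>' x)\<^sup>2 = (\<eta> x)\<^sup>2" for x by (simp add: \<eta>_def indicator_def)
    ultimately show ?thesis by (simp add: set_integrable_def)
  qed
  have "bounded (\<phi> ` {a..b})"
    by (intro compact_imp_bounded compact_continuous_image c\<phi> compact_Icc)
  then obtain M0 where M0: "\<forall>x\<in>{a..b}. \<bar>\<phi> x\<bar> \<le> M0" unfolding bounded_iff by auto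
  define M where "M = \<bar>M0\<bar>"
  have M: "\<bar>F x\<bar> \<le> M" for x using M0[rule_format, of x] by (auto simp: F_def M_def indicator_def)
  let ?one = "\<lambda>x. indicator {a..b} x :: real"
  have one: "integrable lborel ?one" "(LINT x|lborel. ?one x) = b - a"
    using set_integral_const_Icc[of a b 1] ab borel_integrable_atLeastAtMost'[of a b "\<lambda>x. 1 :: real"]
    by (simp_all add: set_lebesgue_integral_def set_integrable_def)
  have L1_le: "integrable lborel h \<and> (LINT x|lborel. \<bar>h x\<bar>) \<le> sqrt (b - a) * sqrt (LINT x|lborel. (h x)\<^sup>2)"
    if [measurable]: "h \<in> borel_measurable borel" and h: "integrable lborel (\<lambda>x. (h x)\<^sup>2)" "\<And>x. x \<notin> {a..b} \<Longrightarrow> h x = 0"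
    for h :: "real \<Rightarrow> real"
  proof -
    have sq: "(?one x)\<^sup>2 = ?one x" for x by (simp add: indicator_def)
    have one2: "integrable lborel (\<lambda>x. (?one x)\<^sup>2)" using one(1) by (simp only: sq)
    have eq: "?one x * h x = h x" for x using h(2) by (auto simp: indicator_def)
    have "integrable lborel (\<lambda>x. ?one x * h x)"
      by (rule integrable_mult_L2) (use one2 h(1) in auto)
    moreover have "(LINT x|lborel. \<bar>?one x\<bar> * \<bar>h x\<bar>)\<^sup>2 \<le> (LINT x|lborel. (?one x)\<^sup>2) * (LINT x|lborel. (h x)\<^sup>2)"
      by (rule Cauchy_Schwarz_integral) (use one2 h(1) in auto)
    then have "(LINT x|lborel. \<bar>h x\<bar>)\<^sup>2 \<le> (b - a) * (LINT x|lborel. (h x)\<^sup>2)"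
      by (simp only: abs_mult[symmetric] eq sq one(2))
    then have "(LINT x|lborel. \<bar>h x\<bar>) \<le> sqrt ((b - a) * (LINT x|lborel. (h x)\<^sup>2))"
      by (rule real_le_rsqrt)
    ultimately show ?thesis by (simp add: eq real_sqrt_mult)
  qed
  \<comment> \<open>Any function closer to the indicator in L1 than the length of the interval has a
    positive integral, so it can be normalized to mean 1.\<close>
  obtain \<theta>0 where \<theta>0: "real_test \<theta>0" "\<And>x. x \<notin> {a..b} \<Longrightarrow> \<theta>0 x = 0"
    "integrable lborel (\<lambda>x. \<bar>?one x - \<theta>0 x\<bar> ^ 1)" "(LINT x|lborel. \<bar>?one x - \<theta>0 x\<bar> ^ 1) < b - a"
    by (rule real_test_dense_Icc[of ?one 1 a b "b - a"]) (use ab one(1) in auto)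
  have "(LINT x|lborel. ?one x) - (LINT x|lborel. \<theta>0 x) = (LINT x|lborel. ?one x - \<theta>0 x)"
    using one(1) real_test_integrable[OF \<theta>0(1)] by simp
  also have "\<dots> \<le> (LINT x|lborel. \<bar>?one x - \<theta>0 x\<bar>)"
    by (intro integral_mono) (use one(1) real_test_integrable[OF \<theta>0(1)] in auto)
  also have "\<dots> < b - a" using \<theta>0(4) by simp
  finally have \<theta>0pos: "(LINT x|lborel. \<theta>0 x) > 0" using one(2) by simp
  define \<theta> where "\<theta> = (\<lambda>x. \<theta>0 x / (LINT x|lborel. \<theta>0 x))"
  have \<theta>: "real_test \<theta>" "\<And>x. x \<notin> {a..b} \<Longrightarrow> \<theta> x = 0" "(LINT x|lborel. \<theta> x) = 1"
  proof -
    show "real_test \<theta>"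
      using test_function_cmult[OF \<theta>0(1)[unfolded real_test_def], of "complex_of_real (1 / (LINT x|lborel. \<theta>0 x))"]
      by (simp add: \<theta>_def real_test_def)
    show "\<theta> x = 0" if "x \<notin> {a..b}" for x using \<theta>0(2)[OF that] by (simp add: \<theta>_def)
    show "(LINT x|lborel. \<theta> x) = 1" using \<theta>0pos by (simp add: \<theta>_def)
  qed
  have ex: "\<exists>\<rho>. real_test \<rho> \<and> (\<forall>x. x \<notin> {a..b} \<longrightarrow> \<rho> x = 0) \<and> integrable lborel (\<lambda>x. (\<eta> x - \<rho> x)\<^sup>2)
      \<and> (LINT x|lborel. (\<eta> x - \<rho> x)\<^sup>2) < 1 / real (Suc k)" for k
  proof -
    obtain \<rho> where "real_test \<rho>" "\<And>x. x \<notin> {a..b} \<Longrightarrow> \<rho> x = 0"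
      "integrable lborel (\<lambda>x. \<bar>\<eta> x - \<rho> x\<bar>\<^sup>2)" "(LINT x|lborel. \<bar>\<eta> x - \<rho> x\<bar>\<^sup>2) < 1 / real (Suc k)"
    proof (rule real_test_dense_Icc[of \<eta> 2 a b "1 / real (Suc k)"])
      show "\<eta> x = 0" if "x \<notin> {a..b}" for x using that by (simp add: \<eta>_def)
    qed (use ab I\<eta>2 in simp_all)
    then show ?thesis by (intro exI[of _ \<rho>]) simp
  qed
  obtain \<rho> where "\<forall>k. real_test (\<rho> k) \<and> (\<forall>x. x \<notin> {a..b} \<longrightarrow> \<rho> k x = 0) \<and>
      integrable lborel (\<lambda>x. (\<eta> x - \<rho> k x)\<^sup>2) \<and> (LINT x|lborel. (\<eta> x - \<rho> k x)\<^sup>2) < 1 / real (Suc k)"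
    by (rule exE[OF choice[OF allI[OF ex]]])
  then have \<rho>: "\<And>k. real_test (\<rho> k)" "\<And>k x. x \<notin> {a..b} \<Longrightarrow> \<rho> k x = 0"
    "\<And>k. integrable lborel (\<lambda>x. (\<eta> x - \<rho> k x)\<^sup>2)"
    "\<And>k. (LINT x|lborel. (\<eta> x - \<rho> k x)\<^sup>2) < 1 / real (Suc k)" by simp_all
  note [measurable] = real_test_measurable[OF \<rho>(1)] real_test_measurable[OF \<theta>(1)]
  have \<rho>0: "(\<lambda>k. LINT x|lborel. (\<eta> x - \<rho> k x)\<^sup>2) \<longlonglongrightarrow> 0"
    by (rule tendsto_sandwich[OF _ _ tendsto_const[of 0] LIMSEQ_inverse_real_of_nat])
      (use \<rho>(4) in \<open>auto intro!: always_eventually less_imp_le simp: inverse_eq_divide\<close>)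
  define m where "m = (\<lambda>k. LINT x|lborel. \<rho> k x)"
  have "(LINT x:{a..b}|lborel. \<phi>' x) = 0" using FTC_Icc[of a b \<phi> \<phi>'] ab d\<phi> c\<phi>' \<phi>0 by simp
  then have \<eta>0: "(LINT x|lborel. \<eta> x) = 0" by (simp add: set_lebesgue_integral_def \<eta>_def)
  have mle: "\<bar>m k\<bar> \<le> sqrt (b - a) * sqrt (LINT x|lborel. (\<eta> x - \<rho> k x)\<^sup>2)" for k
  proof -
    have *: "integrable lborel (\<lambda>x. \<eta> x - \<rho> k x) \<and> (LINT x|lborel. \<bar>\<eta> x - \<rho> k x\<bar>)
        \<le> sqrt (b - a) * sqrt (LINT x|lborel. (\<eta> x - \<rho> k x)\<^sup>2)"
    proof (rule L1_le)
      show "\<eta> x - \<rho> k x = 0" if "x \<notin> {a..b}" for x using that \<rho>(2) by (simp add: \<eta>_def)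
    qed (use \<rho>(3) in measurable)
    have "\<bar>m k\<bar> = \<bar>LINT x|lborel. \<eta> x - \<rho> k x\<bar>"
      using \<eta>0 I\<eta> real_test_integrable[OF \<rho>(1)] by (simp add: m_def)
    also have "\<dots> \<le> (LINT x|lborel. \<bar>\<eta> x - \<rho> k x\<bar>)" by (rule integral_abs_bound)
    finally show ?thesis using * by simp
  qed
  have sqrt0: "(\<lambda>k. sqrt (b - a) * sqrt (LINT x|lborel. (\<eta> x - \<rho> k x)\<^sup>2)) \<longlonglongrightarrow> 0"
    using tendsto_mult_left[OF tendsto_real_sqrt[OF \<rho>0], of "sqrt (b - a)"] by simp
  have m0: "m \<longlonglongrightarrow> 0"
    by (rule Lim_null_comparison[OF _ sqrt0]) (use mle in \<open>auto intro!: always_eventually\<close>)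
  \<comment> \<open>The approximants of \<open>\<eta>\<close> need not have mean zero; the multiple
    of \<open>\<theta>\<close> repairs this, so that the primitives keep their support. The
    correction tends to 0, because \<open>\<eta>\<close> itself has mean zero by
    \<open>\<phi> a = \<phi> b\<close>.\<close>
  define \<sigma> where "\<sigma> = (\<lambda>k x. \<rho> k x - m k * \<theta> x)"
  have \<sigma>: "real_test (\<sigma> k)" "\<And>x. x \<notin> {a..b} \<Longrightarrow> \<sigma> k x = 0" "(LINT x|lborel. \<sigma> k x) = 0" for k
  proof -
    show "real_test (\<sigma> k)"
    proof (rule real_testI[of _ a b])
      show "smooth (\<lambda>x. complex_of_real (\<sigma> k x))"
        unfolding \<sigma>_def of_real_diff of_real_mult
        by (intro smooth_diff smooth_cmult real_test_smooth \<rho> \<theta>)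
    qed (use \<rho> \<theta> in \<open>simp add: \<sigma>_def\<close>)
    show "\<sigma> k x = 0" if "x \<notin> {a..b}" for x using that \<rho> \<theta> by (simp add: \<sigma>_def)
    show "(LINT x|lborel. \<sigma> k x) = 0"
      using real_test_integrable[OF \<rho>(1)] real_test_integrable[OF \<theta>(1)] \<theta>(3) by (simp add: \<sigma>_def m_def)
  qed
  note [measurable] = real_test_measurable[OF \<sigma>(1)]
  have \<sigma>\<eta>: "integrable lborel (\<lambda>x. (norm (\<sigma> k x - \<eta> x))\<^sup>2)"
    "(LINT x|lborel. (norm (\<sigma> k x - \<eta> x))\<^sup>2) \<le> 2 * (LINT x|lborel. (\<eta> x - \<rho> k x)\<^sup>2) + 2 * ((m k)\<^sup>2 * (LINT x|lborel. (\<theta> x)\<^sup>2))" for k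
  proof -
    have eq: "norm (\<sigma> k x - \<eta> x) = norm ((\<eta> x - \<rho> k x) + m k * \<theta> x)" for x
      by (simp add: \<sigma>_def abs_minus_commute algebra_simps)
    have i: "integrable lborel (\<lambda>x. (norm (\<eta> x - \<rho> k x))\<^sup>2)" "integrable lborel (\<lambda>x. (norm (m k * \<theta> x))\<^sup>2)"
      using \<rho>(3) real_test_square_integrable[OF \<theta>(1)] by (simp_all add: power_mult_distrib)
    show "integrable lborel (\<lambda>x. (norm (\<sigma> k x - \<eta> x))\<^sup>2)"
      unfolding eq by (rule L2_norm_add_sq_le) (use i in auto)
    show "(LINT x|lborel. (norm (\<sigma> k x - \<eta> x))\<^sup>2) \<le> 2 * (LINT x|lborel. (\<eta> x - \<rho> k x)\<^sup>2) + 2 * ((m k)\<^sup>2 * (LINT x|lborel. (\<theta> x)\<^sup>2))"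
      using L2_norm_add_sq_le(2)[OF _ _ i] unfolding eq by (simp add: power_mult_distrib)
  qed
  have \<sigma>0: "(\<lambda>k. LINT x|lborel. (norm (\<sigma> k x - \<eta> x))\<^sup>2) \<longlonglongrightarrow> 0"
  proof (rule tendsto_sandwich[OF _ _ tendsto_const])
    show "(\<lambda>k. 2 * (LINT x|lborel. (\<eta> x - \<rho> k x)\<^sup>2) + 2 * ((m k)\<^sup>2 * (LINT x|lborel. (\<theta> x)\<^sup>2))) \<longlonglongrightarrow> 0"
      by (rule tendsto_eq_intros refl \<rho>0 m0)+ simp
  qed (use \<sigma>\<eta>(2) in \<open>auto intro!: always_eventually\<close>)
  have ex': "\<exists>P. real_test P \<and> (\<forall>x. x \<notin> {a..b} \<longrightarrow> P x = 0) \<and> (\<forall>x. (P has_real_derivative \<sigma> k x) (at x))" for k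
  proof -
    obtain P where "real_test P" "\<And>x. x \<notin> {a..b} \<Longrightarrow> P x = 0" "\<And>x. (P has_real_derivative \<sigma> k x) (at x)"
      using real_test_primitive[OF \<sigma>(1) \<sigma>(2) ab \<sigma>(3), of k] by blast
    then show ?thesis by blast
  qed
  obtain P where "\<forall>k. real_test (P k) \<and> (\<forall>x. x \<notin> {a..b} \<longrightarrow> P k x = 0) \<and>
      (\<forall>x. (P k has_real_derivative \<sigma> k x) (at x))"
    by (rule exE[OF choice[OF allI[OF ex']]])
  then have P: "\<And>k. real_test (P k)" "\<And>k x. x \<notin> {a..b} \<Longrightarrow> P k x = 0"
    "\<And>k x. (P k has_real_derivative \<sigma> k x) (at x)" by simp_all
  note [measurable] = real_test_measurable[OF P(1)]
  have rdP: "real_deriv (P k) = \<sigma> k" for k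
    using real_test_has_derivative[OF P(1)] P(3) DERIV_unique by blast
  define s where "s = (\<lambda>k. LINT x|lborel. \<bar>\<sigma> k x - \<eta> x\<bar>)"
  have s_le: "s k \<le> sqrt (b - a) * sqrt (LINT x|lborel. (norm (\<sigma> k x - \<eta> x))\<^sup>2)" for k
  proof -
    have "integrable lborel (\<lambda>x. \<sigma> k x - \<eta> x) \<and> (LINT x|lborel. \<bar>\<sigma> k x - \<eta> x\<bar>)
        \<le> sqrt (b - a) * sqrt (LINT x|lborel. (\<sigma> k x - \<eta> x)\<^sup>2)"
    proof (rule L1_le)
      show "integrable lborel (\<lambda>x. (\<sigma> k x - \<eta> x)\<^sup>2)" using \<sigma>\<eta>(1)[of k] by simp
      show "\<sigma> k x - \<eta> x = 0" if "x \<notin> {a..b}" for x using that \<sigma>(2) by (simp add: \<eta>_def)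
    qed measurable
    then show ?thesis by (simp add: s_def)
  qed
  have s0: "s \<longlonglongrightarrow> 0"
  proof (rule tendsto_sandwich[OF _ _ tendsto_const])
    show "(\<lambda>k. sqrt (b - a) * sqrt (LINT x|lborel. (norm (\<sigma> k x - \<eta> x))\<^sup>2)) \<longlonglongrightarrow> 0"
      using tendsto_mult_left[OF tendsto_real_sqrt[OF \<sigma>0], of "sqrt (b - a)"] by simp
  qed (use s_le in \<open>auto intro!: always_eventually simp: s_def\<close>)
  have PF: "\<bar>P k x - F x\<bar> \<le> s k" for k x
  proof (cases "x \<in> {a..b}")
    case True
    \<comment> \<open>The support condition speaks only of points off the closed interval; the end
      point needs continuity.\<close>
    have "P k a = 0"
    proof -
      have "continuous (at_left a) (P k)"
        using DERIV_isCont[OF P(3)] continuous_at_imp_continuous_at_within by blast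
      then have "(P k \<longlongrightarrow> P k a) (at_left a)" by (simp add: continuous_within)
      moreover have "(P k \<longlongrightarrow> 0) (at_left a)"
        by (rule tendsto_eventually) (auto simp: eventually_at_filter P(2))
      ultimately show ?thesis by (rule tendsto_unique[OF trivial_limit_at_left_real])
    qed
    have "\<bar>(P k x - \<phi> x) - (P k a - \<phi> a)\<bar> \<le> (LINT t:{a..b}|lborel. \<bar>\<sigma> k t - \<phi>' t\<bar>)"
    proof (rule FTC_abs_diff_le[where F = "\<lambda>x. P k x - \<phi> x"])
      show "((\<lambda>x. P k x - \<phi> x) has_real_derivative \<sigma> k t - \<phi>' t) (at t within {a..b})" if "t \<in> {a..b}" for t
        using that d\<phi> P(3) by (intro DERIV_diff) (auto intro: has_field_derivative_at_within)
      show "continuous_on {a..b} (\<lambda>t. \<sigma> k t - \<phi>' t)"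
        by (intro continuous_on_diff real_test_continuous[OF \<sigma>(1)] c\<phi>')
    qed (use True ab in auto)
    also have "\<dots> = s k"
      unfolding s_def set_lebesgue_integral_def
      by (rule Bochner_Integration.integral_cong) (auto simp: indicator_def \<eta>_def \<sigma>)
    finally show ?thesis using True \<open>P k a = 0\<close> \<phi>0 by (simp add: F_def)
  next
    case False
    then show ?thesis by (simp add: F_def P s_def)
  qed
  obtain S where "S > 0" "\<forall>k. norm (s k) \<le> S"
    using convergent_imp_Bseq[OF convergentI[OF s0]] by (rule BseqE)
  then have S: "\<And>k. \<bar>s k\<bar> \<le> S" "S > 0" by auto
  have PS: "\<bar>P k x\<bar> \<le> M + S" for k x using PF[of k x] M[of x] S(1)[of k] by linarith
  have T1: "(\<lambda>k. LINT x|lborel. \<sigma> k x * \<sigma> k x) \<longlonglongrightarrow> (LINT x|lborel. \<eta> x * \<eta> x)"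
    by (rule L2_tendsto_mult) (use I\<eta>2 \<sigma>\<eta> \<sigma>0 in auto)
  \<comment> \<open>\<open>f\<close> is merely square integrable, but multiplication by it turns
    uniform convergence of \<open>P k\<close> into L2 convergence, which pairs with that of
    \<open>\<sigma> k\<close>.\<close>
  have fP: "integrable lborel (\<lambda>x. (norm (f x * P k x - f x * F x))\<^sup>2) \<and>
      (LINT x|lborel. (norm (f x * P k x - f x * F x))\<^sup>2) \<le> (s k)\<^sup>2 * (LINT x|lborel. (f x)\<^sup>2)" for k
  proof -
    have le: "(norm (f x * P k x - f x * F x))\<^sup>2 \<le> (s k)\<^sup>2 * (f x)\<^sup>2" for x
    proof -
      have "(norm (f x * P k x - f x * F x))\<^sup>2 = \<bar>P k x - F x\<bar>\<^sup>2 * (f x)\<^sup>2"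
        by (simp add: right_diff_distrib[symmetric] power_mult_distrib)
      also have "\<dots> \<le> (s k)\<^sup>2 * (f x)\<^sup>2" by (intro mult_right_mono power_mono PF) auto
      finally show ?thesis .
    qed
    have i: "integrable lborel (\<lambda>x. (s k)\<^sup>2 * (f x)\<^sup>2)" using f by simp
    have i': "integrable lborel (\<lambda>x. (norm (f x * P k x - f x * F x))\<^sup>2)"
      by (rule integrable_bound_le[OF i]) (measurable, use le in simp)
    show ?thesis using i' integral_mono[OF i' i le] by (simp only: integral_mult_right_zero simp_thms)
  qed
  have fPl: "(\<lambda>k. LINT x|lborel. (norm (f x * P k x - f x * F x))\<^sup>2) \<longlonglongrightarrow> 0"
  proof (rule tendsto_sandwich[OF _ _ tendsto_const])
    show "(\<lambda>k. (s k)\<^sup>2 * (LINT x|lborel. (f x)\<^sup>2)) \<longlonglongrightarrow> 0"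
      by (rule tendsto_eq_intros refl s0)+ simp
  qed (use fP in \<open>auto intro!: always_eventually\<close>)
  have fF: "integrable lborel (\<lambda>x. (norm (f x * F x))\<^sup>2)"
  proof (rule Bochner_Integration.integrable_bound)
    show "integrable lborel (\<lambda>x. M\<^sup>2 * (f x)\<^sup>2)" using f by simp
    have "(norm (f x * F x))\<^sup>2 \<le> M\<^sup>2 * (f x)\<^sup>2" for x
    proof -
      have "\<bar>F x\<bar>\<^sup>2 * (f x)\<^sup>2 \<le> M\<^sup>2 * (f x)\<^sup>2" by (intro mult_right_mono power_mono M) auto
      then show ?thesis by (simp add: power_mult_distrib mult.commute)
    qed
    then show "AE x in lborel. norm ((norm (f x * F x))\<^sup>2) \<le> norm (M\<^sup>2 * (f x)\<^sup>2)"
      by (intro AE_I2) simp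
  qed measurable
  have T2: "(\<lambda>k. LINT x|lborel. (f x * P k x) * \<sigma> k x) \<longlonglongrightarrow> (LINT x|lborel. (f x * F x) * \<eta> x)"
    by (rule L2_tendsto_mult) (use I\<eta>2 \<sigma>\<eta> \<sigma>0 fP fPl fF in auto)
  have wI: "integrable lborel (\<lambda>x. (M + S)\<^sup>2 * \<bar>g x\<bar>)" using g by simp
  have T3: "(\<lambda>k. LINT x|lborel. g x * (P k x)\<^sup>2) \<longlonglongrightarrow> (LINT x|lborel. g x * (F x)\<^sup>2)"
  proof (rule integral_dominated_convergence[OF _ _ wI])
    have "(\<lambda>k. P k x) \<longlonglongrightarrow> F x" for x
    proof -
      have "(\<lambda>k. P k x - F x) \<longlonglongrightarrow> 0"
        by (rule Lim_null_comparison[OF _ s0]) (use PF in \<open>auto intro!: always_eventually\<close>)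
      then show ?thesis by (simp add: LIM_zero_iff)
    qed
    then show "AE x in lborel. (\<lambda>k. g x * (P k x)\<^sup>2) \<longlonglongrightarrow> g x * (F x)\<^sup>2"
      by (intro AE_I2 tendsto_intros)
    have "\<bar>g x * (P k x)\<^sup>2\<bar> \<le> (M + S)\<^sup>2 * \<bar>g x\<bar>" for k x
    proof -
      have "\<bar>P k x\<bar>\<^sup>2 * \<bar>g x\<bar> \<le> (M + S)\<^sup>2 * \<bar>g x\<bar>" by (intro mult_right_mono power_mono PS) auto
      then show ?thesis by (simp add: abs_mult mult.commute)
    qed
    then show "AE x in lborel. norm (g x * (P k x)\<^sup>2) \<le> (M + S)\<^sup>2 * \<bar>g x\<bar>" for k by simp
  qed auto
  let ?lim = "(LINT x|lborel. \<eta> x * \<eta> x) - 2 * (LINT x|lborel. (f x * F x) * \<eta> x) + (LINT x|lborel. g x * (F x)\<^sup>2)"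
  have "(\<lambda>k. (LINT x|lborel. \<sigma> k x * \<sigma> k x) - 2 * (LINT x|lborel. (f x * P k x) * \<sigma> k x) + (LINT x|lborel. g x * (P k x)\<^sup>2))
      \<longlonglongrightarrow> ?lim"
    by (intro tendsto_intros T1 T2 T3)
  moreover have "0 \<le> (LINT x|lborel. \<sigma> k x * \<sigma> k x) - 2 * (LINT x|lborel. (f x * P k x) * \<sigma> k x) + (LINT x|lborel. g x * (P k x)\<^sup>2)" for k
  proof -
    have "(LINT x|lborel. f x * (2 * P k x * \<sigma> k x)) = (LINT x|lborel. 2 * ((f x * P k x) * \<sigma> k x))"
      by (rule Bochner_Integration.integral_cong) auto
    then show ?thesis using Q[OF P(1), of k] by (simp add: rdP power2_eq_square)
  qed
  ultimately have "0 \<le> ?lim" by (intro LIMSEQ_le_const) auto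
  moreover have "(LINT x:{a..b}|lborel. (\<phi>' x)\<^sup>2 - 2 * f x * \<phi> x * \<phi>' x + g x * (\<phi> x)\<^sup>2) = ?lim"
  proof -
    have i1: "integrable lborel (\<lambda>x. \<eta> x * \<eta> x)" using I\<eta>2 by (simp add: power2_eq_square)
    have i2: "integrable lborel (\<lambda>x. (f x * F x) * \<eta> x)"
      by (rule integrable_mult_L2) (use fF I\<eta>2 in auto)
    have i3: "integrable lborel (\<lambda>x. g x * (F x)\<^sup>2)"
    proof (rule Bochner_Integration.integrable_bound)
      show "integrable lborel (\<lambda>x. M\<^sup>2 * \<bar>g x\<bar>)" using g by simp
      have "\<bar>g x * (F x)\<^sup>2\<bar> \<le> M\<^sup>2 * \<bar>g x\<bar>" for x
      proof -
        have "\<bar>F x\<bar>\<^sup>2 * \<bar>g x\<bar> \<le> M\<^sup>2 * \<bar>g x\<bar>" by (intro mult_right_mono power_mono M) auto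
        then show ?thesis by (simp add: abs_mult mult.commute)
      qed
      then show "AE x in lborel. norm (g x * (F x)\<^sup>2) \<le> norm (M\<^sup>2 * \<bar>g x\<bar>)" by (intro AE_I2) simp
    qed measurable
    have "(LINT x:{a..b}|lborel. (\<phi>' x)\<^sup>2 - 2 * f x * \<phi> x * \<phi>' x + g x * (\<phi> x)\<^sup>2)
        = (LINT x|lborel. \<eta> x * \<eta> x - 2 * ((f x * F x) * \<eta> x) + g x * (F x)\<^sup>2)"
      unfolding set_lebesgue_integral_def
      by (rule Bochner_Integration.integral_cong) (auto simp: indicator_def \<eta>_def F_def power2_eq_square)
    then show ?thesis using i1 i2 i3 by simp
  qed
  ultimately show "0 \<le> (LINT x:{a..b}|lborel. (\<phi>' x)\<^sup>2 - 2 * f x * \<phi> x * \<phi>' x + g x * (\<phi> x)\<^sup>2)" by simp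
qed

subsection \<open>The Riccati equation with singular data\<close>

text \<open>
  The difference of two solutions satisfies a linear equation with coefficient
  \<open>(f\<^sub>1 + v\<^sub>1) + (f\<^sub>2 + v\<^sub>2)\<close>, whose \<open>L\<^sup>1\<close> norm is controlled by \<open>C\<close>.
\<close>

lemma riccati_difference_bound:
  fixes f1 f2 g1 g2 v1 v2 :: "real \<Rightarrow> real"
  defines "I \<equiv> \<lambda>M. {- M..M::real}"
  assumes M: "M > 0"
    and d1: "\<And>x. x \<in> {- M..M} \<Longrightarrow> (v1 has_real_derivative g1 x + e1 - (f1 x + v1 x)\<^sup>2) (at x within {- M..M})"
    and d2: "\<And>x. x \<in> {- M..M} \<Longrightarrow> (v2 has_real_derivative g2 x + e2 - (f2 x + v2 x)\<^sup>2) (at x within {- M..M})"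
    and c: "continuous_on {- M..M} f1" "continuous_on {- M..M} f2"
      "continuous_on {- M..M} g1" "continuous_on {- M..M} g2"
    and C: "(LINT x:{- M..M}|lborel. (f1 x + v1 x)\<^sup>2) \<le> C" "(LINT x:{- M..M}|lborel. (f2 x + v2 x)\<^sup>2) \<le> C"
    and t: "t \<in> {- M..M}"
  shows "\<bar>v1 t - v2 t\<bar> \<le> exp (2 * (2 * M + 4 * C)) *
    (\<bar>v1 0 - v2 0\<bar> + (LINT x:{- M..M}|lborel. \<bar>g1 x - g2 x\<bar>) + 2 * M * \<bar>e1 - e2\<bar>
      + sqrt (4 * C) * sqrt (LINT x:{- M..M}|lborel. (f1 x - f2 x)\<^sup>2))"
proof -
  let ?I = "{- M..M}"
  \<comment> \<open>Bound for the integral of \<open>\<bar>a\<bar>\<close>, from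
    \<open>\<bar>a\<bar> \<le> 1 + a\<^sup>2\<close> and the L2 bound \<open>4 * C\<close>.\<close>
  define L where "L = 2 * M + 4 * C"
  have cv: "continuous_on ?I v1" "continuous_on ?I v2"
    using continuous_on_derivative[OF d1] continuous_on_derivative[OF d2] by blast+
  have ci: "set_integrable lborel ?I h" if "continuous_on ?I h" for h :: "real \<Rightarrow> real"
    using that by (rule borel_integrable_atLeastAtMost')
  define a where "a = (\<lambda>x. (f1 x + v1 x) + (f2 x + v2 x))"
  have ca: "continuous_on ?I a" unfolding a_def by (intro continuous_intros cv c)
  define A where "A = (\<lambda>x. integral {- M..x} a)"
  have dA: "(A has_real_derivative a x) (at x within ?I)" if "x \<in> ?I" for x
    unfolding A_def by (rule integral_has_real_derivative[OF ca that])
  have I1: "set_integrable lborel ?I (\<lambda>x. 2 * (f1 x + v1 x)\<^sup>2)" and I2: "set_integrable lborel ?I (\<lambda>x. 2 * (f2 x + v2 x)\<^sup>2)"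
    and Ia: "set_integrable lborel ?I (\<lambda>x. (a x)\<^sup>2)"
    by (intro ci continuous_intros cv c ca)+
  have a2: "(LINT x:?I|lborel. (a x)\<^sup>2) \<le> 4 * C"
  proof -
    have "(LINT x:?I|lborel. (a x)\<^sup>2) \<le> (LINT x:?I|lborel. 2 * (f1 x + v1 x)\<^sup>2 + 2 * (f2 x + v2 x)\<^sup>2)"
    proof (rule set_integral_mono[OF Ia set_integral_add(1)[OF I1 I2]])
      fix x
      show "(a x)\<^sup>2 \<le> 2 * (f1 x + v1 x)\<^sup>2 + 2 * (f2 x + v2 x)\<^sup>2"
        using sum_squares_bound[of "f1 x + v1 x" "f2 x + v2 x"] unfolding a_def power2_sum[of "f1 x + v1 x"] by linarith
    qed
    also have "\<dots> = 2 * (LINT x:?I|lborel. (f1 x + v1 x)\<^sup>2) + 2 * (LINT x:?I|lborel. (f2 x + v2 x)\<^sup>2)"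
      by (subst set_integral_add(2)[OF I1 I2]) simp
    finally show ?thesis using C by simp
  qed
  have ab: "(LINT x:?I|lborel. \<bar>a x\<bar>) \<le> L"
  proof -
    have k: "set_integrable lborel ?I (\<lambda>x. 1 :: real)" by (intro ci continuous_intros)
    have "(LINT x:?I|lborel. \<bar>a x\<bar>) \<le> (LINT x:?I|lborel. 1 + (a x)\<^sup>2)"
    proof (rule set_integral_mono[OF _ set_integral_add(1)[OF k Ia]])
      show "set_integrable lborel ?I (\<lambda>x. \<bar>a x\<bar>)" by (intro ci continuous_intros ca)
      fix x
      have "0 \<le> (\<bar>a x\<bar> - 1)\<^sup>2" by simp
      then have "2 * \<bar>a x\<bar> \<le> 1 + (a x)\<^sup>2" by (simp add: power2_diff)
      then show "\<bar>a x\<bar> \<le> 1 + (a x)\<^sup>2" using abs_ge_zero[of "a x"] by linarith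
    qed
    also have "\<dots> = 2 * M + (LINT x:?I|lborel. (a x)\<^sup>2)"
      using set_integral_const_Icc[of "- M" M 1] M by (subst set_integral_add(2)[OF k Ia]) simp
    finally show ?thesis using a2 by (simp add: L_def)
  qed
  define B where "B = (\<lambda>x. A x - A 0)"
  have dB: "(B has_real_derivative a x) (at x within ?I)" if "x \<in> ?I" for x
    unfolding B_def using DERIV_diff[OF dA[OF that] DERIV_const[of "A 0"]] by simp
  have cB: "continuous_on ?I B" using dB by (rule continuous_on_derivative)
  have BL: "\<bar>B x\<bar> \<le> L" if "x \<in> ?I" for x
    using FTC_abs_diff_le[OF dA ca that, of 0] ab M by (simp add: B_def)
  \<comment> \<open>The difference of the squares factors as
    \<open>a * ((f1 - f2) + (v1 - v2))\<close>; the part with \<open>f1 - f2\<close> joins the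
    source \<open>s\<close>, the other is the linear term.\<close>
  define s where "s = (\<lambda>x. (g1 x - g2 x) + (e1 - e2) - a x * (f1 x - f2 x))"
  have cs: "continuous_on ?I s" unfolding s_def by (intro continuous_intros ca c)
  define d where "d = (\<lambda>x. v1 x - v2 x)"
  have dd: "(d has_real_derivative s x - a x * d x) (at x within ?I)" if "x \<in> ?I" for x
  proof -
    have "(d has_real_derivative (g1 x + e1 - (f1 x + v1 x)\<^sup>2) - (g2 x + e2 - (f2 x + v2 x)\<^sup>2)) (at x within ?I)"
      unfolding d_def by (intro DERIV_diff d1 d2 that)
    moreover have "(g1 x + e1 - (f1 x + v1 x)\<^sup>2) - (g2 x + e2 - (f2 x + v2 x)\<^sup>2) = s x - a x * d x"
      by (simp add: s_def a_def d_def power2_eq_square algebra_simps)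
    ultimately show ?thesis by simp
  qed
  \<comment> \<open>Integrating factor, normalized by \<open>B 0 = 0\<close> because the estimate
    starts from the values at 0. It is bounded by \<open>exp L\<close> once inside the integral and
    once when it is removed, which makes \<open>exp (2 * L)\<close>.\<close>
  define E where "E = (\<lambda>x. d x * exp (B x))"
  have dE: "(E has_real_derivative s x * exp (B x)) (at x within ?I)" if "x \<in> ?I" for x
  proof -
    have "(E has_real_derivative (s x - a x * d x) * exp (B x) + (exp (B x) * a x) * d x) (at x within ?I)"
      unfolding E_def by (rule DERIV_mult[OF dd[OF that] DERIV_chain2[OF DERIV_exp dB[OF that]]])
    moreover have "(s x - a x * d x) * exp (B x) + (exp (B x) * a x) * d x = s x * exp (B x)"
      by (simp add: algebra_simps)
    ultimately show ?thesis by simp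
  qed
  have cE: "continuous_on ?I (\<lambda>x. s x * exp (B x))" by (intro continuous_intros cs cB)
  have sI: "set_integrable lborel ?I (\<lambda>x. \<bar>s x\<bar>)" by (intro ci continuous_intros cs)
  have s0: "0 \<le> (LINT x:?I|lborel. \<bar>s x\<bar>)" unfolding set_lebesgue_integral_def by simp
  have "\<bar>E t - E 0\<bar> \<le> (LINT x:?I|lborel. \<bar>s x * exp (B x)\<bar>)"
    by (rule FTC_abs_diff_le[OF dE cE t]) (use M in auto)
  also have "\<dots> \<le> (LINT x:?I|lborel. exp L * \<bar>s x\<bar>)"
  proof (rule set_integral_mono)
    fix x assume "x \<in> ?I"
    then have "exp (B x) \<le> exp L" using BL[of x] by auto
    then show "\<bar>s x * exp (B x)\<bar> \<le> exp L * \<bar>s x\<bar>"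
      by (simp add: abs_mult mult.commute[of "\<bar>s x\<bar>"] mult_right_mono)
  qed (intro ci continuous_intros cs cB)+
  also have "\<dots> = exp L * (LINT x:?I|lborel. \<bar>s x\<bar>)" by simp
  finally have E: "\<bar>E t - E 0\<bar> \<le> exp L * (LINT x:?I|lborel. \<bar>s x\<bar>)" .
  have "0 \<le> L" using BL[OF t] by linarith
  then have eL: "1 \<le> exp L" by simp
  have "\<bar>E t\<bar> \<le> \<bar>d 0\<bar> + exp L * (LINT x:?I|lborel. \<bar>s x\<bar>)"
    using E by (simp add: E_def B_def)
  also have "\<dots> \<le> exp L * \<bar>d 0\<bar> + exp L * (LINT x:?I|lborel. \<bar>s x\<bar>)"
    using mult_right_mono[OF eL, of "\<bar>d 0\<bar>"] by simp
  also have "\<dots> = exp L * (\<bar>d 0\<bar> + (LINT x:?I|lborel. \<bar>s x\<bar>))" by (simp add: algebra_simps)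
  finally have Et: "\<bar>E t\<bar> \<le> exp L * (\<bar>d 0\<bar> + (LINT x:?I|lborel. \<bar>s x\<bar>))" .
  have "\<bar>d t\<bar> = exp (- B t) * \<bar>E t\<bar>" by (simp add: E_def abs_mult exp_minus)
  also have "\<dots> \<le> exp L * (exp L * (\<bar>d 0\<bar> + (LINT x:?I|lborel. \<bar>s x\<bar>)))"
    using BL[OF t] Et by (intro mult_mono) auto
  also have "\<dots> = exp (2 * L) * (\<bar>d 0\<bar> + (LINT x:?I|lborel. \<bar>s x\<bar>))"
    by (simp add: mult.assoc[symmetric] exp_double power2_eq_square)
  finally have dt: "\<bar>d t\<bar> \<le> exp (2 * L) * (\<bar>d 0\<bar> + (LINT x:?I|lborel. \<bar>s x\<bar>))" .
  have i1: "set_integrable lborel ?I (\<lambda>x. \<bar>g1 x - g2 x\<bar>)" and i2: "set_integrable lborel ?I (\<lambda>x. \<bar>e1 - e2\<bar>)"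
    and i3: "set_integrable lborel ?I (\<lambda>x. \<bar>a x\<bar> * \<bar>f1 x - f2 x\<bar>)"
    by (intro ci continuous_intros ca c)+
  have "(LINT x:?I|lborel. \<bar>s x\<bar>) \<le> (LINT x:?I|lborel. \<bar>g1 x - g2 x\<bar> + (\<bar>e1 - e2\<bar> + \<bar>a x\<bar> * \<bar>f1 x - f2 x\<bar>))"
  proof (rule set_integral_mono[OF sI])
    show "set_integrable lborel ?I (\<lambda>x. \<bar>g1 x - g2 x\<bar> + (\<bar>e1 - e2\<bar> + \<bar>a x\<bar> * \<bar>f1 x - f2 x\<bar>))"
      by (intro set_integral_add(1) i1 i2 i3)
    fix x
    have "\<bar>a x * (f1 x - f2 x)\<bar> = \<bar>a x\<bar> * \<bar>f1 x - f2 x\<bar>" by (rule abs_mult)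
    then show "\<bar>s x\<bar> \<le> \<bar>g1 x - g2 x\<bar> + (\<bar>e1 - e2\<bar> + \<bar>a x\<bar> * \<bar>f1 x - f2 x\<bar>)"
      unfolding s_def by linarith
  qed
  also have "\<dots> = (LINT x:?I|lborel. \<bar>g1 x - g2 x\<bar>) + (2 * M * \<bar>e1 - e2\<bar> + (LINT x:?I|lborel. \<bar>a x\<bar> * \<bar>f1 x - f2 x\<bar>))"
    using set_integral_const_Icc[of "- M" M "\<bar>e1 - e2\<bar>"] M
    by (subst set_integral_add(2)[OF i1 set_integral_add(1)[OF i2 i3]], subst set_integral_add(2)[OF i2 i3]) simp
  also have "(LINT x:?I|lborel. \<bar>a x\<bar> * \<bar>f1 x - f2 x\<bar>) \<le> sqrt (4 * C) * sqrt (LINT x:?I|lborel. (f1 x - f2 x)\<^sup>2)"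
  proof -
    let ?a = "\<lambda>x. indicator ?I x *\<^sub>R a x" and ?f = "\<lambda>x. indicator ?I x *\<^sub>R (f1 x - f2 x)"
    have cf: "continuous_on ?I (\<lambda>x. f1 x - f2 x)" "continuous_on ?I (\<lambda>x. (f1 x - f2 x)\<^sup>2)"
      by (intro continuous_intros c)+
    have sq: "(indicator ?I x *\<^sub>R h)\<^sup>2 = indicator ?I x *\<^sub>R h\<^sup>2" for h x :: real by (simp add: indicator_def)
    have ab: "\<bar>?a x\<bar> * \<bar>?f x\<bar> = indicator ?I x *\<^sub>R (\<bar>a x\<bar> * \<bar>f1 x - f2 x\<bar>)" for x by (simp add: indicator_def)
    have "(LINT x|lborel. \<bar>?a x\<bar> * \<bar>?f x\<bar>)\<^sup>2 \<le> (LINT x|lborel. (?a x)\<^sup>2) * (LINT x|lborel. (?f x)\<^sup>2)"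
    proof (rule Cauchy_Schwarz_integral)
      show "?a \<in> borel_measurable lborel" "?f \<in> borel_measurable lborel"
        using borel_measurable_integrable[OF ci[OF ca, unfolded set_integrable_def]]
          borel_measurable_integrable[OF ci[OF cf(1), unfolded set_integrable_def]] .
      show "integrable lborel (\<lambda>x. (?a x)\<^sup>2)" "integrable lborel (\<lambda>x. (?f x)\<^sup>2)"
        unfolding sq using Ia ci[OF cf(2)] unfolding set_integrable_def by auto
    qed
    then have "(LINT x:?I|lborel. \<bar>a x\<bar> * \<bar>f1 x - f2 x\<bar>)\<^sup>2
        \<le> (LINT x:?I|lborel. (a x)\<^sup>2) * (LINT x:?I|lborel. (f1 x - f2 x)\<^sup>2)"
      unfolding sq ab set_lebesgue_integral_def .
    also have "\<dots> \<le> 4 * C * (LINT x:?I|lborel. (f1 x - f2 x)\<^sup>2)"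
      using a2 by (intro mult_right_mono) (auto simp: set_lebesgue_integral_def)
    finally show ?thesis unfolding real_sqrt_mult[symmetric] by (rule real_le_rsqrt)
  qed
  finally have sle: "(LINT x:?I|lborel. \<bar>s x\<bar>) \<le> (LINT x:?I|lborel. \<bar>g1 x - g2 x\<bar>) + (2 * M * \<bar>e1 - e2\<bar>
      + sqrt (4 * C) * sqrt (LINT x:?I|lborel. (f1 x - f2 x)\<^sup>2))" by simp
  have "exp (2 * L) * (\<bar>d 0\<bar> + (LINT x:?I|lborel. \<bar>s x\<bar>)) \<le> exp (2 * L) *
    (\<bar>d 0\<bar> + (LINT x:?I|lborel. \<bar>g1 x - g2 x\<bar>) + 2 * M * \<bar>e1 - e2\<bar>
      + sqrt (4 * C) * sqrt (LINT x:?I|lborel. (f1 x - f2 x)\<^sup>2))"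
    using sle by (intro mult_left_mono) auto
  then show ?thesis using dt unfolding d_def L_def by linarith
qed

text \<open>\<open>\<bar>v 0\<bar>\<close> exceeds \<open>\<bar>v x\<bar>\<close> by at most the
  integral of \<open>\<bar>v'\<bar>\<close>, and averaging over \<open>x\<close> needs only the L1
  norm of \<open>v\<close>. By the equation and by \<open>v = (f + v) - f\<close>, both integrals
  are controlled by \<open>C\<close>, \<open>\<Phi>\<close> and \<open>\<Gamma>\<close>; the length
  2 of the interval is divided out at the end.\<close>

lemma riccati_value_bound:
  fixes f g v :: "real \<Rightarrow> real"
  assumes d: "\<And>x. x \<in> {- 1..1} \<Longrightarrow> (v has_real_derivative g x + \<epsilon> - (f x + v x)\<^sup>2) (at x within {- 1..1})"
    and c: "continuous_on {- 1..1} f" "continuous_on {- 1..1} g"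
    and C: "(LINT x:{- 1..1}|lborel. (f x + v x)\<^sup>2) \<le> C"
    and \<Phi>: "(LINT x:{- 1..1}|lborel. (f x)\<^sup>2) \<le> \<Phi>"
    and \<Gamma>: "(LINT x:{- 1..1}|lborel. \<bar>g x\<bar>) \<le> \<Gamma>"
    and \<epsilon>: "0 \<le> \<epsilon>" "\<epsilon> \<le> 1"
  shows "\<bar>v 0\<bar> \<le> 3 + 2 * C + \<Phi> + \<Gamma>"
proof -
  let ?I = "{- 1..1 :: real}"
  have ci: "set_integrable lborel ?I h" if "continuous_on ?I h" for h :: "real \<Rightarrow> real"
    using that by (rule borel_integrable_atLeastAtMost')
  have cv: "continuous_on ?I v" using d by (rule continuous_on_derivative)
  let ?v' = "\<lambda>x. g x + \<epsilon> - (f x + v x)\<^sup>2"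
  have cv': "continuous_on ?I ?v'" by (intro continuous_intros cv c)
  have i1: "set_integrable lborel ?I (\<lambda>x. \<bar>g x\<bar>)" and i2: "set_integrable lborel ?I (\<lambda>x. 1 :: real)"
    and i3: "set_integrable lborel ?I (\<lambda>x. (f x + v x)\<^sup>2)" and i4: "set_integrable lborel ?I (\<lambda>x. (f x)\<^sup>2)"
    and i5: "set_integrable lborel ?I (\<lambda>x. \<bar>?v' x\<bar>)" and i6: "set_integrable lborel ?I (\<lambda>x. \<bar>v x\<bar>)"
    by (intro ci continuous_intros c cv)+
  have k: "(LINT x:?I|lborel. 1 :: real) = 2" using set_integral_const_Icc[of "-1" 1 1] by simp
  have "(LINT x:?I|lborel. \<bar>?v' x\<bar>) \<le> (LINT x:?I|lborel. \<bar>g x\<bar> + (1 + (f x + v x)\<^sup>2))"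
  proof (rule set_integral_mono[OF i5 set_integral_add(1)[OF i1 set_integral_add(1)[OF i2 i3]]])
    fix x
    have "0 \<le> (f x + v x)\<^sup>2" by simp
    then show "\<bar>?v' x\<bar> \<le> \<bar>g x\<bar> + (1 + (f x + v x)\<^sup>2)" using \<epsilon> by linarith
  qed
  also have "\<dots> = (LINT x:?I|lborel. \<bar>g x\<bar>) + (2 + (LINT x:?I|lborel. (f x + v x)\<^sup>2))"
    by (simp only: set_integral_add(2)[OF i1 set_integral_add(1)[OF i2 i3]] set_integral_add(2)[OF i2 i3] k)
  finally have L: "(LINT x:?I|lborel. \<bar>?v' x\<bar>) \<le> \<Gamma> + 2 + C" using \<Gamma> C by simp
  have i7: "set_integrable lborel ?I (\<lambda>x. 2 * (f x + v x)\<^sup>2)" and i8: "set_integrable lborel ?I (\<lambda>x. 2 * (f x)\<^sup>2)"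
    by (intro ci continuous_intros c cv)+
  have "(LINT x:?I|lborel. \<bar>v x\<bar>) \<le> (LINT x:?I|lborel. 1 + (2 * (f x + v x)\<^sup>2 + 2 * (f x)\<^sup>2))"
  proof (rule set_integral_mono[OF i6 set_integral_add(1)[OF i2 set_integral_add(1)[OF i7 i8]]])
    fix x
    have "0 \<le> (\<bar>v x\<bar> - 1)\<^sup>2" by simp
    then have 1: "2 * \<bar>v x\<bar> \<le> 1 + (v x)\<^sup>2" by (simp add: power2_diff)
    have "0 \<le> (v x + 2 * f x)\<^sup>2" by simp
    then have 2: "(v x)\<^sup>2 \<le> 2 * (f x + v x)\<^sup>2 + 2 * (f x)\<^sup>2"
      by (simp add: power2_eq_square algebra_simps)
    show "\<bar>v x\<bar> \<le> 1 + (2 * (f x + v x)\<^sup>2 + 2 * (f x)\<^sup>2)" using 1 2 abs_ge_zero[of "v x"] by linarith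
  qed
  also have "\<dots> = 2 + (2 * (LINT x:?I|lborel. (f x + v x)\<^sup>2) + 2 * (LINT x:?I|lborel. (f x)\<^sup>2))"
    by (simp only: set_integral_add(2)[OF i2 set_integral_add(1)[OF i7 i8]] set_integral_add(2)[OF i7 i8] k set_integral_mult_right)
  finally have V: "(LINT x:?I|lborel. \<bar>v x\<bar>) \<le> 2 + 2 * C + 2 * \<Phi>" using C \<Phi> by simp
  have i9: "set_integrable lborel ?I (\<lambda>x. \<Gamma> + 2 + C)" by (intro ci continuous_intros)
  have "2 * \<bar>v 0\<bar> = (LINT x:?I|lborel. \<bar>v 0\<bar>)" using set_integral_const_Icc[of "-1" 1 "\<bar>v 0\<bar>"] by simp
  also have "\<dots> \<le> (LINT x:?I|lborel. \<bar>v x\<bar> + (\<Gamma> + 2 + C))"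
  proof (rule set_integral_mono[OF _ set_integral_add(1)[OF i6 i9]])
    show "set_integrable lborel ?I (\<lambda>x. \<bar>v 0\<bar>)" by (intro ci continuous_intros)
    fix x assume x: "x \<in> ?I"
    have "\<bar>v 0 - v x\<bar> \<le> (LINT x:?I|lborel. \<bar>?v' x\<bar>)"
      by (rule FTC_abs_diff_le[OF d cv']) (use x in auto)
    then show "\<bar>v 0\<bar> \<le> \<bar>v x\<bar> + (\<Gamma> + 2 + C)" using L by linarith
  qed
  also have "\<dots> = (LINT x:?I|lborel. \<bar>v x\<bar>) + 2 * (\<Gamma> + 2 + C)"
    using set_integral_const_Icc[of "-1" 1 "\<Gamma> + 2 + C"] by (subst set_integral_add(2)[OF i6 i9]) simp
  finally show ?thesis using V by simp
qed

text \<open>Compactness is used for the values at 0 alone: a subsequence makes these converge, and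
  the difference estimate will carry the convergence to all other points. The condition
  \<open>2 * M \<le> real n\<close> reflects that the L2 bound holds on the inner half of the
  interval on which the solution lives.\<close>

lemma riccati_approximations:
  fixes f g :: "real \<Rightarrow> real"
  assumes fm [measurable]: "f \<in> borel_measurable borel" and f: "integrable lborel (\<lambda>x. (f x)\<^sup>2)"
    and g: "integrable lborel g" and form: "form_nonneg f g"
  obtains fn gn vn :: "nat \<Rightarrow> real \<Rightarrow> real" and en :: "nat \<Rightarrow> real" and C l :: real where
    "\<And>n. real_test (fn n)" "\<And>n. real_test (gn n)"
    "\<And>n. integrable lborel (\<lambda>x. (fn n x - f x)\<^sup>2)" "(\<lambda>n. LINT x|lborel. (fn n x - f x)\<^sup>2) \<longlonglongrightarrow> 0"
    "(\<lambda>n. LINT x|lborel. \<bar>gn n x - g x\<bar>) \<longlonglongrightarrow> 0" "en \<longlonglongrightarrow> 0"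
    "\<And>n M x. M > 0 \<Longrightarrow> 2 * M \<le> real n \<Longrightarrow> x \<in> {- M..M} \<Longrightarrow>
      (vn n has_real_derivative gn n x + en n - (fn n x + vn n x)\<^sup>2) (at x within {- M..M})"
    "\<And>n M. M > 0 \<Longrightarrow> 2 * M \<le> real n \<Longrightarrow> (LINT x:{- M..M}|lborel. (fn n x + vn n x)\<^sup>2) \<le> C"
    "(\<lambda>n. vn n 0) \<longlonglongrightarrow> l"
proof -
  have [measurable]: "g \<in> borel_measurable borel" using borel_measurable_integrable[OF g] by simp
  \<comment> \<open>\<open>\<Phi>\<close> and \<open>\<Gamma>\<close> must bound the norms of all
    approximants, so they are taken from \<open>f\<close> and \<open>g\<close> with room for an
    error \<open>\<delta> n \<le> 1\<close>.\<close>
  define \<Phi> where "\<Phi> = 2 * (LINT x|lborel. (f x)\<^sup>2) + 2"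
  define \<Gamma> where "\<Gamma> = (LINT x|lborel. \<bar>g x\<bar>) + 1"
  define K where "K = 4 * \<Phi> + 2 * \<Gamma> + 1"
  define C where "C = 104 + 4 * \<Phi> + 4 * \<Gamma>"
  have "0 \<le> (LINT x|lborel. (f x)\<^sup>2)" "0 \<le> (LINT x|lborel. \<bar>g x\<bar>)" by simp_all
  then have nn: "2 \<le> \<Phi>" "1 \<le> \<Gamma>" unfolding \<Phi>_def \<Gamma>_def by linarith+
  then have K1: "1 \<le> K" by (simp add: K_def)
  define H where "H = 4 * K\<^sup>2 + 8 * K"
  have H1: "1 \<le> H" using K1 zero_le_power2[of K] unfolding H_def by linarith
  \<comment> \<open>Choice of the parameters: \<open>en n * N n = 1\<close> is what
    \<open>riccati_L2_bound\<close> tolerates, \<open>\<delta> n * H\<close> is half of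
    \<open>en n\<close> and so below it, and \<open>N n \<ge> 2\<close> puts \<open>{-1..1}\<close>
    into the inner half for every \<open>n\<close>, as the bound of the values at 0
    requires.\<close>
  define N where "N = (\<lambda>n. real n + 2)"
  define en where "en = (\<lambda>n. 1 / N n)"
  define \<delta> where "\<delta> = (\<lambda>n. en n / (2 * H))"
  have N: "N n \<ge> 2" for n by (simp add: N_def)
  have en: "en n > 0" "en n \<le> 1" "en n * N n \<le> 1" for n using N[of n] by (auto simp: en_def)
  have \<delta>: "\<delta> n > 0" "\<delta> n \<le> 1" "\<delta> n * H < en n" "(\<delta> n)\<^sup>2 \<le> \<delta> n" "\<delta> n \<le> en n" for n
  proof -
    show 1: "\<delta> n > 0" using en H1 by (simp add: \<delta>_def)
    show 2: "\<delta> n \<le> en n" using en(1)[of n] H1 by (simp add: \<delta>_def divide_le_eq)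
    then show 3: "\<delta> n \<le> 1" using en(2)[of n] by linarith
    show "\<delta> n * H < en n" using en(1)[of n] H1 by (simp add: \<delta>_def)
    show "(\<delta> n)\<^sup>2 \<le> \<delta> n" using 1 3 by (simp add: power2_eq_square mult_left_le)
  qed
  have en0: "en \<longlonglongrightarrow> 0" unfolding en_def N_def by real_asymp
  have \<delta>0: "\<delta> \<longlonglongrightarrow> 0"
    by (rule tendsto_sandwich[OF _ _ tendsto_const en0]) (use \<delta> in \<open>auto intro!: always_eventually less_imp_le\<close>)
  have ex1: "\<exists>p. real_test p \<and> integrable lborel (\<lambda>x. (f x - p x)\<^sup>2) \<and> (LINT x|lborel. (f x - p x)\<^sup>2) < (\<delta> n)\<^sup>2" for n
  proof -
    obtain p where "real_test p" "integrable lborel (\<lambda>x. \<bar>f x - p x\<bar>\<^sup>2)" "(LINT x|lborel. \<bar>f x - p x\<bar>\<^sup>2) < (\<delta> n)\<^sup>2"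
      by (rule real_test_dense[of f 2 "(\<delta> n)\<^sup>2"]) (use f \<delta>(1)[of n] in auto)
    then show ?thesis by (intro exI[of _ p]) simp
  qed
  have ex2: "\<exists>p. real_test p \<and> integrable lborel (\<lambda>x. \<bar>g x - p x\<bar>) \<and> (LINT x|lborel. \<bar>g x - p x\<bar>) < \<delta> n" for n
  proof -
    obtain p where "real_test p" "integrable lborel (\<lambda>x. \<bar>g x - p x\<bar> ^ 1)" "(LINT x|lborel. \<bar>g x - p x\<bar> ^ 1) < \<delta> n"
      by (rule real_test_dense[of g 1 "\<delta> n"]) (use g \<delta>(1)[of n] in auto)
    then show ?thesis by (intro exI[of _ p]) simp
  qed
  obtain fn where "\<forall>n. real_test (fn n) \<and> integrable lborel (\<lambda>x. (f x - fn n x)\<^sup>2) \<and> (LINT x|lborel. (f x - fn n x)\<^sup>2) < (\<delta> n)\<^sup>2"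
    by (rule exE[OF choice[OF allI[OF ex1]]])
  then have fn: "\<And>n. real_test (fn n)" "\<And>n. integrable lborel (\<lambda>x. (f x - fn n x)\<^sup>2)"
    "\<And>n. (LINT x|lborel. (f x - fn n x)\<^sup>2) < (\<delta> n)\<^sup>2" by simp_all
  obtain gn where "\<forall>n. real_test (gn n) \<and> integrable lborel (\<lambda>x. \<bar>g x - gn n x\<bar>) \<and> (LINT x|lborel. \<bar>g x - gn n x\<bar>) < \<delta> n"
    by (rule exE[OF choice[OF allI[OF ex2]]])
  then have gn: "\<And>n. real_test (gn n)" "\<And>n. integrable lborel (\<lambda>x. \<bar>g x - gn n x\<bar>)"
    "\<And>n. (LINT x|lborel. \<bar>g x - gn n x\<bar>) < \<delta> n" by simp_all
  note [measurable] = real_test_measurable[OF fn(1)] real_test_measurable[OF gn(1)]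
  have fn\<Phi>: "(LINT x|lborel. (fn n x)\<^sup>2) \<le> \<Phi>" for n
  proof -
    have i: "integrable lborel (\<lambda>x. (norm (fn n x - f x))\<^sup>2)" "integrable lborel (\<lambda>x. (norm (f x))\<^sup>2)"
      using fn(2)[of n] f by (simp_all add: power2_commute)
    have "(LINT x|lborel. (norm ((fn n x - f x) + f x))\<^sup>2)
        \<le> 2 * (LINT x|lborel. (norm (fn n x - f x))\<^sup>2) + 2 * (LINT x|lborel. (norm (f x))\<^sup>2)"
      by (rule L2_norm_add_sq_le(2)[OF _ _ i]) auto
    then have "(LINT x|lborel. (fn n x)\<^sup>2) \<le> 2 * (LINT x|lborel. (f x - fn n x)\<^sup>2) + 2 * (LINT x|lborel. (f x)\<^sup>2)"
      by (simp add: power2_commute)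
    also have "\<dots> \<le> \<Phi>" using fn(3)[of n] \<delta>(2,4)[of n] by (simp add: \<Phi>_def)
    finally show ?thesis .
  qed
  have gn\<Gamma>: "(LINT x|lborel. \<bar>gn n x\<bar>) \<le> \<Gamma>" for n
  proof -
    have i: "integrable lborel (\<lambda>x. \<bar>g x - gn n x\<bar>)" "integrable lborel (\<lambda>x. \<bar>g x\<bar>)" "integrable lborel (\<lambda>x. \<bar>gn n x\<bar>)"
      using gn(2) g real_test_integrable[OF gn(1)] by auto
    have "(LINT x|lborel. \<bar>gn n x\<bar>) \<le> (LINT x|lborel. \<bar>g x - gn n x\<bar> + \<bar>g x\<bar>)"
      by (rule integral_mono) (use i in auto)
    also have "\<dots> = (LINT x|lborel. \<bar>g x - gn n x\<bar>) + (LINT x|lborel. \<bar>g x\<bar>)" using i by simp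
    also have "\<dots> \<le> \<Gamma>" using gn(3)[of n] \<delta>(2)[of n] by (simp add: \<Gamma>_def)
    finally show ?thesis .
  qed
  have ex3: "\<exists>v. \<forall>x\<in>{- N n..N n}. (v has_real_derivative gn n x + en n - (fn n x + v x)\<^sup>2) (at x within {- N n..N n})" for n
  proof -
    obtain v where "\<And>x. x \<in> {- N n..N n} \<Longrightarrow>
        (v has_real_derivative gn n x + en n - (fn n x + v x)\<^sup>2) (at x within {- N n..N n})"
    proof (rule riccati_solution_exists[where f = f and g = g and ft = "fn n" and ft' = "real_deriv (fn n)" and gt = "gn n"
          and \<delta> = "\<delta> n" and \<Phi> = \<Phi> and \<Gamma> = \<Gamma> and K = K and N = "N n" and \<epsilon> = "en n"])
      show "(fn n has_real_derivative real_deriv (fn n) x) (at x)" for x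
        by (rule real_test_has_derivative[OF fn(1)])
      show "continuous_on UNIV (real_deriv (fn n))" "continuous_on UNIV (gn n)"
        by (intro real_test_continuous real_test_deriv fn gn)+
      show "integrable lborel (\<lambda>x. (fn n x)\<^sup>2)" by (intro real_test_square_integrable fn)
      show "integrable lborel (\<lambda>x. \<bar>gn n x\<bar>)" by (intro integrable_abs real_test_integrable gn)
      show "\<delta> n * (4 * K\<^sup>2 + 8 * K) < en n" using \<delta>(3)[of n] by (simp add: H_def)
    qed (use N[of n] form f g fn(2)[of n] less_imp_le[OF fn(3)[of n]] gn(2)[of n] less_imp_le[OF gn(3)[of n]]
        fn\<Phi> gn\<Gamma> \<delta>(1) in \<open>auto simp: K_def\<close>)
    then show ?thesis by blast
  qed
  obtain vn where "\<forall>n. \<forall>x\<in>{- N n..N n}. (vn n has_real_derivative gn n x + en n - (fn n x + vn n x)\<^sup>2) (at x within {- N n..N n})"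
    by (rule exE[OF choice[OF allI[OF ex3]]])
  then have vn: "\<And>n x. x \<in> {- N n..N n} \<Longrightarrow> (vn n has_real_derivative gn n x + en n - (fn n x + vn n x)\<^sup>2) (at x within {- N n..N n})"
    by blast
  have vM: "(vn n has_real_derivative gn n x + en n - (fn n x + vn n x)\<^sup>2) (at x within {- M..M})"
    if "2 * M \<le> N n" "M > 0" "x \<in> {- M..M}" for n M x
  proof -
    have "{- M..M} \<subseteq> {- N n..N n}" using that N[of n] by auto
    then show ?thesis using that vn[of x n] by (auto intro: DERIV_subset)
  qed
  have bound: "(LINT x:{- M..M}|lborel. (fn n x + vn n x)\<^sup>2) \<le> C" if M: "2 * M \<le> N n" "M > 0" for n M
  proof -
    have cv: "continuous_on {- N n..N n} (vn n)" using vn by (rule continuous_on_derivative)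
    have cr: "continuous_on {- (N n / 2)..N n / 2} (\<lambda>x. (fn n x + vn n x)\<^sup>2)"
      using N[of n] by (intro continuous_intros real_test_continuous fn continuous_on_subset[OF cv]) auto
    have sub: "{- M..M} \<subseteq> {- (N n / 2)..N n / 2}" using M by auto
    note i = borel_integrable_atLeastAtMost'[OF cr]
    have "(LINT x:{- M..M}|lborel. (fn n x + vn n x)\<^sup>2) \<le> (LINT x:{- (N n / 2)..N n / 2}|lborel. (fn n x + vn n x)\<^sup>2)"
      unfolding set_lebesgue_integral_def
      by (rule integral_mono[OF set_integrable_subset[OF i _ sub, unfolded set_integrable_def] i[unfolded set_integrable_def]])
        (use sub in \<open>auto simp: indicator_def\<close>)
    also have "\<dots> \<le> C"
      unfolding C_def
    proof (rule riccati_L2_bound[where \<epsilon> = "en n" and gt = "gn n"])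
      show "1 \<le> N n" using N[of n] by simp
      show "continuous_on {- N n..N n} (fn n)" "continuous_on {- N n..N n} (gn n)"
        by (intro real_test_continuous fn gn)+
      show "integrable lborel (\<lambda>x. (fn n x)\<^sup>2)" by (intro real_test_square_integrable fn)
      show "integrable lborel (\<lambda>x. \<bar>gn n x\<bar>)" by (intro integrable_abs real_test_integrable gn)
    qed (use vn fn\<Phi> gn\<Gamma> en(1,3)[of n] in \<open>auto intro: less_imp_le\<close>)
    finally show ?thesis .
  qed
  define D where "D = 3 + 2 * C + \<Phi> + \<Gamma>"
  have "vn n 0 \<in> {- D..D}" for n
  proof -
    have "\<bar>vn n 0\<bar> \<le> D"
      unfolding D_def
    proof (rule riccati_value_bound)
      show "(vn n has_real_derivative gn n x + en n - (fn n x + vn n x)\<^sup>2) (at x within {- 1..1})"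
        if "x \<in> {- 1..1}" for x using that N[of n] by (intro vM) auto
      show "continuous_on {- 1..1} (fn n)" "continuous_on {- 1..1} (gn n)"
        by (intro real_test_continuous fn gn)+
      show "(LINT x:{- 1..1}|lborel. (fn n x + vn n x)\<^sup>2) \<le> C" using N[of n] by (intro bound) auto
      show "(LINT x:{- 1..1}|lborel. (fn n x)\<^sup>2) \<le> \<Phi>"
        using set_integral_le_integral(2)[OF real_test_square_integrable[OF fn(1)[of n]], where S = "{- 1..1}"] fn\<Phi>[of n] by simp
      show "(LINT x:{- 1..1}|lborel. \<bar>gn n x\<bar>) \<le> \<Gamma>"
        using set_integral_le_integral(2)[OF integrable_abs[OF real_test_integrable[OF gn(1)[of n]]], where S = "{- 1..1}"] gn\<Gamma>[of n] by simp
    qed (use en[of n] in auto)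
    then show ?thesis by auto
  qed
  then have "\<exists>l\<in>{- D..D}. \<exists>r. strict_mono r \<and> ((\<lambda>n. vn n 0) \<circ> r) \<longlonglongrightarrow> l"
    using compact_Icc[of "- D" D] unfolding compact_def by (elim allE[of _ "\<lambda>n. vn n 0"]) simp
  then obtain l r where lr: "strict_mono r" "((\<lambda>n. vn n 0) \<circ> r) \<longlonglongrightarrow> l"
    by blast
  have rN: "2 * M \<le> N (r n)" if "2 * M \<le> real n" for n M
    using that seq_suble[OF lr(1), of n] by (simp add: N_def)
  show ?thesis
  proof (rule that[of "\<lambda>n. fn (r n)" "\<lambda>n. gn (r n)" "\<lambda>n. en (r n)" "\<lambda>n. vn (r n)" C l])
    have f0: "(\<lambda>n. LINT x|lborel. (f x - fn n x)\<^sup>2) \<longlonglongrightarrow> 0"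
      by (rule tendsto_sandwich[OF _ _ tendsto_const \<delta>0])
        (auto intro!: always_eventually order_trans[OF less_imp_le[OF fn(3)] \<delta>(4)])
    show "(\<lambda>n. LINT x|lborel. (fn (r n) x - f x)\<^sup>2) \<longlonglongrightarrow> 0"
      using LIMSEQ_subseq_LIMSEQ[OF f0 lr(1)] by (simp add: o_def power2_commute)
    have g0: "(\<lambda>n. LINT x|lborel. \<bar>g x - gn n x\<bar>) \<longlonglongrightarrow> 0"
      by (rule tendsto_sandwich[OF _ _ tendsto_const \<delta>0])
        (use gn(3) in \<open>auto intro!: always_eventually intro: less_imp_le\<close>)
    show "(\<lambda>n. LINT x|lborel. \<bar>gn (r n) x - g x\<bar>) \<longlonglongrightarrow> 0"
      using LIMSEQ_subseq_LIMSEQ[OF g0 lr(1)] by (simp add: o_def abs_minus_commute)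
    show "(\<lambda>n. en (r n)) \<longlonglongrightarrow> 0" using LIMSEQ_subseq_LIMSEQ[OF en0 lr(1)] by (simp add: o_def)
    show "(\<lambda>n. vn (r n) 0) \<longlonglongrightarrow> l" using lr(2) by (simp add: o_def)
    show "integrable lborel (\<lambda>x. (fn (r n) x - f x)\<^sup>2)" for n using fn(2)[of "r n"] by (simp add: power2_commute)
    show "(vn (r n) has_real_derivative gn (r n) x + en (r n) - (fn (r n) x + vn (r n) x)\<^sup>2) (at x within {- M..M})"
      if "M > 0" "2 * M \<le> real n" "x \<in> {- M..M}" for n M x using that rN by (intro vM) auto
    show "(LINT x:{- M..M}|lborel. (fn (r n) x + vn (r n) x)\<^sup>2) \<le> C"
      if "M > 0" "2 * M \<le> real n" for n M using that rN by (intro bound) auto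
  qed (use fn gn in auto)
qed

lemma sqrt_L2_diff_le:
  fixes f1 f2 f :: "real \<Rightarrow> real"
  assumes [measurable]: "f1 \<in> borel_measurable borel" "f2 \<in> borel_measurable borel" "f \<in> borel_measurable borel"
    and i: "integrable lborel (\<lambda>x. (f1 x - f x)\<^sup>2)" "integrable lborel (\<lambda>x. (f2 x - f x)\<^sup>2)"
    and S: "S \<in> sets borel"
  shows "sqrt (LINT x:S|lborel. (f1 x - f2 x)\<^sup>2)
    \<le> sqrt (2 * (LINT x|lborel. (f1 x - f x)\<^sup>2)) + sqrt (2 * (LINT x|lborel. (f2 x - f x)\<^sup>2))"
proof -
  have i': "integrable lborel (\<lambda>x. (norm (f1 x - f x))\<^sup>2)" "integrable lborel (\<lambda>x. (norm (f x - f2 x))\<^sup>2)"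
    using i by (simp_all add: power2_commute)
  note L = L2_norm_add_sq_le[OF _ _ i']
  have "integrable lborel (\<lambda>x. (f1 x - f2 x)\<^sup>2)" using L(1) by simp
  then have "(LINT x:S|lborel. (f1 x - f2 x)\<^sup>2) \<le> (LINT x|lborel. (f1 x - f2 x)\<^sup>2)"
    using S by (intro set_integral_le_integral) auto
  also have "\<dots> \<le> 2 * (LINT x|lborel. (f1 x - f x)\<^sup>2) + 2 * (LINT x|lborel. (f2 x - f x)\<^sup>2)"
    using L(2) by (simp add: power2_commute)
  finally have "sqrt (LINT x:S|lborel. (f1 x - f2 x)\<^sup>2)
      \<le> sqrt (2 * (LINT x|lborel. (f1 x - f x)\<^sup>2) + 2 * (LINT x|lborel. (f2 x - f x)\<^sup>2))"
    by (rule real_sqrt_le_mono)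
  also have "\<dots> \<le> sqrt (2 * (LINT x|lborel. (f1 x - f x)\<^sup>2)) + sqrt (2 * (LINT x|lborel. (f2 x - f x)\<^sup>2))"
    by (rule sqrt_add_le_add_sqrt) auto
  finally show ?thesis .
qed

lemma set_integral_L1_diff_le:
  fixes g1 g2 g :: "real \<Rightarrow> real"
  assumes i: "integrable lborel g1" "integrable lborel g2" "integrable lborel g" and S: "S \<in> sets borel"
  shows "(LINT x:S|lborel. \<bar>g1 x - g2 x\<bar>) \<le> (LINT x|lborel. \<bar>g1 x - g x\<bar>) + (LINT x|lborel. \<bar>g2 x - g x\<bar>)"
proof -
  have "(LINT x:S|lborel. \<bar>g1 x - g2 x\<bar>) \<le> (LINT x|lborel. \<bar>g1 x - g2 x\<bar>)"
    using i S by (intro set_integral_le_integral) auto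
  also have "\<dots> \<le> (LINT x|lborel. \<bar>g1 x - g x\<bar> + \<bar>g2 x - g x\<bar>)"
    by (rule integral_mono) (use i in auto)
  also have "\<dots> = (LINT x|lborel. \<bar>g1 x - g x\<bar>) + (LINT x|lborel. \<bar>g2 x - g x\<bar>)" using i by simp
  finally show ?thesis .
qed

text \<open>The approximants \<open>vn n\<close> form a Cauchy sequence locally uniformly, hence
  \<open>fn n + vn n\<close> converges to \<open>r = f + v\<close> in L2 on compact sets, and the
  weak equation survives. Since \<open>C\<close> does not depend on the window, the limit is square
  integrable on the whole line.\<close>

lemma riccati_exists:
  fixes f g :: "real \<Rightarrow> real"
  assumes fm [measurable]: "f \<in> borel_measurable borel" and f: "integrable lborel (\<lambda>x. (f x)\<^sup>2)"
    and g: "integrable lborel g" and form: "form_nonneg f g"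
  obtains r where "r \<in> borel_measurable borel" "integrable lborel (\<lambda>x. (r x)\<^sup>2)"
    "\<And>p. real_test p \<Longrightarrow> - (LINT x|lborel. r x * real_deriv p x) + (LINT x|lborel. (r x)\<^sup>2 * p x)
      = - (LINT x|lborel. f x * real_deriv p x) + (LINT x|lborel. g x * p x)"
proof (rule riccati_approximations[OF fm f g form])
  have gm [measurable]: "g \<in> borel_measurable borel" using borel_measurable_integrable[OF g] by simp
  fix fn gn vn :: "nat \<Rightarrow> real \<Rightarrow> real" and en :: "nat \<Rightarrow> real" and C l :: real
  assume fn: "\<And>n. real_test (fn n)" and gn: "\<And>n. real_test (gn n)"
    and fnI: "\<And>n. integrable lborel (\<lambda>x. (fn n x - f x)\<^sup>2)" and fn0: "(\<lambda>n. LINT x|lborel. (fn n x - f x)\<^sup>2) \<longlonglongrightarrow> 0"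
    and gn0: "(\<lambda>n. LINT x|lborel. \<bar>gn n x - g x\<bar>) \<longlonglongrightarrow> 0" and en0: "en \<longlonglongrightarrow> 0"
    and dvn: "\<And>n M x. M > 0 \<Longrightarrow> 2 * M \<le> real n \<Longrightarrow> x \<in> {- M..M} \<Longrightarrow>
      (vn n has_real_derivative gn n x + en n - (fn n x + vn n x)\<^sup>2) (at x within {- M..M})"
    and vnC: "\<And>n M. M > 0 \<Longrightarrow> 2 * M \<le> real n \<Longrightarrow> (LINT x:{- M..M}|lborel. (fn n x + vn n x)\<^sup>2) \<le> C"
    and vn0: "(\<lambda>n. vn n 0) \<longlonglongrightarrow> l"
  note [measurable] = real_test_measurable[OF fn] real_test_measurable[OF gn]
  note gnI = real_test_integrable[OF gn]
  \<comment> \<open>The distance of the data with index \<open>n\<close> from the limit data.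
    Comparing through the limit bounds the difference of two approximants by
    \<open>b M n + b M m\<close>, a form suited to the Cauchy criterion; \<open>E M\<close> is the
    Gronwall factor.\<close>
  define b where "b = (\<lambda>M n. \<bar>vn n 0 - l\<bar> + (LINT x|lborel. \<bar>gn n x - g x\<bar>) + 2 * M * \<bar>en n\<bar>
    + sqrt (4 * C) * sqrt (2 * (LINT x|lborel. (fn n x - f x)\<^sup>2)))"
  define E where "E = (\<lambda>M. exp (2 * (2 * M + 4 * C)))"
  have b0: "(\<lambda>n. E M * b M n) \<longlonglongrightarrow> 0" for M
  proof -
    have "(\<lambda>n. E M * b M n) \<longlonglongrightarrow> E M * (\<bar>l - l\<bar> + 0 + 2 * M * \<bar>0\<bar> + sqrt (4 * C) * sqrt (2 * 0))"
      unfolding b_def by (intro tendsto_intros vn0 gn0 en0 fn0)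
    then show ?thesis by simp
  qed
  have C0: "0 \<le> C"
    using vnC[of 1 2] by (auto simp: set_lebesgue_integral_def intro: order_trans[rotated])
  have diff: "\<bar>vn n t - vn m t\<bar> \<le> E M * b M n + E M * b M m"
    if M: "M > 0" "2 * M \<le> real n" "2 * M \<le> real m" "t \<in> {- M..M}" for M n m t
  proof -
    have "\<bar>vn n t - vn m t\<bar> \<le> E M * (\<bar>vn n 0 - vn m 0\<bar> + (LINT x:{- M..M}|lborel. \<bar>gn n x - gn m x\<bar>)
        + 2 * M * \<bar>en n - en m\<bar> + sqrt (4 * C) * sqrt (LINT x:{- M..M}|lborel. (fn n x - fn m x)\<^sup>2))"
      unfolding E_def
      by (rule riccati_difference_bound[OF M(1) dvn[OF M(1,2)] dvn[OF M(1,3)]])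
        (use M in \<open>auto intro!: real_test_continuous fn gn vnC\<close>)
    also have "\<dots> \<le> E M * (b M n + b M m)"
    proof (rule mult_left_mono)
      have 1: "\<bar>vn n 0 - vn m 0\<bar> \<le> \<bar>vn n 0 - l\<bar> + \<bar>vn m 0 - l\<bar>" by linarith
      have 2: "(LINT x:{- M..M}|lborel. \<bar>gn n x - gn m x\<bar>) \<le> (LINT x|lborel. \<bar>gn n x - g x\<bar>) + (LINT x|lborel. \<bar>gn m x - g x\<bar>)"
        by (rule set_integral_L1_diff_le) (use gnI g in auto)
      have 3: "2 * M * \<bar>en n - en m\<bar> \<le> 2 * M * (\<bar>en n\<bar> + \<bar>en m\<bar>)" using M(1) by (intro mult_left_mono) auto
      have 4: "sqrt (4 * C) * sqrt (LINT x:{- M..M}|lborel. (fn n x - fn m x)\<^sup>2)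
          \<le> sqrt (4 * C) * (sqrt (2 * (LINT x|lborel. (fn n x - f x)\<^sup>2)) + sqrt (2 * (LINT x|lborel. (fn m x - f x)\<^sup>2)))"
        using C0 by (intro mult_left_mono sqrt_L2_diff_le fnI) auto
      show "\<bar>vn n 0 - vn m 0\<bar> + (LINT x:{- M..M}|lborel. \<bar>gn n x - gn m x\<bar>) + 2 * M * \<bar>en n - en m\<bar>
          + sqrt (4 * C) * sqrt (LINT x:{- M..M}|lborel. (fn n x - fn m x)\<^sup>2) \<le> b M n + b M m"
        using 1 2 3 4 unfolding b_def distrib_left by linarith
    qed (simp add: E_def)
    finally show ?thesis by (simp only: distrib_left)
  qed
  have conv: "convergent (\<lambda>n. vn n t)" for t
  proof -
    define M where "M = \<bar>t\<bar> + 1"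
    have M: "M > 0" "t \<in> {- M..M}" by (auto simp: M_def)
    obtain n0 where n0: "2 * M \<le> real n0" using real_arch_simple by blast
    have "Cauchy (\<lambda>n. vn n t)"
    proof (rule metric_CauchyI)
      fix e :: real assume "e > 0"
      then have "\<forall>\<^sub>F n in sequentially. E M * b M n < e / 2" by (intro order_tendstoD[OF b0]) auto
      then obtain n1 where n1: "\<And>n. n \<ge> n1 \<Longrightarrow> E M * b M n < e / 2" unfolding eventually_sequentially by blast
      show "\<exists>N. \<forall>m\<ge>N. \<forall>n\<ge>N. dist (vn m t) (vn n t) < e"
      proof (intro exI[of _ "max n0 n1"] allI impI)
        fix m n assume mn: "max n0 n1 \<le> m" "max n0 n1 \<le> n"
        then have "2 * M \<le> real m" "2 * M \<le> real n" using n0 by auto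
        then have "\<bar>vn m t - vn n t\<bar> \<le> E M * b M m + E M * b M n" using diff M by blast
        then show "dist (vn m t) (vn n t) < e" using n1[of m] n1[of n] mn by (simp add: dist_real_def)
      qed
    qed
    then show ?thesis by (simp add: Cauchy_convergent_iff)
  qed
  define v where "v = (\<lambda>t. lim (\<lambda>n. vn n t))"
  have vl: "(\<lambda>n. vn n t) \<longlonglongrightarrow> v t" for t using conv[of t] unfolding v_def by (simp add: convergent_LIMSEQ_iff)
  have vb: "\<bar>vn n t - v t\<bar> \<le> E M * b M n" if M: "M > 0" "2 * M \<le> real n" "t \<in> {- M..M}" for M n t
  proof (rule LIMSEQ_le)
    show "(\<lambda>m. \<bar>vn n t - vn m t\<bar>) \<longlonglongrightarrow> \<bar>vn n t - v t\<bar>" by (intro tendsto_intros vl)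
    show "(\<lambda>m. E M * b M n + E M * b M m) \<longlonglongrightarrow> E M * b M n" using tendsto_add[OF tendsto_const b0] by simp
    obtain n0 where n0: "2 * M \<le> real n0" using real_arch_simple by blast
    show "\<exists>N. \<forall>m\<ge>N. \<bar>vn n t - vn m t\<bar> \<le> E M * b M n + E M * b M m"
    proof (intro exI[of _ n0] allI impI)
      fix m assume "n0 \<le> m"
      then have "2 * M \<le> real m" using n0 by linarith
      then show "\<bar>vn n t - vn m t\<bar> \<le> E M * b M n + E M * b M m" using diff M by blast
    qed
  qed
  have cvn: "continuous_on {- M..M} (vn n)" if "M > 0" "2 * M \<le> real n" for M n
    using dvn[OF that] by (rule continuous_on_derivative)
  have vm [measurable]: "v \<in> borel_measurable borel"
  proof (rule borel_measurable_LIMSEQ_real)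
    show "(\<lambda>n. indicator {- (real n / 2)..real n / 2} x *\<^sub>R vn n x) \<longlonglongrightarrow> v x" for x
    proof (rule Lim_transform_eventually[OF vl])
      obtain n0 where n0: "2 * \<bar>x\<bar> \<le> real n0" using real_arch_simple by blast
      show "\<forall>\<^sub>F n in sequentially. vn n x = indicator {- (real n / 2)..real n / 2} x *\<^sub>R vn n x"
        unfolding eventually_sequentially
      proof (intro exI[of _ n0] allI impI)
        fix n assume "n0 \<le> n"
        then have "2 * \<bar>x\<bar> \<le> real n" using n0 by linarith
        then show "vn n x = indicator {- (real n / 2)..real n / 2} x *\<^sub>R vn n x"
          by (auto simp: indicator_def abs_le_iff)
      qed
    qed
    show "(\<lambda>x. indicator {- (real n / 2)..real n / 2} x *\<^sub>R vn n x) \<in> borel_measurable borel" for n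
    \<comment> \<open>For \<open>n = 0\<close> the window is the single point 0 and no continuity is
      known, since the equation is given only for \<open>M > 0\<close>.\<close>
    proof (cases "n = 0")
      case True
      have "(\<lambda>x. indicator {0..0} x *\<^sub>R vn n x) \<in> borel_measurable borel"
      proof -
        have "(\<lambda>x. indicator {0..0} x *\<^sub>R vn n x) = (\<lambda>x. indicator {0..0} x *\<^sub>R vn n 0)"
          by (auto simp: indicator_def)
        then show ?thesis by simp
      qed
      then show ?thesis using True by simp
    next
      case False
      then have "set_integrable lborel {- (real n / 2)..real n / 2} (vn n)"
        by (intro borel_integrable_atLeastAtMost' cvn) auto
      then show ?thesis unfolding set_integrable_def using borel_measurable_integrable by auto
    qed
  qed
  define r where "r = (\<lambda>x. f x + v x)"
  have rm [measurable]: "r \<in> borel_measurable borel" unfolding r_def by measurable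
  let ?ind = "\<lambda>M x. indicator {- M..M::real} x :: real"
  define rI where "rI = (\<lambda>M x. ?ind M x * r x)"
  define rnI where "rnI = (\<lambda>M n x. ?ind M x * (fn n x + vn n x))"
  have rIm [measurable]: "rI M \<in> borel_measurable borel" for M unfolding rI_def by measurable
  have rn: "rnI M n \<in> borel_measurable borel \<and> integrable lborel (\<lambda>x. (rnI M n x)\<^sup>2) \<and> (LINT x|lborel. (rnI M n x)\<^sup>2) \<le> C"
    if M: "M > 0" "2 * M \<le> real n" for M n
  proof -
    have c: "continuous_on {- M..M} (\<lambda>x. fn n x + vn n x)" "continuous_on {- M..M} (\<lambda>x. (fn n x + vn n x)\<^sup>2)"
      by (intro continuous_intros real_test_continuous fn cvn M)+
    have eq: "(rnI M n x)\<^sup>2 = indicator {- M..M} x *\<^sub>R (fn n x + vn n x)\<^sup>2" for x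
      by (simp add: rnI_def indicator_def)
    have "rnI M n \<in> borel_measurable lborel"
      using borel_measurable_integrable[OF borel_integrable_atLeastAtMost'[OF c(1), unfolded set_integrable_def]]
      by (simp add: rnI_def[abs_def])
    then show ?thesis
      using borel_integrable_atLeastAtMost'[OF c(2), unfolded set_integrable_def] vnC[OF M]
      unfolding eq by (simp add: set_lebesgue_integral_def)
  qed
  have dr: "integrable lborel (\<lambda>x. (norm (rnI M n x - rI M x))\<^sup>2) \<and>
      (LINT x|lborel. (norm (rnI M n x - rI M x))\<^sup>2) \<le> 2 * (LINT x|lborel. (fn n x - f x)\<^sup>2) + 2 * (2 * M * (E M * b M n)\<^sup>2)"
    if M: "M > 0" "2 * M \<le> real n" for M n
  proof -
    have rnm [measurable]: "rnI M n \<in> borel_measurable borel" using rn[OF M] by simp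
    have le: "(norm (rnI M n x - rI M x))\<^sup>2 \<le> 2 * (fn n x - f x)\<^sup>2 + ?ind M x * (2 * (E M * b M n)\<^sup>2)" for x
    proof (cases "x \<in> {- M..M}")
      case True
      have "\<bar>vn n x - v x\<bar>\<^sup>2 \<le> (E M * b M n)\<^sup>2" by (intro power_mono vb M True) auto
      moreover have "0 \<le> ((fn n x - f x) - (vn n x - v x))\<^sup>2" by simp
      then have "((fn n x - f x) + (vn n x - v x))\<^sup>2 \<le> 2 * (fn n x - f x)\<^sup>2 + 2 * (vn n x - v x)\<^sup>2"
        by (simp add: power2_eq_square algebra_simps)
      moreover have "rnI M n x - rI M x = (fn n x - f x) + (vn n x - v x)"
        using True by (simp add: rnI_def rI_def r_def)
      ultimately show ?thesis using True by simp
    next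
      case False
      then show ?thesis by (simp add: rnI_def rI_def)
    qed
    have k: "integrable lborel (\<lambda>x. ?ind M x * (2 * (E M * b M n)\<^sup>2))"
      "(LINT x|lborel. ?ind M x * (2 * (E M * b M n)\<^sup>2)) = 2 * (2 * M * (E M * b M n)\<^sup>2)"
      using set_integral_const_Icc[of "- M" M "2 * (E M * b M n)\<^sup>2"] M(1)
        borel_integrable_atLeastAtMost'[of "- M" M "\<lambda>x. 2 * (E M * b M n)\<^sup>2"]
      by (simp_all add: set_lebesgue_integral_def set_integrable_def)
    have i: "integrable lborel (\<lambda>x. 2 * (fn n x - f x)\<^sup>2)" using fnI by simp
    have i2: "integrable lborel (\<lambda>x. 2 * (fn n x - f x)\<^sup>2 + ?ind M x * (2 * (E M * b M n)\<^sup>2))"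
      by (intro Bochner_Integration.integrable_add i k)
    have i1: "integrable lborel (\<lambda>x. (norm (rnI M n x - rI M x))\<^sup>2)"
      by (rule integrable_bound_le[OF i2]) (measurable, use le in simp)
    have "(LINT x|lborel. (norm (rnI M n x - rI M x))\<^sup>2) \<le> (LINT x|lborel. 2 * (fn n x - f x)\<^sup>2 + ?ind M x * (2 * (E M * b M n)\<^sup>2))"
      by (rule integral_mono[OF i1 i2 le])
    also have "\<dots> = 2 * (LINT x|lborel. (fn n x - f x)\<^sup>2) + 2 * (2 * M * (E M * b M n)\<^sup>2)"
      using i k by (simp only: Bochner_Integration.integral_add integral_mult_right_zero)
    finally show ?thesis using i1 by simp
  qed
  \<comment> \<open>Index shift after which the equation and the bounds hold on
    \<open>{- M..M}\<close> for every member of the sequence.\<close>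
  define n0 where "n0 = (\<lambda>M::real. nat \<lceil>2 * M\<rceil>)"
  have n0: "2 * M \<le> real (k + n0 M)" for M k unfolding n0_def by linarith
  have dr0: "(\<lambda>k. LINT x|lborel. (norm (rnI M (k + n0 M) x - rI M x))\<^sup>2) \<longlonglongrightarrow> 0" if M: "M > 0" for M
  proof (rule tendsto_sandwich[OF _ _ tendsto_const])
    have "(\<lambda>n. 2 * (LINT x|lborel. (fn n x - f x)\<^sup>2) + 2 * (2 * M * (E M * b M n)\<^sup>2)) \<longlonglongrightarrow> 2 * 0 + 2 * (2 * M * 0\<^sup>2)"
      by (intro tendsto_intros fn0 b0)
    from LIMSEQ_ignore_initial_segment[OF this, of "n0 M"]
    show "(\<lambda>k. 2 * (LINT x|lborel. (fn (k + n0 M) x - f x)\<^sup>2) + 2 * (2 * M * (E M * b M (k + n0 M))\<^sup>2)) \<longlonglongrightarrow> 0"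
      by simp
  qed (use dr[OF M n0] in \<open>auto intro!: always_eventually\<close>)
  have rI2: "integrable lborel (\<lambda>x. (rI M x)\<^sup>2)" if M: "M > 0" for M
  proof -
    have [measurable]: "rnI M (n0 M) \<in> borel_measurable borel" using rn[OF M n0[of M 0]] by simp
    have "integrable lborel (\<lambda>x. (norm (- (rnI M (n0 M) x - rI M x) + rnI M (n0 M) x))\<^sup>2)"
    proof (rule L2_norm_add_sq_le(1))
      show "integrable lborel (\<lambda>x. (norm (- (rnI M (n0 M) x - rI M x)))\<^sup>2)"
        using dr[OF M n0[of M 0]] by (simp only: norm_minus_cancel add_0)
      show "integrable lborel (\<lambda>x. (norm (rnI M (n0 M) x))\<^sup>2)"
        using rn[OF M n0[of M 0]] by simp
    qed measurable
    then show ?thesis by simp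
  qed
  have rIC: "(LINT x|lborel. (rI M x)\<^sup>2) \<le> C" if M: "M > 0" for M
  proof (rule LIMSEQ_le_const2)
    have "(\<lambda>k. LINT x|lborel. rnI M (k + n0 M) x * rnI M (k + n0 M) x) \<longlonglongrightarrow> (LINT x|lborel. rI M x * rI M x)"
      by (rule L2_tendsto_mult) (use rI2[OF M] rn[OF M n0] dr[OF M n0] dr0[OF M] in auto)
    then show "(\<lambda>k. LINT x|lborel. (rnI M (k + n0 M) x)\<^sup>2) \<longlonglongrightarrow> (LINT x|lborel. (rI M x)\<^sup>2)"
      by (simp add: power2_eq_square)
    show "\<exists>N. \<forall>k\<ge>N. (LINT x|lborel. (rnI M (k + n0 M) x)\<^sup>2) \<le> C" using rn[OF M n0] by blast
  qed
  have r2: "integrable lborel (\<lambda>x. (r x)\<^sup>2)"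
  proof -
    \<comment> \<open>Squares restricted to growing windows increase to \<open>r\<^sup>2\<close>,
      with integrals at most \<open>C\<close>: monotone convergence.\<close>
    define G where "G = (\<lambda>k x. (rI (real (Suc k)) x)\<^sup>2)"
    have Gi: "integrable lborel (G k)" for k unfolding G_def by (rule rI2) simp
    have mono: "G k x \<le> G m x" if "k \<le> m" for k m x
      using that by (auto simp: G_def rI_def indicator_def power_mult_distrib)
    have "incseq (\<lambda>k. integral\<^sup>L lborel (G k))"
      by (intro incseq_SucI integral_mono Gi mono) simp
    moreover have "integral\<^sup>L lborel (G k) \<le> C" for k unfolding G_def by (rule rIC) simp
    ultimately obtain L where L: "(\<lambda>k. integral\<^sup>L lborel (G k)) \<longlonglongrightarrow> L"
      using incseq_convergent by blast
    have Gl: "(\<lambda>k. G k x) \<longlonglongrightarrow> (r x)\<^sup>2" for x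
    proof (rule tendsto_eventually)
      obtain k0 where k0: "\<bar>x\<bar> \<le> real k0" using real_arch_simple by blast
      show "\<forall>\<^sub>F k in sequentially. G k x = (r x)\<^sup>2"
        unfolding eventually_sequentially
      proof (intro exI[of _ k0] allI impI)
        fix k assume "k0 \<le> k"
        then have "\<bar>x\<bar> \<le> real (Suc k)" using k0 by simp
        then show "G k x = (r x)\<^sup>2" by (auto simp: G_def rI_def indicator_def abs_le_iff)
      qed
    qed
    show ?thesis
    proof (rule integrable_monotone_convergence[OF Gi _ _ L])
      show "AE x in lborel. mono (\<lambda>k. G k x)" by (intro AE_I2 monoI mono)
      show "AE x in lborel. (\<lambda>k. G k x) \<longlonglongrightarrow> (r x)\<^sup>2" by (intro AE_I2 Gl)
    qed measurable
  qed
  have weak: "- (LINT x|lborel. r x * real_deriv p x) + (LINT x|lborel. (r x)\<^sup>2 * p x)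
      = - (LINT x|lborel. f x * real_deriv p x) + (LINT x|lborel. g x * p x)" if p: "real_test p" for p
  proof -
    note dp = real_test_deriv[OF p]
    note [measurable] = real_test_measurable[OF p] real_test_measurable[OF dp]
    obtain M where M: "M > 0" "\<And>x. \<bar>x\<bar> \<ge> M \<Longrightarrow> p x = 0" using real_test_support[OF p] by blast
    obtain M' where M': "M' > 0" "\<And>x. \<bar>x\<bar> \<ge> M' \<Longrightarrow> real_deriv p x = 0" using real_test_support[OF dp] by blast
    define L where "L = max M M'"
    have L: "L > 0" using M(1) by (simp add: L_def)
    have pz: "p x = 0" "real_deriv p x = 0" if "\<bar>x\<bar> \<ge> L" for x
      using that M(2) M'(2) by (simp_all add: L_def)
    have pz': "p x = 0" "real_deriv p x = 0" if "x \<notin> {- L..L}" for x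
      by (rule pz; use that in auto)+
    obtain B where B: "\<And>x. \<bar>p x\<bar> \<le> B" using real_test_bounded[OF p] by blast
    have B0: "0 \<le> B" using B[of 0] by linarith
    let ?r = "\<lambda>k. rnI L (k + n0 L)"
    note rk = rn[OF L n0] and dk = dr[OF L n0] and dk0 = dr0[OF L]
    have [measurable]: "?r k \<in> borel_measurable borel" for k using rk[of k] by simp
    have dp2: "integrable lborel (\<lambda>x. (norm (real_deriv p x))\<^sup>2)"
      using real_test_square_integrable[OF dp] by simp
    have t1: "(\<lambda>k. LINT x|lborel. ?r k x * real_deriv p x) \<longlonglongrightarrow> (LINT x|lborel. rI L x * real_deriv p x)"
      by (rule L2_tendsto_mult) (use rI2[OF L] dk dk0 dp2 in auto)
    have mp: "integrable lborel (\<lambda>x. (norm (h x * p x))\<^sup>2) \<and> (LINT x|lborel. (norm (h x * p x))\<^sup>2) \<le> B\<^sup>2 * (LINT x|lborel. (norm (h x))\<^sup>2)"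
      if [measurable]: "h \<in> borel_measurable borel" and h: "integrable lborel (\<lambda>x. (norm (h x))\<^sup>2)" for h :: "real \<Rightarrow> real"
    proof -
      have le: "(norm (h x * p x))\<^sup>2 \<le> B\<^sup>2 * (norm (h x))\<^sup>2" for x
      proof -
        have "\<bar>p x\<bar>\<^sup>2 * (h x)\<^sup>2 \<le> B\<^sup>2 * (h x)\<^sup>2" by (intro mult_right_mono power_mono B) auto
        then show ?thesis by (simp add: power_mult_distrib mult.commute)
      qed
      have i: "integrable lborel (\<lambda>x. B\<^sup>2 * (norm (h x))\<^sup>2)" using h by simp
      have i': "integrable lborel (\<lambda>x. (norm (h x * p x))\<^sup>2)"
        by (rule integrable_bound_le[OF i]) (measurable, use le in simp)
      show ?thesis using i' integral_mono[OF i' i le] by (simp only: integral_mult_right_zero simp_thms)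
    qed
    have rdm: "(\<lambda>x. ?r k x - rI L x) \<in> borel_measurable borel" for k by measurable
    have rp: "integrable lborel (\<lambda>x. (norm (?r k x * p x - rI L x * p x))\<^sup>2)"
      "(LINT x|lborel. (norm (?r k x * p x - rI L x * p x))\<^sup>2) \<le> B\<^sup>2 * (LINT x|lborel. (norm (?r k x - rI L x))\<^sup>2)" for k
      using mp[OF rdm conjunct1[OF dk[of k]]] by (simp_all only: left_diff_distrib)
    have rp0: "(\<lambda>k. LINT x|lborel. (norm (?r k x * p x - rI L x * p x))\<^sup>2) \<longlonglongrightarrow> 0"
    proof (rule tendsto_sandwich[OF _ _ tendsto_const])
      show "(\<lambda>k. B\<^sup>2 * (LINT x|lborel. (norm (?r k x - rI L x))\<^sup>2)) \<longlonglongrightarrow> 0"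
        using tendsto_mult[OF tendsto_const dk0, of "B\<^sup>2"] by simp
    qed (use rp(2) in \<open>auto intro!: always_eventually\<close>)
    have rIp: "integrable lborel (\<lambda>x. (norm (rI L x * p x))\<^sup>2)"
      using mp[OF rIm] rI2[OF L] by simp
    have t2: "(\<lambda>k. LINT x|lborel. ?r k x * (?r k x * p x)) \<longlonglongrightarrow> (LINT x|lborel. rI L x * (rI L x * p x))"
      by (rule L2_tendsto_mult) (use rI2[OF L] dk dk0 rp(1) rp0 rIp in auto)
    have fd: "integrable lborel (\<lambda>x. (norm (f x))\<^sup>2)" "integrable lborel (\<lambda>x. (norm (fn n x - f x))\<^sup>2)"
      "(\<lambda>n. LINT x|lborel. (norm (fn n x - f x))\<^sup>2) \<longlonglongrightarrow> 0" for n
      using f fnI fn0 by simp_all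
    have "(\<lambda>n. LINT x|lborel. fn n x * real_deriv p x) \<longlonglongrightarrow> (LINT x|lborel. f x * real_deriv p x)"
      by (rule L2_tendsto_mult) (use fd dp2 in auto)
    then have t3: "(\<lambda>k. LINT x|lborel. fn (k + n0 L) x * real_deriv p x) \<longlonglongrightarrow> (LINT x|lborel. f x * real_deriv p x)"
      by (rule LIMSEQ_ignore_initial_segment)
    have gp: "integrable lborel (\<lambda>x. h x * p x)" if "integrable lborel h" for h :: "real \<Rightarrow> real"
    proof (rule integrable_bound_le)
      show "integrable lborel (\<lambda>x. B * \<bar>h x\<bar>)" using that by simp
      show "(\<lambda>x. h x * p x) \<in> borel_measurable lborel" using borel_measurable_integrable[OF that] by simp
      show "norm (h x * p x) \<le> B * \<bar>h x\<bar>" for x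
        using mult_right_mono[OF B, of "\<bar>h x\<bar>" x] by (simp add: abs_mult mult.commute)
    qed
    have "(\<lambda>n. (LINT x|lborel. gn n x * p x) - (LINT x|lborel. g x * p x)) \<longlonglongrightarrow> 0"
    proof (rule Lim_null_comparison)
      show "(\<lambda>n. B * (LINT x|lborel. \<bar>gn n x - g x\<bar>)) \<longlonglongrightarrow> 0"
        using tendsto_mult[OF tendsto_const gn0, of B] by simp
      have "norm ((LINT x|lborel. gn n x * p x) - (LINT x|lborel. g x * p x)) \<le> B * (LINT x|lborel. \<bar>gn n x - g x\<bar>)" for n
      proof -
        have i: "integrable lborel (\<lambda>x. gn n x - g x)" using gnI g by simp
        have "(LINT x|lborel. gn n x * p x) - (LINT x|lborel. g x * p x) = (LINT x|lborel. (gn n x - g x) * p x)"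
          unfolding left_diff_distrib by (rule Bochner_Integration.integral_diff[symmetric]) (intro gp gnI g)+
        also have "norm \<dots> \<le> (LINT x|lborel. norm ((gn n x - g x) * p x))" by (rule integral_norm_bound)
        also have "\<dots> \<le> (LINT x|lborel. B * \<bar>gn n x - g x\<bar>)"
        proof (rule integral_mono)
          show "integrable lborel (\<lambda>x. norm ((gn n x - g x) * p x))" by (intro integrable_norm gp i)
          show "norm ((gn n x - g x) * p x) \<le> B * \<bar>gn n x - g x\<bar>" for x
            using mult_right_mono[OF B, of "\<bar>gn n x - g x\<bar>" x] by (simp add: abs_mult mult.commute)
        qed (use i in auto)
        finally show ?thesis by simp
      qed
      then show "\<forall>\<^sub>F n in sequentially. norm ((LINT x|lborel. gn n x * p x) - (LINT x|lborel. g x * p x))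
          \<le> B * (LINT x|lborel. \<bar>gn n x - g x\<bar>)" by simp
    qed
    then have "(\<lambda>n. LINT x|lborel. gn n x * p x) \<longlonglongrightarrow> (LINT x|lborel. g x * p x)" by (simp add: LIM_zero_iff)
    then have t4: "(\<lambda>k. LINT x|lborel. gn (k + n0 L) x * p x) \<longlonglongrightarrow> (LINT x|lborel. g x * p x)"
      by (rule LIMSEQ_ignore_initial_segment)
    have t5: "(\<lambda>k. en (k + n0 L) * (LINT x|lborel. p x)) \<longlonglongrightarrow> 0"
      using tendsto_mult[OF LIMSEQ_ignore_initial_segment[OF en0] tendsto_const] by simp
    \<comment> \<open>The derivative of \<open>vn * p\<close> integrates to zero over the support of
      \<open>p\<close>. Writing \<open>vn\<close> as \<open>rnI - fn\<close> next to the derivative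
      of \<open>p\<close> turns this into the weak form of the approximate equation, in which
      \<open>fn\<close> is not differentiated.\<close>
    have key: "- (LINT x|lborel. ?r k x * real_deriv p x) + (LINT x|lborel. ?r k x * (?r k x * p x))
        = - (LINT x|lborel. fn (k + n0 L) x * real_deriv p x) + (LINT x|lborel. gn (k + n0 L) x * p x)
          + en (k + n0 L) * (LINT x|lborel. p x)" for k
    proof -
      let ?n = "k + n0 L"
      let ?I = "{- L..L}"
      note cv = cvn[OF L n0[of L k]]
      have "(LINT x:?I|lborel. (gn ?n x + en ?n - (fn ?n x + vn ?n x)\<^sup>2) * p x + real_deriv p x * vn ?n x)
          = vn ?n L * p L - vn ?n (- L) * p (- L)"
      proof (rule FTC_Icc)
        show "((\<lambda>x. vn ?n x * p x) has_real_derivative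
            (gn ?n x + en ?n - (fn ?n x + vn ?n x)\<^sup>2) * p x + real_deriv p x * vn ?n x) (at x within ?I)" if "x \<in> ?I" for x
          by (rule DERIV_mult[OF dvn[OF L n0[of L k] that] has_field_derivative_at_within[OF real_test_has_derivative[OF p]]])
        show "continuous_on ?I (\<lambda>x. (gn ?n x + en ?n - (fn ?n x + vn ?n x)\<^sup>2) * p x + real_deriv p x * vn ?n x)"
          by (intro continuous_intros real_test_continuous fn gn p dp cv)
      qed (use L in simp)
      also have "\<dots> = 0" using pz L by simp
      finally have z: "(LINT x:?I|lborel. (gn ?n x + en ?n - (fn ?n x + vn ?n x)\<^sup>2) * p x + real_deriv p x * vn ?n x) = 0" .
      have i1: "integrable lborel (\<lambda>x. ?r k x * real_deriv p x)"
        by (rule integrable_mult_L2) (use rk[of k] dp2 in auto)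
      have rp2: "integrable lborel (\<lambda>x. (norm (?r k x * p x))\<^sup>2)"
        using mp[of "?r k"] rk[of k] by simp
      have i2: "integrable lborel (\<lambda>x. ?r k x * (?r k x * p x))"
        by (rule integrable_mult_L2) (use rk[of k] rp2 in auto)
      have i3: "integrable lborel (\<lambda>x. fn ?n x * real_deriv p x)"
        by (intro real_test_integrable real_test_mult fn dp)
      have i4: "integrable lborel (\<lambda>x. gn ?n x * p x)" by (intro real_test_integrable real_test_mult gn p)
      have i5: "integrable lborel (\<lambda>x. en ?n * p x)" using real_test_integrable[OF p] by simp
      have "indicator ?I x *\<^sub>R ((gn ?n x + en ?n - (fn ?n x + vn ?n x)\<^sup>2) * p x + real_deriv p x * vn ?n x)
          = (gn ?n x * p x + en ?n * p x) - ?r k x * (?r k x * p x) + (?r k x * real_deriv p x - fn ?n x * real_deriv p x)" for x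
      proof (cases "x \<in> ?I")
        case True
        then show ?thesis by (simp add: rnI_def power2_eq_square algebra_simps)
      next
        case False
        then show ?thesis using pz'[of x] by (simp add: rnI_def)
      qed
      then have "(LINT x:?I|lborel. (gn ?n x + en ?n - (fn ?n x + vn ?n x)\<^sup>2) * p x + real_deriv p x * vn ?n x)
          = (LINT x|lborel. (gn ?n x * p x + en ?n * p x) - ?r k x * (?r k x * p x) + (?r k x * real_deriv p x - fn ?n x * real_deriv p x))"
        unfolding set_lebesgue_integral_def by (simp only:)
      also have "\<dots> = ((LINT x|lborel. gn ?n x * p x) + en ?n * (LINT x|lborel. p x)) - (LINT x|lborel. ?r k x * (?r k x * p x))
          + ((LINT x|lborel. ?r k x * real_deriv p x) - (LINT x|lborel. fn ?n x * real_deriv p x))"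
        using i1 i2 i3 i4 i5
        by (simp only: Bochner_Integration.integral_add Bochner_Integration.integral_diff
            Bochner_Integration.integrable_add Bochner_Integration.integrable_diff integral_mult_right_zero)
      finally show ?thesis using z by linarith
    qed
    have "(\<lambda>k. - (LINT x|lborel. ?r k x * real_deriv p x) + (LINT x|lborel. ?r k x * (?r k x * p x)))
        \<longlonglongrightarrow> - (LINT x|lborel. rI L x * real_deriv p x) + (LINT x|lborel. rI L x * (rI L x * p x))"
      by (intro tendsto_intros t1 t2)
    moreover have "(\<lambda>k. - (LINT x|lborel. ?r k x * real_deriv p x) + (LINT x|lborel. ?r k x * (?r k x * p x)))
        \<longlonglongrightarrow> - (LINT x|lborel. f x * real_deriv p x) + (LINT x|lborel. g x * p x) + 0"
      unfolding key by (intro tendsto_add tendsto_minus t3 t4 t5)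
    ultimately have "- (LINT x|lborel. rI L x * real_deriv p x) + (LINT x|lborel. rI L x * (rI L x * p x))
        = - (LINT x|lborel. f x * real_deriv p x) + (LINT x|lborel. g x * p x)"
      using LIMSEQ_unique by fastforce
    moreover have "rI L x * real_deriv p x = r x * real_deriv p x" for x
      using pz'(2)[of x] by (cases "x \<in> {- L..L}") (auto simp: rI_def)
    moreover have "rI L x * (rI L x * p x) = (r x)\<^sup>2 * p x" for x
      using pz'(1)[of x] by (cases "x \<in> {- L..L}") (auto simp: rI_def power2_eq_square)
    ultimately show ?thesis by (simp only:)
  qed
  show thesis by (rule that[OF rm r2 weak])
qed

subsection \<open>The Fourier transform\<close>

lemma continuous_on_cis_mult: "continuous_on S (\<lambda>x. cis (c * x))"
  by (intro continuous_intros)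

lemma integrable_cis_mult:
  assumes \<phi>: "integrable lborel (\<phi> :: real \<Rightarrow> complex)"
  shows "integrable lborel (\<lambda>x. cis (- (x * \<xi>)) * \<phi> x)"
proof (rule Bochner_Integration.integrable_bound[OF \<phi>])
  have [measurable]: "\<phi> \<in> borel_measurable borel" using borel_measurable_integrable[OF \<phi>] by simp
  have "(\<lambda>x. cis (- \<xi> * x)) \<in> borel_measurable borel"
    by (intro borel_measurable_continuous_onI continuous_on_cis_mult)
  then have [measurable]: "(\<lambda>x. cis (- (x * \<xi>))) \<in> borel_measurable borel" by (simp add: mult.commute)
  show "(\<lambda>x. cis (- (x * \<xi>)) * \<phi> x) \<in> borel_measurable lborel" by measurable
qed (simp add: norm_mult)

lemma norm_fourier_le: "norm (fourier \<phi> \<xi>) \<le> (LINT x|lborel. norm (\<phi> x))"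
  unfolding fourier_def using integral_norm_bound[of lborel "\<lambda>x. cis (- (x * \<xi>)) * \<phi> x"] by (simp add: norm_mult)

lemma cis_pair_measurable [measurable]:
  "(\<lambda>z. cis (- (fst z * snd z))) \<in> borel_measurable (lborel \<Otimes>\<^sub>M lborel)"
proof -
  have [measurable]: "cis \<in> borel_measurable borel"
    by (intro borel_measurable_continuous_onI continuous_intros)
  show ?thesis by measurable
qed

lemma fourier_measurable:
  assumes \<phi>: "integrable lborel (\<phi> :: real \<Rightarrow> complex)"
  shows "fourier \<phi> \<in> borel_measurable borel"
proof -
  have [measurable]: "\<phi> \<in> borel_measurable borel" using borel_measurable_integrable[OF \<phi>] by simp
  have [measurable]: "cis \<in> borel_measurable borel"
    by (intro borel_measurable_continuous_onI continuous_intros)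
  have "(\<lambda>\<xi>. LINT x|lborel. cis (- (x * \<xi>)) * \<phi> x) \<in> borel_measurable lborel" by measurable
  then show ?thesis by (simp add: fourier_def[abs_def])
qed

lemma fourier_multiplication:
  assumes \<phi>: "integrable lborel (\<phi> :: real \<Rightarrow> complex)" and \<psi>: "integrable lborel (\<psi> :: real \<Rightarrow> complex)"
  shows "(LINT \<xi>|lborel. fourier \<phi> \<xi> * \<psi> \<xi>) = (LINT x|lborel. \<phi> x * fourier \<psi> x)"
proof -
  have [measurable]: "\<phi> \<in> borel_measurable borel" "\<psi> \<in> borel_measurable borel"
    using borel_measurable_integrable[OF \<phi>] borel_measurable_integrable[OF \<psi>] by simp_all
  let ?f = "\<lambda>x \<xi>. cis (- (x * \<xi>)) * \<phi> x * \<psi> \<xi>"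
  have "integrable (lborel \<Otimes>\<^sub>M lborel) (\<lambda>z. cis (- (fst z * snd z)) * \<phi> (fst z) * \<psi> (snd z))"
  proof (rule lborel_pair.Fubini_integrable)
    show "integrable lborel (\<lambda>x. LINT y|lborel. norm (cis (- (fst (x, y) * snd (x, y))) * \<phi> (fst (x, y)) * \<psi> (snd (x, y))))"
      using \<phi> by (simp add: norm_mult)
    have "integrable lborel (\<lambda>y. \<phi> x * (cis (- (y * x)) * \<psi> y))" for x
      by (intro integrable_mult_right integrable_cis_mult \<psi>)
    then show "AE x in lborel. integrable lborel (\<lambda>y. cis (- (fst (x, y) * snd (x, y))) * \<phi> (fst (x, y)) * \<psi> (snd (x, y)))"
      by (intro AE_I2) (simp add: mult_ac)
  qed measurable
  then have "integrable (lborel \<Otimes>\<^sub>M lborel) (case_prod ?f)" by (simp add: case_prod_beta')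
  then have "(LINT \<xi>|lborel. LINT x|lborel. ?f x \<xi>) = (LINT x|lborel. LINT \<xi>|lborel. ?f x \<xi>)"
    by (rule lborel_pair.Fubini_integral)
  moreover have "(LINT x|lborel. ?f x \<xi>) = fourier \<phi> \<xi> * \<psi> \<xi>" for \<xi>
    by (simp only: integral_mult_left_zero fourier_def)
  moreover have "(LINT \<xi>|lborel. ?f x \<xi>) = \<phi> x * fourier \<psi> x" for x
  proof -
    have "?f x \<xi> = \<phi> x * (cis (- (\<xi> * x)) * \<psi> \<xi>)" for \<xi> by (simp add: mult_ac)
    then show ?thesis by (simp only: integral_mult_right_zero fourier_def)
  qed
  ultimately show ?thesis by (simp only:)
qed

section \<open>Gaussian integrals and Fourier inversion\<close>

lemma gaussian:
  shows integrable_gaussian: "integrable lborel (\<lambda>z::real. exp (- z\<^sup>2 / 2))"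
    and integral_gaussian: "(LINT z::real|lborel. exp (- z\<^sup>2 / 2)) = sqrt (2 * pi)"
proof -
  have eq: "exp (- z\<^sup>2 / 2) = sqrt (2 * pi) * std_normal_density z" for z :: real
    by (simp add: std_normal_density_def)
  show "integrable lborel (\<lambda>z::real. exp (- z\<^sup>2 / 2))"
    unfolding eq using integrable_std_normal_moment[of 0] by simp
  show "(LINT z::real|lborel. exp (- z\<^sup>2 / 2)) = sqrt (2 * pi)"
    unfolding eq using integral_std_normal_moment_even[of 0] by simp
qed

text \<open>This is the characteristic function of the standard normal distribution, with the
  normalization of the density undone.\<close>

lemma integral_cis_gaussian:
  "(LINT z|lborel. cis (t * z) * of_real (exp (- z\<^sup>2 / 2))) = of_real (sqrt (2 * pi) * exp (- t\<^sup>2 / 2))"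
proof -
  have "char std_normal_distribution t = (LINT z|lborel. std_normal_density z *\<^sub>R iexp (t * z))"
    unfolding char_def by (subst integral_density) (auto simp: normal_density_nonneg)
  then have c: "(LINT z|lborel. std_normal_density z *\<^sub>R iexp (t * z)) = of_real (exp (- t\<^sup>2 / 2))"
    by (simp add: char_std_normal_distribution)
  have "cis (t * z) * of_real (exp (- z\<^sup>2 / 2)) = of_real (sqrt (2 * pi)) * (std_normal_density z *\<^sub>R iexp (t * z))" for z
    by (simp add: std_normal_density_def cis_conv_exp scaleR_conv_of_real mult_ac)
  then have "(LINT z|lborel. cis (t * z) * of_real (exp (- z\<^sup>2 / 2)))
      = of_real (sqrt (2 * pi)) * (LINT z|lborel. std_normal_density z *\<^sub>R iexp (t * z))"
    by (simp only: integral_mult_right_zero)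
  then show ?thesis by (simp only: c) (simp only: of_real_mult)
qed

lemma integrable_scaled_gaussian:
  assumes "\<epsilon> > 0"
  shows "integrable lborel (\<lambda>\<xi>. cis (- (y * \<xi>)) * complex_of_real (exp (- (\<epsilon> * \<xi>)\<^sup>2 / 2)))"
proof -
  have "integrable lborel (\<lambda>\<xi>. exp (- (0 + \<epsilon> * \<xi>)\<^sup>2 / 2))"
    by (rule lborel_integrable_real_affine[OF integrable_gaussian]) (use assms in simp)
  then have "integrable lborel (\<lambda>\<xi>. complex_of_real (exp (- (\<epsilon> * \<xi>)\<^sup>2 / 2)))"
    by (intro integrable_of_real) simp
  from integrable_cis_mult[OF this, of y] show ?thesis by (simp add: mult.commute)
qed

lemma fourier_gaussian:
  assumes "\<epsilon> > 0"
  shows "fourier (\<lambda>\<xi>. cis (- (y * \<xi>)) * of_real (exp (- (\<epsilon> * \<xi>)\<^sup>2 / 2))) x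
    = of_real (sqrt (2 * pi) / \<epsilon> * exp (- ((x + y) / \<epsilon>)\<^sup>2 / 2))"
proof -
  let ?T = "- ((x + y) / \<epsilon>)"
  let ?f = "\<lambda>z. cis (?T * z) * complex_of_real (exp (- z\<^sup>2 / 2))"
  have "(LINT z|lborel. ?f z) = \<bar>\<epsilon>\<bar> *\<^sub>R (LINT \<xi>|lborel. ?f (0 + \<epsilon> * \<xi>))"
    by (rule lborel_integral_real_affine) (use assms in simp)
  moreover have "?f (0 + \<epsilon> * \<xi>) = cis (- (\<xi> * x)) * (cis (- (y * \<xi>)) * of_real (exp (- (\<epsilon> * \<xi>)\<^sup>2 / 2)))" for \<xi>
  proof -
    have 1: "?T * (0 + \<epsilon> * \<xi>) = - (\<xi> * x) + - (y * \<xi>)"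
      using assms by (simp add: divide_simps) (simp add: algebra_simps)
    show ?thesis unfolding 1 cis_mult[symmetric] mult.assoc by simp
  qed
  ultimately have "(LINT z|lborel. ?f z) = of_real \<epsilon> * fourier (\<lambda>\<xi>. cis (- (y * \<xi>)) * of_real (exp (- (\<epsilon> * \<xi>)\<^sup>2 / 2))) x"
    using assms by (simp only: fourier_def) (simp add: scaleR_conv_of_real)
  then show ?thesis
    using assms unfolding integral_cis_gaussian by (simp add: field_simps)
qed

text \<open>Gaussian summation: the double integral is not absolutely convergent, so a factor
  \<open>exp (- (\<epsilon> \<xi>)\<^sup>2 / 2)\<close> is inserted. The multiplication formula
  moves the transform onto the Gaussian, whose transform is an approximate identity at
  \<open>- y\<close>. As \<open>\<epsilon>\<close> tends to 0, one side converges because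
  \<open>fourier \<phi>\<close> is integrable, the other because \<open>\<phi>\<close> is bounded
  and continuous.\<close>

lemma fourier_inversion:
  fixes \<phi> :: "real \<Rightarrow> complex"
  assumes \<phi>: "integrable lborel \<phi>" and cont: "continuous_on UNIV \<phi>" and B: "\<And>x. norm (\<phi> x) \<le> B"
    and F: "integrable lborel (fourier \<phi>)"
  shows "fourier (fourier \<phi>) y = of_real (2 * pi) * \<phi> (- y)"
proof -
  have [measurable]: "\<phi> \<in> borel_measurable borel" "fourier \<phi> \<in> borel_measurable borel"
    using borel_measurable_integrable[OF \<phi>] borel_measurable_integrable[OF F] by simp_all
  define \<epsilon> where "\<epsilon> = (\<lambda>n. 1 / real (Suc n))"
  have \<epsilon>: "\<epsilon> n > 0" for n by (simp add: \<epsilon>_def)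
  have \<epsilon>0: "\<epsilon> \<longlonglongrightarrow> 0" unfolding \<epsilon>_def by real_asymp
  define g where "g = (\<lambda>n \<xi>. cis (- (y * \<xi>)) * complex_of_real (exp (- (\<epsilon> n * \<xi>)\<^sup>2 / 2)))"
  have gi: "integrable lborel (g n)" for n unfolding g_def by (rule integrable_scaled_gaussian[OF \<epsilon>])
  note [measurable] = borel_measurable_integrable[OF gi]
  have cism: "(\<lambda>\<xi>. cis (- (\<xi> * y)) * fourier \<phi> \<xi>) \<in> borel_measurable lborel"
    using borel_measurable_integrable[OF integrable_cis_mult[OF F]] .
  have "(\<lambda>n. LINT \<xi>|lborel. fourier \<phi> \<xi> * g n \<xi>) \<longlonglongrightarrow> (LINT \<xi>|lborel. cis (- (\<xi> * y)) * fourier \<phi> \<xi>)"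
  proof (rule integral_dominated_convergence[OF cism _ integrable_norm[OF F]])
    have "(\<lambda>n. fourier \<phi> \<xi> * g n \<xi>) \<longlonglongrightarrow> fourier \<phi> \<xi> * (cis (- (y * \<xi>)) * of_real (exp (- (0 * \<xi>)\<^sup>2 / 2)))" for \<xi>
      unfolding g_def by (intro tendsto_intros \<epsilon>0) simp_all
    then show "AE \<xi> in lborel. (\<lambda>n. fourier \<phi> \<xi> * g n \<xi>) \<longlonglongrightarrow> cis (- (\<xi> * y)) * fourier \<phi> \<xi>"
      by (intro AE_I2) (simp add: mult.commute)
    show "AE \<xi> in lborel. norm (fourier \<phi> \<xi> * g n \<xi>) \<le> norm (fourier \<phi> \<xi>)" for n
      by (intro AE_I2) (simp add: g_def norm_mult mult_left_le)
  qed measurable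
  then have L: "(\<lambda>n. LINT \<xi>|lborel. fourier \<phi> \<xi> * g n \<xi>) \<longlonglongrightarrow> fourier (fourier \<phi>) y"
    by (simp only: fourier_def[of "fourier \<phi>"])
  \<comment> \<open>Rescaling around \<open>- y\<close> freezes the Gaussian and puts all dependence
    on \<open>n\<close> into the argument of \<open>\<phi>\<close>.\<close>
  have eq: "(LINT \<xi>|lborel. fourier \<phi> \<xi> * g n \<xi>)
      = (LINT z|lborel. \<phi> (- y + \<epsilon> n * z) * of_real (sqrt (2 * pi) * exp (- z\<^sup>2 / 2)))" for n
  proof -
    let ?h = "\<lambda>x. \<phi> x * complex_of_real (sqrt (2 * pi) / \<epsilon> n * exp (- ((x + y) / \<epsilon> n)\<^sup>2 / 2))"
    have "(LINT \<xi>|lborel. fourier \<phi> \<xi> * g n \<xi>) = (LINT x|lborel. ?h x)"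
      by (subst fourier_multiplication[OF \<phi> gi]) (simp only: g_def fourier_gaussian[OF \<epsilon>])
    also have "\<dots> = \<bar>\<epsilon> n\<bar> *\<^sub>R (LINT z|lborel. ?h (- y + \<epsilon> n * z))"
      by (rule lborel_integral_real_affine) (use \<epsilon>[of n] in simp)
    also have "\<dots> = (LINT z|lborel. \<bar>\<epsilon> n\<bar> *\<^sub>R ?h (- y + \<epsilon> n * z))" by simp
    also have "\<dots> = (LINT z|lborel. \<phi> (- y + \<epsilon> n * z) * of_real (sqrt (2 * pi) * exp (- z\<^sup>2 / 2)))"
      using \<epsilon>[of n] by (intro Bochner_Integration.integral_cong) (auto simp: scaleR_conv_of_real)
    finally show ?thesis .
  qed
  have wI: "integrable lborel (\<lambda>z::real. B * (sqrt (2 * pi) * exp (- z\<^sup>2 / 2)))"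
    by (intro integrable_mult_right integrable_gaussian)
  have R: "(\<lambda>n. LINT z|lborel. \<phi> (- y + \<epsilon> n * z) * of_real (sqrt (2 * pi) * exp (- z\<^sup>2 / 2)))
      \<longlonglongrightarrow> (LINT z|lborel. \<phi> (- y) * of_real (sqrt (2 * pi) * exp (- z\<^sup>2 / 2)))"
  proof (rule integral_dominated_convergence[OF _ _ wI])
    have "(\<lambda>n. \<phi> (- y + \<epsilon> n * z)) \<longlonglongrightarrow> \<phi> (- y)" for z
    proof -
      have "isCont \<phi> (- y)" using cont by (simp add: continuous_on_eq_continuous_at)
      moreover have "(\<lambda>n. - y + \<epsilon> n * z) \<longlonglongrightarrow> - y + 0 * z" by (intro tendsto_intros \<epsilon>0)
      then have "(\<lambda>n. - y + \<epsilon> n * z) \<longlonglongrightarrow> - y" by simp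
      ultimately show ?thesis by (rule isCont_tendsto_compose)
    qed
    then show "AE z in lborel. (\<lambda>n. \<phi> (- y + \<epsilon> n * z) * of_real (sqrt (2 * pi) * exp (- z\<^sup>2 / 2)))
        \<longlonglongrightarrow> \<phi> (- y) * of_real (sqrt (2 * pi) * exp (- z\<^sup>2 / 2))"
      by (intro AE_I2 tendsto_mult_right)
    have "norm (\<phi> (- y + \<epsilon> n * z) * complex_of_real (sqrt (2 * pi) * exp (- z\<^sup>2 / 2)))
        \<le> B * (sqrt (2 * pi) * exp (- z\<^sup>2 / 2))" for n z
      unfolding norm_mult norm_of_real using B by (intro mult_mono) (auto intro: order_trans[OF norm_ge_zero B])
    then show "AE z in lborel. norm (\<phi> (- y + \<epsilon> n * z) * complex_of_real (sqrt (2 * pi) * exp (- z\<^sup>2 / 2)))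
        \<le> B * (sqrt (2 * pi) * exp (- z\<^sup>2 / 2))" for n by simp
  qed measurable
  have val: "(LINT z|lborel. \<phi> (- y) * complex_of_real (sqrt (2 * pi) * exp (- z\<^sup>2 / 2))) = of_real (2 * pi) * \<phi> (- y)"
  proof -
    have "(LINT z|lborel. \<phi> (- y) * complex_of_real (sqrt (2 * pi) * exp (- z\<^sup>2 / 2)))
        = \<phi> (- y) * of_real (LINT z|lborel. sqrt (2 * pi) * exp (- z\<^sup>2 / 2))"
      by (simp only: integral_mult_right_zero integral_complex_of_real)
    also have "(LINT z::real|lborel. sqrt (2 * pi) * exp (- z\<^sup>2 / 2)) = 2 * pi"
      by (simp only: integral_mult_right_zero integral_gaussian) simp
    finally show ?thesis by (simp add: mult.commute)
  qed
  have "(\<lambda>n. LINT \<xi>|lborel. fourier \<phi> \<xi> * g n \<xi>) \<longlonglongrightarrow> of_real (2 * pi) * \<phi> (- y)"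
    using R unfolding eq val .
  then show ?thesis using L LIMSEQ_unique by blast
qed

text \<open>The hypotheses of the inversion theorem. Besides Schwartz functions, they are easily
  checked for conjugates and for Schwartz functions times a character, which is how Plancherel and
  the convolution formula are obtained.\<close>

definition fourier_invertible :: "(real \<Rightarrow> complex) \<Rightarrow> bool" where
  "fourier_invertible \<phi> \<longleftrightarrow> continuous_on UNIV \<phi> \<and> (\<exists>B. \<forall>x. norm (\<phi> x) \<le> B) \<and> integrable lborel \<phi>
    \<and> integrable lborel (fourier \<phi>)"

lemma integral_uminus: "(LINT x|lborel. h (- x)) = (LINT x|lborel. (h x :: complex))" for h :: "real \<Rightarrow> complex"
  using lborel_integral_real_affine[of "-1" h 0] by simp

lemma integrable_uminus: "integrable lborel h \<Longrightarrow> integrable lborel (\<lambda>x. h (- x :: real))" for h :: "real \<Rightarrow> complex"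
  using lborel_integrable_real_affine[of h "-1" 0] by simp

lemma fourier_cnj: "fourier (\<lambda>x. cnj (\<phi> x)) \<xi> = cnj (fourier \<phi> (- \<xi>))"
proof -
  have "cis (- (x * \<xi>)) * cnj (\<phi> x) = cnj (cis (- (x * - \<xi>)) * \<phi> x)" for x by (simp add: cis_cnj)
  then show ?thesis by (simp only: fourier_def Bochner_Integration.integral_cnj)
qed

text \<open>By inversion, the reflected transform of \<open>\<psi>\<close> is a function whose own
  transform is \<open>2 \<pi> \<psi>\<close>, so this is the multiplication formula. Stated without
  conjugation it yields Plancherel for \<open>\<psi> = cnj \<phi>\<close> and the convolution
  formula for a modulated \<open>\<psi>\<close>.\<close>

lemma parseval:
  assumes \<phi>: "integrable lborel \<phi>" and \<psi>: "fourier_invertible \<psi>"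
  shows "(LINT \<eta>|lborel. fourier \<phi> \<eta> * fourier \<psi> (- \<eta>)) = of_real (2 * pi) * (LINT x|lborel. \<phi> x * \<psi> x)"
proof -
  have \<psi>': "integrable lborel (fourier \<psi>)" using \<psi> by (simp add: fourier_invertible_def)
  have "fourier (\<lambda>\<eta>. fourier \<psi> (- \<eta>)) x = of_real (2 * pi) * \<psi> x" for x
  proof -
    have "fourier (\<lambda>\<eta>. fourier \<psi> (- \<eta>)) x = (LINT \<eta>|lborel. cis (- (- \<eta> * - x)) * fourier \<psi> (- \<eta>))"
      by (simp only: fourier_def[of "\<lambda>\<eta>. fourier \<psi> (- \<eta>)"] minus_mult_minus)
    also have "\<dots> = (LINT \<eta>|lborel. cis (- (\<eta> * - x)) * fourier \<psi> \<eta>)"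
      by (rule integral_uminus)
    also have "\<dots> = fourier (fourier \<psi>) (- x)"
      by (simp only: fourier_def[of "fourier \<psi>"])
    also have "\<dots> = of_real (2 * pi) * \<psi> x"
      using \<psi> fourier_inversion[of \<psi> _ "- x"] by (auto simp: fourier_invertible_def)
    finally show ?thesis .
  qed
  then have "(LINT \<eta>|lborel. fourier \<phi> \<eta> * fourier \<psi> (- \<eta>)) = (LINT x|lborel. of_real (2 * pi) * (\<phi> x * \<psi> x))"
    by (simp only: fourier_multiplication[OF \<phi> integrable_uminus[OF \<psi>']] mult.left_commute)
  then show ?thesis by (simp only: integral_mult_right_zero)
qed

lemma plancherel:
  assumes \<phi>: "fourier_invertible \<phi>"
  shows "(LINT \<eta>|lborel. (norm (fourier \<phi> \<eta>))\<^sup>2) = 2 * pi * (LINT x|lborel. (norm (\<phi> x))\<^sup>2)"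
proof -
  have i: "integrable lborel \<phi>" using \<phi> by (simp add: fourier_invertible_def)
  have "fourier_invertible (\<lambda>x. cnj (\<phi> x))"
  proof -
    have "fourier (\<lambda>x. cnj (\<phi> x)) = (\<lambda>\<xi>. cnj (fourier \<phi> (- \<xi>)))" by (rule ext) (rule fourier_cnj)
    moreover have "integrable lborel (\<lambda>\<xi>. cnj (fourier \<phi> (- \<xi>)))"
      using \<phi> integrable_uminus[of "fourier \<phi>"] by (simp add: fourier_invertible_def)
    moreover have "continuous_on UNIV (\<lambda>x. cnj (\<phi> x))" "\<exists>B. \<forall>x. norm (cnj (\<phi> x)) \<le> B" "integrable lborel (\<lambda>x. cnj (\<phi> x))"
      using \<phi> by (simp_all add: fourier_invertible_def continuous_on_cnj)
    ultimately show ?thesis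
      unfolding fourier_invertible_def by (simp only: simp_thms)
  qed
  from parseval[OF i this]
  have "(LINT \<eta>|lborel. fourier \<phi> \<eta> * cnj (fourier \<phi> \<eta>)) = of_real (2 * pi) * (LINT x|lborel. \<phi> x * cnj (\<phi> x))"
    by (simp add: fourier_cnj)
  then have "complex_of_real (LINT \<eta>|lborel. (norm (fourier \<phi> \<eta>))\<^sup>2) = complex_of_real (2 * pi * (LINT x|lborel. (norm (\<phi> x))\<^sup>2))"
    by (simp add: complex_norm_square[symmetric] del: of_real_power)
  then show ?thesis by (simp only: of_real_eq_iff)
qed

subsection \<open>Schwartz functions\<close>

lemma schwartz_smooth: "\<phi> \<in> schwartz_functions \<Longrightarrow> smooth \<phi>"
  by (simp add: schwartz_functions_def)

lemma one_plus_power_le: "(1 + t) ^ k \<le> 2 ^ k * (1 + t ^ k)" if "0 \<le> t" for t :: real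
proof -
  have "(1 + t) ^ k \<le> (2 * max 1 t) ^ k" using that by (intro power_mono) auto
  also have "\<dots> = 2 ^ k * max 1 t ^ k" by (simp add: power_mult_distrib)
  also have "\<dots> \<le> 2 ^ k * (1 + t ^ k)" using that by (intro mult_left_mono) (auto simp: max_def)
  finally show ?thesis .
qed

lemma schwartz_bound:
  assumes "\<phi> \<in> schwartz_functions"
  shows "\<exists>C. \<forall>x. (1 + \<bar>x\<bar>) ^ k * norm (nderiv n \<phi> x) \<le> C"
proof -
  obtain C0 where C0: "\<And>x. \<bar>x\<bar> ^ 0 * norm (nderiv n \<phi> x) \<le> C0"
    using assms unfolding schwartz_functions_def by blast
  obtain Ck where Ck: "\<And>x. \<bar>x\<bar> ^ k * norm (nderiv n \<phi> x) \<le> Ck"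
    using assms unfolding schwartz_functions_def by blast
  have "(1 + \<bar>x\<bar>) ^ k * norm (nderiv n \<phi> x) \<le> 2 ^ k * (C0 + Ck)" for x
  proof -
    have "(1 + \<bar>x\<bar>) ^ k * norm (nderiv n \<phi> x) \<le> (2 ^ k * (1 + \<bar>x\<bar> ^ k)) * norm (nderiv n \<phi> x)"
      by (intro mult_right_mono one_plus_power_le) auto
    also have "\<dots> = 2 ^ k * (\<bar>x\<bar> ^ 0 * norm (nderiv n \<phi> x) + \<bar>x\<bar> ^ k * norm (nderiv n \<phi> x))"
      by (simp add: algebra_simps)
    also have "\<dots> \<le> 2 ^ k * (C0 + Ck)" by (intro mult_left_mono add_mono C0 Ck) auto
    finally show ?thesis .
  qed
  then show ?thesis by blast
qed

lemma schwartzI: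
  assumes "smooth \<phi>" "\<And>k n. \<exists>C. \<forall>x. (1 + \<bar>x\<bar>) ^ k * norm (nderiv n \<phi> x) \<le> C"
  shows "\<phi> \<in> schwartz_functions"
  unfolding schwartz_functions_def
proof (intro CollectI conjI allI assms(1))
  fix k n
  obtain C where C: "\<forall>x. (1 + \<bar>x\<bar>) ^ k * norm (nderiv n \<phi> x) \<le> C" using assms(2) by blast
  have "\<bar>x\<bar> ^ k * norm (nderiv n \<phi> x) \<le> C" for x
  proof -
    have "\<bar>x\<bar> ^ k * norm (nderiv n \<phi> x) \<le> (1 + \<bar>x\<bar>) ^ k * norm (nderiv n \<phi> x)"
      by (intro mult_right_mono power_mono) auto
    then show ?thesis using C by (meson order_trans)
  qed
  then show "\<exists>C. \<forall>x. \<bar>x\<bar> ^ k * norm (nderiv n \<phi> x) \<le> C" by blast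
qed

text \<open>The bound must be linear in \<open>a\<close> with a constant \<open>K\<close> common to
  all \<open>g\<close>: for the multipliers 1 minus a cutoff, whose size \<open>a\<close> tends to
  0, it then gives convergence in every seminorm. One spare power of
  \<open>1 + \<bar>x\<bar>\<close> in the decay of \<open>\<phi>\<close> absorbs the linear growth
  of \<open>g\<close>.\<close>

lemma nderiv_mult_growth:
  assumes f: "smooth f" and \<phi>: "\<phi> \<in> schwartz_functions"
    and A: "\<And>i x. norm (nderiv i f x) \<le> A i * (1 + \<bar>x\<bar>)"
  shows "\<exists>K. \<forall>a\<ge>0. \<forall>g. smooth g \<longrightarrow> (\<forall>i x. norm (nderiv i g x) \<le> a * (A i * (1 + \<bar>x\<bar>))) \<longrightarrow>
    (\<forall>x. (1 + \<bar>x\<bar>) ^ k * norm (nderiv n (\<lambda>x. g x * \<phi> x) x) \<le> a * K)"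
proof -
  have "\<forall>j. \<exists>C. \<forall>x. (1 + \<bar>x\<bar>) ^ (Suc k) * norm (nderiv j \<phi> x) \<le> C" using schwartz_bound[OF \<phi>] by blast
  then obtain C where C: "\<And>j x. (1 + \<bar>x\<bar>) ^ (Suc k) * norm (nderiv j \<phi> x) \<le> C j" by (auto dest!: choice)
  have A0: "0 \<le> A i" for i
    using order_trans[OF norm_ge_zero A[of i 0]] by simp
  let ?K = "2 ^ n * (\<Sum>i\<le>n. A i) * (\<Sum>j\<le>n. C j)"
  have "(1 + \<bar>x\<bar>) ^ k * norm (nderiv n (\<lambda>x. g x * \<phi> x) x) \<le> a * ?K"
    if a: "a \<ge> 0" and g: "smooth g" "\<forall>i x. norm (nderiv i g x) \<le> a * (A i * (1 + \<bar>x\<bar>))" for a g x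
  proof -
    have "norm (nderiv n (\<lambda>x. g x * \<phi> x) x) \<le> 2 ^ n * (\<Sum>i\<le>n. norm (nderiv i g x)) * (\<Sum>j\<le>n. norm (nderiv j \<phi> x))"
      by (rule norm_nderiv_mult_le[OF g(1) schwartz_smooth[OF \<phi>]])
    also have "\<dots> \<le> 2 ^ n * (\<Sum>i\<le>n. a * (A i * (1 + \<bar>x\<bar>))) * (\<Sum>j\<le>n. norm (nderiv j \<phi> x))"
      using g(2) by (intro mult_right_mono mult_left_mono sum_mono) (auto intro: sum_nonneg)
    also have "(\<Sum>i\<le>n. a * (A i * (1 + \<bar>x\<bar>))) = a * ((\<Sum>i\<le>n. A i) * (1 + \<bar>x\<bar>))"
      by (simp add: sum_distrib_left sum_distrib_right)
    finally have "(1 + \<bar>x\<bar>) ^ k * norm (nderiv n (\<lambda>x. g x * \<phi> x) x)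
        \<le> (1 + \<bar>x\<bar>) ^ k * (2 ^ n * (a * ((\<Sum>i\<le>n. A i) * (1 + \<bar>x\<bar>))) * (\<Sum>j\<le>n. norm (nderiv j \<phi> x)))"
      by (intro mult_left_mono) auto
    also have "\<dots> = a * (2 ^ n * (\<Sum>i\<le>n. A i) * (\<Sum>j\<le>n. (1 + \<bar>x\<bar>) ^ (Suc k) * norm (nderiv j \<phi> x)))"
    proof -
      have e: "(\<Sum>j\<le>n. (1 + \<bar>x\<bar>) ^ (Suc k) * norm (nderiv j \<phi> x)) = (1 + \<bar>x\<bar>) ^ (Suc k) * (\<Sum>j\<le>n. norm (nderiv j \<phi> x))"
        by (simp only: sum_distrib_left)
      show ?thesis unfolding e by (simp only: power_Suc mult_ac)
    qed
    also have "\<dots> \<le> a * ?K"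
      using a A0 by (intro mult_left_mono sum_mono C) (auto intro!: sum_nonneg mult_nonneg_nonneg)
    finally show ?thesis .
  qed
  then show ?thesis by (intro exI[of _ ?K]) blast
qed

lemma schwartz_mult_growth:
  assumes f: "smooth f" and A: "\<And>i x. norm (nderiv i f x) \<le> A i * (1 + \<bar>x\<bar>)"
    and \<phi>: "\<phi> \<in> schwartz_functions"
  shows "(\<lambda>x. f x * \<phi> x) \<in> schwartz_functions"
proof (rule schwartzI)
  show "smooth (\<lambda>x. f x * \<phi> x)" by (intro smooth_mult f schwartz_smooth \<phi>)
  fix k n
  obtain K where K: "\<forall>a\<ge>0. \<forall>g. smooth g \<longrightarrow> (\<forall>i x. norm (nderiv i g x) \<le> a * (A i * (1 + \<bar>x\<bar>))) \<longrightarrow>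
      (\<forall>x. (1 + \<bar>x\<bar>) ^ k * norm (nderiv n (\<lambda>x. g x * \<phi> x) x) \<le> a * K)"
    using nderiv_mult_growth[OF f \<phi> A] by blast
  have "\<forall>x. (1 + \<bar>x\<bar>) ^ k * norm (nderiv n (\<lambda>x. f x * \<phi> x) x) \<le> 1 * K"
    using K[rule_format, of 1 f] f A by simp
  then show "\<exists>C. \<forall>x. (1 + \<bar>x\<bar>) ^ k * norm (nderiv n (\<lambda>x. f x * \<phi> x) x) \<le> C" by blast
qed

lemma nderiv_const: "nderiv n (\<lambda>x. c) = (\<lambda>x. if n = 0 then c else 0)"
proof (induction n)
  case (Suc n)
  have "vector_derivative (\<lambda>x. if n = 0 then c else 0) (at x) = 0" for x :: real by simp
  then show ?case by (simp add: nderiv_Suc Suc)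
qed simp

lemma schwartz_cmult: "\<phi> \<in> schwartz_functions \<Longrightarrow> (\<lambda>x. c * \<phi> x) \<in> schwartz_functions"
  by (rule schwartz_mult_growth[where A = "\<lambda>i. norm c", OF smooth_const])
    (auto simp: nderiv_const mult_le_cancel_left1 intro!: mult_nonneg_nonneg)

lemma schwartz_mult_x: "\<phi> \<in> schwartz_functions \<Longrightarrow> (\<lambda>x. of_real x * \<phi> x) \<in> schwartz_functions"
proof (rule schwartz_mult_growth[where A = "\<lambda>i. 1", OF smooth_of_real])
  fix i and x :: real
  show "norm (nderiv i complex_of_real x) \<le> 1 * (1 + \<bar>x\<bar>)"
  proof (cases i)
    case (Suc j)
    have "nderiv i complex_of_real = (\<lambda>x. if j = 0 then 1 else 0)"
      unfolding Suc nderiv_Suc'[of j] nderiv_of_real_ident nderiv_const ..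
    then show ?thesis by simp
  qed simp
qed

lemma schwartz_nderiv:
  assumes \<phi>: "\<phi> \<in> schwartz_functions"
  shows "nderiv m \<phi> \<in> schwartz_functions"
  using assms unfolding schwartz_functions_def by (auto simp: smooth_nderiv nderiv_nderiv)

lemma schwartz_add:
  assumes "\<phi> \<in> schwartz_functions" "\<psi> \<in> schwartz_functions"
  shows "(\<lambda>x. \<phi> x + \<psi> x) \<in> schwartz_functions"
proof (rule schwartzI)
  show "smooth (\<lambda>x. \<phi> x + \<psi> x)" by (intro smooth_add schwartz_smooth assms)
  fix k n
  obtain C where C: "\<forall>x. (1 + \<bar>x\<bar>) ^ k * norm (nderiv n \<phi> x) \<le> C" using schwartz_bound[OF assms(1)] by blast
  obtain D where D: "\<forall>x. (1 + \<bar>x\<bar>) ^ k * norm (nderiv n \<psi> x) \<le> D" using schwartz_bound[OF assms(2)] by blast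
  have "(1 + \<bar>x\<bar>) ^ k * norm (nderiv n (\<lambda>x. \<phi> x + \<psi> x) x) \<le> C + D" for x
  proof -
    have "(1 + \<bar>x\<bar>) ^ k * norm (nderiv n (\<lambda>x. \<phi> x + \<psi> x) x)
        \<le> (1 + \<bar>x\<bar>) ^ k * (norm (nderiv n \<phi> x) + norm (nderiv n \<psi> x))"
      unfolding nderiv_add[OF schwartz_smooth[OF assms(1)] schwartz_smooth[OF assms(2)]]
      by (intro mult_left_mono norm_triangle_ineq) auto
    also have "\<dots> = (1 + \<bar>x\<bar>) ^ k * norm (nderiv n \<phi> x) + (1 + \<bar>x\<bar>) ^ k * norm (nderiv n \<psi> x)"
      by (rule distrib_left)
    also have "\<dots> \<le> C + D" using C D by (intro add_mono) blast+
    finally show ?thesis .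
  qed
  then show "\<exists>C. \<forall>x. (1 + \<bar>x\<bar>) ^ k * norm (nderiv n (\<lambda>x. \<phi> x + \<psi> x) x) \<le> C" by blast
qed

section \<open>Seminorms and pairings with functions\<close>

definition schwartz_seminorm :: "nat \<Rightarrow> (real \<Rightarrow> complex) \<Rightarrow> real" where
  "schwartz_seminorm N \<phi> = (\<Sum>k\<le>N. \<Sum>n\<le>N. SUP x. \<bar>x\<bar> ^ k * norm (nderiv n \<phi> x))"

lemma schwartz_SUP:
  assumes "\<phi> \<in> schwartz_functions"
  shows "\<bar>x\<bar> ^ k * norm (nderiv n \<phi> x) \<le> (SUP x. \<bar>x\<bar> ^ k * norm (nderiv n \<phi> x))"
    and "0 \<le> (SUP x. \<bar>x\<bar> ^ k * norm (nderiv n \<phi> x))"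
proof -
  obtain C where "\<forall>x. \<bar>x\<bar> ^ k * norm (nderiv n \<phi> x) \<le> C"
    using assms unfolding schwartz_functions_def by blast
  then have "bdd_above (range (\<lambda>x. \<bar>x\<bar> ^ k * norm (nderiv n \<phi> x)))" by (intro bdd_aboveI) auto
  then show 1: "\<bar>x\<bar> ^ k * norm (nderiv n \<phi> x) \<le> (SUP x. \<bar>x\<bar> ^ k * norm (nderiv n \<phi> x))" for x
    by (rule cSUP_upper[OF UNIV_I])
  show "0 \<le> (SUP x. \<bar>x\<bar> ^ k * norm (nderiv n \<phi> x))"
    by (rule order_trans[OF _ 1[of 0]]) simp
qed

lemma schwartz_seminorm_ge:
  assumes \<phi>: "\<phi> \<in> schwartz_functions" and "n \<le> 2"
  shows "(1 + x\<^sup>2) * norm (nderiv n \<phi> x) \<le> schwartz_seminorm 2 \<phi>"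
proof -
  let ?S = "\<lambda>k n. SUP x. \<bar>x\<bar> ^ k * norm (nderiv n \<phi> x)"
  have "(1 + x\<^sup>2) * norm (nderiv n \<phi> x) = \<bar>x\<bar> ^ 0 * norm (nderiv n \<phi> x) + \<bar>x\<bar> ^ 2 * norm (nderiv n \<phi> x)"
    by (simp add: algebra_simps)
  also have "\<dots> \<le> ?S 0 n + ?S 2 n" by (intro add_mono schwartz_SUP \<phi>)
  also have "\<dots> = (\<Sum>k\<in>{0, 2}. ?S k n)" by simp
  also have "\<dots> \<le> (\<Sum>k\<le>2. ?S k n)" by (intro sum_mono2) (auto intro: schwartz_SUP \<phi>)
  also have "\<dots> \<le> (\<Sum>k\<le>2. \<Sum>n\<le>2. ?S k n)"
    using \<open>n \<le> 2\<close> by (intro sum_mono member_le_sum) (auto intro: schwartz_SUP \<phi>)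
  finally show ?thesis by (simp add: schwartz_seminorm_def)
qed

lemma integrable_inverse_1_plus_sq: "integrable lborel (\<lambda>x::real. 1 / (1 + x\<^sup>2))"
  using integrable_inverse_1_plus_square
  by (simp add: set_integrable_def einterval_def inverse_eq_divide)

text \<open>The weight \<open>1 / (1 + x\<^sup>2)\<close> covers \<open>L\<^sup>1\<close> and
  \<open>L\<^sup>2\<close> functions at once, so \<open>r\<close> and \<open>r\<^sup>2\<close> are
  treated alike; the decay of the test function pays for it within a single seminorm.\<close>

lemma schwartz_pairing:
  fixes h :: "real \<Rightarrow> complex"
  assumes [measurable]: "h \<in> borel_measurable borel" and h: "integrable lborel (\<lambda>x. norm (h x) / (1 + x\<^sup>2))"
    and \<phi>: "\<phi> \<in> schwartz_functions" and n: "n \<le> 2"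
  shows "integrable lborel (\<lambda>x. h x * nderiv n \<phi> x)"
    and "norm (LINT x|lborel. h x * nderiv n \<phi> x) \<le> (LINT x|lborel. norm (h x) / (1 + x\<^sup>2)) * schwartz_seminorm 2 \<phi>"
proof -
  have [measurable]: "nderiv n \<phi> \<in> borel_measurable borel"
    by (intro smooth_measurable smooth_nderiv schwartz_smooth \<phi>)
  have le: "norm (h x * nderiv n \<phi> x) \<le> norm (h x) / (1 + x\<^sup>2) * schwartz_seminorm 2 \<phi>" for x
  proof -
    have p: "0 < 1 + x\<^sup>2" by (simp add: add_pos_nonneg)
    have "norm (nderiv n \<phi> x) \<le> schwartz_seminorm 2 \<phi> / (1 + x\<^sup>2)"
      using schwartz_seminorm_ge[OF \<phi> n, of x] p by (simp add: pos_le_divide_eq mult.commute)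
    then have "norm (h x) * norm (nderiv n \<phi> x) \<le> norm (h x) * (schwartz_seminorm 2 \<phi> / (1 + x\<^sup>2))"
      by (intro mult_left_mono) auto
    then show ?thesis by (simp add: norm_mult)
  qed
  have i: "integrable lborel (\<lambda>x. norm (h x) / (1 + x\<^sup>2) * schwartz_seminorm 2 \<phi>)" using h by (rule integrable_mult_left)
  show i': "integrable lborel (\<lambda>x. h x * nderiv n \<phi> x)"
    by (rule integrable_bound_le[OF i _ le]) measurable
  have "norm (LINT x|lborel. h x * nderiv n \<phi> x) \<le> (LINT x|lborel. norm (h x * nderiv n \<phi> x))" by (rule integral_norm_bound)
  also have "\<dots> \<le> (LINT x|lborel. norm (h x) / (1 + x\<^sup>2) * schwartz_seminorm 2 \<phi>)"
    by (rule integral_mono[OF integrable_norm[OF i'] i le])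
  also have "\<dots> = (LINT x|lborel. norm (h x) / (1 + x\<^sup>2)) * schwartz_seminorm 2 \<phi>" by (rule integral_mult_left_zero)
  finally show "norm (LINT x|lborel. h x * nderiv n \<phi> x) \<le> (LINT x|lborel. norm (h x) / (1 + x\<^sup>2)) * schwartz_seminorm 2 \<phi>" .
qed

lemma schwartz_integrable: "\<phi> \<in> schwartz_functions \<Longrightarrow> integrable lborel \<phi>"
  using schwartz_pairing(1)[of "\<lambda>x. 1" \<phi> 0] integrable_inverse_1_plus_sq by simp

lemma schwartz_bounded:
  assumes "\<phi> \<in> schwartz_functions"
  obtains B where "\<And>x. norm (\<phi> x) \<le> B"
  using schwartz_bound[OF assms, of 0 0] that by auto

lemma schwartz_square_integrable:
  assumes \<phi>: "\<phi> \<in> schwartz_functions"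
  shows "integrable lborel (\<lambda>x. (norm (\<phi> x))\<^sup>2)"
proof -
  obtain B where B: "\<And>x. norm (\<phi> x) \<le> B" using schwartz_bounded[OF \<phi>] by blast
  have [measurable]: "\<phi> \<in> borel_measurable borel" by (intro smooth_measurable schwartz_smooth \<phi>)
  show ?thesis
  proof (rule integrable_bound_le)
    show "integrable lborel (\<lambda>x. B * norm (\<phi> x))" using schwartz_integrable[OF \<phi>] by simp
    show "norm ((norm (\<phi> x))\<^sup>2) \<le> B * norm (\<phi> x)" for x
      using mult_right_mono[OF B[of x], of "norm (\<phi> x)"] by (simp add: power2_eq_square)
  qed measurable
qed

section \<open>The Fourier transform on the Schwartz space\<close>

lemma integral_derivative_zero:
  fixes F F' :: "real \<Rightarrow> complex"
  assumes d: "\<And>x. (F has_vector_derivative F' x) (at x)" and c: "continuous_on UNIV F'"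
    and i: "integrable lborel F'" and l: "(\<lambda>n. F (real n)) \<longlonglongrightarrow> 0" "(\<lambda>n. F (- real n)) \<longlonglongrightarrow> 0"
  shows "(LINT x|lborel. F' x) = 0"
proof -
  have [measurable]: "F' \<in> borel_measurable borel" using borel_measurable_integrable[OF i] by simp
  have "(\<lambda>n. LINT x|lborel. indicator {- real n..real n} x *\<^sub>R F' x) \<longlonglongrightarrow> (LINT x|lborel. F' x)"
  proof (rule integral_dominated_convergence[OF _ _ integrable_norm[OF i]])
    have "(\<lambda>n. indicator {- real n..real n} x *\<^sub>R F' x) \<longlonglongrightarrow> F' x" for x
    proof (rule tendsto_eventually)
      obtain k0 where k0: "\<bar>x\<bar> \<le> real k0" using real_arch_simple by blast
      show "\<forall>\<^sub>F n in sequentially. indicator {- real n..real n} x *\<^sub>R F' x = F' x"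
        unfolding eventually_sequentially
      proof (intro exI[of _ k0] allI impI)
        fix n assume "k0 \<le> n"
        then have "\<bar>x\<bar> \<le> real n" using k0 by simp
        then show "indicator {- real n..real n} x *\<^sub>R F' x = F' x" by (auto simp: indicator_def abs_le_iff)
      qed
    qed
    then show "AE x in lborel. (\<lambda>n. indicator {- real n..real n} x *\<^sub>R F' x) \<longlonglongrightarrow> F' x" by simp
    show "AE x in lborel. norm (indicator {- real n..real n} x *\<^sub>R F' x) \<le> norm (F' x)" for n
      by (intro AE_I2) (simp add: indicator_def)
  qed measurable
  moreover have "(LINT x|lborel. indicator {- real n..real n} x *\<^sub>R F' x) = F (real n) - F (- real n)" for n
    by (rule integral_FTC_atLeastAtMost)
      (auto intro: has_vector_derivative_at_within d continuous_on_subset[OF c])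
  moreover have "(\<lambda>n. F (real n) - F (- real n)) \<longlonglongrightarrow> 0" using tendsto_diff[OF l] by simp
  ultimately show ?thesis by (simp add: LIMSEQ_unique)
qed

lemma has_vector_derivative_cis:
  "((\<lambda>x. cis (- (x * \<xi>))) has_vector_derivative - (\<i> * of_real \<xi> * cis (- (x * \<xi>)))) (at x)"
proof -
  have e: "cis (- (x * \<xi>)) = exp (- (\<i> * of_real \<xi>) * of_real x)" for x
    by (simp add: cis_conv_exp mult_ac)
  have "((\<lambda>z. exp (- (\<i> * of_real \<xi>) * z)) has_field_derivative exp (- (\<i> * of_real \<xi>) * of_real x) * (- (\<i> * of_real \<xi>))) (at (of_real x))"
    by (auto intro!: derivative_eq_intros)
  from has_vector_derivative_real_field[OF this] show ?thesis
    unfolding e by (simp add: mult.commute)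
qed

lemma schwartz_tendsto_0:
  assumes \<phi>: "\<phi> \<in> schwartz_functions"
  shows "(\<lambda>n. \<phi> (real n)) \<longlonglongrightarrow> 0" "(\<lambda>n. \<phi> (- real n)) \<longlonglongrightarrow> 0"
proof -
  obtain C where C: "\<forall>x. (1 + \<bar>x\<bar>) ^ 1 * norm (nderiv 0 \<phi> x) \<le> C" using schwartz_bound[OF \<phi>] by blast
  have le: "norm (\<phi> x) \<le> C / (1 + \<bar>x\<bar>)" for x
    using C[rule_format, of x] by (simp add: pos_le_divide_eq mult.commute add_pos_nonneg)
  have l: "(\<lambda>n. C / (1 + real n)) \<longlonglongrightarrow> 0" by real_asymp
  show "(\<lambda>n. \<phi> (real n)) \<longlonglongrightarrow> 0"
    by (rule Lim_null_comparison[OF always_eventually l]) (use le in \<open>auto intro: order_trans\<close>, metis abs_of_nat le)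
  show "(\<lambda>n. \<phi> (- real n)) \<longlonglongrightarrow> 0"
    by (rule Lim_null_comparison[OF always_eventually l]) (metis abs_of_nat abs_minus_cancel le)
qed

lemma fourier_nderiv_1:
  assumes \<phi>: "\<phi> \<in> schwartz_functions"
  shows "fourier (nderiv 1 \<phi>) \<xi> = \<i> * of_real \<xi> * fourier \<phi> \<xi>"
proof -
  note sm = schwartz_smooth[OF \<phi>]
  let ?F' = "\<lambda>x. cis (- (x * \<xi>)) * nderiv 1 \<phi> x + (- (\<i> * of_real \<xi> * cis (- (x * \<xi>)))) * \<phi> x"
  have i1: "integrable lborel (\<lambda>x. cis (- (x * \<xi>)) * nderiv 1 \<phi> x)"
    and i2: "integrable lborel (\<lambda>x. cis (- (x * \<xi>)) * \<phi> x)"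
    by (intro integrable_cis_mult schwartz_integrable schwartz_nderiv \<phi>)+
  have eq: "?F' x = cis (- (x * \<xi>)) * nderiv 1 \<phi> x + (- (\<i> * of_real \<xi>)) * (cis (- (x * \<xi>)) * \<phi> x)" for x
    by (simp add: mult_ac)
  have i3: "integrable lborel (\<lambda>x. (- (\<i> * of_real \<xi>)) * (cis (- (x * \<xi>)) * \<phi> x))"
    using i2 by (rule integrable_mult_right)
  have "(LINT x|lborel. ?F' x) = 0"
  proof (rule integral_derivative_zero)
    show "((\<lambda>x. cis (- (x * \<xi>)) * \<phi> x) has_vector_derivative ?F' x) (at x)" for x
      by (intro has_vector_derivative_mult has_vector_derivative_cis smooth_has_vector_derivative_1 sm)
    show "continuous_on UNIV ?F'"
      by (intro continuous_intros smooth_continuous_on smooth_nderiv sm)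
    show "integrable lborel ?F'" unfolding eq by (intro Bochner_Integration.integrable_add i1 i3)
    show "(\<lambda>n. cis (- (real n * \<xi>)) * \<phi> (real n)) \<longlonglongrightarrow> 0"
      using schwartz_tendsto_0(1)[OF \<phi>] by (subst tendsto_norm_zero_iff[symmetric]) (simp add: norm_mult tendsto_norm_zero)
    show "(\<lambda>n. cis (- (- real n * \<xi>)) * \<phi> (- real n)) \<longlonglongrightarrow> 0"
      using schwartz_tendsto_0(2)[OF \<phi>] by (subst tendsto_norm_zero_iff[symmetric]) (simp add: norm_mult tendsto_norm_zero)
  qed
  then have "fourier (nderiv 1 \<phi>) \<xi> + (- (\<i> * of_real \<xi>)) * fourier \<phi> \<xi> = 0"
    unfolding eq Bochner_Integration.integral_add[OF i1 i3] integral_mult_right_zero fourier_def .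
  then show ?thesis by simp
qed

text \<open>The remainder of \<open>cis\<close> after its linear Taylor term is at most quadratic in
  its argument, and \<open>x\<^sup>2 \<phi>\<close> is integrable. The error is therefore of second
  order in the increment, which is more than differentiability asks for.\<close>

lemma fourier_has_derivative:
  assumes \<phi>: "\<phi> \<in> schwartz_functions"
  shows "(fourier \<phi> has_vector_derivative fourier (\<lambda>x. - \<i> * (of_real x * \<phi> x)) \<xi>) (at \<xi>)"
proof -
  let ?D = "fourier (\<lambda>x. - \<i> * (of_real x * \<phi> x)) \<xi>"
  define K where "K = (LINT x|lborel. norm (of_real x * (of_real x * \<phi> x)))"
  note x\<phi> = schwartz_mult_x[OF \<phi>] and xx\<phi> = schwartz_mult_x[OF schwartz_mult_x[OF \<phi>]]
  have i0: "integrable lborel (\<lambda>x. cis (- (x * \<eta>)) * \<phi> x)" for \<eta>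
    by (intro integrable_cis_mult schwartz_integrable \<phi>)
  have i1: "integrable lborel (\<lambda>x. cis (- (x * \<xi>)) * (- \<i> * (of_real x * \<phi> x)))"
    by (intro integrable_cis_mult schwartz_integrable schwartz_cmult x\<phi>)
  have i2: "integrable lborel (\<lambda>x. norm (complex_of_real x * (of_real x * \<phi> x)))"
    by (intro integrable_norm schwartz_integrable xx\<phi>)
  have main: "norm (fourier \<phi> \<eta> - fourier \<phi> \<xi> - (\<eta> - \<xi>) *\<^sub>R ?D) \<le> (\<eta> - \<xi>)\<^sup>2 * K" for \<eta>
  proof -
    let ?h = "\<eta> - \<xi>"
    define G where "G = (\<lambda>x. cis (- (x * \<eta>)) * \<phi> x - cis (- (x * \<xi>)) * \<phi> x
      - ?h *\<^sub>R (cis (- (x * \<xi>)) * (- \<i> * (of_real x * \<phi> x))))"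
    define W where "W = (\<lambda>x. norm (complex_of_real x * (of_real x * \<phi> x)))"
    have ih: "integrable lborel (\<lambda>x. ?h *\<^sub>R (cis (- (x * \<xi>)) * (- \<i> * (of_real x * \<phi> x))))"
      using i1 by (rule integrable_scaleR_right)
    note i00 = Bochner_Integration.integrable_diff[OF i0[of \<eta>] i0[of \<xi>]]
    have GI: "integrable lborel G"
      unfolding G_def by (rule Bochner_Integration.integrable_diff[OF i00 ih])
    have WI: "integrable lborel W" using i2 by (simp only: W_def)
    have le: "norm (G x) \<le> ?h\<^sup>2 * W x" for x
    proof -
      let ?t = "- (x * ?h)"
      have c: "cis (- (x * \<eta>)) = cis (- (x * \<xi>)) * cis ?t" by (simp add: cis_mult algebra_simps)
      have G: "G x = cis (- (x * \<xi>)) * (cis ?t - 1 - \<i> * of_real ?t) * \<phi> x"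
        unfolding G_def c by (simp add: algebra_simps scaleR_conv_of_real)
      have "norm (cis ?t - (1 + \<i> * of_real ?t)) \<le> \<bar>?t\<bar>\<^sup>2"
      proof -
        have "norm (iexp ?t - (\<Sum>k\<le>1. (\<i> * ?t) ^ k / fact k)) \<le> \<bar>?t\<bar> ^ Suc 1 / fact (Suc 1)"
          by (rule iexp_approx1)
        moreover have "(\<Sum>k\<le>1. (\<i> * complex_of_real ?t) ^ k / fact k) = 1 + \<i> * of_real ?t"
          by (simp add: One_nat_def)
        moreover have "\<bar>?t\<bar> ^ Suc 1 / fact (Suc 1) = \<bar>?t\<bar>\<^sup>2 / 2"
          by (simp add: One_nat_def power2_eq_square)
        ultimately have "norm (cis ?t - (1 + \<i> * of_real ?t)) \<le> \<bar>?t\<bar>\<^sup>2 / 2"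
          by (simp only: cis_conv_exp)
        moreover have "\<bar>?t\<bar>\<^sup>2 / 2 \<le> \<bar>?t\<bar>\<^sup>2" by simp
        ultimately show ?thesis by (rule order_trans)
      qed
      then have "norm (G x) \<le> \<bar>?t\<bar>\<^sup>2 * norm (\<phi> x)"
        unfolding G norm_mult norm_cis diff_diff_eq by (simp only: mult_1_left mult_right_mono norm_ge_zero)
      also have "\<dots> = ?h\<^sup>2 * W x"
        unfolding W_def norm_mult norm_of_real abs_minus_cancel abs_mult power_mult_distrib power2_abs
        by (simp add: power2_eq_square mult_ac)
      finally show ?thesis .
    qed
    have "fourier \<phi> \<eta> - fourier \<phi> \<xi> - ?h *\<^sub>R ?D = (LINT x|lborel. G x)"
      unfolding fourier_def G_def Bochner_Integration.integral_diff[OF i00 ih]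
        Bochner_Integration.integral_diff[OF i0[of \<eta>] i0[of \<xi>]] integral_scaleR_right ..
    also have "norm \<dots> \<le> (LINT x|lborel. norm (G x))" by (rule integral_norm_bound)
    also have "\<dots> \<le> (LINT x|lborel. ?h\<^sup>2 * W x)"
      by (rule integral_mono[OF integrable_norm[OF GI] integrable_mult_right[OF WI] le])
    also have "\<dots> = ?h\<^sup>2 * K" unfolding K_def W_def by (rule integral_mult_right_zero)
    finally show ?thesis .
  qed
  show ?thesis
    unfolding has_vector_derivative_def has_derivative_iff_norm
  proof
    show "bounded_linear (\<lambda>x. x *\<^sub>R ?D)" by (rule bounded_linear_scaleR_left)
    have "((\<lambda>\<eta>. \<bar>\<eta> - \<xi>\<bar> * K) \<longlongrightarrow> \<bar>\<xi> - \<xi>\<bar> * K) (at \<xi>)" by (intro tendsto_intros)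
    then have l: "((\<lambda>\<eta>. \<bar>\<eta> - \<xi>\<bar> * K) \<longlongrightarrow> 0) (at \<xi>)" by simp
    show "((\<lambda>\<eta>. norm (fourier \<phi> \<eta> - fourier \<phi> \<xi> - (\<eta> - \<xi>) *\<^sub>R ?D) / norm (\<eta> - \<xi>)) \<longlongrightarrow> 0) (at \<xi>)"
    proof (rule tendsto_sandwich[OF _ _ tendsto_const l])
      have "norm (fourier \<phi> \<eta> - fourier \<phi> \<xi> - (\<eta> - \<xi>) *\<^sub>R ?D) / norm (\<eta> - \<xi>) \<le> \<bar>\<eta> - \<xi>\<bar> * K" if "\<eta> \<noteq> \<xi>" for \<eta>
      proof -
        have "(\<eta> - \<xi>)\<^sup>2 * K = \<bar>\<eta> - \<xi>\<bar> * K * \<bar>\<eta> - \<xi>\<bar>" by (simp add: power2_eq_square)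
        from main[of \<eta>, unfolded this] show ?thesis using that by (subst pos_divide_le_eq) simp_all
      qed
      then show "\<forall>\<^sub>F \<eta> in at \<xi>. norm (fourier \<phi> \<eta> - fourier \<phi> \<xi> - (\<eta> - \<xi>) *\<^sub>R ?D) / norm (\<eta> - \<xi>) \<le> \<bar>\<eta> - \<xi>\<bar> * K"
        by (auto simp: eventually_at_filter)
    qed simp
  qed
qed

text \<open>Every derivative of a transform is again the transform of a Schwartz function, so decay
  has to be shown for transforms only; there each power of \<open>\<xi>\<close> is traded for a
  derivative of the original function.\<close>

lemma fourier_schwartz:
  assumes \<phi>: "\<phi> \<in> schwartz_functions"
  shows "fourier \<phi> \<in> schwartz_functions"
proof -
  let ?S = "\<lambda>\<phi> x. - \<i> * (of_real x * \<phi> x)"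
  have S: "?S \<phi> \<in> schwartz_functions" if "\<phi> \<in> schwartz_functions" for \<phi>
    by (intro schwartz_cmult schwartz_mult_x that)
  have sm: "smooth (fourier \<phi>)"
  proof (rule smooth_coinduct[where P = "\<lambda>f. \<exists>\<psi>\<in>schwartz_functions. f = fourier \<psi>"])
    fix f assume "\<exists>\<psi>\<in>schwartz_functions. f = fourier \<psi>"
    then obtain \<psi> where \<psi>: "\<psi> \<in> schwartz_functions" "f = fourier \<psi>" by blast
    have "\<forall>\<xi>. (f has_vector_derivative fourier (?S \<psi>) \<xi>) (at \<xi>)" unfolding \<psi>(2)
      using fourier_has_derivative[OF \<psi>(1)] by blast
    then show "\<exists>f'. (\<exists>\<psi>\<in>schwartz_functions. f' = fourier \<psi>) \<and> (\<forall>x. (f has_vector_derivative f' x) (at x))"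
      using S[OF \<psi>(1)] by blast
  qed (use \<phi> in blast)
  have nd: "\<exists>\<psi>\<in>schwartz_functions. nderiv n (fourier \<phi>) = fourier \<psi>" for n
  proof (induction n)
    case (Suc n)
    then obtain \<psi> where \<psi>: "\<psi> \<in> schwartz_functions" "nderiv n (fourier \<phi>) = fourier \<psi>" by blast
    have "nderiv (Suc n) (fourier \<phi>) = fourier (?S \<psi>)"
      unfolding nderiv_Suc \<psi>(2) using fourier_has_derivative[OF \<psi>(1)] vector_derivative_at by blast
    then show ?case using S[OF \<psi>(1)] by blast
  qed (use \<phi> in auto)
  have decay: "\<exists>C. \<forall>\<xi>. \<bar>\<xi>\<bar> ^ k * norm (fourier \<psi> \<xi>) \<le> C" if "\<psi> \<in> schwartz_functions" for k \<psi>
    using that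
  proof (induction k arbitrary: \<psi>)
    case 0
    then show ?case using norm_fourier_le by (auto intro!: exI)
  next
    case (Suc k)
    obtain C where C: "\<forall>\<xi>. \<bar>\<xi>\<bar> ^ k * norm (fourier (nderiv 1 \<psi>) \<xi>) \<le> C"
      using Suc.IH[OF schwartz_nderiv[OF Suc.prems]] by blast
    have e: "\<bar>\<xi>\<bar> ^ Suc k * norm (fourier \<psi> \<xi>) = \<bar>\<xi>\<bar> ^ k * norm (fourier (nderiv 1 \<psi>) \<xi>)" for \<xi>
      unfolding fourier_nderiv_1[OF Suc.prems] by (simp add: norm_mult mult_ac)
    show ?case unfolding e using C by blast
  qed
  show ?thesis
    unfolding schwartz_functions_def
  proof (intro CollectI conjI allI sm)
    fix k n
    show "\<exists>C. \<forall>x. \<bar>x\<bar> ^ k * norm (nderiv n (fourier \<phi>) x) \<le> C"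
      using nd[of n] decay by metis
  qed
qed

lemma schwartz_fourier_invertible:
  assumes \<phi>: "\<phi> \<in> schwartz_functions"
  shows "fourier_invertible \<phi>"
proof -
  have "\<exists>B. \<forall>x. norm (\<phi> x) \<le> B" using schwartz_bound[OF \<phi>, of 0 0] by simp
  moreover have "integrable lborel \<phi>" "integrable lborel (fourier \<phi>)"
    by (intro schwartz_integrable fourier_schwartz \<phi>)+
  moreover have "continuous_on UNIV \<phi>" by (intro smooth_continuous_on schwartz_smooth \<phi>)
  ultimately show ?thesis by (simp only: fourier_invertible_def simp_thms)
qed

text \<open>The cutoffs are dilations of one bump with value 1 at the origin, without a plateau.
  What replaces the plateau is the Lipschitz bound: 1 minus the cutoff is at most a constant times
  \<open>s m * \<bar>x\<bar>\<close>, and each derivative brings out a further factor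
  \<open>s m\<close>, so \<open>nderiv_mult_growth\<close> applies with
  \<open>a = s m\<close>.\<close>

lemma schwartz_cutoff:
  obtains \<chi>' :: "nat \<Rightarrow> real \<Rightarrow> complex" where
    "\<And>m \<psi>. \<psi> \<in> schwartz_functions \<Longrightarrow> (\<lambda>x. \<chi>' m x * \<psi> x) \<in> test_functions"
    "\<And>N \<psi>. \<psi> \<in> schwartz_functions \<Longrightarrow> (\<lambda>m. schwartz_seminorm N (\<lambda>x. \<psi> x - \<chi>' m x * \<psi> x)) \<longlonglongrightarrow> 0"
proof -
  define b where "b = bump (-1) 1 0"
  have b: "b > 0" by (simp add: b_def bump_pos)
  define c where "c = (\<lambda>x. complex_of_real (1 / b) * of_real (bump (-1) 1 x))"
  have c: "c \<in> test_functions" "c 0 = 1"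
  proof -
    have "(\<lambda>x. complex_of_real (bump (-1) 1 x)) \<in> test_functions"
      by (rule test_functionI[OF smooth_bump, of "-1" 1]) (simp add: bump_eq_0)
    then show "c \<in> test_functions" unfolding c_def by (rule test_function_cmult)
    show "c 0 = 1" using b by (simp add: c_def b_def)
  qed
  note csm = test_function_smooth[OF c(1)]
  have "\<forall>i. \<exists>B. \<forall>x. norm (nderiv i c x) \<le> B"
    using test_function_bounded[OF test_function_nderiv[OF c(1)]] by metis
  then obtain B where B: "\<And>i x. norm (nderiv i c x) \<le> B i" by (auto dest!: choice)
  have B0: "0 \<le> B i" for i using order_trans[OF norm_ge_zero B] by blast
  have lip: "norm (c x - c 0) \<le> B 1 * \<bar>x\<bar>" for x
  proof -
    have "norm (c x - c 0) \<le> B 1 * norm (x - 0)"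
    proof (rule differentiable_bound[of UNIV c "\<lambda>x h. h *\<^sub>R nderiv 1 c x"])
      show "(c has_derivative (\<lambda>h. h *\<^sub>R nderiv 1 c x)) (at x within UNIV)" for x
        using smooth_has_vector_derivative_1[OF csm, of x] by (simp add: has_vector_derivative_def)
      show "onorm (\<lambda>h. h *\<^sub>R nderiv 1 c x) \<le> B 1" for x
      proof (rule onorm_bound)
        show "norm (h *\<^sub>R nderiv 1 c x) \<le> B 1 * norm h" for h
          using mult_right_mono[OF B[of 1 x] abs_ge_zero[of h]] by (simp add: mult.commute)
      qed (rule B0)
    qed auto
    then show ?thesis by simp
  qed
  define s where "s = (\<lambda>m::nat. 1 / real (Suc m))"
  have s: "0 < s m" "s m \<le> 1" for m by (auto simp: s_def)
  define X where "X = (\<lambda>m x. c (s m * x + 0))"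
  have Xsm: "smooth (X m)" for m unfolding X_def by (rule smooth_affine[OF csm])
  obtain M where M: "M > 0" "\<And>x. \<bar>x\<bar> \<ge> M \<Longrightarrow> c x = 0" using test_function_support[OF c(1)] by blast
  have Xt: "X m \<in> test_functions" for m
  proof (rule test_functionI[OF Xsm, of "- (M / s m)" "M / s m"])
    fix x assume "x \<notin> {- (M / s m)..M / s m}"
    then have "\<bar>x\<bar> \<ge> M / s m" by auto
    then have "\<bar>s m * x\<bar> \<ge> M" using s(1)[of m] by (simp add: abs_mult pos_divide_le_eq mult.commute)
    then show "X m x = 0" using M(2) by (simp add: X_def)
  qed
  define Y where "Y = (\<lambda>m x. 1 + (-1) * X m x)"
  have Ysm: "smooth (Y m)" for m unfolding Y_def by (intro smooth_add smooth_cmult smooth_const Xsm)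
  \<comment> \<open>\<open>B 1\<close> is the Lipschitz constant, for the case \<open>i = 0\<close>;
    \<open>B i\<close> bounds the derivatives in all other cases.\<close>
  define A where "A = (\<lambda>i. B i + B 1)"
  have Y: "norm (nderiv i (Y m) x) \<le> s m * (A i * (1 + \<bar>x\<bar>))" for i m x
  proof (cases i)
    case 0
    have "norm (Y m x) = norm (c (s m * x) - c 0)" by (simp add: Y_def X_def c(2) norm_minus_commute)
    also have "\<dots> \<le> B 1 * \<bar>s m * x\<bar>" by (rule lip)
    also have "\<dots> = s m * (B 1 * \<bar>x\<bar>)" using s(1)[of m] by (simp add: abs_mult)
    also have "\<dots> \<le> s m * (A i * (1 + \<bar>x\<bar>))"
      using s(1)[of m] B0 by (intro mult_left_mono mult_mono) (auto simp: A_def)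
    finally show ?thesis using 0 by simp
  next
    case (Suc j)
    have "nderiv i (Y m) = (\<lambda>x. nderiv i (\<lambda>x. 1) x + (-1) * nderiv i (X m) x)"
      unfolding Y_def by (simp only: nderiv_add[OF smooth_const smooth_cmult[OF Xsm]] nderiv_cmult[OF Xsm])
    also have "\<dots> = (\<lambda>x. - (of_real (s m) ^ i * nderiv i c (s m * x + 0)))"
      unfolding X_def nderiv_affine[OF csm] nderiv_const using Suc by simp
    finally have "norm (nderiv i (Y m) x) = s m ^ i * norm (nderiv i c (s m * x + 0))"
      using s(1)[of m] by (simp add: norm_mult norm_power)
    also have "\<dots> \<le> s m * (A i * (1 + \<bar>x\<bar>))"
    proof -
      have "s m ^ i \<le> s m" using s[of m] Suc by (simp add: mult_left_le power_le_one)
      moreover have "norm (nderiv i c (s m * x + 0)) \<le> A i * (1 + \<bar>x\<bar>)"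
      proof -
        have "norm (nderiv i c (s m * x + 0)) \<le> A i * 1" using B[of i "s m * x + 0"] B0[of 1] by (simp add: A_def)
        also have "\<dots> \<le> A i * (1 + \<bar>x\<bar>)" using B0 by (intro mult_left_mono) (auto simp: A_def)
        finally show ?thesis .
      qed
      ultimately show ?thesis using s(1)[of m] by (intro mult_mono) auto
    qed
    finally show ?thesis .
  qed
  have Y1: "norm (nderiv i (Y 0) x) \<le> A i * (1 + \<bar>x\<bar>)" for i x using Y[of i 0 x] by (simp add: s_def)
  show ?thesis
  proof (rule that[of X])
    fix \<psi> assume \<psi>: "\<psi> \<in> schwartz_functions"
    show "(\<lambda>x. X m x * \<psi> x) \<in> test_functions" for m
      by (rule test_function_mult[OF Xt schwartz_smooth[OF \<psi>]])
    fix N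
    have eq: "(\<lambda>x. \<psi> x - X m x * \<psi> x) = (\<lambda>x. Y m x * \<psi> x)" for m by (auto simp: Y_def algebra_simps)
    have Y\<psi>: "(\<lambda>x. Y m x * \<psi> x) \<in> schwartz_functions" for m
    proof (rule schwartz_mult_growth[OF Ysm _ \<psi>])
      show "norm (nderiv i (Y m) x) \<le> (s m * A i) * (1 + \<bar>x\<bar>)" for i x using Y[of i m x] by (simp add: mult.assoc)
    qed
    have ex: "\<forall>k. \<forall>n. \<exists>K. \<forall>m. (SUP x. \<bar>x\<bar> ^ k * norm (nderiv n (\<lambda>x. Y m x * \<psi> x) x)) \<le> s m * K"
    proof (intro allI)
      fix k n
      obtain K where K: "\<forall>a\<ge>0. \<forall>g. smooth g \<longrightarrow> (\<forall>i x. norm (nderiv i g x) \<le> a * (A i * (1 + \<bar>x\<bar>))) \<longrightarrow>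
          (\<forall>x. (1 + \<bar>x\<bar>) ^ k * norm (nderiv n (\<lambda>x. g x * \<psi> x) x) \<le> a * K)"
        using nderiv_mult_growth[OF Ysm \<psi> Y1] by blast
      have "(SUP x. \<bar>x\<bar> ^ k * norm (nderiv n (\<lambda>x. Y m x * \<psi> x) x)) \<le> s m * K" for m
      proof (rule cSUP_least)
        fix x :: real
        have "\<bar>x\<bar> ^ k * norm (nderiv n (\<lambda>x. Y m x * \<psi> x) x) \<le> (1 + \<bar>x\<bar>) ^ k * norm (nderiv n (\<lambda>x. Y m x * \<psi> x) x)"
          by (intro mult_right_mono power_mono) auto
        also have "\<dots> \<le> s m * K"
          by (rule K[rule_format, OF less_imp_le[OF s(1)] Ysm Y])
        finally show "\<bar>x\<bar> ^ k * norm (nderiv n (\<lambda>x. Y m x * \<psi> x) x) \<le> s m * K" .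
      qed simp
      then show "\<exists>K. \<forall>m. (SUP x. \<bar>x\<bar> ^ k * norm (nderiv n (\<lambda>x. Y m x * \<psi> x) x)) \<le> s m * K" by blast
    qed
    have "\<forall>k. \<exists>K. \<forall>n m. (SUP x. \<bar>x\<bar> ^ k * norm (nderiv n (\<lambda>x. Y m x * \<psi> x) x)) \<le> s m * K n"
    proof
      fix k
      show "\<exists>K. \<forall>n m. (SUP x. \<bar>x\<bar> ^ k * norm (nderiv n (\<lambda>x. Y m x * \<psi> x) x)) \<le> s m * K n"
        by (rule choice[OF spec[OF ex, of k]])
    qed
    from choice[OF this] obtain K where K: "\<And>k n m. (SUP x. \<bar>x\<bar> ^ k * norm (nderiv n (\<lambda>x. Y m x * \<psi> x) x)) \<le> s m * K k n"
      by blast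
    show "(\<lambda>m. schwartz_seminorm N (\<lambda>x. \<psi> x - X m x * \<psi> x)) \<longlonglongrightarrow> 0"
      unfolding eq schwartz_seminorm_def
    proof (intro tendsto_null_sum)
      fix k n
      have sK: "(\<lambda>m. s m * K k n) \<longlonglongrightarrow> 0" unfolding s_def by real_asymp
      show "(\<lambda>m. SUP x. \<bar>x\<bar> ^ k * norm (nderiv n (\<lambda>x. Y m x * \<psi> x) x)) \<longlonglongrightarrow> 0"
        by (rule tendsto_sandwich[OF _ _ tendsto_const sK])
          (auto intro!: always_eventually K schwartz_SUP(2)[OF Y\<psi>])
    qed
  qed
qed

subsection \<open>Fourier transform of square integrable functions and the bootstrap\<close>

text \<open>Riesz-Fischer for a rapidly converging sequence. The weights \<open>4 ^ k\<close> still
  leave a summable series of integrals, with ratio 1/2. Wherever their sum is finite, consecutive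
  terms differ by at most its square root times \<open>(1/2) ^ k\<close>, so the sequence converges
  there and its distance from the limit has an integrable majorant.\<close>

lemma L2_complete:
  fixes un :: "nat \<Rightarrow> real \<Rightarrow> complex"
  assumes [measurable]: "\<And>n. un n \<in> borel_measurable borel"
    and i: "\<And>n. integrable lborel (\<lambda>x. (norm (un (Suc n) x - un n x))\<^sup>2)"
    and le: "\<And>n. (LINT x|lborel. (norm (un (Suc n) x - un n x))\<^sup>2) \<le> (1/8) ^ n"
  obtains u where "u \<in> borel_measurable borel" "\<And>n. integrable lborel (\<lambda>x. (norm (un n x - u x))\<^sup>2)"
    "(\<lambda>n. LINT x|lborel. (norm (un n x - u x))\<^sup>2) \<longlonglongrightarrow> 0"
proof -
  define D where "D = (\<lambda>k x. 4 ^ k * (norm (un (Suc k) x - un k x))\<^sup>2)"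
  have Dm [measurable]: "D k \<in> borel_measurable borel" for k unfolding D_def by measurable
  have D0: "0 \<le> D k x" for k x by (simp add: D_def)
  have Di: "integrable lborel (D k)" for k unfolding D_def using i by (intro integrable_mult_right)
  have DI: "(LINT x|lborel. D k x) \<le> (1/2) ^ k" for k
  proof -
    have "(LINT x|lborel. D k x) = 4 ^ k * (LINT x|lborel. (norm (un (Suc k) x - un k x))\<^sup>2)"
      unfolding D_def by (rule integral_mult_right_zero)
    also have "\<dots> \<le> 4 ^ k * (1/8) ^ k" by (intro mult_left_mono le) simp
    also have "\<dots> = (1/2) ^ k" by (simp add: power_mult_distrib[symmetric])
    finally show ?thesis .
  qed
  have DI0: "0 \<le> (LINT x|lborel. D k x)" for k by (simp add: D0)
  have sI: "summable (\<lambda>k. LINT x|lborel. D k x)"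
    by (rule summable_comparison_test'[OF summable_geometric[of "1/2 :: real"]]) (use DI DI0 in auto)
  have "(\<integral>\<^sup>+x. (\<Sum>k. ennreal (D k x)) \<partial>lborel) = (\<Sum>k. \<integral>\<^sup>+x. ennreal (D k x) \<partial>lborel)"
    by (rule nn_integral_suminf) measurable
  also have "\<dots> = (\<Sum>k. ennreal (LINT x|lborel. D k x))"
    by (intro suminf_cong nn_integral_eq_integral Di) (simp add: D0)
  also have "\<dots> \<noteq> \<infinity>" using ennreal_suminf_neq_top[OF sI DI0] unfolding infinity_ennreal_def .
  finally have "AE x in lborel. (\<Sum>k. ennreal (D k x)) \<noteq> \<infinity>"
    by (intro nn_integral_PInf_AE) measurable
  then have AEs: "AE x in lborel. summable (\<lambda>k. D k x)"
    by eventually_elim (rule summable_suminf_not_top, auto simp: D0)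
  have DDi: "integrable lborel (\<lambda>x. \<Sum>k. D k x)"
    by (rule integrable_suminf[OF Di]) (use AEs sI D0 in auto)
  define u where "u = (\<lambda>x. lim (\<lambda>n. un n x))"
  have um [measurable]: "u \<in> borel_measurable borel" unfolding u_def by measurable
  have AEb: "AE x in lborel. \<forall>n. (norm (un n x - u x))\<^sup>2 \<le> 4 * (1/4) ^ n * (\<Sum>k. D k x)"
    using AEs
  proof eventually_elim
    case (elim x)
    let ?S = "\<Sum>k. D k x"
    have S0: "0 \<le> ?S" by (intro suminf_nonneg elim D0)
    have step: "norm (un (Suc k) x - un k x) \<le> sqrt ?S * (1/2) ^ k" for k
    proof -
      have "D k x = (\<Sum>j\<in>{k}. D j x)" by simp
      also have "\<dots> \<le> ?S" by (rule sum_le_suminf[OF elim]) (auto simp: D0)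
      finally have "4 ^ k * (norm (un (Suc k) x - un k x))\<^sup>2 \<le> ?S" by (simp add: D_def)
      moreover have "((2::real) ^ k)\<^sup>2 = 4 ^ k" by (simp add: power2_eq_square power_mult_distrib[symmetric])
      ultimately have "(2 ^ k * norm (un (Suc k) x - un k x))\<^sup>2 \<le> ?S" by (simp only: power_mult_distrib)
      then have "2 ^ k * norm (un (Suc k) x - un k x) \<le> sqrt ?S" by (rule real_le_rsqrt)
      then show ?thesis by (simp add: power_one_over field_simps)
    qed
    have tele: "norm (un (n + j) x - un n x) \<le> sqrt ?S * (1/2) ^ n * (2 - 2 * (1/2) ^ j)" for n j
    proof (induction j)
      case (Suc j)
      have "norm (un (n + Suc j) x - un n x) \<le> norm (un (Suc (n + j)) x - un (n + j) x) + norm (un (n + j) x - un n x)"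
        using norm_triangle_ineq[of "un (Suc (n + j)) x - un (n + j) x" "un (n + j) x - un n x"] by simp
      also have "\<dots> \<le> sqrt ?S * (1/2) ^ (n + j) + sqrt ?S * (1/2) ^ n * (2 - 2 * (1/2) ^ j)"
        by (intro add_mono step Suc)
      also have "\<dots> = sqrt ?S * (1/2) ^ n * (2 - 2 * (1/2) ^ Suc j)"
        by (simp add: power_add algebra_simps)
      finally show ?case .
    qed simp
    have tele2: "norm (un m x - un n x) \<le> 2 * sqrt ?S * (1/2) ^ n" if "n \<le> m" for n m
    proof -
      have "norm (un m x - un n x) \<le> sqrt ?S * (1/2) ^ n * (2 - 2 * (1/2) ^ (m - n))"
        using tele[of n "m - n"] that by simp
      also have "\<dots> \<le> sqrt ?S * (1/2) ^ n * 2" using S0 by (intro mult_left_mono) auto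
      finally show ?thesis by (simp add: mult_ac)
    qed
    have lim0: "(\<lambda>n. 2 * sqrt ?S * (1/2) ^ n) \<longlonglongrightarrow> 0"
      using tendsto_mult[OF tendsto_const LIMSEQ_power_zero[of "1/2 :: real"]] by simp
    have "Cauchy (\<lambda>n. un n x)"
    proof (rule CauchyI')
      fix e :: real assume "e > 0"
      then obtain N where N: "2 * sqrt ?S * (1/2) ^ N < e"
        using order_tendstoD(2)[OF lim0 \<open>e > 0\<close>] eventually_happens'[OF sequentially_bot] by blast
      show "\<exists>M. \<forall>m\<ge>M. \<forall>n>m. dist (un m x) (un n x) < e"
      proof (intro exI[of _ N] allI impI)
        fix m n assume mn: "N \<le> m" "m < n"
        have "norm (un m x - un n x) = norm (un n x - un m x)" by (rule norm_minus_commute)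
        also have "\<dots> \<le> 2 * sqrt ?S * (1/2) ^ m" using mn by (intro tele2) simp
        also have "\<dots> \<le> 2 * sqrt ?S * (1/2) ^ N" using mn S0 by (intro mult_left_mono power_decreasing) auto
        finally show "dist (un m x) (un n x) < e" using N by (simp add: dist_norm)
      qed
    qed
    then have ul: "(\<lambda>n. un n x) \<longlonglongrightarrow> u x" unfolding u_def by (simp add: Cauchy_convergent_iff convergent_LIMSEQ_iff)
    show ?case
    proof
      fix n
      have "(\<lambda>m. norm (un m x - un n x)) \<longlonglongrightarrow> norm (u x - un n x)" by (intro tendsto_intros ul)
      then have "norm (u x - un n x) \<le> 2 * sqrt ?S * (1/2) ^ n"
        by (rule LIMSEQ_le_const2) (use tele2 in blast)
      then have "(norm (un n x - u x))\<^sup>2 \<le> (2 * sqrt ?S * (1/2) ^ n)\<^sup>2"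
        by (intro power_mono) (auto simp: norm_minus_commute)
      also have "\<dots> = 4 * (1/4) ^ n * ?S"
      proof -
        have "((1/2::real) ^ n)\<^sup>2 = (1/4) ^ n" by (simp add: power2_eq_square power_mult_distrib[symmetric])
        then show ?thesis using S0 by (simp add: power_mult_distrib)
      qed
      finally show "(norm (un n x - u x))\<^sup>2 \<le> 4 * (1/4) ^ n * ?S" .
    qed
  qed
  have bi: "integrable lborel (\<lambda>x. 4 * (1/4) ^ n * (\<Sum>k. D k x))" for n using DDi by (rule integrable_mult_right)
  have ui: "integrable lborel (\<lambda>x. (norm (un n x - u x))\<^sup>2)" for n
  proof (rule Bochner_Integration.integrable_bound[OF bi[of n]])
    show "AE x in lborel. norm ((norm (un n x - u x))\<^sup>2) \<le> norm (4 * (1/4) ^ n * (\<Sum>k. D k x))"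
      using AEb
    proof eventually_elim
      case (elim x)
      then have "(norm (un n x - u x))\<^sup>2 \<le> 4 * (1/4) ^ n * (\<Sum>k. D k x)" by blast
      then show ?case by (simp only: real_norm_def abs_power2 order_trans[OF _ abs_ge_self])
    qed
  qed measurable
  have b: "(LINT x|lborel. (norm (un n x - u x))\<^sup>2) \<le> 4 * (1/4) ^ n * (LINT x|lborel. (\<Sum>k. D k x))" for n
  proof -
    have "(LINT x|lborel. (norm (un n x - u x))\<^sup>2) \<le> (LINT x|lborel. 4 * (1/4) ^ n * (\<Sum>k. D k x))"
      by (rule integral_mono_AE[OF ui bi]) (use AEb in eventually_elim, blast)
    then show ?thesis by (simp only: integral_mult_right_zero)
  qed
  have l: "(\<lambda>n. 4 * (1/4) ^ n * (LINT x|lborel. (\<Sum>k. D k x))) \<longlonglongrightarrow> 0"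
    using tendsto_mult[OF tendsto_mult[OF tendsto_const LIMSEQ_power_zero[of "1/4 :: real"]] tendsto_const] by simp
  have "(\<lambda>n. LINT x|lborel. (norm (un n x - u x))\<^sup>2) \<longlonglongrightarrow> 0"
    by (rule tendsto_sandwich[OF _ _ tendsto_const l]) (simp, intro always_eventually allI b)
  then show ?thesis by (rule that[OF um ui])
qed

lemma
  fixes h :: "real \<Rightarrow> real"
  assumes "integrable lborel h"
  shows integrable_reflect_shift: "integrable lborel (\<lambda>\<eta>. h (\<xi> - \<eta>))"
    and integral_reflect_shift: "(LINT \<eta>|lborel. h (\<xi> - \<eta>)) = (LINT \<eta>|lborel. h \<eta>)"
  using lborel_integrable_real_affine[OF assms, of "-1" \<xi>] lborel_integral_real_affine[of "-1" h \<xi>] by simp_all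

text \<open>\<open>R\<close> is the L2 Fourier transform of \<open>r\<close>, a limit of transforms
  of test functions that Plancherel makes Cauchy. Both formulas are inherited from the approximants;
  the convolution formula holds at every \<open>\<xi>\<close>, not just almost everywhere, since
  both of its sides are pairings of L2 functions.\<close>

lemma L2_fourier:
  fixes r :: "real \<Rightarrow> real"
  assumes rm [measurable]: "r \<in> borel_measurable borel" and r: "integrable lborel (\<lambda>x. (r x)\<^sup>2)"
  obtains R where "R \<in> borel_measurable borel" "integrable lborel (\<lambda>\<xi>. (norm (R \<xi>))\<^sup>2)"
    "\<And>\<phi>. \<phi> \<in> schwartz_functions \<Longrightarrow> (LINT x|lborel. of_real (r x) * fourier \<phi> x) = (LINT \<xi>|lborel. R \<xi> * \<phi> \<xi>)"
    "\<And>\<xi>. of_real (2 * pi) * fourier (\<lambda>x. of_real ((r x)\<^sup>2)) \<xi> = (LINT \<eta>|lborel. R \<eta> * R (\<xi> - \<eta>))"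
proof -
  \<comment> \<open>Consecutive approximants differ by at most \<open>4 * \<delta> n\<close> in
    squared norm, and Plancherel multiplies by \<open>2 * pi\<close>: together exactly the
    \<open>(1/8) ^ n\<close> that \<open>L2_complete\<close> expects.\<close>
  define \<delta> where "\<delta> = (\<lambda>n::nat. (1/8) ^ n / (8 * pi) :: real)"
  have \<delta>: "\<delta> n > 0" for n by (simp add: \<delta>_def)
  have ex: "\<exists>p. real_test p \<and> integrable lborel (\<lambda>x. (r x - p x)\<^sup>2) \<and> (LINT x|lborel. (r x - p x)\<^sup>2) < \<delta> n" for n
  proof -
    obtain p where "real_test p" "integrable lborel (\<lambda>x. \<bar>r x - p x\<bar>\<^sup>2)" "(LINT x|lborel. \<bar>r x - p x\<bar>\<^sup>2) < \<delta> n"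
      by (rule real_test_dense[of r 2 "\<delta> n"]) (use r \<delta> in auto)
    then show ?thesis by (intro exI[of _ p]) simp
  qed
  obtain p where "\<forall>n. real_test (p n) \<and> integrable lborel (\<lambda>x. (r x - p n x)\<^sup>2) \<and> (LINT x|lborel. (r x - p n x)\<^sup>2) < \<delta> n"
    by (rule exE[OF choice[OF allI[OF ex]]])
  then have p: "\<And>n. real_test (p n)" "\<And>n. integrable lborel (\<lambda>x. (r x - p n x)\<^sup>2)"
    "\<And>n. (LINT x|lborel. (r x - p n x)\<^sup>2) < \<delta> n" by simp_all
  note [measurable] = real_test_measurable[OF p(1)]
  define f where "f = (\<lambda>n x. complex_of_real (p n x))"
  have fS: "f n \<in> schwartz_functions" for n
    using p(1) test_subset_schwartz by (auto simp: f_def real_test_def)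
  have fm [measurable]: "f n \<in> borel_measurable borel" for n unfolding f_def by measurable
  define F where "F = (\<lambda>n. fourier (f n))"
  have FS: "F n \<in> schwartz_functions" for n unfolding F_def by (intro fourier_schwartz fS)
  have Fm [measurable]: "F n \<in> borel_measurable borel" for n
    by (intro smooth_measurable schwartz_smooth FS)
  note F2 = schwartz_square_integrable[OF FS]
  have Fd: "integrable lborel (\<lambda>x. (norm (F (Suc n) x - F n x))\<^sup>2) \<and>
      (LINT x|lborel. (norm (F (Suc n) x - F n x))\<^sup>2) \<le> (1/8) ^ n" for n
  proof -
    define d where "d = (\<lambda>x. f (Suc n) x + (-1) * f n x)"
    have dS: "d \<in> schwartz_functions" unfolding d_def by (intro schwartz_add schwartz_cmult fS)
    have Fd: "F (Suc n) \<xi> - F n \<xi> = fourier d \<xi>" for \<xi>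
    proof -
      have i: "integrable lborel (\<lambda>x. cis (- (x * \<xi>)) * f k x)" for k
        by (intro integrable_cis_mult schwartz_integrable fS)
      have "cis (- (x * \<xi>)) * d x = cis (- (x * \<xi>)) * f (Suc n) x - cis (- (x * \<xi>)) * f n x" for x
        by (simp add: d_def algebra_simps)
      then show ?thesis
        unfolding F_def fourier_def by (simp only: Bochner_Integration.integral_diff[OF i i])
    qed
    have i: "integrable lborel (\<lambda>x. (norm (p (Suc n) x - r x))\<^sup>2)" "integrable lborel (\<lambda>x. (norm (r x - p n x))\<^sup>2)"
      using p(2)[of "Suc n"] p(2)[of n] by (simp_all add: power2_commute)
    have "(LINT x|lborel. (norm (d x))\<^sup>2) = (LINT x|lborel. (norm ((p (Suc n) x - r x) + (r x - p n x)))\<^sup>2)"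
    proof (rule Bochner_Integration.integral_cong)
      fix x
      have "d x = complex_of_real (p (Suc n) x - p n x)" by (simp add: d_def f_def)
      then show "(norm (d x))\<^sup>2 = (norm ((p (Suc n) x - r x) + (r x - p n x)))\<^sup>2" by (simp only: norm_of_real) simp
    qed simp
    also have "\<dots> \<le> 2 * (LINT x|lborel. (norm (p (Suc n) x - r x))\<^sup>2) + 2 * (LINT x|lborel. (norm (r x - p n x))\<^sup>2)"
      by (rule L2_norm_add_sq_le(2)[OF _ _ i]) measurable
    also have "\<dots> \<le> 2 * \<delta> (Suc n) + 2 * \<delta> n"
      using p(3)[of "Suc n"] p(3)[of n] by (simp add: power2_commute)
    also have "\<delta> (Suc n) = \<delta> n / 8" by (simp add: \<delta>_def)
    also have "2 * (\<delta> n / 8) + 2 * \<delta> n \<le> 4 * \<delta> n" using \<delta>[of n] by linarith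
    finally have d: "(LINT x|lborel. (norm (d x))\<^sup>2) \<le> 4 * \<delta> n" .
    have "(LINT x|lborel. (norm (fourier d x))\<^sup>2) \<le> 2 * pi * (4 * \<delta> n)"
      unfolding plancherel[OF schwartz_fourier_invertible[OF dS]] using d by (intro mult_left_mono) auto
    also have "\<dots> = (1/8) ^ n" by (simp add: \<delta>_def)
    finally show ?thesis
      unfolding Fd using schwartz_square_integrable[OF fourier_schwartz[OF dS]] by blast
  qed
  obtain R where Rm [measurable]: "R \<in> borel_measurable borel" and FR: "\<And>n. integrable lborel (\<lambda>x. (norm (F n x - R x))\<^sup>2)"
    and FR0: "(\<lambda>n. LINT x|lborel. (norm (F n x - R x))\<^sup>2) \<longlonglongrightarrow> 0"
  proof (rule L2_complete[of F])
    fix u assume u: "u \<in> borel_measurable borel" "\<And>n. integrable lborel (\<lambda>x. (norm (F n x - u x))\<^sup>2)"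
      "(\<lambda>n. LINT x|lborel. (norm (F n x - u x))\<^sup>2) \<longlonglongrightarrow> 0"
    show thesis by (rule that[OF u])
  qed (use Fd in auto)
  have R2: "integrable lborel (\<lambda>x. (norm (R x))\<^sup>2)"
  proof -
    have "integrable lborel (\<lambda>x. (norm (- (F 0 x - R x) + F 0 x))\<^sup>2)"
    proof (rule L2_norm_add_sq_le(1))
      show "integrable lborel (\<lambda>x. (norm (- (F 0 x - R x)))\<^sup>2)" unfolding norm_minus_cancel by (rule FR)
    qed (use F2 in auto)
    then show ?thesis by simp
  qed
  have frI: "\<And>n. integrable lborel (\<lambda>x. (norm (f n x - of_real (r x)))\<^sup>2)"
    and fr0: "(\<lambda>n. LINT x|lborel. (norm (f n x - of_real (r x)))\<^sup>2) \<longlonglongrightarrow> 0"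
  proof -
    have eq: "(norm (f n x - of_real (r x)))\<^sup>2 = (r x - p n x)\<^sup>2" for n x
    proof -
      have "f n x - of_real (r x) = of_real (p n x - r x)" by (simp add: f_def)
      then show ?thesis by (simp only: norm_of_real power2_abs) (rule power2_commute)
    qed
    show "integrable lborel (\<lambda>x. (norm (f n x - of_real (r x)))\<^sup>2)" for n unfolding eq by (rule p(2))
    have \<delta>0: "\<delta> \<longlonglongrightarrow> 0" unfolding \<delta>_def by real_asymp
    show "(\<lambda>n. LINT x|lborel. (norm (f n x - of_real (r x)))\<^sup>2) \<longlonglongrightarrow> 0"
      unfolding eq by (rule tendsto_sandwich[OF _ _ tendsto_const \<delta>0]) (auto intro!: always_eventually less_imp_le[OF p(3)])
  qed
  have r2: "integrable lborel (\<lambda>x. (norm (complex_of_real (r x)))\<^sup>2)" using r by simp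
  show ?thesis
  proof (rule that[OF Rm R2])
    fix \<phi> assume \<phi>: "\<phi> \<in> schwartz_functions"
    note FS\<phi> = fourier_schwartz[OF \<phi>]
    have [measurable]: "\<phi> \<in> borel_measurable borel" "fourier \<phi> \<in> borel_measurable borel"
      by (intro smooth_measurable schwartz_smooth \<phi> FS\<phi>)+
    have "(\<lambda>n. LINT x|lborel. f n x * fourier \<phi> x) \<longlonglongrightarrow> (LINT x|lborel. of_real (r x) * fourier \<phi> x)"
      by (rule L2_tendsto_mult) (simp_all add: r2[simplified] frI fr0 schwartz_square_integrable[OF FS\<phi>])
    moreover have "(\<lambda>n. LINT \<xi>|lborel. F n \<xi> * \<phi> \<xi>) \<longlonglongrightarrow> (LINT \<xi>|lborel. R \<xi> * \<phi> \<xi>)"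
      by (rule L2_tendsto_mult) (simp_all add: R2 FR FR0 schwartz_square_integrable[OF \<phi>])
    moreover have "(LINT \<xi>|lborel. F n \<xi> * \<phi> \<xi>) = (LINT x|lborel. f n x * fourier \<phi> x)" for n
      unfolding F_def by (rule fourier_multiplication) (intro schwartz_integrable fS \<phi>)+
    ultimately show "(LINT x|lborel. of_real (r x) * fourier \<phi> x) = (LINT \<xi>|lborel. R \<xi> * \<phi> \<xi>)"
      using LIMSEQ_unique by (simp only:)
  next
    fix \<xi> :: real
    define e where "e = (\<lambda>x. cis (- (x * \<xi>)))"
    have ne: "norm (e x) = 1" for x by (simp add: e_def)
    have em [measurable]: "e \<in> borel_measurable borel"
      unfolding e_def by (intro borel_measurable_continuous_onI continuous_intros)
    have efr: "norm (e x * f n x - e x * of_real (r x)) = norm (f n x - of_real (r x))" for n x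
      by (simp add: right_diff_distrib[symmetric] norm_mult ne)
    have L: "(\<lambda>n. LINT x|lborel. (e x * f n x) * f n x) \<longlonglongrightarrow> (LINT x|lborel. (e x * of_real (r x)) * of_real (r x))"
    proof (rule L2_tendsto_mult)
      show "integrable lborel (\<lambda>x. (norm (e x * complex_of_real (r x)))\<^sup>2)" using r by (simp add: norm_mult ne)
    qed (simp_all add: efr r2[simplified] frI fr0)
    have R': "(LINT x|lborel. (e x * of_real (r x)) * of_real (r x)) = fourier (\<lambda>x. of_real ((r x)\<^sup>2)) \<xi>"
      unfolding fourier_def e_def by (rule Bochner_Integration.integral_cong) (auto simp: power2_eq_square)
    have FRs: "integrable lborel (\<lambda>\<eta>. (norm (F n (\<xi> - \<eta>) - R (\<xi> - \<eta>)))\<^sup>2)"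
      "(LINT \<eta>|lborel. (norm (F n (\<xi> - \<eta>) - R (\<xi> - \<eta>)))\<^sup>2) = (LINT \<eta>|lborel. (norm (F n \<eta> - R \<eta>))\<^sup>2)" for n
      using integrable_reflect_shift[OF FR[of n], of \<xi>] integral_reflect_shift[OF FR[of n], of \<xi>] by simp_all
    have "(\<lambda>n. LINT \<eta>|lborel. F n \<eta> * F n (\<xi> - \<eta>)) \<longlonglongrightarrow> (LINT \<eta>|lborel. R \<eta> * R (\<xi> - \<eta>))"
      by (rule L2_tendsto_mult) (simp_all add: R2 FR FR0 FRs integrable_reflect_shift[OF R2])
    moreover have "(LINT \<eta>|lborel. F n \<eta> * F n (\<xi> - \<eta>)) = of_real (2 * pi) * (LINT x|lborel. (e x * f n x) * f n x)" for n
    proof -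
      \<comment> \<open>Modulation by \<open>e\<close> translates the transform by
        \<open>\<xi>\<close>, and the reflection in \<open>parseval\<close> then produces the
        argument \<open>\<xi> - \<eta>\<close> of a convolution.\<close>
      define \<psi> where "\<psi> = (\<lambda>x. e x * f n x)"
      have \<psi>F: "fourier \<psi> \<eta> = F n (\<xi> + \<eta>)" for \<eta>
      proof -
        have "cis (- (x * \<eta>)) * \<psi> x = cis (- (x * (\<xi> + \<eta>))) * f n x" for x
          by (simp add: \<psi>_def e_def mult.assoc[symmetric] cis_mult) (simp add: algebra_simps)
        then show ?thesis unfolding F_def fourier_def by (simp only:)
      qed
      have "fourier_invertible \<psi>"
        unfolding fourier_invertible_def
      proof (intro conjI)
        show "continuous_on UNIV \<psi>"
          unfolding \<psi>_def e_def by (intro continuous_intros smooth_continuous_on schwartz_smooth fS)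
        obtain B where "\<And>x. norm (f n x) \<le> B" using schwartz_bounded[OF fS] by blast
        then show "\<exists>B. \<forall>x. norm (\<psi> x) \<le> B" by (auto simp: \<psi>_def norm_mult ne)
        show "integrable lborel \<psi>"
          unfolding \<psi>_def e_def by (intro integrable_cis_mult schwartz_integrable fS)
        have "integrable lborel (\<lambda>\<eta>. F n (\<xi> + 1 * \<eta>))"
          by (rule lborel_integrable_real_affine[OF schwartz_integrable[OF FS]]) simp
        moreover have "fourier \<psi> = (\<lambda>\<eta>. F n (\<xi> + \<eta>))" using \<psi>F by blast
        ultimately show "integrable lborel (fourier \<psi>)" by simp
      qed
      from parseval[OF schwartz_integrable[OF fS[of n]] this]
      have "(LINT \<eta>|lborel. F n \<eta> * F n (\<xi> - \<eta>)) = of_real (2 * pi) * (LINT x|lborel. f n x * \<psi> x)"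
        unfolding \<psi>F F_def diff_conv_add_uminus .
      then show ?thesis by (simp only: \<psi>_def mult.commute[of "f n _"])
    qed
    ultimately have "(\<lambda>n. of_real (2 * pi) * (LINT x|lborel. (e x * f n x) * f n x)) \<longlonglongrightarrow> (LINT \<eta>|lborel. R \<eta> * R (\<xi> - \<eta>))"
      by (simp only:)
    moreover have "(\<lambda>n. of_real (2 * pi) * (LINT x|lborel. (e x * f n x) * f n x))
        \<longlonglongrightarrow> of_real (2 * pi) * fourier (\<lambda>x. of_real ((r x)\<^sup>2)) \<xi>"
      using tendsto_mult_left[OF L, of "of_real (2 * pi)"] unfolding R' .
    ultimately show "of_real (2 * pi) * fourier (\<lambda>x. of_real ((r x)\<^sup>2)) \<xi> = (LINT \<eta>|lborel. R \<eta> * R (\<xi> - \<eta>))"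
      using LIMSEQ_unique by blast
  qed
qed

section \<open>Decay of autoconvolutions and the regularity bootstrap\<close>

lemma weight_triangle:
  fixes s \<xi> \<eta> :: real
  assumes "s \<ge> 0"
  shows "(1 + \<xi>\<^sup>2) powr s \<le> 4 powr s * ((1 + \<eta>\<^sup>2) powr s + (1 + (\<xi> - \<eta>)\<^sup>2) powr s)"
proof -
  \<comment> \<open>At least one of \<open>\<eta>\<close> and \<open>\<xi> - \<eta>\<close> has half
    the size of \<open>\<xi>\<close>, so the weight of \<open>\<xi>\<close> is at most 4 times the
    larger of the two weights.\<close>
  let ?m = "max (1 + \<eta>\<^sup>2) (1 + (\<xi> - \<eta>)\<^sup>2)"
  have "0 \<le> (\<eta> - (\<xi> - \<eta>))\<^sup>2" by simp
  then have "\<xi>\<^sup>2 \<le> 2 * \<eta>\<^sup>2 + 2 * (\<xi> - \<eta>)\<^sup>2" by (simp add: power2_eq_square algebra_simps)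
  moreover have "0 \<le> \<eta>\<^sup>2" "0 \<le> (\<xi> - \<eta>)\<^sup>2" by simp_all
  ultimately have "1 + \<xi>\<^sup>2 \<le> 4 * m" if "1 + \<eta>\<^sup>2 \<le> m" "1 + (\<xi> - \<eta>)\<^sup>2 \<le> m" for m
    using that by linarith
  then have "1 + \<xi>\<^sup>2 \<le> 4 * ?m" by simp
  then have "(1 + \<xi>\<^sup>2) powr s \<le> (4 * ?m) powr s" using assms by (intro powr_mono2) auto
  also have "\<dots> = 4 powr s * ?m powr s" by (rule powr_mult)
  also have "\<dots> \<le> 4 powr s * ((1 + \<eta>\<^sup>2) powr s + (1 + (\<xi> - \<eta>)\<^sup>2) powr s)"
    by (intro mult_left_mono) (auto simp: max_def)
  finally show ?thesis .
qed

text \<open>Peetre-type inequality under the integral, then Cauchy-Schwarz.\<close>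

lemma autoconvolution_decay:
  fixes R :: "real \<Rightarrow> complex"
  assumes [measurable]: "R \<in> borel_measurable borel" and R: "integrable lborel (\<lambda>\<xi>. (norm (R \<xi>))\<^sup>2)"
    and s: "s \<ge> 0" and Rs: "integrable lborel (\<lambda>\<xi>. (1 + \<xi>\<^sup>2) powr s * (norm (R \<xi>))\<^sup>2)"
  obtains C where "\<And>\<xi>. (1 + \<xi>\<^sup>2) powr (s/2) * norm (LINT \<eta>|lborel. R \<eta> * R (\<xi> - \<eta>)) \<le> C"
proof -
  define a where "a = (\<lambda>\<eta>. norm (R \<eta>))"
  \<comment> \<open>The square root of the weight, which makes \<open>b\<^sup>2\<close> integrable.
    The weight falls on one factor of the convolution at a time; the other factor is used with its
    plain L2 norm.\<close>
  define b where "b = (\<lambda>\<eta>. (1 + \<eta>\<^sup>2) powr (s/2) * norm (R \<eta>))"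
  have [measurable]: "a \<in> borel_measurable borel" "b \<in> borel_measurable borel" unfolding a_def b_def by measurable
  have b2eq: "(b \<eta>)\<^sup>2 = (1 + \<eta>\<^sup>2) powr s * (norm (R \<eta>))\<^sup>2" for \<eta>
  proof -
    have "((1 + \<eta>\<^sup>2) powr (s/2))\<^sup>2 = (1 + \<eta>\<^sup>2) powr s" unfolding power2_eq_square powr_add[symmetric] by simp
    then show ?thesis by (simp add: b_def power_mult_distrib)
  qed
  have a2: "integrable lborel (\<lambda>\<eta>. (a \<eta>)\<^sup>2)" and b2: "integrable lborel (\<lambda>\<eta>. (b \<eta>)\<^sup>2)"
    using R Rs by (simp_all add: a_def b2eq)
  note a2s = integrable_reflect_shift[OF a2] and b2s = integrable_reflect_shift[OF b2]
  define K where "K = sqrt (LINT \<eta>|lborel. (b \<eta>)\<^sup>2) * sqrt (LINT \<eta>|lborel. (a \<eta>)\<^sup>2)"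
  have nn: "0 \<le> a x" "0 \<le> b x" for x by (simp_all add: a_def b_def)
  have "(1 + \<xi>\<^sup>2) powr (s/2) * norm (LINT \<eta>|lborel. R \<eta> * R (\<xi> - \<eta>)) \<le> 4 powr (s/2) * (K + K)" for \<xi>
  proof -
    have i1: "integrable lborel (\<lambda>\<eta>. b \<eta> * a (\<xi> - \<eta>))"
      by (rule integrable_mult_L2) (simp_all add: b2 a2s)
    have i2: "integrable lborel (\<lambda>\<eta>. a \<eta> * b (\<xi> - \<eta>))"
      by (rule integrable_mult_L2) (simp_all add: a2 b2s)
    have i0: "integrable lborel (\<lambda>\<eta>. R \<eta> * R (\<xi> - \<eta>))"
      by (rule integrable_mult_L2) (use R integrable_reflect_shift[OF R, of \<xi>] in simp_all)
    have "(LINT \<eta>|lborel. b \<eta> * a (\<xi> - \<eta>)) \<le> sqrt (LINT \<eta>|lborel. (norm (b \<eta>))\<^sup>2) * sqrt (LINT \<eta>|lborel. (norm (a (\<xi> - \<eta>)))\<^sup>2)"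
      using Cauchy_Schwarz_integral_norm[of b lborel "\<lambda>\<eta>. a (\<xi> - \<eta>)"] b2 a2s by simp
    then have k1: "(LINT \<eta>|lborel. b \<eta> * a (\<xi> - \<eta>)) \<le> K"
      using integral_reflect_shift[OF a2, of \<xi>] by (simp add: K_def)
    have "(LINT \<eta>|lborel. a \<eta> * b (\<xi> - \<eta>)) \<le> sqrt (LINT \<eta>|lborel. (norm (a \<eta>))\<^sup>2) * sqrt (LINT \<eta>|lborel. (norm (b (\<xi> - \<eta>)))\<^sup>2)"
      using Cauchy_Schwarz_integral_norm[of a lborel "\<lambda>\<eta>. b (\<xi> - \<eta>)"] a2 b2s by simp
    then have k2: "(LINT \<eta>|lborel. a \<eta> * b (\<xi> - \<eta>)) \<le> K"
      using integral_reflect_shift[OF b2, of \<xi>] by (simp add: K_def mult.commute)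
    have "(1 + \<xi>\<^sup>2) powr (s/2) * norm (LINT \<eta>|lborel. R \<eta> * R (\<xi> - \<eta>))
        \<le> (1 + \<xi>\<^sup>2) powr (s/2) * (LINT \<eta>|lborel. norm (R \<eta> * R (\<xi> - \<eta>)))"
      by (intro mult_left_mono integral_norm_bound) simp
    also have "\<dots> = (LINT \<eta>|lborel. (1 + \<xi>\<^sup>2) powr (s/2) * norm (R \<eta> * R (\<xi> - \<eta>)))"
      by (rule integral_mult_right_zero[symmetric])
    also have "\<dots> \<le> (LINT \<eta>|lborel. 4 powr (s/2) * (b \<eta> * a (\<xi> - \<eta>) + a \<eta> * b (\<xi> - \<eta>)))"
    proof (rule integral_mono)
      show "integrable lborel (\<lambda>\<eta>. (1 + \<xi>\<^sup>2) powr (s/2) * norm (R \<eta> * R (\<xi> - \<eta>)))"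
        using i0 by (intro integrable_mult_right integrable_norm)
      show "integrable lborel (\<lambda>\<eta>. 4 powr (s/2) * (b \<eta> * a (\<xi> - \<eta>) + a \<eta> * b (\<xi> - \<eta>)))"
        using i1 i2 by (intro integrable_mult_right Bochner_Integration.integrable_add)
      fix \<eta>
      have "(1 + \<xi>\<^sup>2) powr (s/2) * norm (R \<eta> * R (\<xi> - \<eta>))
          \<le> (4 powr (s/2) * ((1 + \<eta>\<^sup>2) powr (s/2) + (1 + (\<xi> - \<eta>)\<^sup>2) powr (s/2))) * norm (R \<eta> * R (\<xi> - \<eta>))"
        using s by (intro mult_right_mono weight_triangle) auto
      then show "(1 + \<xi>\<^sup>2) powr (s/2) * norm (R \<eta> * R (\<xi> - \<eta>)) \<le> 4 powr (s/2) * (b \<eta> * a (\<xi> - \<eta>) + a \<eta> * b (\<xi> - \<eta>))"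
        by (simp add: a_def b_def norm_mult algebra_simps)
    qed
    also have "\<dots> = 4 powr (s/2) * ((LINT \<eta>|lborel. b \<eta> * a (\<xi> - \<eta>)) + (LINT \<eta>|lborel. a \<eta> * b (\<xi> - \<eta>)))"
      by (simp only: integral_mult_right_zero Bochner_Integration.integral_add[OF i1 i2])
    also have "\<dots> \<le> 4 powr (s/2) * (K + K)" by (intro mult_left_mono add_mono k1 k2) simp
    finally show ?thesis .
  qed
  then show ?thesis by (rule that)
qed

text \<open>Comparison with the power -3/2 of \<open>1 + \<bar>x\<bar>\<close>, which has an
  explicit primitive, by way of
  \<open>(1 + \<bar>x\<bar>)\<^sup>2 \<le> 2 * (1 + x\<^sup>2)\<close>.\<close>

lemma integrable_weight: "integrable lborel (\<lambda>\<xi>::real. (1 + \<xi>\<^sup>2) powr (- (3/4)))"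
proof -
  let ?f = "\<lambda>x::real. (1 + x) powr (- (3/2))"
  have "(\<integral>\<^sup>+x. ennreal (?f x) * indicator {0..} x \<partial>lborel) = ennreal (0 - (- 2 * (1 + 0) powr (- (1/2))))"
  proof (rule nn_integral_FTC_atLeast)
    show "((\<lambda>x. - 2 * (1 + x) powr (- (1/2))) has_real_derivative ?f x) (at x)" if "0 \<le> x" for x :: real
      using that by (auto intro!: derivative_eq_intros)
    show "((\<lambda>x::real. - 2 * (1 + x) powr (- (1/2))) \<longlongrightarrow> 0) at_top" by real_asymp
  qed auto
  moreover have "ennreal (?f x * indicator {0..} x) = ennreal (?f x) * indicator {0..} x" for x
    by (simp add: indicator_def)
  ultimately have fin: "(\<integral>\<^sup>+x. ennreal (?f x * indicator {0..} x) \<partial>lborel) < \<infinity>"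
    by (simp only: infinity_ennreal_def ennreal_less_top)
  have h: "integrable lborel (\<lambda>x. ?f x * indicator {0..} x)"
    by (rule integrableI_nonneg[OF _ _ fin]) auto
  have h': "integrable lborel (\<lambda>x. ?f (- x) * indicator {0..} (- x))"
    using lborel_integrable_real_affine[OF h, of "-1" 0] by simp
  show ?thesis
  proof (rule integrable_bound_le)
    show "integrable lborel (\<lambda>x. 2 powr (3/4) * (?f x * indicator {0..} x + ?f (- x) * indicator {0..} (- x)))"
      using h h' by (intro integrable_mult_right Bochner_Integration.integrable_add)
    fix x :: real
    have "0 \<le> (1 - \<bar>x\<bar>)\<^sup>2" by simp
    then have "(1 + \<bar>x\<bar>)\<^sup>2 \<le> 2 * (1 + x\<^sup>2)" by (simp add: power2_eq_square algebra_simps)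
    then have "((1 + \<bar>x\<bar>)\<^sup>2) powr (3/4) \<le> (2 * (1 + x\<^sup>2)) powr (3/4)" by (intro powr_mono2) auto
    also have "\<dots> = 2 powr (3/4) * (1 + x\<^sup>2) powr (3/4)" by (rule powr_mult)
    also have "((1 + \<bar>x\<bar>)\<^sup>2) powr (3/4) = (1 + \<bar>x\<bar>) powr (3/2)"
      by (simp add: powr_power[symmetric] powr_powr flip: powr_numeral)
    finally have 1: "(1 + \<bar>x\<bar>) powr (3/2) \<le> 2 powr (3/4) * (1 + x\<^sup>2) powr (3/4)" .
    have p1: "0 < (1 + \<bar>x\<bar>) powr (3/2)" by (simp add: add_pos_nonneg)
    have "0 < 1 + x\<^sup>2" by (simp add: add_pos_nonneg)
    then have p2: "0 < (1 + x\<^sup>2) powr (3/4)" unfolding powr_gt_zero by linarith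
    have "1 / (1 + x\<^sup>2) powr (3/4) \<le> 2 powr (3/4) / (1 + \<bar>x\<bar>) powr (3/2)"
      using 1 p1 p2 by (simp add: divide_simps)
    then have "(1 + x\<^sup>2) powr (- (3/4)) \<le> 2 powr (3/4) * ?f \<bar>x\<bar>"
      by (simp add: powr_minus_divide)
    also have "\<dots> \<le> 2 powr (3/4) * (?f x * indicator {0..} x + ?f (- x) * indicator {0..} (- x))"
      by (intro mult_left_mono) (auto simp: indicator_def abs_if)
    finally show "norm ((1 + x\<^sup>2) powr (- (3/4))) \<le> 2 powr (3/4) * (?f x * indicator {0..} x + ?f (- x) * indicator {0..} (- x))"
      by simp
  qed measurable
qed

text \<open>Each round raises the exponent of the weight by \<open>1/4\<close>, up to \<open>\<beta>\<close>.\<close>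

lemma sobolev_bootstrap:
  fixes R Q G :: "real \<Rightarrow> complex"
  assumes [measurable]: "R \<in> borel_measurable borel" "Q \<in> borel_measurable borel" "G \<in> borel_measurable borel"
    and R: "integrable lborel (\<lambda>\<xi>. (norm (R \<xi>))\<^sup>2)"
    and Q: "integrable lborel (\<lambda>\<xi>. (1 + \<xi>\<^sup>2) powr (\<beta> - 1) * (norm (Q \<xi>))\<^sup>2)"
    and G: "\<And>\<xi>. of_real (2 * pi) * G \<xi> = (LINT \<eta>|lborel. R \<eta> * R (\<xi> - \<eta>))"
    and eq: "AE \<xi> in lborel. Q \<xi> = \<i> * of_real \<xi> * R \<xi> + G \<xi>"
    and \<beta>: "\<beta> \<ge> 0"
  shows "integrable lborel (\<lambda>\<xi>. (1 + \<xi>\<^sup>2) powr \<beta> * (norm (R \<xi>))\<^sup>2)"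
proof -
  have step: "integrable lborel (\<lambda>\<xi>. (1 + \<xi>\<^sup>2) powr t * (norm (R \<xi>))\<^sup>2)"
    if s: "0 \<le> s" "integrable lborel (\<lambda>\<xi>. (1 + \<xi>\<^sup>2) powr s * (norm (R \<xi>))\<^sup>2)"
      and t: "0 \<le> t" "t \<le> \<beta>" "t \<le> s + 1/4" for s t
  proof -
    obtain C where C: "\<And>\<xi>. (1 + \<xi>\<^sup>2) powr (s/2) * norm (LINT \<eta>|lborel. R \<eta> * R (\<xi> - \<eta>)) \<le> C"
      using autoconvolution_decay[OF _ R s] by (metis assms(1))
    have GC: "(1 + \<xi>\<^sup>2) powr s * (norm (G \<xi>))\<^sup>2 \<le> C\<^sup>2" for \<xi>
    proof -
      have "norm (G \<xi>) \<le> 2 * pi * norm (G \<xi>)"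
        using pi_ge_two mult_right_mono[of 1 "2 * pi" "norm (G \<xi>)"] by simp
      also have "\<dots> = norm (LINT \<eta>|lborel. R \<eta> * R (\<xi> - \<eta>))" by (simp add: G[symmetric] norm_mult)
      finally have "(1 + \<xi>\<^sup>2) powr (s/2) * norm (G \<xi>) \<le> C"
        using C[of \<xi>] mult_left_mono[of "norm (G \<xi>)" _ "(1 + \<xi>\<^sup>2) powr (s/2)"] by (meson order_trans powr_ge_zero)
      then have "((1 + \<xi>\<^sup>2) powr (s/2) * norm (G \<xi>))\<^sup>2 \<le> C\<^sup>2" by (intro power_mono) auto
      moreover have "((1 + \<xi>\<^sup>2) powr (s/2))\<^sup>2 = (1 + \<xi>\<^sup>2) powr s" unfolding power2_eq_square powr_add[symmetric] by simp
      ultimately show ?thesis by (simp add: power_mult_distrib)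
    qed
    \<comment> \<open>The first term serves \<open>\<bar>\<xi>\<bar> \<le> 1\<close>, where one
      cannot divide by \<open>\<xi>\<close>. In the last, \<open>G\<close> is only bounded against
      the weight, and the exponent left over is \<open>t - 1 - s\<close>, at most -3/4.
      Integrability would allow anything below -1/2, so a step of 1/4 is a safe choice.\<close>
    let ?dom = "\<lambda>\<xi>. 2 powr t * (norm (R \<xi>))\<^sup>2 + (4 * ((1 + \<xi>\<^sup>2) powr (\<beta> - 1) * (norm (Q \<xi>))\<^sup>2) + (4 * C\<^sup>2) * (1 + \<xi>\<^sup>2) powr (- (3/4)))"
    have dom: "integrable lborel ?dom"
      by (intro Bochner_Integration.integrable_add integrable_mult_right R Q integrable_weight)
    show ?thesis
    proof (rule Bochner_Integration.integrable_bound[OF dom])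
      show "AE \<xi> in lborel. norm ((1 + \<xi>\<^sup>2) powr t * (norm (R \<xi>))\<^sup>2) \<le> norm (?dom \<xi>)"
        using eq
      proof eventually_elim
        case (elim \<xi>)
        let ?w = "1 + \<xi>\<^sup>2"
        have w: "1 \<le> ?w" by simp
        have "?w powr t * (norm (R \<xi>))\<^sup>2 \<le> ?dom \<xi>"
        proof (cases "\<bar>\<xi>\<bar> \<le> 1")
          case True
          then have "\<xi>\<^sup>2 \<le> 1" by (simp add: abs_square_le_1)
          then have "?w powr t \<le> 2 powr t" using t(1) by (intro powr_mono2) auto
          then have "?w powr t * (norm (R \<xi>))\<^sup>2 \<le> 2 powr t * (norm (R \<xi>))\<^sup>2" by (intro mult_right_mono) auto
          then show ?thesis by (smt (verit) mult_nonneg_nonneg powr_ge_zero zero_le_power2)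
        next
          case False
          then have \<xi>2: "1 \<le> \<xi>\<^sup>2" by (metis abs_square_le_1 abs_le_square_iff abs_one linear one_power2)
          have "\<i> * of_real \<xi> * R \<xi> = Q \<xi> - G \<xi>" using elim by simp
          then have "\<bar>\<xi>\<bar> * norm (R \<xi>) = norm (Q \<xi> - G \<xi>)" by (metis norm_mult norm_ii norm_of_real mult_1)
          then have "\<xi>\<^sup>2 * (norm (R \<xi>))\<^sup>2 = (norm (Q \<xi> - G \<xi>))\<^sup>2" by (metis power_mult_distrib power2_abs)
          also have "\<dots> \<le> (norm (Q \<xi>) + norm (G \<xi>))\<^sup>2" by (intro power_mono norm_triangle_ineq4) auto
          also have "\<dots> \<le> 2 * (norm (Q \<xi>))\<^sup>2 + 2 * (norm (G \<xi>))\<^sup>2"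
            using sum_squares_bound[of "norm (Q \<xi>)" "norm (G \<xi>)"] unfolding power2_sum by linarith
          finally have 1: "\<xi>\<^sup>2 * (norm (R \<xi>))\<^sup>2 \<le> 2 * (norm (Q \<xi>))\<^sup>2 + 2 * (norm (G \<xi>))\<^sup>2" .
          have "?w * (norm (R \<xi>))\<^sup>2 \<le> (2 * \<xi>\<^sup>2) * (norm (R \<xi>))\<^sup>2" using \<xi>2 by (intro mult_right_mono) auto
          also have "\<dots> = 2 * (\<xi>\<^sup>2 * (norm (R \<xi>))\<^sup>2)" by simp
          also have "\<dots> \<le> 4 * (norm (Q \<xi>))\<^sup>2 + 4 * (norm (G \<xi>))\<^sup>2" using 1 by linarith
          finally have 2: "?w * (norm (R \<xi>))\<^sup>2 \<le> 4 * (norm (Q \<xi>))\<^sup>2 + 4 * (norm (G \<xi>))\<^sup>2" .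
          have "?w powr t = ?w powr (t - 1) * ?w" using w powr_add[of ?w "t - 1" 1] by simp
          then have "?w powr t * (norm (R \<xi>))\<^sup>2 = ?w powr (t - 1) * (?w * (norm (R \<xi>))\<^sup>2)" by (simp only: mult.assoc)
          also have "\<dots> \<le> ?w powr (t - 1) * (4 * (norm (Q \<xi>))\<^sup>2 + 4 * (norm (G \<xi>))\<^sup>2)"
            by (intro mult_left_mono 2) simp
          also have "\<dots> = 4 * (?w powr (t - 1) * (norm (Q \<xi>))\<^sup>2) + 4 * (?w powr (t - 1) * (norm (G \<xi>))\<^sup>2)"
            by (simp add: algebra_simps)
          also have "\<dots> \<le> 4 * (?w powr (\<beta> - 1) * (norm (Q \<xi>))\<^sup>2) + (4 * C\<^sup>2) * ?w powr (- (3/4))"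
          proof (intro add_mono)
            show "4 * (?w powr (t - 1) * (norm (Q \<xi>))\<^sup>2) \<le> 4 * (?w powr (\<beta> - 1) * (norm (Q \<xi>))\<^sup>2)"
              using t w by (intro mult_left_mono mult_right_mono powr_mono) auto
            have "?w powr (t - 1) \<le> ?w powr (- (3/4) + s)" using t w by (intro powr_mono) auto
            then have "?w powr (t - 1) * (norm (G \<xi>))\<^sup>2 \<le> ?w powr (- (3/4) + s) * (norm (G \<xi>))\<^sup>2"
              by (intro mult_right_mono) auto
            also have "\<dots> = ?w powr (- (3/4)) * (?w powr s * (norm (G \<xi>))\<^sup>2)" by (simp only: powr_add mult.assoc)
            also have "\<dots> \<le> ?w powr (- (3/4)) * C\<^sup>2" by (intro mult_left_mono GC) simp
            finally show "4 * (?w powr (t - 1) * (norm (G \<xi>))\<^sup>2) \<le> (4 * C\<^sup>2) * ?w powr (- (3/4))"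
              by (simp add: mult_ac)
          qed
          also have "\<dots> \<le> ?dom \<xi>" by simp
          finally show ?thesis .
        qed
        moreover have "0 \<le> ?w powr t * (norm (R \<xi>))\<^sup>2" by simp
        ultimately show ?case by (simp only: real_norm_def abs_of_nonneg order_trans[OF _ abs_ge_self])
      qed
    qed measurable
  qed
  \<comment> \<open>The exponent climbs from 0, where the hypothesis is plain square integrability,
    and the minimum stops it at \<open>\<beta>\<close>, beyond which \<open>Q\<close> has no decay
    to offer.\<close>
  have all: "integrable lborel (\<lambda>\<xi>. (1 + \<xi>\<^sup>2) powr (min \<beta> (real n / 4)) * (norm (R \<xi>))\<^sup>2)" for n
  proof (induction n)
    case 0
    have "(1 + \<xi>\<^sup>2) powr 0 = 1" for \<xi> :: real
    proof -
      have "0 < 1 + \<xi>\<^sup>2" by (simp add: add_pos_nonneg)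
      then show ?thesis by (metis powr_zero_eq_one less_irrefl)
    qed
    moreover have "min \<beta> (real 0 / 4) = 0" using \<beta> by simp
    ultimately show ?case using R by (simp only: mult_1_left)
  next
    case (Suc n)
    show ?case by (rule step[OF _ Suc]) (use \<beta> in \<open>auto simp: min_def field_simps\<close>)
  qed
  obtain n where "4 * \<beta> \<le> real n" using real_arch_simple by blast
  then have "min \<beta> (real n / 4) = \<beta>" by simp
  then show ?thesis using all[of n] by (simp only:)
qed

subsection \<open>The Miura map\<close>

lemma L1_weighted_integrable:
  fixes h :: "real \<Rightarrow> complex"
  assumes h: "integrable lborel h"
  shows "integrable lborel (\<lambda>x. norm (h x) / (1 + x\<^sup>2))"
proof (rule integrable_bound_le[OF integrable_norm[OF h]])
  have [measurable]: "h \<in> borel_measurable borel" using borel_measurable_integrable[OF h] by simp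
  show "(\<lambda>x. norm (h x) / (1 + x\<^sup>2)) \<in> borel_measurable lborel" by measurable
  show "norm (norm (h x) / (1 + x\<^sup>2)) \<le> norm (h x)" for x
    using divide_left_mono[of 1 "1 + x\<^sup>2" "norm (h x)"] by (simp add: add_pos_nonneg)
qed

lemma L2_weighted_integrable:
  fixes h :: "real \<Rightarrow> complex"
  assumes [measurable]: "h \<in> borel_measurable borel" and h: "integrable lborel (\<lambda>x. (norm (h x))\<^sup>2)"
  shows "integrable lborel (\<lambda>x. norm (h x) / (1 + x\<^sup>2))"
proof (rule integrable_bound_le[OF Bochner_Integration.integrable_add[OF h integrable_inverse_1_plus_sq]])
  show "(\<lambda>x. norm (h x) / (1 + x\<^sup>2)) \<in> borel_measurable lborel" by measurable
  fix x :: real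
  have p: "1 \<le> 1 + x\<^sup>2" by simp
  have "norm (h x) \<le> (norm (h x))\<^sup>2 + 1"
    using sum_squares_bound[of "norm (h x)" 1] norm_ge_zero[of "h x"] unfolding power_one mult_1_right by linarith
  then have "norm (h x) / (1 + x\<^sup>2) \<le> ((norm (h x))\<^sup>2 + 1) / (1 + x\<^sup>2)"
    using p by (intro divide_right_mono) auto
  also have "\<dots> = (norm (h x))\<^sup>2 / (1 + x\<^sup>2) + 1 / (1 + x\<^sup>2)" by (rule add_divide_distrib)
  also have "(norm (h x))\<^sup>2 / (1 + x\<^sup>2) \<le> (norm (h x))\<^sup>2 / 1"
    by (rule divide_left_mono) (use p in \<open>auto intro: add_pos_nonneg\<close>)
  finally show "norm (norm (h x) / (1 + x\<^sup>2)) \<le> (norm (h x))\<^sup>2 + 1 / (1 + x\<^sup>2)" by simp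
qed

lemma of_real_L2:
  fixes r :: "real \<Rightarrow> real"
  assumes [measurable]: "r \<in> borel_measurable borel" and r: "integrable lborel (\<lambda>x. (r x)\<^sup>2)"
  shows "integrable lborel (\<lambda>x. norm (complex_of_real (r x)) / (1 + x\<^sup>2))"
    and "integrable lborel (\<lambda>x. norm (complex_of_real ((r x)\<^sup>2)) / (1 + x\<^sup>2))"
  by (rule L2_weighted_integrable; use r in simp)
    (rule L1_weighted_integrable, rule integrable_of_real, rule r)

lemma schwartz_pairing_linear:
  fixes h :: "real \<Rightarrow> complex"
  assumes [measurable]: "h \<in> borel_measurable borel" and h: "integrable lborel (\<lambda>x. norm (h x) / (1 + x\<^sup>2))"
    and n: "n \<le> 2"
  shows "linear_functional_on schwartz_functions (\<lambda>\<phi>. LINT x|lborel. h x * nderiv n \<phi> x)"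
  unfolding linear_functional_on_def
proof (intro conjI ballI allI)
  fix \<phi> \<psi> assume S: "\<phi> \<in> schwartz_functions" "\<psi> \<in> schwartz_functions"
  show "(LINT x|lborel. h x * nderiv n (\<lambda>x. \<phi> x + \<psi> x) x)
      = (LINT x|lborel. h x * nderiv n \<phi> x) + (LINT x|lborel. h x * nderiv n \<psi> x)"
    unfolding nderiv_add[OF schwartz_smooth[OF S(1)] schwartz_smooth[OF S(2)]] distrib_left
    by (intro Bochner_Integration.integral_add schwartz_pairing(1) assms S)
next
  fix c \<phi> assume S: "\<phi> \<in> schwartz_functions"
  show "(LINT x|lborel. h x * nderiv n (\<lambda>x. c * \<phi> x) x) = c * (LINT x|lborel. h x * nderiv n \<phi> x)"
    unfolding nderiv_cmult[OF schwartz_smooth[OF S]] mult.left_commute[of _ c]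
    by (rule integral_mult_right_zero)
qed

lemma function_tempered:
  fixes h :: "real \<Rightarrow> complex"
  assumes hm: "h \<in> borel_measurable borel" and h: "integrable lborel (\<lambda>x. norm (h x) / (1 + x\<^sup>2))"
  shows "(\<lambda>\<phi>\<in>schwartz_functions. LINT x|lborel. h x * \<phi> x) \<in> tempered_distributions"
proof -
  have lin: "linear_functional_on schwartz_functions (\<lambda>\<phi>\<in>schwartz_functions. LINT x|lborel. h x * \<phi> x)"
    using schwartz_pairing_linear[OF hm h, of 0]
    by (simp add: linear_functional_on_def schwartz_add schwartz_cmult)
  have "norm (LINT x|lborel. h x * \<phi> x)
      \<le> (LINT x|lborel. norm (h x) / (1 + x\<^sup>2)) * (\<Sum>k\<le>2. \<Sum>n\<le>2. SUP x. \<bar>x\<bar> ^ k * norm (nderiv n \<phi> x))"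
    if "\<phi> \<in> schwartz_functions" for \<phi>
    using schwartz_pairing(2)[OF hm h that, of 0] by (simp only: schwartz_seminorm_def nderiv_0)
  then have "\<exists>N C. \<forall>\<phi>\<in>schwartz_functions. norm ((\<lambda>\<phi>\<in>schwartz_functions. LINT x|lborel. h x * \<phi> x) \<phi>)
      \<le> C * (\<Sum>k\<le>N. \<Sum>n\<le>N. SUP x. \<bar>x\<bar> ^ k * norm (nderiv n \<phi> x))"
    by (intro exI ballI) (simp only: restrict_apply')
  with lin show ?thesis by (simp only: tempered_distributions_def restrict_extensional mem_Collect_eq simp_thms)
qed

lemma linear_functional_on_mono:
  "linear_functional_on V T \<Longrightarrow> W \<subseteq> V \<Longrightarrow> linear_functional_on W T"
  unfolding linear_functional_on_def by blast

lemma dist_of_fun_linear: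
  fixes h :: "real \<Rightarrow> complex"
  assumes "h \<in> borel_measurable borel" "integrable lborel (\<lambda>x. norm (h x) / (1 + x\<^sup>2))"
  shows "linear_functional_on test_functions (dist_of_fun h)"
  using linear_functional_on_mono[OF schwartz_pairing_linear[OF assms, of 0] test_subset_schwartz]
  by (simp add: dist_of_fun_def linear_functional_on_def test_function_add test_function_cmult)

lemma dist_of_fun_distribution:
  fixes h :: "real \<Rightarrow> complex"
  assumes hm [measurable]: "h \<in> borel_measurable borel" and h: "integrable lborel (\<lambda>x. norm (h x) / (1 + x\<^sup>2))"
  shows "dist_of_fun h \<in> distributions"
proof -
  have "\<exists>N C. \<forall>\<phi>\<in>test_functions. closure {x. \<phi> x \<noteq> 0} \<subseteq> K \<longrightarrow>
      norm (dist_of_fun h \<phi>) \<le> C * (\<Sum>n\<le>N. SUP x. norm (nderiv n \<phi> x))" if "compact K" for K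
  proof -
    obtain M where M: "\<forall>x\<in>K. \<bar>x\<bar> \<le> M"
      using compact_imp_bounded[OF \<open>compact K\<close>] by (auto simp: bounded_iff)
    let ?I = "LINT x|lborel. norm (h x) / (1 + x\<^sup>2)"
    have "norm (dist_of_fun h \<phi>) \<le> (?I * (1 + M\<^sup>2)) * (\<Sum>n\<le>0. SUP x. norm (nderiv n \<phi> x))"
      if \<phi>: "\<phi> \<in> test_functions" and K: "closure {x. \<phi> x \<noteq> 0} \<subseteq> K" for \<phi>
    proof -
      have S: "\<phi> \<in> schwartz_functions" using \<phi> test_subset_schwartz by blast
      define s where "s = (SUP x. norm (\<phi> x))"
      have s: "norm (\<phi> x) \<le> s" "0 \<le> s" for x
        using schwartz_SUP(1)[OF S, of x 0 0] schwartz_SUP(2)[OF S, of 0 0] unfolding s_def by simp_all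
      have le: "norm (h x * \<phi> x) \<le> norm (h x) / (1 + x\<^sup>2) * ((1 + M\<^sup>2) * s)" for x
      proof (cases "\<phi> x = 0")
        case False
        then have "x \<in> K" using K closure_subset[of "{x. \<phi> x \<noteq> 0}"] by blast
        then have "x\<^sup>2 \<le> M\<^sup>2" using M by (metis abs_ge_zero power2_abs power_mono)
        then have "(1 + x\<^sup>2) * norm (\<phi> x) \<le> (1 + M\<^sup>2) * s"
          using s by (intro mult_mono) auto
        then have "norm (h x) / (1 + x\<^sup>2) * ((1 + x\<^sup>2) * norm (\<phi> x)) \<le> norm (h x) / (1 + x\<^sup>2) * ((1 + M\<^sup>2) * s)"
          by (rule mult_left_mono) simp
        moreover have "1 + x\<^sup>2 \<noteq> 0" using add_pos_nonneg[of 1 "x\<^sup>2"] by simp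
        ultimately show ?thesis by (simp add: norm_mult)
      qed (simp add: s)
      have i: "integrable lborel (\<lambda>x. h x * \<phi> x)" using schwartz_pairing(1)[OF hm h S, of 0] by simp
      have "norm (LINT x|lborel. h x * \<phi> x) \<le> (LINT x|lborel. norm (h x * \<phi> x))" by (rule integral_norm_bound)
      also have "\<dots> \<le> (LINT x|lborel. norm (h x) / (1 + x\<^sup>2) * ((1 + M\<^sup>2) * s))"
        by (intro integral_mono integrable_norm i integrable_mult_left h le)
      also have "\<dots> = ?I * ((1 + M\<^sup>2) * s)" by (rule integral_mult_left_zero)
      finally show ?thesis using \<phi> by (simp add: dist_of_fun_def s_def mult.assoc)
    qed
    then show ?thesis by blast
  qed
  then show ?thesis
    using dist_of_fun_linear[OF hm h] by (simp add: distributions_def dist_of_fun_def)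
qed

lemma dist_eval:
  "\<phi> \<in> test_functions \<Longrightarrow> dist_add (dist_deriv (dist_of_fun f)) (dist_of_fun g) \<phi>
    = - (LINT x|lborel. f x * nderiv 1 \<phi> x) + (LINT x|lborel. g x * \<phi> x)"
  by (simp add: dist_add_def dist_deriv_def dist_of_fun_def test_function_nderiv)

text \<open>The functions \<open>f\<close> and \<open>g\<close> that represent \<open>q\<close> are
  allowed to be complex. On real test functions the real part of the value sees only their real
  parts, which is how real data for the Riccati equation arise.\<close>

lemma dist_eval_real_test:
  fixes f g :: "real \<Rightarrow> complex"
  assumes [measurable]: "f \<in> borel_measurable borel" and f: "integrable lborel (\<lambda>x. (norm (f x))\<^sup>2)"
    and g: "integrable lborel g" and p: "real_test p"
  shows "Re (dist_add (dist_deriv (dist_of_fun f)) (dist_of_fun g) (\<lambda>x. of_real (p x)))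
    = - (LINT x|lborel. Re (f x) * real_deriv p x) + (LINT x|lborel. Re (g x) * p x)"
proof -
  let ?\<phi> = "\<lambda>x. complex_of_real (p x)"
  have \<phi>: "?\<phi> \<in> test_functions" using p by (simp add: real_test_def)
  have S: "?\<phi> \<in> schwartz_functions" using \<phi> test_subset_schwartz by blast
  have [measurable]: "g \<in> borel_measurable borel" using borel_measurable_integrable[OF g] by simp
  have i: "integrable lborel (\<lambda>x. f x * of_real (real_deriv p x))"
    using schwartz_pairing(1)[OF _ L2_weighted_integrable[OF _ f] S, of 1] by (simp only: nderiv_1_of_real[OF p]) simp
  have j: "integrable lborel (\<lambda>x. g x * of_real (p x))"
    using schwartz_pairing(1)[OF _ L1_weighted_integrable[OF g] S, of 0] by simp
  show ?thesis
    unfolding dist_eval[OF \<phi>] nderiv_1_of_real[OF p] plus_complex.sel uminus_complex.sel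
      integral_Re[OF i, symmetric] integral_Re[OF j, symmetric]
    by simp
qed

lemma linear_real_test_eqI:
  assumes "S \<in> extensional test_functions" "T \<in> extensional test_functions"
    and S: "linear_functional_on test_functions S" and T: "linear_functional_on test_functions T"
    and eq: "\<And>p. real_test p \<Longrightarrow> S (\<lambda>x. of_real (p x)) = T (\<lambda>x. of_real (p x))"
  shows "S = T"
proof (rule extensionalityI[OF assms(1,2)])
  fix \<phi> assume \<phi>: "\<phi> \<in> test_functions"
  let ?u = "\<lambda>x. complex_of_real (Re (\<phi> x))" and ?v = "\<lambda>x. complex_of_real (Im (\<phi> x))"
  have "?u = (\<lambda>x. (1/2) * (\<phi> x + cnj (\<phi> x)))" by (auto simp: complex_eq_iff)
  then have u: "?u \<in> test_functions"
    by (simp only:) (intro test_function_cmult test_function_add test_function_cnj \<phi>)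
  have "?v = (\<lambda>x. (- \<i>/2) * (\<phi> x + (-1) * cnj (\<phi> x)))" by (auto simp: complex_eq_iff)
  then have v: "?v \<in> test_functions"
    by (simp only:) (intro test_function_cmult test_function_add test_function_cnj \<phi>)
  have split: "\<phi> = (\<lambda>x. ?u x + \<i> * ?v x)" by (auto simp: complex_eq_iff)
  have e: "X \<phi> = X ?u + \<i> * X ?v" if X: "linear_functional_on test_functions X" for X
  proof -
    have iv: "(\<lambda>x. \<i> * ?v x) \<in> test_functions" by (intro test_function_cmult v)
    have "X \<phi> = X (\<lambda>x. ?u x + \<i> * ?v x)" by (rule arg_cong[OF split])
    also have "\<dots> = X ?u + X (\<lambda>x. \<i> * ?v x)" by (rule X[unfolded linear_functional_on_def, THEN conjunct1, rule_format, OF u iv])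
    also have "X (\<lambda>x. \<i> * ?v x) = \<i> * X ?v" by (rule X[unfolded linear_functional_on_def, THEN conjunct2, rule_format, OF v])
    finally show ?thesis .
  qed
  show "S \<phi> = T \<phi>"
    unfolding e[OF S] e[OF T] by (simp only: eq[unfolded real_test_def, OF u] eq[unfolded real_test_def, OF v])
qed

section \<open>The quadratic form and the regularity of Miura preimages\<close>

lemma miura_linear:
  fixes r :: "real \<Rightarrow> real"
  assumes [measurable]: "r \<in> borel_measurable borel" and r: "integrable lborel (\<lambda>x. (r x)\<^sup>2)"
  shows "linear_functional_on test_functions (miura r)"
proof -
  have m: "(\<lambda>x. complex_of_real (r x)) \<in> borel_measurable borel"
    "(\<lambda>x. complex_of_real ((r x)\<^sup>2)) \<in> borel_measurable borel" by measurable
  have 1: "linear_functional_on test_functions (\<lambda>\<phi>. LINT x|lborel. of_real (r x) * nderiv 1 \<phi> x)"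
    by (rule linear_functional_on_mono[OF schwartz_pairing_linear[OF m(1) of_real_L2(1)[OF _ r]] test_subset_schwartz]) simp_all
  have 2: "linear_functional_on test_functions (\<lambda>\<phi>. LINT x|lborel. of_real ((r x)\<^sup>2) * nderiv 0 \<phi> x)"
    by (rule linear_functional_on_mono[OF schwartz_pairing_linear[OF m(2) of_real_L2(2)[OF _ r]] test_subset_schwartz]) simp_all
  from 1 2 show ?thesis
    unfolding linear_functional_on_def miura_def
    by (simp add: dist_eval test_function_add test_function_cmult algebra_simps)
qed

lemma miura_schroedinger_nonneg:
  fixes r :: "real \<Rightarrow> real"
  assumes [measurable]: "r \<in> borel_measurable borel" and r: "integrable lborel (\<lambda>x. (r x)\<^sup>2)"
  shows "schroedinger_nonneg (miura r)"
  unfolding schroedinger_nonneg_def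
proof
  fix \<phi> assume \<phi>: "\<phi> \<in> test_functions"
  note sm = test_function_smooth[OF \<phi>]
  let ?\<psi> = "\<lambda>x. complex_of_real ((norm (\<phi> x))\<^sup>2)"
  let ?D = "\<lambda>x. 2 * Re (\<phi> x * cnj (nderiv 1 \<phi> x))"
  \<comment> \<open>Written as a product with the conjugate, the squared modulus is visibly smooth,
    and its derivative is the mixed term of
    \<open>\<bar>\<phi>' - r \<phi>\<bar>\<^sup>2\<close>.\<close>
  have e: "?\<psi> = (\<lambda>x. \<phi> x * cnj (\<phi> x))" by (simp only: complex_norm_square)
  have \<psi>: "?\<psi> \<in> test_functions" unfolding e by (intro test_function_mult smooth_cnj \<phi> sm)
  have S: "?\<psi> \<in> schwartz_functions" using \<psi> test_subset_schwartz by blast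
  have dc: "nderiv 1 (\<lambda>x. cnj (\<phi> x)) = (\<lambda>x. cnj (nderiv 1 \<phi> x))"
    by (intro nderiv_1_eqI has_vector_derivative_cnj smooth_has_vector_derivative_1 sm)
  have d: "nderiv 1 ?\<psi> = (\<lambda>x. of_real (?D x))"
    unfolding e nderiv_1_mult[OF sm smooth_cnj[OF sm]] dc by (auto simp: complex_eq_iff)
  have "integrable lborel (\<lambda>x. complex_of_real (r x) * nderiv 1 ?\<psi> x)"
    by (rule schwartz_pairing(1)[OF _ of_real_L2(1)[OF _ r] S]) simp_all
  then have "integrable lborel (\<lambda>x. complex_of_real (r x * ?D x))" unfolding d of_real_mult .
  then have i1: "integrable lborel (\<lambda>x. r x * ?D x)" by (rule integrable_Re[of _ "\<lambda>x. complex_of_real (r x * ?D x)", unfolded Re_complex_of_real])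
  have "integrable lborel (\<lambda>x. complex_of_real ((r x)\<^sup>2) * nderiv 0 ?\<psi> x)"
    by (rule schwartz_pairing(1)[OF _ of_real_L2(2)[OF _ r] S]) simp_all
  then have "integrable lborel (\<lambda>x. complex_of_real ((r x)\<^sup>2 * (norm (\<phi> x))\<^sup>2))" by simp
  then have i2: "integrable lborel (\<lambda>x. (r x)\<^sup>2 * (norm (\<phi> x))\<^sup>2)"
    by (rule integrable_Re[of _ "\<lambda>x. complex_of_real ((r x)\<^sup>2 * (norm (\<phi> x))\<^sup>2)", unfolded Re_complex_of_real])
  have i3: "integrable lborel (\<lambda>x. (norm (nderiv 1 \<phi> x))\<^sup>2)"
    using \<phi> test_subset_schwartz by (intro schwartz_square_integrable schwartz_nderiv) blast
  have "miura r ?\<psi> = - (LINT x|lborel. complex_of_real (r x * ?D x)) + (LINT x|lborel. complex_of_real ((r x)\<^sup>2 * (norm (\<phi> x))\<^sup>2))"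
    unfolding miura_def dist_eval[OF \<psi>] d of_real_mult ..
  then have "Re (miura r ?\<psi>) = - (LINT x|lborel. r x * ?D x) + (LINT x|lborel. (r x)\<^sup>2 * (norm (\<phi> x))\<^sup>2)"
    by (simp only: integral_complex_of_real plus_complex.sel uminus_complex.sel Re_complex_of_real)
  then have "(LINT x|lborel. (norm (nderiv 1 \<phi> x))\<^sup>2) + Re (miura r ?\<psi>)
      = (LINT x|lborel. (norm (nderiv 1 \<phi> x))\<^sup>2 - r x * ?D x + (r x)\<^sup>2 * (norm (\<phi> x))\<^sup>2)"
    by (simp only: Bochner_Integration.integral_add[OF Bochner_Integration.integrable_diff[OF i3 i1] i2]
        Bochner_Integration.integral_diff[OF i3 i1])
  also have "\<dots> = (LINT x|lborel. (norm (nderiv 1 \<phi> x - of_real (r x) * \<phi> x))\<^sup>2)"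
    by (intro Bochner_Integration.integral_cong refl) (unfold cmod_power2, simp add: power2_eq_square algebra_simps)
  also have "0 \<le> \<dots>" by simp
  finally show "0 \<le> (LINT x|lborel. (norm (nderiv 1 \<phi> x))\<^sup>2) + Re (miura r ?\<psi>)" .
qed

text \<open>Membership in the Sobolev space supplies some tempered \<open>U\<close> that agrees with
  the Miura image on test functions only, while its Fourier transform is defined through values at
  transforms of Schwartz functions, which need not have compact support. Both sides are continuous
  for the Schwartz seminorms, and the cutoffs of \<open>schwartz_cutoff\<close> approximate
  \<open>\<psi>\<close>.\<close>

lemma tempered_ext_schwartz:
  fixes r :: "real \<Rightarrow> real"
  assumes [measurable]: "r \<in> borel_measurable borel" and r: "integrable lborel (\<lambda>x. (r x)\<^sup>2)"
    and U: "U \<in> tempered_distributions" and eq: "miura r = restrict U test_functions"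
    and \<psi>: "\<psi> \<in> schwartz_functions"
  shows "U \<psi> = - (LINT x|lborel. of_real (r x) * nderiv 1 \<psi> x) + (LINT x|lborel. of_real ((r x)\<^sup>2) * \<psi> x)"
proof -
  let ?V1 = "\<lambda>\<psi>. LINT x|lborel. complex_of_real (r x) * nderiv 1 \<psi> x"
  let ?V2 = "\<lambda>\<psi>. LINT x|lborel. complex_of_real ((r x)\<^sup>2) * nderiv 0 \<psi> x"
  have m: "(\<lambda>x. complex_of_real (r x)) \<in> borel_measurable borel"
    "(\<lambda>x. complex_of_real ((r x)\<^sup>2)) \<in> borel_measurable borel" by measurable
  have V1: "linear_functional_on schwartz_functions ?V1"
    by (rule schwartz_pairing_linear[OF m(1) of_real_L2(1)[OF _ r]]) simp_all
  have V2: "linear_functional_on schwartz_functions ?V2"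
    by (rule schwartz_pairing_linear[OF m(2) of_real_L2(2)[OF _ r]]) simp_all
  have UL: "linear_functional_on schwartz_functions U" using U by (simp add: tempered_distributions_def)
  obtain N C where UC: "\<And>\<phi>. \<phi> \<in> schwartz_functions \<Longrightarrow> norm (U \<phi>) \<le> C * schwartz_seminorm N \<phi>"
    using U unfolding tempered_distributions_def schwartz_seminorm_def by blast
  define A where "A = (LINT x|lborel. norm (complex_of_real (r x)) / (1 + x\<^sup>2))"
  define B where "B = (LINT x|lborel. norm (complex_of_real ((r x)\<^sup>2)) / (1 + x\<^sup>2))"
  have A: "norm (?V1 \<phi>) \<le> A * schwartz_seminorm 2 \<phi>" if "\<phi> \<in> schwartz_functions" for \<phi>
    unfolding A_def by (rule schwartz_pairing(2)[OF m(1) of_real_L2(1)[OF _ r] that]) simp_all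
  have B: "norm (?V2 \<phi>) \<le> B * schwartz_seminorm 2 \<phi>" if "\<phi> \<in> schwartz_functions" for \<phi>
    unfolding B_def by (rule schwartz_pairing(2)[OF m(2) of_real_L2(2)[OF _ r] that]) simp_all
  have "norm (U \<psi> - (- ?V1 \<psi> + ?V2 \<psi>)) \<le> 0"
  proof (rule schwartz_cutoff)
    fix X :: "nat \<Rightarrow> real \<Rightarrow> complex"
    assume test: "\<And>m \<psi>. \<psi> \<in> schwartz_functions \<Longrightarrow> (\<lambda>x. X m x * \<psi> x) \<in> test_functions"
      and lim: "\<And>N \<psi>. \<psi> \<in> schwartz_functions \<Longrightarrow> (\<lambda>m. schwartz_seminorm N (\<lambda>x. \<psi> x - X m x * \<psi> x)) \<longlonglongrightarrow> 0"
    define t where "t = (\<lambda>m x. X m x * \<psi> x)"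
    define d where "d = (\<lambda>m x. \<psi> x - X m x * \<psi> x)"
    have t: "t m \<in> test_functions" for m unfolding t_def by (rule test[OF \<psi>])
    have tS: "t m \<in> schwartz_functions" for m using t test_subset_schwartz by blast
    have "d m = (\<lambda>x. \<psi> x + (-1) * t m x)" for m by (simp add: d_def t_def)
    then have dS: "d m \<in> schwartz_functions" for m by (simp only:) (intro schwartz_add schwartz_cmult \<psi> tS)
    have split: "\<psi> = (\<lambda>x. t m x + d m x)" for m by (simp add: d_def t_def)
    have lin: "T \<psi> = T (t m) + T (d m)" if T: "linear_functional_on schwartz_functions T" for T :: "(real \<Rightarrow> complex) \<Rightarrow> complex" and m
    proof -
      have "T \<psi> = T (\<lambda>x. t m x + d m x)" by (rule arg_cong[OF split])
      also have "\<dots> = T (t m) + T (d m)"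
        by (rule T[unfolded linear_functional_on_def, THEN conjunct1, rule_format, OF tS dS])
      finally show ?thesis .
    qed
    have Ut: "U (t m) = - ?V1 (t m) + ?V2 (t m)" for m
    proof -
      have "U (t m) = miura r (t m)" using t by (simp add: eq)
      also have "\<dots> = - ?V1 (t m) + ?V2 (t m)" unfolding miura_def dist_eval[OF t] nderiv_0 ..
      finally show ?thesis .
    qed
    have diff_lemma: "(- a + b) + u - (- (a + c) + (b + e)) = u + (c - e)" for a b c e u :: complex by simp
    have le: "norm (U \<psi> - (- ?V1 \<psi> + ?V2 \<psi>))
        \<le> C * schwartz_seminorm N (d m) + (A * schwartz_seminorm 2 (d m) + B * schwartz_seminorm 2 (d m))" for m
    proof -
      have "U \<psi> - (- ?V1 \<psi> + ?V2 \<psi>) = U (d m) + (?V1 (d m) - ?V2 (d m))"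
        unfolding lin[OF UL, of m] lin[OF V1, of m] lin[OF V2, of m] Ut by (rule diff_lemma)
      also have "norm \<dots> \<le> norm (U (d m)) + (norm (?V1 (d m)) + norm (?V2 (d m)))"
        by (intro norm_triangle_le add_mono order_refl norm_triangle_ineq4)
      finally show ?thesis using UC[OF dS, of m] A[OF dS, of m] B[OF dS, of m] by linarith
    qed
    have l: "(\<lambda>m. C * schwartz_seminorm N (d m) + (A * schwartz_seminorm 2 (d m) + B * schwartz_seminorm 2 (d m))) \<longlonglongrightarrow> C * 0 + (A * 0 + B * 0)"
      unfolding d_def by (intro tendsto_add tendsto_mult tendsto_const lim \<psi>)
    have "norm (U \<psi> - (- ?V1 \<psi> + ?V2 \<psi>)) \<le> C * 0 + (A * 0 + B * 0)"
      by (rule LIMSEQ_le_const[OF l]) (use le in blast)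
    then show ?thesis by simp
  qed
  then show ?thesis by simp
qed

lemma set_integrable_Icc_bound:
  fixes H :: "real \<Rightarrow> complex"
  assumes [measurable]: "H \<in> borel_measurable borel" and w: "integrable lborel w"
    and le: "\<And>x. \<bar>x\<bar> \<le> N \<Longrightarrow> norm (H x) \<le> C + w x" and w0: "\<And>x. 0 \<le> w x" and "0 \<le> C"
  shows "set_integrable lborel {- N..N} H"
  unfolding set_integrable_def
proof (rule integrable_bound_le)
  have "integrable lborel (\<lambda>x. C * indicator {-N..N} x :: real)"
    by (intro integrable_mult_right integrable_real_indicator) (simp_all add: emeasure_lborel_Icc_eq)
  then show "integrable lborel (\<lambda>x. C * indicator {-N..N} x + w x)" using w by (rule Bochner_Integration.integrable_add)
  show "norm (indicator {- N..N} x *\<^sub>R H x) \<le> C * indicator {-N..N} x + w x" for x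
  proof (cases "x \<in> {-N..N}")
    case True
    then have "\<bar>x\<bar> \<le> N" by auto
    then show ?thesis using le[of x] True by simp
  qed (use w0 in simp)
qed measurable

text \<open>Evaluating \<open>U\<close> at the transform of a test function expresses the pairing
  with \<open>Q\<close> through \<open>r\<close> and \<open>r\<^sup>2\<close>; moving the transforms
  back gives \<open>Q = \<i> \<xi> R + G\<close> almost everywhere. This is an identity between
  functions, on which the bootstrap can work.\<close>

lemma miura_preimage_sobolev:
  fixes r :: "real \<Rightarrow> real"
  assumes rm [measurable]: "r \<in> borel_measurable borel" and r: "integrable lborel (\<lambda>x. (r x)\<^sup>2)"
    and q: "miura r \<in> sobolev (\<beta> - 1)" and \<beta>: "\<beta> \<ge> 0"
  shows "r \<in> real_sobolev_functions \<beta>"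
proof (rule L2_fourier[OF rm r])
  fix R :: "real \<Rightarrow> complex"
  assume Rm [measurable]: "R \<in> borel_measurable borel" and R: "integrable lborel (\<lambda>\<xi>. (norm (R \<xi>))\<^sup>2)"
    and four: "\<And>\<phi>. \<phi> \<in> schwartz_functions \<Longrightarrow> (LINT x|lborel. of_real (r x) * fourier \<phi> x) = (LINT \<xi>|lborel. R \<xi> * \<phi> \<xi>)"
    and conv: "\<And>\<xi>. of_real (2 * pi) * fourier (\<lambda>x. of_real ((r x)\<^sup>2)) \<xi> = (LINT \<eta>|lborel. R \<eta> * R (\<xi> - \<eta>))"
  obtain U Q where U: "U \<in> tempered_distributions" "miura r = restrict U test_functions"
    and "Q \<in> borel_measurable lborel"
    and Q: "integrable lborel (\<lambda>\<xi>. (1 + \<xi>\<^sup>2) powr (\<beta> - 1) * (norm (Q \<xi>))\<^sup>2)"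
    and FU: "fourier_tempered U = (\<lambda>\<phi>\<in>schwartz_functions. LINT \<xi>|lborel. Q \<xi> * \<phi> \<xi>)"
    using q unfolding sobolev_def by blast
  then have Qm [measurable]: "Q \<in> borel_measurable borel" by simp
  have r2: "integrable lborel (\<lambda>x. complex_of_real ((r x)\<^sup>2))" using r by (rule integrable_of_real)
  define G where "G = fourier (\<lambda>x. complex_of_real ((r x)\<^sup>2))"
  have Gm [measurable]: "G \<in> borel_measurable borel" unfolding G_def by (rule fourier_measurable[OF r2])
  \<comment> \<open>The weight in the hypothesis may decay when \<open>\<beta> < 1\<close>, but on a
    bounded interval it has a positive lower bound, so \<open>Q\<close> is locally integrable for
    every \<open>\<beta>\<close>.\<close>
  have Qi: "set_integrable lborel {- N..N} Q" for N
  proof (rule set_integrable_Icc_bound[OF Qm integrable_mult_right[OF Q]])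
    let ?K = "(1 + N\<^sup>2) powr \<bar>1 - \<beta>\<bar>"
    fix \<xi> :: real
    show "0 \<le> ?K * ((1 + \<xi>\<^sup>2) powr (\<beta> - 1) * (norm (Q \<xi>))\<^sup>2)" by simp
    assume "\<bar>\<xi>\<bar> \<le> N"
    then have "\<xi>\<^sup>2 \<le> N\<^sup>2" by (metis abs_ge_zero power2_abs power_mono)
    have p: "0 < 1 + \<xi>\<^sup>2" by (simp add: add_pos_nonneg)
    have "(1 + \<xi>\<^sup>2) powr (1 - \<beta>) \<le> (1 + \<xi>\<^sup>2) powr \<bar>1 - \<beta>\<bar>" by (rule powr_mono) auto
    also have "\<dots> \<le> ?K" using \<open>\<xi>\<^sup>2 \<le> N\<^sup>2\<close> by (intro powr_mono2) auto
    finally have K: "(1 + \<xi>\<^sup>2) powr (1 - \<beta>) \<le> ?K" .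
    have "(norm (Q \<xi>))\<^sup>2 = (1 + \<xi>\<^sup>2) powr (1 - \<beta>) * ((1 + \<xi>\<^sup>2) powr (\<beta> - 1) * (norm (Q \<xi>))\<^sup>2)"
      using p by (simp add: mult.assoc[symmetric] powr_add[symmetric])
    also have "\<dots> \<le> ?K * ((1 + \<xi>\<^sup>2) powr (\<beta> - 1) * (norm (Q \<xi>))\<^sup>2)"
      by (rule mult_right_mono[OF K]) simp
    finally show "norm (Q \<xi>) \<le> 1 + ?K * ((1 + \<xi>\<^sup>2) powr (\<beta> - 1) * (norm (Q \<xi>))\<^sup>2)"
      using sum_squares_bound[of "norm (Q \<xi>)" 1] norm_ge_zero[of "Q \<xi>"] unfolding power_one mult_1_right by linarith
  qed simp
  have Ri: "set_integrable lborel {- N..N} (\<lambda>\<xi>. \<i> * of_real \<xi> * R \<xi>)" for N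
  proof (rule set_integrable_Icc_bound[OF _ R, where C = "N\<^sup>2"])
    fix \<xi> :: real
    assume "\<bar>\<xi>\<bar> \<le> N"
    then have "\<bar>\<xi>\<bar>\<^sup>2 \<le> N\<^sup>2" by (intro power_mono) auto
    then show "norm (\<i> * of_real \<xi> * R \<xi>) \<le> N\<^sup>2 + (norm (R \<xi>))\<^sup>2"
      using sum_squares_bound[of "\<bar>\<xi>\<bar>" "norm (R \<xi>)"] mult_nonneg_nonneg[OF abs_ge_zero norm_ge_zero, of \<xi> "R \<xi>"]
      unfolding norm_mult norm_ii norm_of_real mult_1_left power2_abs mult.assoc by (smt (verit) zero_le_power2)
  qed simp_all
  have Gi: "set_integrable lborel {- N..N} G" for N
  proof (rule set_integrable_Icc_bound[OF Gm, where w = "\<lambda>x. 0"])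
    show "norm (G \<xi>) \<le> (LINT x|lborel. norm (complex_of_real ((r x)\<^sup>2))) + 0" for \<xi>
      unfolding G_def using norm_fourier_le by simp
  qed simp_all
  define H where "H = (\<lambda>\<xi>. Q \<xi> - (\<i> * of_real \<xi> * R \<xi> + G \<xi>))"
  have "AE \<xi> in lborel. H \<xi> = 0"
  proof (rule du_Bois_Reymond)
    show "H \<in> borel_measurable borel" unfolding H_def by measurable
    show "set_integrable lborel {- N..N} H" for N
      unfolding H_def by (intro set_integral_diff(1) set_integral_add(1) Qi Ri Gi)
    fix \<psi> assume \<psi>: "\<psi> \<in> test_functions"
    have S: "\<psi> \<in> schwartz_functions" using \<psi> test_subset_schwartz by blast
    have [measurable]: "\<psi> \<in> borel_measurable borel" by (intro smooth_measurable test_function_smooth \<psi>)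
    obtain N where N: "N > 0" "\<And>x. \<bar>x\<bar> \<ge> N \<Longrightarrow> \<psi> x = 0" using test_function_support[OF \<psi>] by blast
    obtain K where K: "\<And>x. norm (\<psi> x) \<le> K" using test_function_bounded[OF \<psi>] by blast
    have supp: "\<psi> x = 0" if "x \<notin> {-N..N}" for x using N(2)[of x] that by auto
    have pair: "integrable lborel (\<lambda>\<xi>. h \<xi> * \<psi> \<xi>)"
      if "set_integrable lborel {-N..N} h" "h \<in> borel_measurable borel" for h
      by (rule integrable_mult_bounded_support[OF that _ K supp]) simp_all
    have Qp: "integrable lborel (\<lambda>\<xi>. Q \<xi> * \<psi> \<xi>)" by (rule pair[OF Qi]) simp
    have Rp: "integrable lborel (\<lambda>\<xi>. (\<i> * of_real \<xi> * R \<xi>) * \<psi> \<xi>)" by (rule pair[OF Ri]) measurable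
    have Gp: "integrable lborel (\<lambda>\<xi>. G \<xi> * \<psi> \<xi>)" by (rule pair[OF Gi]) simp
    let ?\<psi>1 = "\<lambda>x. - \<i> * (of_real x * \<psi> x)"
    have S1: "?\<psi>1 \<in> schwartz_functions" by (intro schwartz_cmult schwartz_mult_x S)
    have "(LINT \<xi>|lborel. Q \<xi> * \<psi> \<xi>) = fourier_tempered U \<psi>" using S by (simp add: FU)
    also have "\<dots> = U (fourier \<psi>)" using S by (simp add: fourier_tempered_def)
    also have "\<dots> = - (LINT x|lborel. of_real (r x) * nderiv 1 (fourier \<psi>) x) + (LINT x|lborel. of_real ((r x)\<^sup>2) * fourier \<psi> x)"
      by (rule tempered_ext_schwartz[OF rm r U fourier_schwartz[OF S]])
    \<comment> \<open>The derivative that falls on the transform becomes the multiplier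
      \<open>- \<i> x\<close>; its sign cancels the one from the distributional derivative.\<close>
    also have "nderiv 1 (fourier \<psi>) = fourier ?\<psi>1"
      by (intro nderiv_1_eqI fourier_has_derivative S)
    also have "(LINT x|lborel. of_real (r x) * fourier ?\<psi>1 x) = (LINT \<xi>|lborel. R \<xi> * ?\<psi>1 \<xi>)" by (rule four[OF S1])
    also have "\<dots> = (LINT \<xi>|lborel. - ((\<i> * of_real \<xi> * R \<xi>) * \<psi> \<xi>))"
      by (intro Bochner_Integration.integral_cong refl) (simp add: mult_ac)
    also have "\<dots> = - (LINT \<xi>|lborel. (\<i> * of_real \<xi> * R \<xi>) * \<psi> \<xi>)" by (rule integral_minus)
    also have "(LINT x|lborel. of_real ((r x)\<^sup>2) * fourier \<psi> x) = (LINT \<xi>|lborel. G \<xi> * \<psi> \<xi>)"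
      unfolding G_def by (rule fourier_multiplication[OF r2 schwartz_integrable[OF S], symmetric])
    finally have e: "(LINT \<xi>|lborel. Q \<xi> * \<psi> \<xi>)
        = (LINT \<xi>|lborel. (\<i> * of_real \<xi> * R \<xi>) * \<psi> \<xi>) + (LINT \<xi>|lborel. G \<xi> * \<psi> \<xi>)"
      by (simp only: minus_minus)
    show "(LINT \<xi>|lborel. H \<xi> * \<psi> \<xi>) = 0"
      unfolding H_def left_diff_distrib distrib_right
        Bochner_Integration.integral_diff[OF Qp Bochner_Integration.integrable_add[OF Rp Gp]]
        Bochner_Integration.integral_add[OF Rp Gp] e by (rule right_minus_eq[THEN iffD2, OF refl])
  qed
  then have eq: "AE \<xi> in lborel. Q \<xi> = \<i> * of_real \<xi> * R \<xi> + G \<xi>" by (simp add: H_def)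
  have W: "integrable lborel (\<lambda>\<xi>. (1 + \<xi>\<^sup>2) powr \<beta> * (norm (R \<xi>))\<^sup>2)"
    by (rule sobolev_bootstrap[OF Rm Qm Gm R Q conv[folded G_def] eq \<beta>])
  let ?r = "\<lambda>x. complex_of_real (r x)"
  \<comment> \<open>The tempered extension that witnesses membership in the Sobolev space is
    integration against \<open>r\<close> itself, and \<open>R\<close> is its Fourier
    transform.\<close>
  let ?T = "\<lambda>\<phi>\<in>schwartz_functions. LINT x|lborel. ?r x * \<phi> x"
  have rc: "?r \<in> borel_measurable borel" "integrable lborel (\<lambda>x. norm (?r x) / (1 + x\<^sup>2))"
    using of_real_L2(1)[OF rm r] by simp_all
  have 1: "dist_of_fun ?r = restrict ?T test_functions"
    unfolding dist_of_fun_def restrict_restrict Int_absorb1[OF test_subset_schwartz] ..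
  have 2: "fourier_tempered ?T = (\<lambda>\<phi>\<in>schwartz_functions. LINT \<xi>|lborel. R \<xi> * \<phi> \<xi>)"
    unfolding fourier_tempered_def
    by (rule restrict_ext) (simp only: restrict_apply' fourier_schwartz four)
  have "dist_of_fun ?r \<in> sobolev \<beta>"
    unfolding sobolev_def
    by (intro CollectI conjI dist_of_fun_distribution[OF rc] bexI[of _ ?T] bexI[of _ R] 1 2 W function_tempered[OF rc]) simp
  moreover have "?r \<in> L2_space" using r by (simp add: L2_space_def)
  ultimately show ?thesis by (simp add: real_sobolev_functions_def)
qed

theorem theorem1p2:
  fixes \<beta> :: real and q :: "(real \<Rightarrow> complex) \<Rightarrow> complex"
  assumes "\<beta> \<ge> 0"
    and "q \<in> sobolev (\<beta> - 1)"
    and "real_valued_dist q"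
  shows "q \<in> miura_image \<beta> \<longleftrightarrow>
    schroedinger_nonneg q \<and>
    (\<exists>f\<in>L2_space. \<exists>g\<in>L1_space. q = dist_add (dist_deriv (dist_of_fun f)) (dist_of_fun g))"
proof
  assume "q \<in> miura_image \<beta>"
  then obtain r where q: "q = miura r" and r: "(\<lambda>x. complex_of_real (r x)) \<in> L2_space"
    unfolding miura_image_def real_sobolev_functions_def by blast
  have [measurable]: "(\<lambda>x. complex_of_real (r x)) \<in> borel_measurable borel"
    and r2: "integrable lborel (\<lambda>x. (r x)\<^sup>2)" using r by (simp_all add: L2_space_def)
  have "(\<lambda>x. Re (complex_of_real (r x))) \<in> borel_measurable borel" by measurable
  then have rm: "r \<in> borel_measurable borel" by simp
  have "(\<lambda>x. complex_of_real ((r x)\<^sup>2)) \<in> L1_space"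
    unfolding L1_space_def using integrable_of_real[OF r2] by blast
  with r show "schroedinger_nonneg q \<and>
      (\<exists>f\<in>L2_space. \<exists>g\<in>L1_space. q = dist_add (dist_deriv (dist_of_fun f)) (dist_of_fun g))"
    unfolding q using miura_schroedinger_nonneg[OF rm r2] miura_def by blast
next
  assume "schroedinger_nonneg q \<and>
    (\<exists>f\<in>L2_space. \<exists>g\<in>L1_space. q = dist_add (dist_deriv (dist_of_fun f)) (dist_of_fun g))"
  then obtain f g where nonneg: "schroedinger_nonneg q" and f: "f \<in> L2_space" and g: "g \<in> L1_space"
    and q: "q = dist_add (dist_deriv (dist_of_fun f)) (dist_of_fun g)" by blast
  have fm [measurable]: "f \<in> borel_measurable borel" and f2: "integrable lborel (\<lambda>x. (norm (f x))\<^sup>2)"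
    using f by (simp_all add: L2_space_def)
  have gi: "integrable lborel g" using g by (simp add: L1_space_def)
  \<comment> \<open>The Riccati equation needs real data; since \<open>q\<close> is real-valued,
    passing to real parts loses nothing.\<close>
  define F where "F = (\<lambda>x. Re (f x))"
  define G where "G = (\<lambda>x. Re (g x))"
  have Fm: "F \<in> borel_measurable borel" unfolding F_def by measurable
  have F2: "integrable lborel (\<lambda>x. (F x)\<^sup>2)"
  proof (rule integrable_bound_le[OF f2])
    show "(\<lambda>x. (F x)\<^sup>2) \<in> borel_measurable lborel" unfolding F_def by measurable
    show "norm ((F x)\<^sup>2) \<le> (norm (f x))\<^sup>2" for x
      unfolding F_def by (simp add: cmod_power2)
  qed
  have Gi: "integrable lborel G" unfolding G_def using gi by (rule integrable_Re)
  have Re_q: "Re (q (\<lambda>x. of_real (p x))) = - (LINT x|lborel. F x * real_deriv p x) + (LINT x|lborel. G x * p x)"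
    if "real_test p" for p
    unfolding q F_def G_def by (rule dist_eval_real_test[OF fm f2 gi that])
  have form: "form_nonneg F G"
  proof (rule form_nonneg_of_tests[OF Fm F2 Gi])
    fix p assume p: "real_test p"
    \<comment> \<open>The form evaluates \<open>q\<close> at the square of \<open>p\<close>, whose
      derivative supplies the mixed term that \<open>form_nonneg\<close> has after integration by
      parts.\<close>
    have pp: "real_test (\<lambda>x. p x * p x)" by (intro real_test_mult p)
    have d: "real_deriv (\<lambda>x. p x * p x) = (\<lambda>x. 2 * p x * real_deriv p x)"
    proof
      fix x
      have "((\<lambda>x. p x * p x) has_real_derivative real_deriv p x * p x + real_deriv p x * p x) (at x)"
        by (rule DERIV_mult; rule real_test_has_derivative[OF p])
      from DERIV_unique[OF real_test_has_derivative[OF pp] this]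
      show "real_deriv (\<lambda>x. p x * p x) x = 2 * p x * real_deriv p x" by simp
    qed
    have "0 \<le> (LINT x|lborel. (norm (nderiv 1 (\<lambda>x. complex_of_real (p x)) x))\<^sup>2)
        + Re (q (\<lambda>x. of_real ((norm (complex_of_real (p x)))\<^sup>2)))"
      using nonneg p unfolding schroedinger_nonneg_def real_test_def by blast
    also have "(\<lambda>x. complex_of_real ((norm (complex_of_real (p x)))\<^sup>2)) = (\<lambda>x. of_real (p x * p x))"
      by (simp add: power2_eq_square)
    also note Re_q[OF pp]
    finally have "0 \<le> (LINT x|lborel. (norm (complex_of_real (real_deriv p x)))\<^sup>2)
        + (- (LINT x|lborel. F x * (2 * p x * real_deriv p x)) + (LINT x|lborel. G x * (p x * p x)))"
      unfolding nderiv_1_of_real[OF p] d .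
    then show "0 \<le> (LINT x|lborel. (real_deriv p x)\<^sup>2)
        - (LINT x|lborel. F x * (2 * p x * real_deriv p x)) + (LINT x|lborel. G x * (p x)\<^sup>2)"
      by (simp add: power2_eq_square)
  qed
  show "q \<in> miura_image \<beta>"
  proof (rule riccati_exists[OF Fm F2 Gi form])
    fix r :: "real \<Rightarrow> real"
    assume rm: "r \<in> borel_measurable borel" and r2: "integrable lborel (\<lambda>x. (r x)\<^sup>2)"
      and sol: "\<And>p. real_test p \<Longrightarrow> - (LINT x|lborel. r x * real_deriv p x) + (LINT x|lborel. (r x)\<^sup>2 * p x)
        = - (LINT x|lborel. F x * real_deriv p x) + (LINT x|lborel. G x * p x)"
    have qd: "q \<in> distributions" using assms(2) by (simp add: sobolev_def)
    have "q = miura r"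
    proof (rule linear_real_test_eqI)
      show "q \<in> extensional test_functions" "linear_functional_on test_functions q"
        using qd by (simp_all add: distributions_def)
      show "miura r \<in> extensional test_functions" by (simp add: miura_def dist_add_def)
      show "linear_functional_on test_functions (miura r)" by (rule miura_linear[OF rm r2])
      fix p assume p: "real_test p"
      then have \<phi>: "(\<lambda>x. complex_of_real (p x)) \<in> test_functions" by (simp add: real_test_def)
      \<comment> \<open>The solution \<open>r\<close> was matched with the real part of
        \<open>q\<close> only; real-valuedness makes this an equality of complex numbers.\<close>
      have "q (\<lambda>x. of_real (p x)) \<in> \<real>"
        by (rule assms(3)[unfolded real_valued_dist_def, rule_format, OF \<phi> Reals_of_real])
      then have "q (\<lambda>x. of_real (p x)) = of_real (Re (q (\<lambda>x. of_real (p x))))" by (simp only: of_real_Re)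
      also have "\<dots> = of_real (- (LINT x|lborel. r x * real_deriv p x) + (LINT x|lborel. (r x)\<^sup>2 * p x))"
        by (simp only: Re_q[OF p] sol[OF p])
      also have "\<dots> = miura r (\<lambda>x. of_real (p x))"
        unfolding miura_def dist_eval[OF \<phi>] nderiv_1_of_real[OF p]
        by (simp only: of_real_mult[symmetric] integral_complex_of_real of_real_add of_real_minus)
      finally show "q (\<lambda>x. of_real (p x)) = miura r (\<lambda>x. of_real (p x))" .
    qed
    then show ?thesis
      unfolding miura_image_def using miura_preimage_sobolev[OF rm r2 _ assms(1)] assms(2) by blast
  qed
qed

end
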